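(* For any $n$ with $2\le n\le\omega$ (that is, $n\ge 2$ an integer or $n=\omega$), the Cochran–Harvey container $\sigma_n\colon\mathcal{H}_n\to\mathcal{F}_n$ of the I-functor $\mathcal{H}_n$, $\mathcal{H}_n(G)=G/G_H^{(n)}$, is not a universal container of $\mathcal{H}_n$ (with coefficient ring $\mathbb{Q}$).
   Context: A group homomorphism is rationally 2-connected if it induces an isomorphism on $H_1(-;\mathbb{Q})$ and a surjection on $H_2(-;\mathbb{Q})$. $\Omega^{\mathbb{Q}}$ is the class of rationally 2-connected homomorphisms $\alpha\colon\pi\to G$ with $\pi$ finitely generated and $G$ finitely presented. $\mathcal{G}$ is the category of groups; $\mathcal{G}^{\mathbb{Q}}$ is the category of finitely presented groups and rationally 2-connected homomorphisms. I-functor (with respect to $\mathbb{Q}$-coefficients): a pair $(\mathcal{H},p)$ which associates a group $\mathcal{H}(G)$ to each group $G$ and homomorphisms $\mathcal{H}(\alpha)\colon\mathcal{H}(\pi)\to\mathcal{H}(G)$ to certain (not necessarily all) homomorphisms $\alpha\colon\pi\to G$, such that: (1) to each $G$ a homomorphism $p_G\colon G\to\mathcal{H}(G)$ is associated; (2) to each $\alpha\colon\pi\to G$ in $\Omega^{\mathbb{Q}}$ an injection $\mathcal{H}(\alpha)$ is associated; (3) $\mathcal{H}(\beta\circ\alpha)=\mathcal{H}(\beta)\circ\mathcal{H}(\alpha)$, $\mathcal{H}(\alpha)\circ p_\pi=p_G\circ\alpha$, $\mathcal{H}(\mathrm{id}_G)=\mathrm{id}_{\mathcal{H}(G)}$ whenever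 the involved homomorphisms exist; (4) to any isomorphism $\alpha$ an isomorphism $\mathcal{H}(\alpha)$ is associated. A morphism $\tau\colon(\mathcal{H},p)\to(\mathcal{H}',p')$ of I-functors is a natural transformation of the induced functors $\mathcal{G}^{\mathbb{Q}}\to\mathcal{G}$ with $\tau_G\circ p_G=p'_G$ for each finitely presented $G$; it is injective if each $\tau_G$ is. A container of $\mathcal{H}$ is an injective morphism $\tau\colon\mathcal{H}\to\mathcal{F}$ into an I-functor $\mathcal{F}$ such that $\mathcal{F}(\alpha)$ is an isomorphism for every $\alpha\in\Omega^{\mathbb{Q}}$. A container $\tau\colon\mathcal{H}\to\mathcal{F}$ is universal if for any container $\tau'\colon\mathcal{H}\to\mathcal{F}'$ there is a unique injective morphism of I-functors $\theta\colon\mathcal{F}\to\mathcal{F}'$ with $\theta\circ\tau=\tau'$. Torsion-free derived series: for a group $G$, put $G_H^{(0)}=G$. Suppose the normal subgroup $G_H^{(n)}$ has been defined so that $\Gamma=G/G_H^{(n)}$ is poly-torsion-free-abelian (PTFA). For a PTFA group $\Gamma$, $\mathbb{Z}[\Gamma]$ is an Ore domain; $\mathcal{K}\Gamma=\mathcal{K}[\Gamma]=\mathbb{Z}[\Gamma](\mathbb{Z}[\Gamma]-\{0\})^{-1}$ denotes its skew field of (right) quotients. $G_H^{(n+1)}$ is the kernel of the composition $$G_H^{(n)}\to G_H^{(n)}/[G_H^{(n)},G_H^{(n)}]=H_1(G;\mathbb{Z}[\Gamma])\to H_1(G;\mathbb{Z}[\Gamma])\otimes_{\mathbb{Z}[\Gamma]}\mathcal{K}[\Gamma]=H_1(G;\mathcal{K}[\Gamma]).$$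 Then $G/G_H^{(n+1)}$ is again PTFA. Put $G_H^{(\omega)}=\bigcap_{k<\omega}G_H^{(k)}$. $\mathcal{H}_n(G)=G/G_H^{(n)}$, with the projection $p_G\colon G\to\mathcal{H}_n(G)$, is an I-functor (Cochran–Harvey). Cochran–Harvey container: $\mathcal{F}_n(G)=\tilde G_n$ and injections $\sigma_{n,G}\colon\mathcal{H}_n(G)\to\mathcal{F}_n(G)$ are defined as follows. $\tilde G_0=\{e\}$ and $\sigma_{0,G}$ is trivial. If $\tilde G_n$ (a PTFA group) and $\sigma_{n,G}$ are defined, $\tilde G_{n+1}=H_1(G;\mathcal{K}\tilde G_n)\rtimes\tilde G_n$, where $H_1(G;\mathcal{K}\tilde G_n)$ is viewed as a $\mathbb{Z}[\tilde G_n]$-module and $G$ acts on $\mathcal{K}\tilde G_n$ via $G\to\mathcal{H}_n(G)\to\tilde G_n$. Let $\phi_{n,G}$ be the composition $G_H^{(n)}/G_H^{(n+1)}\to H_1(G;\mathcal{K}\mathcal{H}_n(G))\to H_1(G;\mathcal{K}\mathcal{F}_n(G))$, where the first map is the injection $\Phi_{n,G}$ coming from the definition of $G_H^{(n+1)}$ and the second is induced by $\sigma_{n,G}$. There is a derivation $G\to H_1(G;\mathcal{K}\mathcal{F}_n(G))$ which induces $\phi_{n,G}$; together with $G\to\mathcal{H}_n(G)\to\mathcal{F}_n(G)$ it gives a homomorphism $G\to\mathcal{F}_{n+1}(G)$ with kernel $G_H^{(n+1)}$, and hence an injection $\sigma_{n+1,G}\colon\mathcal{H}_{n+1}(G)\to\mathcal{F}_{n+1}(G)$.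 For $n=\omega$, $\tilde G_\omega=\varprojlim_{k<\omega}\tilde G_k$, with $\sigma_{\omega,G}$ induced by the $\sigma_{k,G}$. Cochran and Harvey proved that $\sigma_n\colon\mathcal{H}_n\to\mathcal{F}_n$ is a container of $\mathcal{H}_n$ for any $n\le\omega$. *)

theory Defs
  imports "HOL-Algebra.Algebra"
begin

section \<open>Finitely generated and finitely presented groups\<close>

definition finitely_generated_group :: "'a monoid \<Rightarrow> bool" where
  "finitely_generated_group G \<longleftrightarrow>
     group G \<and> (\<exists>S. finite S \<and> S \<subseteq> carrier G \<and> generate G S = carrier G)"

text \<open>A word is a list of letters; the letter \<open>(i, True)\<close> stands for the generator \<open>x\<^sub>i\<close> and
  \<open>(i, False)\<close> for its inverse.\<close>

type_synonym word = "(nat \<times> bool) list"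

definition words :: "nat \<Rightarrow> word set" where
  "words m = lists ({..<m} \<times> UNIV)"

inductive_set word_cong :: "nat \<Rightarrow> word set \<Rightarrow> (word \<times> word) set"
  for m :: nat and R :: "word set" where
  refl: "u \<in> words m \<Longrightarrow> (u, u) \<in> word_cong m R"
| sym: "(u, v) \<in> word_cong m R \<Longrightarrow> (v, u) \<in> word_cong m R"
| trans: "(u, v) \<in> word_cong m R \<Longrightarrow> (v, w) \<in> word_cong m R \<Longrightarrow> (u, w) \<in> word_cong m R"
| cancel: "u \<in> words m \<Longrightarrow> v \<in> words m \<Longrightarrow> i < m \<Longrightarrow>
             (u @ [(i, b), (i, \<not> b)] @ v, u @ v) \<in> word_cong m R"
| relator: "u \<in> words m \<Longrightarrow> v \<in> words m \<Longrightarrow> r \<in> R \<Longrightarrow> r \<in> words m \<Longrightarrow>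
             (u @ r @ v, u @ v) \<in> word_cong m R"

text \<open>The group \<open>\<langle>x\<^sub>0, \<dots>, x\<^sub>m\<^sub>-\<^sub>1 | R\<rangle>\<close>.\<close>

definition presented_group :: "nat \<Rightarrow> word set \<Rightarrow> word set monoid" where
  "presented_group m R =
     \<lparr>carrier = words m // word_cong m R,
      monoid.mult = (\<lambda>A B. \<Union>u\<in>A. \<Union>v\<in>B. word_cong m R `` {u @ v}),
      one = word_cong m R `` {[]}\<rparr>"

definition finitely_presented_group :: "'a monoid \<Rightarrow> bool" where
  "finitely_presented_group G \<longleftrightarrow>
     group G \<and> (\<exists>m R. finite R \<and> R \<subseteq> words m \<and> G \<cong> presented_group m R)"


section \<open>Group homology\<close>

text \<open>
  Homology of \<open>G\<close> with coefficients in a left \<open>G\<close>-module, computed by the inhomogeneous bar complex.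
  Only the additive part of the ring record \<open>M\<close> is used as the underlying abelian group of the
  module, and \<open>act g m\<close> is \<open>g \<cdot> m\<close>. A \<open>k\<close>-chain \<open>c\<close> stands for the finite sum of the terms
  \<open>c [g\<^sub>1, \<dots>, g\<^sub>k] \<cdot> [g\<^sub>1 | \<dots> | g\<^sub>k]\<close>. The left module is made a right module by \<open>m \<cdot> g = g\<inverse> \<cdot> m\<close>, so
  the boundary is
  \<open>\<partial> (m [g\<^sub>1 | \<dots> | g\<^sub>k]) = (g\<^sub>1\<inverse> \<cdot> m) [g\<^sub>2 | \<dots> | g\<^sub>k]
      + (\<Sum>0 < i < k. (-1)^i m [g\<^sub>1 | \<dots> | g\<^sub>i g\<^sub>i\<^sub>+\<^sub>1 | \<dots> | g\<^sub>k]) + (-1)^k m [g\<^sub>1 | \<dots> | g\<^sub>k\<^sub>-\<^sub>1]\<close>.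
  All of these groups are additive in the literature, but are multiplicative records here.
\<close>

definition chain_group :: "nat \<Rightarrow> 'a monoid \<Rightarrow> 'm ring \<Rightarrow> ('a list \<Rightarrow> 'm) monoid" where
  "chain_group k G M =
     \<lparr>carrier = {c. finite {x. c x \<noteq> \<zero>\<^bsub>M\<^esub>} \<and> (\<forall>x. c x \<in> carrier M) \<and>
                    (\<forall>x. c x \<noteq> \<zero>\<^bsub>M\<^esub> \<longrightarrow> length x = k \<and> set x \<subseteq> carrier G)},
      monoid.mult = (\<lambda>c d x. c x \<oplus>\<^bsub>M\<^esub> d x),
      one = (\<lambda>x. \<zero>\<^bsub>M\<^esub>)\<rparr>"

definition face :: "'a monoid \<Rightarrow> nat \<Rightarrow> 'a list \<Rightarrow> 'a list" where
  "face G i x =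
     (if i = 0 then tl x
      else if i = length x then butlast x
      else take (i - 1) x @ [x ! (i - 1) \<otimes>\<^bsub>G\<^esub> x ! i] @ drop (i + 1) x)"

definition face_coeff ::
  "'a monoid \<Rightarrow> 'm ring \<Rightarrow> ('a \<Rightarrow> 'm \<Rightarrow> 'm) \<Rightarrow> nat \<Rightarrow> 'a list \<Rightarrow> 'm \<Rightarrow> 'm" where
  "face_coeff G M act i x m =
     (if i = 0 then act (inv\<^bsub>G\<^esub> (hd x)) m else if even i then m else \<ominus>\<^bsub>M\<^esub> m)"

text \<open>Used only for chains of positive degree.\<close>

definition boundary ::
  "'a monoid \<Rightarrow> 'm ring \<Rightarrow> ('a \<Rightarrow> 'm \<Rightarrow> 'm) \<Rightarrow> ('a list \<Rightarrow> 'm) \<Rightarrow> 'a list \<Rightarrow> 'm" where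
  "boundary G M act c = (\<lambda>y. \<Oplus>\<^bsub>M\<^esub>x\<in>{x. c x \<noteq> \<zero>\<^bsub>M\<^esub>}. \<Oplus>\<^bsub>M\<^esub>i\<in>{..length x}.
     (if face G i x = y then face_coeff G M act i x (c x) else \<zero>\<^bsub>M\<^esub>))"

definition cycles ::
  "nat \<Rightarrow> 'a monoid \<Rightarrow> 'm ring \<Rightarrow> ('a \<Rightarrow> 'm \<Rightarrow> 'm) \<Rightarrow> ('a list \<Rightarrow> 'm) set" where
  "cycles k G M act = {c \<in> carrier (chain_group k G M). boundary G M act c = (\<lambda>y. \<zero>\<^bsub>M\<^esub>)}"

definition boundaries ::
  "nat \<Rightarrow> 'a monoid \<Rightarrow> 'm ring \<Rightarrow> ('a \<Rightarrow> 'm \<Rightarrow> 'm) \<Rightarrow> ('a list \<Rightarrow> 'm) set" where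
  "boundaries k G M act = boundary G M act ` carrier (chain_group (Suc k) G M)"

text \<open>Meaningful for \<open>k \<ge> 1\<close>.\<close>

definition group_homology ::
  "nat \<Rightarrow> 'a monoid \<Rightarrow> 'm ring \<Rightarrow> ('a \<Rightarrow> 'm \<Rightarrow> 'm) \<Rightarrow> ('a list \<Rightarrow> 'm) set monoid" where
  "group_homology k G M act =
     (chain_group k G M)\<lparr>carrier := cycles k G M act\<rparr> Mod boundaries k G M act"

definition homology_class ::
  "nat \<Rightarrow> 'a monoid \<Rightarrow> 'm ring \<Rightarrow> ('a \<Rightarrow> 'm \<Rightarrow> 'm) \<Rightarrow> ('a list \<Rightarrow> 'm) \<Rightarrow> ('a list \<Rightarrow> 'm) set" where
  "homology_class k G M act c = boundaries k G M act #>\<^bsub>chain_group k G M\<^esub> c"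

text \<open>The map induced by a homomorphism \<open>\<alpha>\<close> of groups and an additive, \<open>\<alpha>\<close>-equivariant map \<open>f\<close>
  from the coefficients \<open>M\<close> to the coefficients \<open>M'\<close>.\<close>

definition chain_map ::
  "'m ring \<Rightarrow> 'n ring \<Rightarrow> ('a \<Rightarrow> 'b) \<Rightarrow> ('m \<Rightarrow> 'n) \<Rightarrow> ('a list \<Rightarrow> 'm) \<Rightarrow> 'b list \<Rightarrow> 'n" where
  "chain_map M M' \<alpha> f c = (\<lambda>y. \<Oplus>\<^bsub>M'\<^esub>x\<in>{x. c x \<noteq> \<zero>\<^bsub>M\<^esub> \<and> map \<alpha> x = y}. f (c x))"

definition homology_map ::
  "nat \<Rightarrow> 'm ring \<Rightarrow> 'b monoid \<Rightarrow> 'n ring \<Rightarrow> ('b \<Rightarrow> 'n \<Rightarrow> 'n) \<Rightarrow> ('a \<Rightarrow> 'b) \<Rightarrow> ('m \<Rightarrow> 'n) \<Rightarrow>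
     ('a list \<Rightarrow> 'm) set \<Rightarrow> ('b list \<Rightarrow> 'n) set" where
  "homology_map k M G M' act \<alpha> f A = (\<Union>c\<in>A. homology_class k G M' act (chain_map M M' \<alpha> f c))"


section \<open>Rationally 2-connected homomorphisms\<close>

definition rat_ring :: "rat ring" where
  "rat_ring = \<lparr>carrier = UNIV, monoid.mult = (*), one = 1, ring.zero = 0, add = (+)\<rparr>"

abbreviation rational_homology :: "nat \<Rightarrow> 'a monoid \<Rightarrow> ('a list \<Rightarrow> rat) set monoid" where
  "rational_homology k G \<equiv> group_homology k G rat_ring (\<lambda>g q. q)"

abbreviation rational_homology_map ::
  "nat \<Rightarrow> 'b monoid \<Rightarrow> ('a \<Rightarrow> 'b) \<Rightarrow> ('a list \<Rightarrow> rat) set \<Rightarrow> ('b list \<Rightarrow> rat) set" where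
  "rational_homology_map k G \<alpha> \<equiv> homology_map k rat_ring G rat_ring (\<lambda>g q. q) \<alpha> (\<lambda>q. q)"

text \<open>Homomorphisms of groups, normalised to be \<open>undefined\<close> off the carrier, so that equality of
  functions is equality of homomorphisms.\<close>

definition homs :: "'a monoid \<Rightarrow> 'b monoid \<Rightarrow> ('a \<Rightarrow> 'b) set" where
  "homs \<pi> G = {\<alpha>. group \<pi> \<and> group G \<and> \<alpha> \<in> hom \<pi> G \<and> \<alpha> \<in> extensional (carrier \<pi>)}"

definition rationally_2_connected :: "'a monoid \<Rightarrow> 'b monoid \<Rightarrow> ('a \<Rightarrow> 'b) \<Rightarrow> bool" where
  "rationally_2_connected \<pi> G \<alpha> \<longleftrightarrow>
     \<alpha> \<in> homs \<pi> G \<and>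
     rational_homology_map 1 G \<alpha> \<in> iso (rational_homology 1 \<pi>) (rational_homology 1 G) \<and>
     rational_homology_map 2 G \<alpha> ` carrier (rational_homology 2 \<pi>) = carrier (rational_homology 2 G)"

definition Omega_Q :: "'a monoid \<Rightarrow> 'b monoid \<Rightarrow> ('a \<Rightarrow> 'b) \<Rightarrow> bool" where
  "Omega_Q \<pi> G \<alpha> \<longleftrightarrow>
     finitely_generated_group \<pi> \<and> finitely_presented_group G \<and> rationally_2_connected \<pi> G \<alpha>"


section \<open>I-functors, containers and universal containers\<close>

text \<open>
  The groups to which an I-functor is applied are the groups with carrier in a type \<open>'a\<close>, its values
  are groups with carrier in a type \<open>'b\<close>; these types play the role of universes. As soon as \<open>'a\<close> is
  infinite, every finitely generated group has an isomorphic copy with carrier in \<open>'a\<close>.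
  \<open>ifun_def\<close> tells on which homomorphisms the functor is defined.
\<close>

record ('a, 'b) ifunctor =
  ifun_obj :: "'a monoid \<Rightarrow> 'b monoid"
  ifun_def :: "'a monoid \<Rightarrow> 'a monoid \<Rightarrow> ('a \<Rightarrow> 'a) \<Rightarrow> bool"
  ifun_map :: "'a monoid \<Rightarrow> 'a monoid \<Rightarrow> ('a \<Rightarrow> 'a) \<Rightarrow> 'b \<Rightarrow> 'b"
  ifun_unit :: "'a monoid \<Rightarrow> 'a \<Rightarrow> 'b"

definition I_functor :: "('a, 'b) ifunctor \<Rightarrow> bool" where
  "I_functor H \<longleftrightarrow>
     (\<forall>G. group G \<longrightarrow> group (ifun_obj H G)) \<and>
     (\<forall>\<pi> G \<alpha>. ifun_def H \<pi> G \<alpha> \<longrightarrow>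
        \<alpha> \<in> homs \<pi> G \<and> ifun_map H \<pi> G \<alpha> \<in> hom (ifun_obj H \<pi>) (ifun_obj H G)) \<and>
     (\<forall>G. group G \<longrightarrow> ifun_unit H G \<in> hom G (ifun_obj H G)) \<and>
     (\<forall>\<pi> G \<alpha>. Omega_Q \<pi> G \<alpha> \<longrightarrow>
        ifun_def H \<pi> G \<alpha> \<and> inj_on (ifun_map H \<pi> G \<alpha>) (carrier (ifun_obj H \<pi>))) \<and>
     (\<forall>\<pi> G P \<alpha> \<beta>. ifun_def H \<pi> G \<alpha> \<and> ifun_def H G P \<beta> \<and>
        ifun_def H \<pi> P (compose (carrier \<pi>) \<beta> \<alpha>) \<longrightarrow>
        (\<forall>x\<in>carrier (ifun_obj H \<pi>).
           ifun_map H \<pi> P (compose (carrier \<pi>) \<beta> \<alpha>) x = ifun_map H G P \<beta> (ifun_map H \<pi> G \<alpha> x))) \<and>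
     (\<forall>\<pi> G \<alpha>. ifun_def H \<pi> G \<alpha> \<longrightarrow>
        (\<forall>g\<in>carrier \<pi>. ifun_map H \<pi> G \<alpha> (ifun_unit H \<pi> g) = ifun_unit H G (\<alpha> g))) \<and>
     (\<forall>G. ifun_def H G G (\<lambda>g\<in>carrier G. g) \<longrightarrow>
        (\<forall>x\<in>carrier (ifun_obj H G). ifun_map H G G (\<lambda>g\<in>carrier G. g) x = x)) \<and>
     (\<forall>\<pi> G \<alpha>. \<alpha> \<in> homs \<pi> G \<and> \<alpha> \<in> iso \<pi> G \<longrightarrow>
        ifun_def H \<pi> G \<alpha> \<and> ifun_map H \<pi> G \<alpha> \<in> iso (ifun_obj H \<pi>) (ifun_obj H G))"

definition I_morphism ::
  "('a, 'b) ifunctor \<Rightarrow> ('a, 'c) ifunctor \<Rightarrow> ('a monoid \<Rightarrow> 'b \<Rightarrow> 'c) \<Rightarrow> bool" where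
  "I_morphism H F \<tau> \<longleftrightarrow>
     I_functor H \<and> I_functor F \<and>
     (\<forall>G. finitely_presented_group G \<longrightarrow>
        \<tau> G \<in> hom (ifun_obj H G) (ifun_obj F G) \<and>
        (\<forall>g\<in>carrier G. \<tau> G (ifun_unit H G g) = ifun_unit F G g)) \<and>
     (\<forall>\<pi> G \<alpha>. finitely_presented_group \<pi> \<and> finitely_presented_group G \<and>
        rationally_2_connected \<pi> G \<alpha> \<longrightarrow>
        (\<forall>x\<in>carrier (ifun_obj H \<pi>). \<tau> G (ifun_map H \<pi> G \<alpha> x) = ifun_map F \<pi> G \<alpha> (\<tau> \<pi> x)))"

definition injective_I_morphism ::
  "('a, 'b) ifunctor \<Rightarrow> ('a, 'c) ifunctor \<Rightarrow> ('a monoid \<Rightarrow> 'b \<Rightarrow> 'c) \<Rightarrow> bool" where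
  "injective_I_morphism H F \<tau> \<longleftrightarrow>
     I_morphism H F \<tau> \<and>
     (\<forall>G. finitely_presented_group G \<longrightarrow> inj_on (\<tau> G) (carrier (ifun_obj H G)))"

definition container ::
  "('a, 'b) ifunctor \<Rightarrow> ('a, 'c) ifunctor \<Rightarrow> ('a monoid \<Rightarrow> 'b \<Rightarrow> 'c) \<Rightarrow> bool" where
  "container H F \<tau> \<longleftrightarrow>
     injective_I_morphism H F \<tau> \<and>
     (\<forall>\<pi> G \<alpha>. Omega_Q \<pi> G \<alpha> \<longrightarrow> ifun_map F \<pi> G \<alpha> \<in> iso (ifun_obj F \<pi>) (ifun_obj F G))"

text \<open>The competing containers \<open>F'\<close> take values in the same universe \<open>'c\<close> as \<open>F\<close>, so a
  container that fails this also fails it with respect to any larger universe. Components of a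
  morphism of I-functors count only on the carriers over finitely presented groups.\<close>

definition universal_container ::
  "('a, 'b) ifunctor \<Rightarrow> ('a, 'c) ifunctor \<Rightarrow> ('a monoid \<Rightarrow> 'b \<Rightarrow> 'c) \<Rightarrow> bool" where
  "universal_container H F \<tau> \<longleftrightarrow>
     container H F \<tau> \<and>
     (\<forall>(F' :: ('a, 'c) ifunctor) \<tau>'. container H F' \<tau>' \<longrightarrow>
        (let factors = (\<lambda>\<theta>. injective_I_morphism F F' \<theta> \<and>
               (\<forall>G. finitely_presented_group G \<longrightarrow>
                  (\<forall>x\<in>carrier (ifun_obj H G). \<theta> G (\<tau> G x) = \<tau>' G x)))
         in \<exists>\<theta>. factors \<theta> \<and>
              (\<forall>\<theta>'. factors \<theta>' \<longrightarrow>
                 (\<forall>G. finitely_presented_group G \<longrightarrow>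
                    (\<forall>x\<in>carrier (ifun_obj F G). \<theta>' G x = \<theta> G x)))))"


section \<open>Group rings and their skew fields of right quotients\<close>

definition group_ring :: "'g monoid \<Rightarrow> ('g \<Rightarrow>\<^sub>0 int) ring" where
  "group_ring \<Gamma> =
     \<lparr>carrier = {a. Poly_Mapping.keys a \<subseteq> carrier \<Gamma>},
      monoid.mult = (\<lambda>a b. frag_extend (\<lambda>x. frag_extend (\<lambda>y. frag_of (x \<otimes>\<^bsub>\<Gamma>\<^esub> y)) b) a),
      one = frag_of \<one>\<^bsub>\<Gamma>\<^esub>, ring.zero = 0, add = (+)\<rparr>"

definition group_ring_map :: "('g \<Rightarrow> 'h) \<Rightarrow> ('g \<Rightarrow>\<^sub>0 int) \<Rightarrow> ('h \<Rightarrow>\<^sub>0 int)" where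
  "group_ring_map \<phi> = frag_extend (\<lambda>x. frag_of (\<phi> x))"

text \<open>The pair \<open>(a, s)\<close> stands for the right fraction \<open>a s\<inverse>\<close>.\<close>

definition frac_rel :: "'r ring \<Rightarrow> (('r \<times> 'r) \<times> ('r \<times> 'r)) set" where
  "frac_rel R =
     {((a, s), (b, t)). {a, b} \<subseteq> carrier R \<and> {s, t} \<subseteq> carrier R - {\<zero>\<^bsub>R\<^esub>} \<and>
        (\<exists>u\<in>carrier R. \<exists>v\<in>carrier R.
           s \<otimes>\<^bsub>R\<^esub> u = t \<otimes>\<^bsub>R\<^esub> v \<and> s \<otimes>\<^bsub>R\<^esub> u \<noteq> \<zero>\<^bsub>R\<^esub> \<and> a \<otimes>\<^bsub>R\<^esub> u = b \<otimes>\<^bsub>R\<^esub> v)}"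

text \<open>Fractions are added over a common denominator. For products, if \<open>b s' = s b'\<close> with \<open>s' \<noteq> 0\<close>,
  then \<open>(a s\<inverse>) (b t\<inverse>) = (a b') (t s')\<inverse>\<close>. This is a skew field if \<open>R\<close> is a right Ore domain.\<close>

definition right_quotients :: "'r ring \<Rightarrow> ('r \<times> 'r) set ring" where
  "right_quotients R =
     \<lparr>carrier = (carrier R \<times> (carrier R - {\<zero>\<^bsub>R\<^esub>})) // frac_rel R,
      monoid.mult = (\<lambda>A B. \<Union>{frac_rel R `` {(a \<otimes>\<^bsub>R\<^esub> b', t \<otimes>\<^bsub>R\<^esub> s')} | a s b t b' s'.
                (a, s) \<in> A \<and> (b, t) \<in> B \<and> b' \<in> carrier R \<and> s' \<in> carrier R - {\<zero>\<^bsub>R\<^esub>} \<and>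
                b \<otimes>\<^bsub>R\<^esub> s' = s \<otimes>\<^bsub>R\<^esub> b'}),
      one = frac_rel R `` {(\<one>\<^bsub>R\<^esub>, \<one>\<^bsub>R\<^esub>)},
      ring.zero = frac_rel R `` {(\<zero>\<^bsub>R\<^esub>, \<one>\<^bsub>R\<^esub>)},
      add = (\<lambda>A B. \<Union>{frac_rel R `` {(a \<oplus>\<^bsub>R\<^esub> b, s)} | a b s. (a, s) \<in> A \<and> (b, s) \<in> B})\<rparr>"

text \<open>\<open>\<K>\<Gamma>\<close>, the inclusion of \<open>\<int>[\<Gamma>]\<close> into it, and its functoriality under injective homomorphisms.\<close>

type_synonym 'g qelem = "(('g \<Rightarrow>\<^sub>0 int) \<times> ('g \<Rightarrow>\<^sub>0 int)) set"

definition quot_field :: "'g monoid \<Rightarrow> 'g qelem ring" where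
  "quot_field \<Gamma> = right_quotients (group_ring \<Gamma>)"

definition quot_incl :: "'g monoid \<Rightarrow> ('g \<Rightarrow>\<^sub>0 int) \<Rightarrow> 'g qelem" where
  "quot_incl \<Gamma> a = frac_rel (group_ring \<Gamma>) `` {(a, \<one>\<^bsub>group_ring \<Gamma>\<^esub>)}"

definition quot_map :: "'h monoid \<Rightarrow> ('g \<Rightarrow> 'h) \<Rightarrow> 'g qelem \<Rightarrow> 'h qelem" where
  "quot_map \<Gamma>' \<phi> A =
     (\<Union>(a, s)\<in>A. frac_rel (group_ring \<Gamma>') `` {(group_ring_map \<phi> a, group_ring_map \<phi> s)})"

text \<open>For \<open>\<rho>\<close> from \<open>G\<close> to \<open>\<Gamma>\<close>, the group \<open>G\<close> acts on \<open>\<int>[\<Gamma>]\<close> and on \<open>\<K>\<Gamma>\<close> by left multiplication.\<close>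

definition ZG_act :: "'g monoid \<Rightarrow> ('a \<Rightarrow> 'g) \<Rightarrow> 'a \<Rightarrow> ('g \<Rightarrow>\<^sub>0 int) \<Rightarrow> ('g \<Rightarrow>\<^sub>0 int)" where
  "ZG_act \<Gamma> \<rho> g x = frag_of (\<rho> g) \<otimes>\<^bsub>group_ring \<Gamma>\<^esub> x"

definition KG_act :: "'g monoid \<Rightarrow> ('a \<Rightarrow> 'g) \<Rightarrow> 'a \<Rightarrow> 'g qelem \<Rightarrow> 'g qelem" where
  "KG_act \<Gamma> \<rho> g x = quot_incl \<Gamma> (frag_of (\<rho> g)) \<otimes>\<^bsub>quot_field \<Gamma>\<^esub> x"

text \<open>\<open>H\<^sub>1(G; \<K>\<Gamma>)\<close> and the map \<open>H\<^sub>1(\<pi>; \<K>\<Gamma>) \<rightarrow> H\<^sub>1(G; \<K>\<Gamma>')\<close> induced by \<open>\<alpha>\<close> from \<open>\<pi>\<close> to \<open>G\<close> and an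
  injective \<open>\<psi>\<close> from \<open>\<Gamma>\<close> to \<open>\<Gamma>'\<close> that is compatible with \<open>\<alpha>\<close>.\<close>

definition H1K :: "'a monoid \<Rightarrow> 'g monoid \<Rightarrow> ('a \<Rightarrow> 'g) \<Rightarrow> ('a list \<Rightarrow> 'g qelem) set monoid" where
  "H1K G \<Gamma> \<rho> = group_homology 1 G (quot_field \<Gamma>) (KG_act \<Gamma> \<rho>)"

definition H1K_map ::
  "'g monoid \<Rightarrow> 'b monoid \<Rightarrow> 'h monoid \<Rightarrow> ('b \<Rightarrow> 'h) \<Rightarrow> ('a \<Rightarrow> 'b) \<Rightarrow> ('g \<Rightarrow> 'h) \<Rightarrow>
     ('a list \<Rightarrow> 'g qelem) set \<Rightarrow> ('b list \<Rightarrow> 'h qelem) set" where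
  "H1K_map \<Gamma> G \<Gamma>' \<rho>' \<alpha> \<psi> =
     homology_map 1 (quot_field \<Gamma>) G (quot_field \<Gamma>') (KG_act \<Gamma>' \<rho>') \<alpha> (quot_map \<Gamma>' \<psi>)"

text \<open>\<open>H\<^sub>1(G; \<K>\<Gamma>)\<close> is a right \<open>\<K>\<Gamma>\<close>-module through right multiplication on the coefficients;
  \<open>\<gamma> \<in> \<Gamma>\<close> acts from the left as right multiplication by \<open>\<gamma>\<inverse>\<close>.\<close>

definition H1K_act ::
  "'a monoid \<Rightarrow> 'g monoid \<Rightarrow> ('a \<Rightarrow> 'g) \<Rightarrow> 'g \<Rightarrow> ('a list \<Rightarrow> 'g qelem) set \<Rightarrow> ('a list \<Rightarrow> 'g qelem) set" where
  "H1K_act G \<Gamma> \<rho> \<gamma> =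
     homology_map 1 (quot_field \<Gamma>) G (quot_field \<Gamma>) (KG_act \<Gamma> \<rho>) (\<lambda>g. g)
       (\<lambda>k. k \<otimes>\<^bsub>quot_field \<Gamma>\<^esub> quot_incl \<Gamma> (frag_of (inv\<^bsub>\<Gamma>\<^esub> \<gamma>)))"


section \<open>The torsion-free derived series\<close>

text \<open>
  For a normal subgroup \<open>N\<close> with quotient \<open>\<Gamma>\<close>, the identification \<open>N / [N, N] = H\<^sub>1(G; \<int>[\<Gamma>])\<close> sends
  the class of \<open>g\<close> to the class of the 1-cycle \<open>1 \<cdot> [g]\<close>. Under \<open>H\<^sub>1(G; \<int>[\<Gamma>]) \<otimes> \<K>\<Gamma> = H\<^sub>1(G; \<K>\<Gamma>)\<close>, which
  holds because \<open>\<K>\<Gamma>\<close> is flat over \<open>\<int>[\<Gamma>]\<close>, the map \<open>x \<mapsto> x \<otimes> 1\<close> is the change of coefficients.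
  \<open>series_map\<close> is the composition \<open>N \<rightarrow> H\<^sub>1(G; \<int>[\<Gamma>]) \<rightarrow> H\<^sub>1(G; \<K>\<Gamma>)\<close>.
\<close>

definition abelianization_map ::
  "'a monoid \<Rightarrow> 'a set \<Rightarrow> 'a \<Rightarrow> ('a list \<Rightarrow> ('a set \<Rightarrow>\<^sub>0 int)) set" where
  "abelianization_map G N g =
     homology_class 1 G (group_ring (G Mod N)) (ZG_act (G Mod N) (\<lambda>h. N #>\<^bsub>G\<^esub> h))
       (\<lambda>x. if x = [g] then \<one>\<^bsub>group_ring (G Mod N)\<^esub> else \<zero>\<^bsub>group_ring (G Mod N)\<^esub>)"

definition series_map :: "'a monoid \<Rightarrow> 'a set \<Rightarrow> 'a \<Rightarrow> ('a list \<Rightarrow> 'a set qelem) set" where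
  "series_map G N g =
     homology_map 1 (group_ring (G Mod N)) G (quot_field (G Mod N))
       (KG_act (G Mod N) (\<lambda>h. N #>\<^bsub>G\<^esub> h)) (\<lambda>h. h) (quot_incl (G Mod N))
       (abelianization_map G N g)"

primrec tf_derived :: "'a monoid \<Rightarrow> nat \<Rightarrow> 'a set" where
  "tf_derived G 0 = carrier G"
| "tf_derived G (Suc n) =
     kernel (G\<lparr>carrier := tf_derived G n\<rparr>)
       (H1K G (G Mod tf_derived G n) (\<lambda>g. tf_derived G n #>\<^bsub>G\<^esub> g))
       (series_map G (tf_derived G n))"

definition tf_derived_omega :: "'a monoid \<Rightarrow> 'a set" where
  "tf_derived_omega G = (\<Inter>k. tf_derived G k)"

text \<open>The functor \<open>G \<mapsto> G / N(G)\<close>, defined on the homomorphisms that respect \<open>N\<close>.\<close>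

definition quotient_functor :: "('a monoid \<Rightarrow> 'a set) \<Rightarrow> ('a, 'a set) ifunctor" where
  "quotient_functor N =
     \<lparr>ifun_obj = (\<lambda>G. G Mod N G),
      ifun_def = (\<lambda>\<pi> G \<alpha>. \<alpha> \<in> homs \<pi> G \<and> \<alpha> ` N \<pi> \<subseteq> N G),
      ifun_map = (\<lambda>\<pi> G \<alpha> A. \<Union>x\<in>A. N G #>\<^bsub>G\<^esub> \<alpha> x),
      ifun_unit = (\<lambda>G g. N G #>\<^bsub>G\<^esub> g)\<rparr>"

definition H_functor :: "nat \<Rightarrow> ('a, 'a set) ifunctor" where
  "H_functor n = quotient_functor (\<lambda>G. tf_derived G n)"

definition H_functor_omega :: "('a, 'a set) ifunctor" where
  "H_functor_omega = quotient_functor tf_derived_omega"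


section \<open>The Cochran--Harvey container\<close>

definition semidirect ::
  "'m monoid \<Rightarrow> 'g monoid \<Rightarrow> ('g \<Rightarrow> 'm \<Rightarrow> 'm) \<Rightarrow> ('m \<times> 'g) monoid" where
  "semidirect M \<Gamma> act =
     \<lparr>carrier = carrier M \<times> carrier \<Gamma>,
      monoid.mult = (\<lambda>(x, \<gamma>) (y, \<delta>). (x \<otimes>\<^bsub>M\<^esub> act \<gamma> y, \<gamma> \<otimes>\<^bsub>\<Gamma>\<^esub> \<delta>)),
      one = (\<one>\<^bsub>M\<^esub>, \<one>\<^bsub>\<Gamma>\<^esub>)\<rparr>"

text \<open>Given \<open>\<Gamma>\<close> standing for \<open>\<F>\<^sub>k(G)\<close>, with \<open>\<rho>\<close> the homomorphism from \<open>G\<close> to \<open>\<F>\<^sub>k(G)\<close>, the semidirect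
  product of \<open>H\<^sub>1(G; \<K>\<F>\<^sub>k(G))\<close> and \<open>\<F>\<^sub>k(G)\<close>.\<close>

definition CH_semidirect ::
  "'a monoid \<Rightarrow> 'g monoid \<Rightarrow> ('a \<Rightarrow> 'g) \<Rightarrow> (('a list \<Rightarrow> 'g qelem) set \<times> 'g) monoid" where
  "CH_semidirect G \<Gamma> \<rho> = semidirect (H1K G \<Gamma> \<rho>) \<Gamma> (H1K_act G \<Gamma> \<rho>)"

text \<open>
  In this form each step raises the type. To have all \<open>\<F>\<^sub>k(G)\<close> in one type, the semidirect product is
  replaced by an isomorphic copy with carrier in \<open>'a\<close>, along an arbitrary injection. The injection
  exists if \<open>'a\<close> is infinite, as then by induction \<open>\<F>\<^sub>k(G)\<close> has at most as many elements as \<open>'a\<close>.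
\<close>

definition CH_code ::
  "'a monoid \<Rightarrow> 'a monoid \<Rightarrow> ('a \<Rightarrow> 'a) \<Rightarrow> ('a list \<Rightarrow> 'a qelem) set \<times> 'a \<Rightarrow> 'a" where
  "CH_code G \<Gamma> \<rho> = (SOME e. inj_on e (carrier (CH_semidirect G \<Gamma> \<rho>)))"

text \<open>The map on cosets induced by a map that is constant on them.\<close>

definition on_cosets :: "('a \<Rightarrow> 'b) \<Rightarrow> 'a set \<Rightarrow> 'b" where
  "on_cosets p A = the_elem (p ` A)"

text \<open>\<open>\<phi>\<^sub>k\<^sub>,\<^sub>G\<close>, as a map on \<open>G\<^sub>H\<^sup>(\<^sup>k\<^sup>)\<close>, given \<open>\<Gamma> = \<F>\<^sub>k(G)\<close> and \<open>\<rho>\<close>; note that \<open>on_cosets \<rho>\<close> is \<open>\<sigma>\<^sub>k\<^sub>,\<^sub>G\<close>.\<close>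

definition CH_phi ::
  "'a monoid \<Rightarrow> nat \<Rightarrow> 'a monoid \<Rightarrow> ('a \<Rightarrow> 'a) \<Rightarrow> 'a \<Rightarrow> ('a list \<Rightarrow> 'a qelem) set" where
  "CH_phi G k \<Gamma> \<rho> g =
     H1K_map (G Mod tf_derived G k) G \<Gamma> \<rho> (\<lambda>h. h) (on_cosets \<rho>)
       (series_map G (tf_derived G k) g)"

text \<open>A derivation which induces \<open>\<phi>\<^sub>k\<^sub>,\<^sub>G\<close>.\<close>

definition CH_derivation ::
  "'a monoid \<Rightarrow> nat \<Rightarrow> 'a monoid \<Rightarrow> ('a \<Rightarrow> 'a) \<Rightarrow> 'a \<Rightarrow> ('a list \<Rightarrow> 'a qelem) set" where
  "CH_derivation G k \<Gamma> \<rho> =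
     (SOME d. d \<in> carrier G \<rightarrow> carrier (H1K G \<Gamma> \<rho>) \<and>
        (\<forall>g\<in>carrier G. \<forall>h\<in>carrier G.
           d (g \<otimes>\<^bsub>G\<^esub> h) = d g \<otimes>\<^bsub>H1K G \<Gamma> \<rho>\<^esub> H1K_act G \<Gamma> \<rho> (\<rho> g) (d h)) \<and>
        (\<forall>g\<in>tf_derived G k. d g = CH_phi G k \<Gamma> \<rho> g))"

text \<open>The pair of \<open>\<F>\<^sub>k(G)\<close> and the homomorphism from \<open>G\<close> to \<open>\<F>\<^sub>k(G)\<close>.\<close>

primrec CH_tower :: "'a monoid \<Rightarrow> nat \<Rightarrow> 'a monoid \<times> ('a \<Rightarrow> 'a)" where
  "CH_tower G 0 = (singleton_group undefined, \<lambda>g. undefined)"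
| "CH_tower G (Suc k) =
     (let (\<Gamma>, \<rho>) = CH_tower G k
      in (image_group (CH_code G \<Gamma> \<rho>) (CH_semidirect G \<Gamma> \<rho>),
          \<lambda>g. CH_code G \<Gamma> \<rho> (CH_derivation G k \<Gamma> \<rho> g, \<rho> g)))"

abbreviation CH_group :: "'a monoid \<Rightarrow> nat \<Rightarrow> 'a monoid" where
  "CH_group G k \<equiv> fst (CH_tower G k)"

abbreviation CH_unit :: "'a monoid \<Rightarrow> nat \<Rightarrow> 'a \<Rightarrow> 'a" where
  "CH_unit G k \<equiv> snd (CH_tower G k)"

text \<open>\<open>CH_pair G k (x, \<gamma>)\<close> is the element of \<open>\<F>\<^sub>k\<^sub>+\<^sub>1(G)\<close> given by \<open>x \<in> H\<^sub>1(G; \<K>\<F>\<^sub>k(G))\<close> and \<open>\<gamma> \<in> \<F>\<^sub>k(G)\<close>.\<close>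

abbreviation CH_pair :: "'a monoid \<Rightarrow> nat \<Rightarrow> ('a list \<Rightarrow> 'a qelem) set \<times> 'a \<Rightarrow> 'a" where
  "CH_pair G k \<equiv> CH_code G (CH_group G k) (CH_unit G k)"

abbreviation CH_module :: "'a monoid \<Rightarrow> nat \<Rightarrow> ('a list \<Rightarrow> 'a qelem) set monoid" where
  "CH_module G k \<equiv> H1K G (CH_group G k) (CH_unit G k)"

text \<open>
  \<open>\<F>\<^sub>k\<^sub>+\<^sub>1(\<alpha>)\<close> is the homomorphism that covers \<open>\<F>\<^sub>k(\<alpha>)\<close>, restricts to the map
  \<open>H\<^sub>1(\<pi>; \<K>\<F>\<^sub>k(\<pi>)) \<rightarrow> H\<^sub>1(G; \<K>\<F>\<^sub>k(G))\<close> induced by \<open>\<alpha>\<close> and \<open>\<F>\<^sub>k(\<alpha>)\<close>, and is compatible with the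
  homomorphisms from \<open>\<pi>\<close> and \<open>G\<close>. It need not be the product of the two maps: the derivations are
  determined only up to inner derivations, so those of \<open>\<pi>\<close> and \<open>G\<close> may correspond only up to an inner
  derivation. The element defining the latter is unique, and so is \<open>\<F>\<^sub>k\<^sub>+\<^sub>1(\<alpha>)\<close> on the carrier.
\<close>

primrec CH_map :: "'a monoid \<Rightarrow> 'a monoid \<Rightarrow> ('a \<Rightarrow> 'a) \<Rightarrow> nat \<Rightarrow> 'a \<Rightarrow> 'a" where
  "CH_map \<pi> G \<alpha> 0 = (\<lambda>z. undefined)"
| "CH_map \<pi> G \<alpha> (Suc k) =
     (SOME f. f \<in> hom (CH_group \<pi> (Suc k)) (CH_group G (Suc k)) \<and>
        (\<forall>x\<in>carrier (CH_module \<pi> k). \<forall>\<gamma>\<in>carrier (CH_group \<pi> k).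
           \<exists>y\<in>carrier (CH_module G k).
             f (CH_pair \<pi> k (x, \<gamma>)) = CH_pair G k (y, CH_map \<pi> G \<alpha> k \<gamma>)) \<and>
        (\<forall>x\<in>carrier (CH_module \<pi> k).
           f (CH_pair \<pi> k (x, \<one>\<^bsub>CH_group \<pi> k\<^esub>)) =
           CH_pair G k
             (H1K_map (CH_group \<pi> k) G (CH_group G k) (CH_unit G k) \<alpha> (CH_map \<pi> G \<alpha> k) x,
              \<one>\<^bsub>CH_group G k\<^esub>)) \<and>
        (\<forall>g\<in>carrier \<pi>. f (CH_unit \<pi> (Suc k) g) = CH_unit G (Suc k) (\<alpha> g)))"

text \<open>\<open>\<F>\<^sub>n\<close> and \<open>\<sigma>\<^sub>n\<close> for finite \<open>n\<close>. As only these are required of an I-functor, it is taken to be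
  defined on \<open>\<Omega>\<^sup>\<rat>\<close> and on isomorphisms.\<close>

definition F_functor :: "nat \<Rightarrow> ('a, 'a) ifunctor" where
  "F_functor n =
     \<lparr>ifun_obj = (\<lambda>G. CH_group G n),
      ifun_def = (\<lambda>\<pi> G \<alpha>. \<alpha> \<in> homs \<pi> G \<and> (Omega_Q \<pi> G \<alpha> \<or> \<alpha> \<in> iso \<pi> G)),
      ifun_map = (\<lambda>\<pi> G \<alpha>. CH_map \<pi> G \<alpha> n),
      ifun_unit = (\<lambda>G. CH_unit G n)\<rparr>"

definition sigma :: "nat \<Rightarrow> 'a monoid \<Rightarrow> 'a set \<Rightarrow> 'a" where
  "sigma n G = on_cosets (CH_unit G n)"

text \<open>The inverse limit of the projections \<open>\<F>\<^sub>k\<^sub>+\<^sub>1(G) \<rightarrow> \<F>\<^sub>k(G)\<close>, as the group of compatible sequences.\<close>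

definition CH_group_omega :: "'a monoid \<Rightarrow> (nat \<Rightarrow> 'a) monoid" where
  "CH_group_omega G =
     (product_group UNIV (CH_group G))
       \<lparr>carrier := {z. \<forall>k. z k \<in> carrier (CH_group G k) \<and>
                       (\<exists>x\<in>carrier (CH_module G k). z (Suc k) = CH_pair G k (x, z k))}\<rparr>"

definition F_functor_omega :: "('a, nat \<Rightarrow> 'a) ifunctor" where
  "F_functor_omega =
     \<lparr>ifun_obj = CH_group_omega,
      ifun_def = (\<lambda>\<pi> G \<alpha>. \<alpha> \<in> homs \<pi> G \<and> (Omega_Q \<pi> G \<alpha> \<or> \<alpha> \<in> iso \<pi> G)),
      ifun_map = (\<lambda>\<pi> G \<alpha> z k. CH_map \<pi> G \<alpha> k (z k)),
      ifun_unit = (\<lambda>G g k. CH_unit G k g)\<rparr>"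

definition sigma_omega :: "'a monoid \<Rightarrow> 'a set \<Rightarrow> nat \<Rightarrow> 'a" where
  "sigma_omega G = on_cosets (\<lambda>g k. CH_unit G k g)"

end

theory Submission
  imports Defs "HOL-Computational_Algebra.Formal_Laurent_Series"
    "HOL-Computational_Algebra.Fraction_Field" "HOL-Library.Countable_Set"
begin

text \<open>
  From the container \<open>\<F>\<close> another one is made, \<open>\<F>'(G) = \<F>(G) \<times> M(G)\<close>, where \<open>M(G)\<close> is trivial or a Heisenberg
  group over a field \<open>K\<close>. It is the latter if \<open>G\<close> has a homomorphism \<open>h\<close> to the Heisenberg group through which
  all such homomorphisms factor uniquely, and which is a quotient of a homomorphism \<open>(p, lam)\<close> from \<open>G\<close> to
  \<open>K[[t]] \<rtimes> K\<close>, with \<open>K\<close> acting by \<open>exp (lam t)\<close> and \<open>lam\<close> injective on \<open>H\<^sub>1(G; \<rat>)\<close>. Homomorphisms to these groups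
  lift uniquely along rationally 2-connected maps, so \<open>M\<close> turns them into isomorphisms, and as \<open>exp (lam t)\<close>
  extends to the skew field of \<open>G / G\<^sub>H\<^sup>(\<^sup>1\<^sup>)\<close>, \<open>h\<close> kills \<open>G\<^sub>H\<^sup>(\<^sup>2\<^sup>)\<close>; so \<open>\<H>\<close> maps to \<open>\<F>'\<close>.

  If \<open>\<F>\<close> were universal, \<open>h\<close> would extend from \<open>G\<close> to \<open>\<F>(G)\<close>. For \<open>G\<close> free of rank two, \<open>h\<close> is not abelian.
  But every commutator \<open>z\<close> in \<open>\<F>(G)\<close> is of the form \<open>[\<gamma>, [\<gamma>, v]]\<close>, with \<open>\<gamma>\<close> a lift of a nontrivial element of
  \<open>\<F>\<^sub>1(G)\<close>: stage by stage, the components of such an equation are linear over a skew field, with coefficient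
  \<open>\<gamma>\<inverse> - z\<inverse> \<noteq> 0\<close>. So \<open>z\<close> dies in the Heisenberg group, which is nilpotent of class two.
\<close>

section \<open>Skew fields of fractions\<close>

text \<open>The form of \<open>M\<close> is forced by two demands. A morphism out of
  \<open>\<H>\<close> has to kill \<open>G_H^(2)\<close>, and a homomorphism to the Heisenberg group
  need not do so: conjugation fixes the centre, which is therefore torsion over the group ring of
  the abelian quotient, and the series absorbs torsion. Deforming the Heisenberg group to
  \<open>K[[t]] \<rtimes> K\<close> removes the torsion, because exponentials with distinct
  exponents are linearly independent; the Heisenberg group is what remains modulo
  \<open>t^2\<close>. The second demand is functoriality for all rationally 2-connected maps, so no
  choice of \<open>h\<close> may matter: unique factorisation through \<open>h\<close> determines
  the transition maps and makes them invertible. Lifting works coefficient by coefficient in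
  \<open>t\<close>, each time against a 2-cocycle with values in a rational vector space with
  trivial action. Injectivity of the new morphism costs nothing, since the component in
  \<open>\<F>\<close> is injective already.\<close>

abbreviation mult_of :: "'a \<Rightarrow> ('a, 'b) monoid_scheme \<Rightarrow> 'a \<Rightarrow> 'a" ("_ *[_] _" [70, 0, 71] 70)
  where "x *[G] y \<equiv> x \<otimes>\<^bsub>G\<^esub> y"
abbreviation one_of :: "('a, 'b) monoid_scheme \<Rightarrow> 'a" ("1[_]")
  where "1[G] \<equiv> \<one>\<^bsub>G\<^esub>"
abbreviation inverse_of :: "('a, 'b) monoid_scheme \<Rightarrow> 'a \<Rightarrow> 'a" ("inv[_] _" [0, 81] 80)
  where "inv[G] x \<equiv> inv\<^bsub>G\<^esub> x"
abbreviation coset_of :: "'a set \<Rightarrow> ('a, 'b) monoid_scheme \<Rightarrow> 'a \<Rightarrow> 'a set" ("_ #>[_] _" [60, 0, 61] 60)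
  where "N #>[G] x \<equiv> N #>\<^bsub>G\<^esub> x"
abbreviation add_of :: "'a \<Rightarrow> ('a, 'b) ring_scheme \<Rightarrow> 'a \<Rightarrow> 'a" ("_ +[_] _" [65, 0, 66] 65)
  where "x +[R] y \<equiv> x \<oplus>\<^bsub>R\<^esub> y"
abbreviation zero_of :: "('a, 'b) ring_scheme \<Rightarrow> 'a" ("0[_]")
  where "0[R] \<equiv> \<zero>\<^bsub>R\<^esub>"
abbreviation uminus_of :: "('a, 'b) ring_scheme \<Rightarrow> 'a \<Rightarrow> 'a" ("-[_] _" [0, 81] 80)
  where "-[R] x \<equiv> \<ominus>\<^bsub>R\<^esub> x"
abbreviation diff_of :: "'a \<Rightarrow> ('a, 'b) ring_scheme \<Rightarrow> 'a \<Rightarrow> 'a" ("_ -[_] _" [65, 0, 66] 65)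
  where "x -[R] y \<equiv> x \<ominus>\<^bsub>R\<^esub> y"


text \<open>The axiom \<open>ore\<close> allows a left fraction with denominator \<open>s\<close>
  and numerator \<open>a\<close> to be rewritten as the right fraction of \<open>u\<close> by
  \<open>v\<close>. This is what multiplication of right fractions and common denominators rest
  on.\<close>

locale right_ore = ring R for R :: "'r ring" (structure) +
  assumes one_not_zero: "\<one> ~= \<zero>"
    and integral: "[|a \<in> carrier R; b \<in> carrier R; a \<otimes> b = \<zero>|] ==> a = \<zero> \<or> b = \<zero>"
    and ore: "[|a \<in> carrier R; s \<in> carrier R; s ~= \<zero>|] ==>
      \<exists>u\<in>carrier R. \<exists>v\<in>carrier R. v ~= \<zero> & a \<otimes> v = s \<otimes> u"
begin

abbreviation "NZ == carrier R - {\<zero>}"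

lemma nz_mult: "[|a \<in> NZ; b \<in> NZ|] ==> a \<otimes> b \<in> NZ"
  using integral by blast

lemma one_NZ: "\<one> \<in> NZ" using one_not_zero by auto

lemma cancel_left: "[|s \<in> NZ; a \<in> carrier R; b \<in> carrier R; s \<otimes> a = s \<otimes> b|] ==> a = b"
proof -
  assume s: "s \<in> NZ" and a: "a \<in> carrier R" and b: "b \<in> carrier R" and e: "s \<otimes> a = s \<otimes> b"
  have "s \<otimes> (a \<ominus> b) = \<zero>" using s a b e by (simp add: r_distr r_minus minus_eq r_neg)
  hence "a \<ominus> b = \<zero>" using integral[of s "a \<ominus> b"] s a b by auto
  thus ?thesis using a b by (simp add: r_right_minus_eq)
qed

lemma cancel_right: "[|s \<in> NZ; a \<in> carrier R; b \<in> carrier R; a \<otimes> s = b \<otimes> s|] ==> a = b"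
proof -
  assume s: "s \<in> NZ" and a: "a \<in> carrier R" and b: "b \<in> carrier R" and e: "a \<otimes> s = b \<otimes> s"
  have "(a \<ominus> b) \<otimes> s = \<zero>" using s a b e by (simp add: l_distr l_minus minus_eq r_neg)
  hence "a \<ominus> b = \<zero>" using integral[of "a \<ominus> b" s] s a b by auto
  thus ?thesis using a b by (simp add: r_right_minus_eq)
qed

lemma ore_NZ:
  assumes "a \<in> NZ" "s \<in> NZ" obtains u v where "u \<in> NZ" "v \<in> NZ" "a \<otimes> v = s \<otimes> u"
proof -
  obtain u v where uv: "u \<in> carrier R" "v \<in> carrier R" "v ~= \<zero>" "a \<otimes> v = s \<otimes> u"
    using ore[of a s] assms by auto
  have "u ~= \<zero>" using uv assms nz_mult[of a v] by auto
  thus ?thesis using uv that by auto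
qed

section \<open>Equivalence of right fractions\<close>

abbreviation "rel == frac_rel R"
definition cls where "cls a s = rel `` {(a, s)}"

lemma relI:
  assumes "a \<in> carrier R" "b \<in> carrier R" "s \<in> NZ" "t \<in> NZ" "u \<in> NZ" "v \<in> carrier R"
    "s \<otimes> u = t \<otimes> v" "a \<otimes> u = b \<otimes> v"
  shows "((a, s), (b, t)) \<in> rel"
proof -
  have "s \<otimes> u ~= \<zero>" using assms nz_mult[of s u] by auto
  thus ?thesis unfolding frac_rel_def using assms by blast
qed

lemma relE:
  assumes "((a, s), (b, t)) \<in> rel"
  obtains u v where "a \<in> carrier R" "b \<in> carrier R" "s \<in> NZ" "t \<in> NZ" "u \<in> NZ" "v \<in> NZ"
    "s \<otimes> u = t \<otimes> v" "a \<otimes> u = b \<otimes> v"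
proof -
  from assms obtain u v where *: "a \<in> carrier R" "b \<in> carrier R" "s \<in> NZ" "t \<in> NZ" "u \<in> carrier R"
    "v \<in> carrier R" "s \<otimes> u = t \<otimes> v" "s \<otimes> u ~= \<zero>" "a \<otimes> u = b \<otimes> v"
    unfolding frac_rel_def by auto
  have "u ~= \<zero>" "v ~= \<zero>" using * by auto
  with * that show ?thesis by blast
qed

lemma equiv_rel: "equiv (carrier R \<times> NZ) rel"
proof (rule equivI)
  show "rel <= (carrier R \<times> NZ) \<times> (carrier R \<times> NZ)" unfolding frac_rel_def by auto
  show "refl_on (carrier R \<times> NZ) rel"
    by (rule refl_onI) (use relI[where u = \<one> and v = \<one>] one_NZ in auto)
  show "sym rel"
  proof (rule symI, clarify)
    fix a s b t assume "((a, s), (b, t)) \<in> rel"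
    then obtain u v where "a \<in> carrier R" "b \<in> carrier R" "s \<in> NZ" "t \<in> NZ" "u \<in> NZ" "v \<in> NZ"
      "s \<otimes> u = t \<otimes> v" "a \<otimes> u = b \<otimes> v" by (rule relE)
    thus "((b, t), (a, s)) \<in> rel" by (intro relI[of b a t s v u]) auto
  qed
  show "trans rel"
  proof (rule transI, clarify)
    fix a s b t c r assume 1: "((a, s), (b, t)) \<in> rel" and 2: "((b, t), (c, r)) \<in> rel"
    obtain u v where u: "a \<in> carrier R" "b \<in> carrier R" "s \<in> NZ" "t \<in> NZ" "u \<in> NZ" "v \<in> NZ"
      "s \<otimes> u = t \<otimes> v" "a \<otimes> u = b \<otimes> v" using 1 by (rule relE)
    obtain u' v' where u': "c \<in> carrier R" "r \<in> NZ" "u' \<in> NZ" "v' \<in> NZ"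
      "t \<otimes> u' = r \<otimes> v'" "b \<otimes> u' = c \<otimes> v'" using 2 by (rule relE)
    \<comment> \<open>The two relations expand the middle denominator \<open>t\<close> by
      \<open>v\<close> and by \<open>u'\<close>. A common right multiple of \<open>v\<close> and
      \<open>u'\<close> makes the expansions agree.\<close>
    obtain x y where xy: "y \<in> NZ" "x \<in> NZ" "v \<otimes> x = u' \<otimes> y" using ore_NZ[OF u(6) u'(3)] by blast
    have c: "a \<in> carrier R" "b \<in> carrier R" "c \<in> carrier R" "s \<in> carrier R" "t \<in> carrier R" "r \<in> carrier R"
      "u \<in> carrier R" "v \<in> carrier R" "u' \<in> carrier R" "v' \<in> carrier R" "x \<in> carrier R" "y \<in> carrier R"
      using u u' xy by auto
    show "((a, s), (c, r)) \<in> rel"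
    proof (rule relI[where u = "u \<otimes> x" and v = "v' \<otimes> y"])
      have "s \<otimes> (u \<otimes> x) = t \<otimes> (v \<otimes> x)" using c u(7) by (metis m_assoc)
      also have "\<dots> = r \<otimes> (v' \<otimes> y)" using c xy(3) u'(5) by (metis m_assoc)
      finally show "s \<otimes> (u \<otimes> x) = r \<otimes> (v' \<otimes> y)" .
      have "a \<otimes> (u \<otimes> x) = b \<otimes> (v \<otimes> x)" using c u(8) by (metis m_assoc)
      also have "\<dots> = c \<otimes> (v' \<otimes> y)" using c xy(3) u'(6) by (metis m_assoc)
      finally show "a \<otimes> (u \<otimes> x) = c \<otimes> (v' \<otimes> y)" .
    qed (use c u u' xy nz_mult in auto)
  qed
qed

lemma cls_eq_iff:
  assumes "a \<in> carrier R" "s \<in> NZ" "b \<in> carrier R" "t \<in> NZ"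
  shows "cls a s = cls b t \<longleftrightarrow> ((a, s), (b, t)) \<in> rel"
  unfolding cls_def using eq_equiv_class_iff[OF equiv_rel] assms by auto

lemma mem_cls: "(b, t) \<in> cls a s \<longleftrightarrow> ((a, s), (b, t)) \<in> rel"
  unfolding cls_def by auto

lemma mem_clsD: "(b, t) \<in> cls a s ==> b \<in> carrier R & t \<in> NZ & cls b t = cls a s"
  unfolding mem_cls using cls_eq_iff by (metis relE)

lemma cls_self: "a \<in> carrier R ==> s \<in> NZ ==> (a, s) \<in> cls a s"
  using cls_eq_iff mem_cls by auto

lemma cls_expand: "[|a \<in> carrier R; s \<in> NZ; u \<in> NZ|] ==> cls (a \<otimes> u) (s \<otimes> u) = cls a s"
  by (subst cls_eq_iff) (use nz_mult one_NZ in \<open>auto intro!: relI[where u = \<one> and v = u]\<close>)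

lemma cls_same_denom: "[|a \<in> carrier R; b \<in> carrier R; s \<in> NZ|] ==> cls a s = cls b s \<longleftrightarrow> a = b"
proof
  assume a: "a \<in> carrier R" "b \<in> carrier R" "s \<in> NZ" and "cls a s = cls b s"
  hence "((a, s), (b, s)) \<in> rel" using cls_eq_iff by auto
  then obtain u v where u: "u \<in> NZ" "v \<in> NZ" "s \<otimes> u = s \<otimes> v" "a \<otimes> u = b \<otimes> v" by (rule relE)
  hence "u = v" using cancel_left[of s u v] a by auto
  thus "a = b" using cancel_right[of u a b] a u by auto
qed auto

section \<open>Arithmetic of right fractions\<close>

abbreviation "Q == right_quotients R"

lemma carrier_Q: "carrier Q = {cls a s | a s. a \<in> carrier R & s \<in> NZ}"
  unfolding right_quotients_def quotient_def cls_def by auto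

lemma Q_cases: assumes "A \<in> carrier Q" obtains a s where "a \<in> carrier R" "s \<in> NZ" "A = cls a s"
  using assms unfolding carrier_Q by auto

lemma cls_closed [simp, intro]: "a \<in> carrier R ==> s \<in> NZ ==> cls a s \<in> carrier Q"
  unfolding carrier_Q by auto

text \<open>A denominator can be moved into the right multiples of any prescribed \<open>s\<close>.
  Repeated use gives common denominators for two and for three fractions.\<close>

lemma common2:
  assumes "A \<in> carrier Q" "s \<in> NZ"
  obtains a t where "a \<in> carrier R" "t \<in> NZ" "s \<otimes> t \<in> NZ" "A = cls a (s \<otimes> t)"
proof -
  obtain b r where b: "b \<in> carrier R" "r \<in> NZ" "A = cls b r" using assms Q_cases by blast
  obtain u v where uv: "u \<in> NZ" "v \<in> NZ" "r \<otimes> v = s \<otimes> u" using ore_NZ[OF b(2) assms(2)] by blast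
  have "A = cls (b \<otimes> v) (s \<otimes> u)" using cls_expand[of b r v] b uv by auto
  thus ?thesis using that[of "b \<otimes> v" u] b uv nz_mult[of s u] assms by auto
qed

lemma Q_cases2:
  assumes "A \<in> carrier Q" "B \<in> carrier Q"
  obtains a b s where "a \<in> carrier R" "b \<in> carrier R" "s \<in> NZ" "A = cls a s" "B = cls b s"
proof -
  obtain a s where a: "a \<in> carrier R" "s \<in> NZ" "A = cls a s" using assms Q_cases by blast
  obtain b t where b: "b \<in> carrier R" "t \<in> NZ" "s \<otimes> t \<in> NZ" "B = cls b (s \<otimes> t)" using common2[OF assms(2) a(2)] by blast
  show ?thesis using that[of "a \<otimes> t" b "s \<otimes> t"] a b cls_expand[of a s t] by auto
qed

lemma Q_cases3:
  assumes "A \<in> carrier Q" "B \<in> carrier Q" "C \<in> carrier Q"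
  obtains a b c s where "a \<in> carrier R" "b \<in> carrier R" "c \<in> carrier R" "s \<in> NZ"
    "A = cls a s" "B = cls b s" "C = cls c s"
proof -
  obtain a b s where a: "a \<in> carrier R" "b \<in> carrier R" "s \<in> NZ" "A = cls a s" "B = cls b s"
    using assms Q_cases2 by blast
  obtain c t where c: "c \<in> carrier R" "t \<in> NZ" "s \<otimes> t \<in> NZ" "C = cls c (s \<otimes> t)" using common2[OF assms(3) a(3)] by blast
  show ?thesis using that[of "a \<otimes> t" "b \<otimes> t" c "s \<otimes> t"] a c cls_expand[of a s t] cls_expand[of b s t] by auto
qed

text \<open>The normal form for a right factor whose left neighbour has denominator
  \<open>s\<close>: the \<open>s\<close> in the numerator then cancels, see \<open>mult_cls\<close>.
  All laws involving products are checked in this form.\<close>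

lemma Q_numer:
  assumes "B \<in> carrier Q" "s \<in> NZ"
  obtains c t where "c \<in> carrier R" "t \<in> NZ" "B = cls (s \<otimes> c) t"
proof -
  obtain b r where b: "b \<in> carrier R" "r \<in> NZ" "B = cls b r" using assms Q_cases by blast
  obtain u v where uv: "u \<in> carrier R" "v \<in> NZ" "b \<otimes> v = s \<otimes> u" using ore[of b s] b assms by auto
  show ?thesis using that[of u "r \<otimes> v"] b uv cls_expand[of b r v] nz_mult[of r v] by auto
qed

lemma Q_numer2:
  assumes "B \<in> carrier Q" "C \<in> carrier Q" "s \<in> NZ"
  obtains b c t where "b \<in> carrier R" "c \<in> carrier R" "t \<in> NZ" "B = cls (s \<otimes> b) t" "C = cls (s \<otimes> c) t"
proof -
  obtain b c r where b: "b \<in> carrier R" "c \<in> carrier R" "r \<in> NZ" "B = cls b r" "C = cls c r"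
    using assms Q_cases2 by blast
  obtain u v where uv: "u \<in> carrier R" "v \<in> NZ" "b \<otimes> v = s \<otimes> u" using ore[of b s] b assms by auto
  obtain x y where xy: "x \<in> carrier R" "y \<in> NZ" "(c \<otimes> v) \<otimes> y = s \<otimes> x" using ore[of "c \<otimes> v" s] b uv assms by auto
  have vy: "v \<otimes> y \<in> NZ" using nz_mult uv xy by auto
  have "b \<otimes> (v \<otimes> y) = s \<otimes> (u \<otimes> y)" using b uv xy assms(3) m_assoc[of b v y] m_assoc[of s u y] by auto
  moreover have "c \<otimes> (v \<otimes> y) = s \<otimes> x" using b uv xy assms(3) m_assoc[of c v y] by auto
  ultimately show ?thesis
    using that[of "u \<otimes> y" x "r \<otimes> (v \<otimes> y)"] b uv xy vy cls_expand[of b r "v \<otimes> y"] cls_expand[of c r "v \<otimes> y"]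
      nz_mult[of r "v \<otimes> y"] by auto
qed

text \<open>Addition in \<open>right_quotients\<close> is a union over all representatives with
  equal denominators. Any two such choices agree after expansion to one denominator, so that the
  union consists of a single class.\<close>

lemma add_cls:
  assumes "a \<in> carrier R" "b \<in> carrier R" "s \<in> NZ"
  shows "cls a s +[Q] cls b s = cls (a \<oplus> b) s"
proof -
  have *: "cls (a' \<oplus> b') r = cls (a \<oplus> b) s" if "(a', r) \<in> cls a s" "(b', r) \<in> cls b s" for a' b' r
  proof -
    have m: "a' \<in> carrier R" "b' \<in> carrier R" "r \<in> NZ" "cls a' r = cls a s" "cls b' r = cls b s"
      using that mem_clsD by auto
    obtain u v where uv: "u \<in> NZ" "v \<in> NZ" "r \<otimes> v = s \<otimes> u" using ore_NZ[OF m(3) assms(3)] by blast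
    have "cls (a' \<otimes> v) (s \<otimes> u) = cls (a \<otimes> u) (s \<otimes> u)" "cls (b' \<otimes> v) (s \<otimes> u) = cls (b \<otimes> u) (s \<otimes> u)"
      using cls_expand[of a' r v] cls_expand[of b' r v] cls_expand[of a s u] cls_expand[of b s u] m uv assms by auto
    hence "a' \<otimes> v = a \<otimes> u" "b' \<otimes> v = b \<otimes> u"
      using cls_same_denom[of "a' \<otimes> v" "a \<otimes> u" "s \<otimes> u"] cls_same_denom[of "b' \<otimes> v" "b \<otimes> u" "s \<otimes> u"]
        m uv assms nz_mult[of s u] by auto
    hence "(a' \<oplus> b') \<otimes> v = (a \<oplus> b) \<otimes> u" using m uv assms by (simp add: l_distr)
    thus ?thesis using cls_expand[of "a' \<oplus> b'" r v] cls_expand[of "a \<oplus> b" s u] m uv assms by auto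
  qed
  have "{rel `` {(a' \<oplus> b', r)} | a' b' r. (a', r) \<in> cls a s & (b', r) \<in> cls b s} = {cls (a \<oplus> b) s}"
    using * cls_self assms unfolding cls_def[symmetric] by fast
  thus ?thesis unfolding right_quotients_def by simp
qed

text \<open>As for addition, the union over all representatives collapses to one class. Two Ore
  multiples are needed, one from comparing the left factors and one to match the numerators
  \<open>b'\<close> and \<open>c\<close>.\<close>

lemma mult_cls:
  assumes "a \<in> carrier R" "s \<in> NZ" "c \<in> carrier R" "t \<in> NZ"
  shows "cls a s *[Q] cls (s \<otimes> c) t = cls (a \<otimes> c) t"
proof -
  have *: "cls (a1 \<otimes> b') (t1 \<otimes> s') = cls (a \<otimes> c) t"
    if "(a1, s1) \<in> cls a s" "(b1, t1) \<in> cls (s \<otimes> c) t" "b' \<in> carrier R" "s' \<in> NZ" "b1 \<otimes> s' = s1 \<otimes> b'"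
    for a1 s1 b1 t1 b' s'
  proof -
    have m: "a1 \<in> carrier R" "s1 \<in> NZ" "b1 \<in> carrier R" "t1 \<in> NZ" and
      m': "cls a1 s1 = cls a s" "cls b1 t1 = cls (s \<otimes> c) t"
      using that mem_clsD by auto
    have "((a1, s1), (a, s)) \<in> rel" using m'(1) cls_eq_iff[of a1 s1 a s] m assms by blast
    then obtain u v where u: "u \<in> NZ" "v \<in> NZ" "s1 \<otimes> u = s \<otimes> v" "a1 \<otimes> u = a \<otimes> v"
      by (rule relE)
    have "cls (b1 \<otimes> s') (t1 \<otimes> s') = cls (s \<otimes> c) t" using cls_expand[of b1 t1 s'] m m' that by auto
    hence "((s1 \<otimes> b', t1 \<otimes> s'), (s \<otimes> c, t)) \<in> rel" using cls_eq_iff that m assms nz_mult by auto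
    then obtain x y where x: "x \<in> NZ" "y \<in> NZ" "t1 \<otimes> s' \<otimes> x = t \<otimes> y" "s1 \<otimes> b' \<otimes> x = s \<otimes> c \<otimes> y"
      by (rule relE)
    have "b' \<otimes> x \<in> carrier R" using \<open>b' \<in> carrier R\<close> x(1) by auto
    then obtain w z where z: "w \<in> carrier R" "z \<in> NZ" "b' \<otimes> x \<otimes> z = u \<otimes> w"
      using ore[of "b' \<otimes> x" u] u(1) by blast
    have c: "a \<in> carrier R" "s \<in> carrier R" "c \<in> carrier R" "t \<in> carrier R" "a1 \<in> carrier R" "s1 \<in> carrier R"
      "b1 \<in> carrier R" "t1 \<in> carrier R" "b' \<in> carrier R" "s' \<in> carrier R" "u \<in> carrier R" "v \<in> carrier R"
      "x \<in> carrier R" "y \<in> carrier R" "w \<in> carrier R" "z \<in> carrier R"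
      using m that u x z assms by auto
    have "s \<otimes> (c \<otimes> y \<otimes> z) = s1 \<otimes> (b' \<otimes> x \<otimes> z)" using c x(4) by (metis m_assoc m_closed)
    also have "\<dots> = s \<otimes> (v \<otimes> w)" using c z(3) u(3) by (metis m_assoc)
    finally have e: "c \<otimes> y \<otimes> z = v \<otimes> w" using cancel_left[of s "c \<otimes> y \<otimes> z" "v \<otimes> w"] assms c by auto
    have "a1 \<otimes> b' \<otimes> (x \<otimes> z) = a1 \<otimes> (u \<otimes> w)" using c z(3) by (metis m_assoc m_closed)
    also have "\<dots> = a \<otimes> (v \<otimes> w)" using c u(4) by (metis m_assoc)
    also have "\<dots> = a \<otimes> c \<otimes> (y \<otimes> z)" using c e by (metis m_assoc m_closed)
    finally have e1: "a1 \<otimes> b' \<otimes> (x \<otimes> z) = a \<otimes> c \<otimes> (y \<otimes> z)" .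
    have e2: "t1 \<otimes> s' \<otimes> (x \<otimes> z) = t \<otimes> (y \<otimes> z)" using c x(3) by (metis m_assoc m_closed)
    show ?thesis
      using c m that assms nz_mult x z
      by (subst cls_eq_iff) (auto intro!: relI[where u = "x \<otimes> z" and v = "y \<otimes> z"] e1 e2)
  qed
  have "{rel `` {(a1 \<otimes> b', t1 \<otimes> s')} | a1 s1 b1 t1 b' s'. (a1, s1) \<in> cls a s & (b1, t1) \<in> cls (s \<otimes> c) t &
     b' \<in> carrier R & s' \<in> NZ & b1 \<otimes> s' = s1 \<otimes> b'} = {cls (a \<otimes> c) t}" (is "?S = _")
  proof
    show "?S <= {cls (a \<otimes> c) t}" using * unfolding cls_def[symmetric] by fast
    \<comment> \<open>The union is not empty: the given representatives are admissible with
      \<open>b' = c\<close> and \<open>s' = \<one>\<close>.\<close>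
    have "cls (a \<otimes> c) (t \<otimes> \<one>) \<in> ?S" unfolding cls_def[symmetric]
      using cls_self[of a s] cls_self[of "s \<otimes> c" t] assms one_NZ
      by (intro CollectI exI[of _ a] exI[of _ s] exI[of _ "s \<otimes> c"] exI[of _ t] exI[of _ c] exI[of _ \<one>]) auto
    thus "{cls (a \<otimes> c) t} <= ?S" using assms by auto
  qed
  thus ?thesis unfolding right_quotients_def by simp
qed

lemma zero_Q: "0[Q] = cls \<zero> \<one>" and one_Q: "1[Q] = cls \<one> \<one>"
  unfolding right_quotients_def cls_def by simp_all

lemma zero_Q': "s \<in> NZ ==> cls \<zero> s = 0[Q]"
  using cls_expand[of \<zero> \<one> s] one_NZ by (simp add: zero_Q)

lemma one_Q': "s \<in> NZ ==> cls s s = 1[Q]"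
  using cls_expand[of \<one> \<one> s] one_NZ by (simp add: one_Q)

lemma cls_zero_iff: "[|a \<in> carrier R; s \<in> NZ|] ==> cls a s = 0[Q] \<longleftrightarrow> a = \<zero>"
  using zero_Q'[of s] cls_same_denom[of a \<zero> s] by auto

lemma abelian_group_Q: "abelian_group Q"
proof (rule abelian_groupI)
  fix A B assume A: "A \<in> carrier Q" and B: "B \<in> carrier Q"
  then obtain a b s where *: "a \<in> carrier R" "b \<in> carrier R" "s \<in> NZ" "A = cls a s" "B = cls b s" by (rule Q_cases2)
  thus "A +[Q] B \<in> carrier Q" by (auto simp: add_cls)
  show "A +[Q] B = B +[Q] A" using * by (auto simp: add_cls a_comm)
  fix C assume "C \<in> carrier Q"
  with A B obtain a b c s where "a \<in> carrier R" "b \<in> carrier R" "c \<in> carrier R" "s \<in> NZ"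
    "A = cls a s" "B = cls b s" "C = cls c s" by (rule Q_cases3)
  thus "A +[Q] B +[Q] C = A +[Q] (B +[Q] C)" by (auto simp: add_cls a_assoc)
next
  show "0[Q] \<in> carrier Q" using one_NZ by (auto simp: zero_Q)
  fix A assume "A \<in> carrier Q"
  then obtain a s where *: "a \<in> carrier R" "s \<in> NZ" "A = cls a s" by (rule Q_cases)
  hence z: "0[Q] = cls \<zero> s" using zero_Q' by simp
  show "0[Q] +[Q] A = A" using * by (simp add: z add_cls)
  show "\<exists>y\<in>carrier Q. y +[Q] A = 0[Q]" using *
    by (intro bexI[of _ "cls (\<ominus> a) s"]) (auto simp: z add_cls l_neg)
qed

lemma ring_Q: "ring Q"
proof (rule ringI)
  show "abelian_group Q" by (rule abelian_group_Q)
  show "Group.monoid Q"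
  proof
    fix A B assume A: "A \<in> carrier Q" and B: "B \<in> carrier Q"
    obtain a s where a: "a \<in> carrier R" "s \<in> NZ" "A = cls a s" using A by (rule Q_cases)
    obtain c t where c: "c \<in> carrier R" "t \<in> NZ" "B = cls (s \<otimes> c) t" using Q_numer[OF B a(2)] by blast
    show "A *[Q] B \<in> carrier Q" using a c by (auto simp: mult_cls)
    fix C assume "C \<in> carrier Q"
    then obtain d r where d: "d \<in> carrier R" "r \<in> NZ" "C = cls (t \<otimes> d) r" using Q_numer[OF _ c(2)] by blast
    have "A *[Q] B *[Q] C = cls (a \<otimes> c \<otimes> d) r" using a c d by (simp add: mult_cls)
    moreover have "B *[Q] C = cls (s \<otimes> (c \<otimes> d)) r" using a c d by (simp add: mult_cls m_assoc)
    ultimately show "A *[Q] B *[Q] C = A *[Q] (B *[Q] C)" using a c d by (simp add: mult_cls m_assoc)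
  next
    show "1[Q] \<in> carrier Q" using one_NZ by (auto simp: one_Q)
    fix A assume "A \<in> carrier Q"
    then obtain a s where *: "a \<in> carrier R" "s \<in> NZ" "A = cls a s" by (rule Q_cases)
    show "1[Q] *[Q] A = A" using mult_cls[of \<one> \<one> a s] * one_NZ by (simp add: one_Q)
    show "A *[Q] 1[Q] = A" using mult_cls[of a s \<one> s] * one_Q'[of s] by simp
  qed
  fix A B C assume A: "A \<in> carrier Q" and B: "B \<in> carrier Q" and C: "C \<in> carrier Q"
  { obtain a b s where a: "a \<in> carrier R" "b \<in> carrier R" "s \<in> NZ" "A = cls a s" "B = cls b s" using A B by (rule Q_cases2)
    obtain c t where c: "c \<in> carrier R" "t \<in> NZ" "C = cls (s \<otimes> c) t" using Q_numer[OF C a(3)] by blast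
    show "(A +[Q] B) *[Q] C = A *[Q] C +[Q] B *[Q] C" using a c by (simp add: mult_cls add_cls l_distr) }
  { obtain c s where c: "c \<in> carrier R" "s \<in> NZ" "C = cls c s" using C by (rule Q_cases)
    obtain a b t where a: "a \<in> carrier R" "b \<in> carrier R" "t \<in> NZ" "A = cls (s \<otimes> a) t" "B = cls (s \<otimes> b) t"
      using Q_numer2[OF A B c(2)] by blast
    have "A +[Q] B = cls (s \<otimes> (a \<oplus> b)) t" using a c by (simp add: add_cls r_distr)
    thus "C *[Q] (A +[Q] B) = C *[Q] A +[Q] C *[Q] B" using a c by (simp add: mult_cls add_cls r_distr del: r_distr[symmetric]) (simp add: r_distr[symmetric] mult_cls) }
qed

lemma inverse_Q:
  assumes "A \<in> carrier Q" "A ~= 0[Q]"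
  obtains B where "B \<in> carrier Q" "A *[Q] B = 1[Q]" "B *[Q] A = 1[Q]"
proof -
  obtain a s where *: "a \<in> carrier R" "s \<in> NZ" "A = cls a s" using assms Q_cases by blast
  have a: "a \<in> NZ" using * assms cls_zero_iff by auto
  show ?thesis
  proof
    show "cls s a \<in> carrier Q" using a * by auto
    show "A *[Q] cls s a = 1[Q]" using mult_cls[of a s \<one> a] a * one_Q'[of a] by auto
    show "cls s a *[Q] A = 1[Q]" using mult_cls[of s a \<one> s] a * one_Q'[of s] by auto
  qed
qed

lemma one_neq_zero_Q: "1[Q] ~= 0[Q]"
  using cls_zero_iff[of \<one> \<one>] one_NZ by (auto simp: one_Q)

end

section \<open>Groups with unique products and the Foelner condition\<close>

definition unique_products :: "'g monoid => bool" where
  "unique_products \<Gamma> \<longleftrightarrow> (\<forall>A B. finite A & finite B & A ~= {} & B ~= {} & A <= carrier \<Gamma> & B <= carrier \<Gamma> -->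
     (\<exists>a\<in>A. \<exists>b\<in>B. \<forall>a'\<in>A. \<forall>b'\<in>B. a' *[\<Gamma>] b' = a *[\<Gamma>] b --> a' = a & b' = b))"

text \<open>The translates are taken on the left because the denominators of right fractions are
  common right multiples: the support of \<open>a v\<close> lies in \<open>S F\<close> if that of
  \<open>a\<close> lies in \<open>S\<close> and that of \<open>v\<close> in
  \<open>F\<close>.\<close>

definition foelner :: "'g monoid => bool" where
  "foelner \<Gamma> \<longleftrightarrow> (\<forall>S (e::real). finite S & S <= carrier \<Gamma> & e > 0 -->
     (\<exists>F. finite F & F ~= {} & F <= carrier \<Gamma> & card (S <#>\<^bsub>\<Gamma>\<^esub> F) \<le> (1 + e) * card F))"

text \<open>A substitute for being PTFA. Unique products make the integral group ring a domain and
  the Foelner condition gives the Ore condition. Both pass to extensions with torsion-free abelian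
  kernel, which is how all quotients and tower groups arise.\<close>

definition ore_group :: "'g monoid => bool" where
  "ore_group \<Gamma> \<longleftrightarrow> group \<Gamma> & unique_products \<Gamma> & foelner \<Gamma>"

lemma unique_productsD:
  assumes "unique_products \<Gamma>" "finite A" "finite B" "A ~= {}" "B ~= {}" "A <= carrier \<Gamma>" "B <= carrier \<Gamma>"
  obtains a b where "a \<in> A" "b \<in> B" "\<forall>a'\<in>A. \<forall>b'\<in>B. a' *[\<Gamma>] b' = a *[\<Gamma>] b --> a' = a & b' = b"
proof -
  have "\<exists>a\<in>A. \<exists>b\<in>B. \<forall>a'\<in>A. \<forall>b'\<in>B. a' *[\<Gamma>] b' = a *[\<Gamma>] b --> a' = a & b' = b"
    using assms unfolding unique_products_def by blast
  thus ?thesis using that by blast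
qed

lemma foelnerD:
  fixes e :: real
  assumes "foelner \<Gamma>" "finite S" "S <= carrier \<Gamma>" "(e::real) > 0"
  obtains F where "finite F" "F ~= {}" "F <= carrier \<Gamma>" "card (S <#>\<^bsub>\<Gamma>\<^esub> F) \<le> (1 + e) * card F"
proof -
  have "\<exists>F. finite F & F ~= {} & F <= carrier \<Gamma> & card (S <#>\<^bsub>\<Gamma>\<^esub> F) \<le> (1 + e) * card F"
    using assms(1)[unfolded foelner_def, rule_format, of S e] assms(2-4) by simp
  thus ?thesis using that by blast
qed

lemma finite_set_mult: "finite A ==> finite B ==> finite (A <#>\<^bsub>G\<^esub> B)"
  unfolding set_mult_def by auto

lemma ore_group_trivial:
  fixes \<Gamma> :: "'g monoid" (structure)
  assumes "group \<Gamma>" "carrier \<Gamma> = {1[\<Gamma>]}"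
  shows "ore_group \<Gamma>"
proof -
  interpret group \<Gamma> by fact
  have "unique_products \<Gamma>" unfolding unique_products_def
  proof (intro allI impI)
    fix A B assume "finite A & finite B & A ~= {} & B ~= {} & A <= carrier \<Gamma> & B <= carrier \<Gamma>"
    hence "A = {\<one>}" "B = {\<one>}" unfolding assms(2) subset_singleton_iff by blast+
    thus "\<exists>a\<in>A. \<exists>b\<in>B. \<forall>a'\<in>A. \<forall>b'\<in>B. a' \<otimes> b' = a \<otimes> b --> a' = a & b' = b" by simp
  qed
  moreover have "foelner \<Gamma>" unfolding foelner_def
  proof (intro allI impI exI conjI)
    fix S :: "'g set" and e :: real assume S: "finite S & S <= carrier \<Gamma> & e > 0"
    hence "S <#> {\<one>} <= {\<one>}" unfolding assms(2) set_mult_def by auto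
    hence "card (S <#> {\<one>}) \<le> card {\<one>}" by (intro card_mono) auto
    thus "real (card (S <#> {\<one>})) \<le> (1 + e) * card {\<one>}" using S by auto
  qed auto
  ultimately show ?thesis using assms unfolding ore_group_def by auto
qed

section \<open>Torsion-free abelian groups\<close>

lemma polynomial_growth_foelner:
  fixes c :: "nat => real"
  assumes "c 0 \<ge> 1" "!!k. c k \<le> real (Suc k) ^ d" "e > 0"
  shows "\<exists>k. c (Suc k) \<le> (1 + e) * c k"
proof (rule ccontr)
  assume "\<not> ?thesis"
  hence *: "c (Suc k) \<ge> (1 + e) * c k" for k by (auto simp: not_le intro: less_imp_le)
  have ge: "c k \<ge> (1 + e) ^ k" for k
  proof (induction k)
    case (Suc k)
    have "(1 + e) ^ Suc k \<le> (1 + e) * c k" unfolding power_Suc by (rule mult_left_mono) (use Suc assms(3) in auto)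
    thus ?case using *[of k] by linarith
  qed (use assms(1) in simp)
  define l where "l = ln (1 + e)"
  have l: "l > 0" using assms(3) by (simp add: l_def)
  have "filterlim (%n. l * real n) at_top sequentially"
    by (rule filterlim_tendsto_pos_mult_at_top[OF tendsto_const l filterlim_real_sequentially])
  hence "(%n. (l * real n) ^ d / exp (l * real n)) \<longlonglongrightarrow> 0"
    by (rule filterlim_compose[OF tendsto_power_div_exp_0])
  hence "\<forall>\<^sub>F n in sequentially. (l * real n) ^ d / exp (l * real n) < (l / 2) ^ d"
    by (rule order_tendstoD(2)) (use l in simp)
  then obtain N where N: "!!n. n \<ge> N ==> (l * real n) ^ d / exp (l * real n) < (l / 2) ^ d"
    unfolding eventually_sequentially by blast
  \<comment> \<open>Since \<open>n\<close> is positive, \<open>n + 1\<close> is at most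
    \<open>2 n\<close>; the factor 2 is absorbed by the bound \<open>(l / 2) ^ d\<close> chosen in
    the limit, and the chain of inequalities returns to its start.\<close>
  define n where "n = Suc N"
  have nN: "n \<ge> N" by (simp add: n_def)
  have e: "exp (l * real n) = (1 + e) ^ n" using assms(3)
    by (simp only: exp_of_nat2_mult) (simp add: l_def)
  have "(l * real n) ^ d < (l / 2) ^ d * (1 + e) ^ n"
    using N[OF nN] assms(3) by (simp add: e divide_less_eq)
  also have "\<dots> \<le> (l / 2) ^ d * real (Suc n) ^ d"
    by (rule mult_left_mono[OF order_trans[OF ge assms(2)]]) (use l in simp)
  also have "\<dots> \<le> (l / 2) ^ d * (2 * real n) ^ d" by (rule mult_left_mono, rule power_mono) (use l in \<open>simp_all add: n_def\<close>)
  also have "\<dots> = (l * real n) ^ d" by (subst power_mult_distrib[symmetric]) simp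
  finally show False by simp
qed

text \<open>The products of elements of \<open>S\<close> with all exponents at most \<open>k\<close>
  number at most \<open>(k + 1) ^ card S\<close>, and multiplication by \<open>S\<close> raises one
  exponent by one. Polynomial growth then provides a good \<open>k\<close>.\<close>

lemma foelner_abelian:
  fixes G :: "'g monoid" (structure)
  assumes "comm_group G"
  shows "foelner G"
  unfolding foelner_def
proof (intro allI impI)
  interpret comm_group G by fact
  fix S and e :: real assume S: "finite S & S <= carrier G & e > 0"
  define P where "P k = (%f. \<Otimes>s\<in>S. s [^] (f s :: nat)) ` (PiE S (%_. {..k}))" for k
  have fin: "finite (P k)" for k unfolding P_def using S by (intro finite_imageI finite_PiE) auto
  have sub: "P k <= carrier G" for k unfolding P_def using S by (auto intro!: finprod_closed)
  have card: "card (P k) \<le> Suc k ^ card S" for k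
    unfolding P_def using S card_image_le[OF finite_PiE[of S "%_. {..k}"], of "%f. \<Otimes>s\<in>S. s [^] (f s :: nat)"]
    by (simp add: card_PiE)
  have ne: "P k ~= {}" for k unfolding P_def by (auto simp: PiE_eq_empty_iff)
  have step: "S <#> P k <= P (Suc k)" for k
  proof
    fix x assume "x \<in> S <#> P k"
    then obtain t f where t: "t \<in> S" and f: "f \<in> PiE S (%_. {..k})" and x: "x = t \<otimes> (\<Otimes>s\<in>S. s [^] (f s :: nat))"
      unfolding set_mult_def P_def by auto
    have tc: "t \<in> carrier G" using t S by auto
    have Sd: "S = insert t (S - {t})" using t by auto
    have c1: "(%s. s [^] f s) \<in> S - {t} \<rightarrow> carrier G" using S by auto
    have "(\<Otimes>s\<in>S. s [^] ((f(t := Suc (f t))) s)) = t [^] Suc (f t) \<otimes> (\<Otimes>s\<in>S-{t}. s [^] f s)"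
      by (subst Sd, subst finprod_insert) (use S t tc c1 in \<open>auto intro!: arg_cong2[where f = "monoid.mult G"] finprod_cong\<close>)
    also have "\<dots> = t \<otimes> (t [^] f t \<otimes> (\<Otimes>s\<in>S-{t}. s [^] f s))"
      using tc c1 by (simp add: m_ac finprod_closed)
    also have "t [^] f t \<otimes> (\<Otimes>s\<in>S-{t}. s [^] f s) = (\<Otimes>s\<in>S. s [^] f s)"
      by (subst (2) Sd, subst finprod_insert) (use S t tc c1 in auto)
    finally have "x = (\<Otimes>s\<in>S. s [^] ((f(t := Suc (f t))) s))" using x by simp
    moreover have "f(t := Suc (f t)) \<in> PiE S (%_. {..Suc k})" using f t by (auto simp: PiE_def Pi_def extensional_def le_SucI)
    ultimately show "x \<in> P (Suc k)" unfolding P_def by blast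
  qed
  have "\<exists>k. real (card (P (Suc k))) \<le> (1 + e) * real (card (P k))"
  proof (rule polynomial_growth_foelner)
    have "card (P 0) > 0" using fin ne by (simp add: card_gt_0_iff)
    thus "1 \<le> real (card (P 0))" by linarith
    show "real (card (P k)) \<le> real (Suc k) ^ card S" for k
      using card[of k] of_nat_mono[of "card (P k)" "Suc k ^ card S"] by simp
  qed (use S in auto)
  then obtain k where k: "real (card (P (Suc k))) \<le> (1 + e) * real (card (P k))" ..
  have "card (S <#> P k) \<le> card (P (Suc k))" by (rule card_mono[OF fin step])
  hence "real (card (S <#> P k)) \<le> (1 + e) * real (card (P k))" using k by linarith
  thus "\<exists>F. finite F & F ~= {} & F <= carrier G & real (card (S <#> F)) \<le> (1 + e) * real (card F)"
    using fin[of k] ne[of k] sub[of k] by blast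
qed

text \<open>Levi's theorem that a torsion-free abelian group can be ordered; the cone consists of
  the elements that are at least the neutral one. A maximal cone is taken by Zorn's lemma and shown
  to be total.\<close>

lemma exists_total_cone:
  fixes G :: "'g monoid" (structure)
  assumes "comm_group G"
    and tf: "!!x n. [|x \<in> carrier G; n > 0; x [^] (n::nat) = \<one>|] ==> x = \<one>"
  shows "\<exists>C. C <= carrier G & \<one> \<in> C & (\<forall>x\<in>C. \<forall>y\<in>C. x \<otimes> y \<in> C) &
    (\<forall>x\<in>C. inv x \<in> C --> x = \<one>) & (\<forall>x\<in>carrier G. x \<in> C \<or> inv x \<in> C)"
proof -
  interpret comm_group G by fact
  define cone where "cone C \<longleftrightarrow> C <= carrier G & \<one> \<in> C & (\<forall>x\<in>C. \<forall>y\<in>C. x \<otimes> y \<in> C) & (\<forall>x\<in>C. inv x \<in> C --> x = \<one>)" for C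
  have "\<exists>M\<in>Collect cone. \<forall>U\<in>Collect cone. M <= U --> U = M"
  proof (rule subset_Zorn_nonempty)
    show "Collect cone ~= {}" unfolding cone_def by (auto intro!: exI[of _ "{\<one>}"])
    fix CC assume ne: "CC ~= {}" and ch: "subset.chain (Collect cone) CC"
    have c: "cone U" if "U \<in> CC" for U using ch that unfolding subset.chain_def by auto
    have lin: "U <= Y \<or> Y <= U" if "U \<in> CC" "Y \<in> CC" for U Y
      using ch that unfolding subset.chain_def by blast
    have both: "\<exists>Z\<in>CC. x \<in> Z & y \<in> Z" if xy: "x \<in> \<Union>CC" "y \<in> \<Union>CC" for x y
    proof -
      obtain U Y where "U \<in> CC" "Y \<in> CC" "x \<in> U" "y \<in> Y" using xy by blast
      thus ?thesis using lin[of U Y] by blast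
    qed
    have "cone (\<Union>CC)" unfolding cone_def
    proof (intro conjI ballI impI)
      show "\<Union>CC <= carrier G" using c unfolding cone_def by blast
      show "\<one> \<in> \<Union>CC" using c ne unfolding cone_def by blast
      fix x assume x: "x \<in> \<Union>CC"
      { fix y assume "y \<in> \<Union>CC"
        with x obtain Z where "Z \<in> CC" "x \<in> Z" "y \<in> Z" using both by blast
        thus "x \<otimes> y \<in> \<Union>CC" using c[of Z] unfolding cone_def by blast }
      assume "inv x \<in> \<Union>CC"
      with x obtain Z where "Z \<in> CC" "x \<in> Z" "inv x \<in> Z" using both by blast
      thus "x = \<one>" using c[of Z] unfolding cone_def by blast
    qed
    thus "\<Union>CC \<in> Collect cone" by simp
  qed
  then obtain C where C: "cone C" and max: "!!U. cone U ==> C <= U ==> U = C" by blast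
  have sub: "C <= carrier G" and one: "\<one> \<in> C" and cl: "!!x y. x \<in> C ==> y \<in> C ==> x \<otimes> y \<in> C"
    and asym: "!!x. x \<in> C ==> inv x \<in> C ==> x = \<one>" using C unfolding cone_def by auto
  have pow: "x [^] (n::nat) \<in> C" if "x \<in> C" for x n
    by (induction n) (use that one cl in auto)
  have ext: "\<exists>n::nat>0. (inv x) [^] n \<in> C" if x: "x \<in> carrier G" "x \<notin> C" for x
  proof -
    define D where "D = {c \<otimes> x [^] (n::nat) | c n. c \<in> C}"
    have CD: "C <= D" unfolding D_def
    proof
      fix c assume c: "c \<in> C"
      hence "c = c \<otimes> x [^] (0::nat)" using sub by auto
      thus "c \<in> {c \<otimes> x [^] (n::nat) | c n. c \<in> C}" using c by blast
    qed
    have "x = \<one> \<otimes> x [^] (1::nat)" using x by auto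
    hence "x \<in> D" unfolding D_def using one by blast
    \<comment> \<open>\<open>D\<close> is closed under products, so by maximality of
      \<open>C\<close> only antisymmetry can fail. The failure is a relation
      \<open>c c' x^(n + n') = 1\<close>, which puts a power of the inverse of \<open>x\<close> into
      \<open>C\<close>; the exponent is positive, since otherwise antisymmetry would fail in
      \<open>C\<close>.\<close>
    hence "\<not> cone D" using max[OF _ CD] x by blast
    moreover have "D <= carrier G" "\<one> \<in> D" using sub x one CD unfolding D_def by auto
    moreover have "y \<otimes> z \<in> D" if yz: "y \<in> D" "z \<in> D" for y z
    proof -
      obtain c n c' n' where cn: "c \<in> C" "c' \<in> C" "y = c \<otimes> x [^] (n::nat)" "z = c' \<otimes> x [^] (n'::nat)"
        using yz unfolding D_def by blast
      hence "c \<in> carrier G" "c' \<in> carrier G" using sub by auto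
      hence "y \<otimes> z = (c \<otimes> c') \<otimes> x [^] (n + n')" using cn x by (simp add: nat_pow_mult[symmetric] m_ac)
      thus ?thesis unfolding D_def using cl cn by blast
    qed
    ultimately obtain y where y: "y \<in> D" "inv y \<in> D" "y ~= \<one>" unfolding cone_def by blast
    obtain c n c' n' where cn: "c \<in> C" "c' \<in> C" "y = c \<otimes> x [^] (n::nat)" "inv y = c' \<otimes> x [^] (n'::nat)"
      using y unfolding D_def by blast
    have c: "c \<in> carrier G" "c' \<in> carrier G" using sub cn by auto
    have yc: "y \<in> carrier G" using cn c x by auto
    have "\<one> = y \<otimes> inv y" using yc by simp
    also have "\<dots> = (c \<otimes> c') \<otimes> x [^] (n + n')" using cn(3,4) c x by (simp add: nat_pow_mult[symmetric] m_ac)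
    finally have e: "(c \<otimes> c') \<otimes> x [^] (n + n') = \<one>" by simp
    have "n + n' > 0"
    proof (rule ccontr)
      assume "\<not> n + n' > 0"
      hence "y \<in> C" "inv y \<in> C" using cn c by auto
      thus False using asym y by blast
    qed
    moreover have "(inv x) [^] (n + n') = c \<otimes> c'"
      using inv_equality[OF e] x c by (simp add: nat_pow_inv)
    ultimately show ?thesis using cl[OF cn(1,2)] by metis
  qed
  have "x \<in> C \<or> inv x \<in> C" if x: "x \<in> carrier G" for x
  proof (rule ccontr)
    assume nC: "\<not> ?thesis"
    then obtain n m :: nat where nm: "n > 0" "(inv x) [^] n \<in> C" "m > 0" "x [^] m \<in> C"
      using ext[of x] ext[of "inv x"] x by auto
    have "x [^] (m * n) \<in> C" using pow[OF nm(4), of n] x by (simp add: nat_pow_pow)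
    moreover have "(inv x) [^] (m * n) \<in> C" using pow[OF nm(2), of m] x by (simp add: nat_pow_pow mult.commute)
    hence "inv (x [^] (m * n)) \<in> C" using x by (simp add: nat_pow_inv)
    ultimately have "x [^] (m * n) = \<one>" using asym by blast
    hence "x = \<one>" using tf[OF x, of "m * n"] nm by simp
    thus False using nC one by simp
  qed
  hence "\<forall>x\<in>carrier G. x \<in> C \<or> inv x \<in> C" by blast
  thus ?thesis using C unfolding cone_def by (intro exI[of _ C]) simp
qed

text \<open>In an ordered group the product of the largest elements of \<open>A\<close> and of
  \<open>B\<close> arises in one way only.\<close>

lemma unique_products_torsion_free:
  fixes G :: "'g monoid" (structure)
  assumes "comm_group G"
    and tf: "!!x n. [|x \<in> carrier G; n > 0; x [^] (n::nat) = \<one>|] ==> x = \<one>"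
  shows "unique_products G"
proof -
  interpret comm_group G by fact
  obtain C where CC: "C <= carrier G & \<one> \<in> C & (\<forall>x\<in>C. \<forall>y\<in>C. x \<otimes> y \<in> C) &
    (\<forall>x\<in>C. inv x \<in> C --> x = \<one>) & (\<forall>x\<in>carrier G. x \<in> C \<or> inv x \<in> C)"
    using exists_total_cone[OF assms(1) tf] ..
  have C: "C <= carrier G" "\<one> \<in> C" "!!x y. x \<in> C ==> y \<in> C ==> x \<otimes> y \<in> C"
    "!!x. x \<in> C ==> inv x \<in> C ==> x = \<one>" "!!x. x \<in> carrier G ==> x \<in> C \<or> inv x \<in> C"
    using CC by simp_all
  have max: "\<exists>a0\<in>A. \<forall>a\<in>A. inv a \<otimes> a0 \<in> C" if "finite A" "A ~= {}" "A <= carrier G" for A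
    using that
  proof (induction A rule: finite_ne_induct)
    case (singleton x)
    thus ?case using C(2) by (auto simp: l_inv)
  next
    case (insert x A)
    then obtain a0 where a0: "a0 \<in> A" "\<forall>a\<in>A. inv a \<otimes> a0 \<in> C" by auto
    have c: "x \<in> carrier G" "a0 \<in> carrier G" using insert a0 by auto
    have inv: "inv (inv x \<otimes> a0) = inv a0 \<otimes> x" using c by (simp add: inv_mult m_comm)
    consider "inv x \<otimes> a0 \<in> C" | "inv a0 \<otimes> x \<in> C" using C(5)[of "inv x \<otimes> a0"] inv c by auto
    thus ?case
    proof cases
      case 1
      thus ?thesis using a0 by auto
    next
      case 2
      have "inv a \<otimes> x \<in> C" if a: "a \<in> A" for a
      proof -
        have ac: "a \<in> carrier G" using a insert by auto
        have "inv a \<otimes> x = (inv a \<otimes> a0) \<otimes> (inv a0 \<otimes> x)"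
          using c ac by (simp add: m_assoc) (simp add: m_assoc[symmetric])
        thus ?thesis using C(3) a0(2) a 2 by metis
      qed
      moreover have "inv x \<otimes> x \<in> C" using c C(2) by simp
      ultimately show ?thesis by auto
    qed
  qed
  show ?thesis unfolding unique_products_def
  proof (intro allI impI)
    fix A B assume AB: "finite A & finite B & A ~= {} & B ~= {} & A <= carrier G & B <= carrier G"
    obtain a0 where a0: "a0 \<in> A" "\<forall>a\<in>A. inv a \<otimes> a0 \<in> C" using max[of A] AB by auto
    obtain b0 where b0: "b0 \<in> B" "\<forall>b\<in>B. inv b \<otimes> b0 \<in> C" using max[of B] AB by auto
    have "a = a0 & b = b0" if a: "a \<in> A" and b: "b \<in> B" and e: "a \<otimes> b = a0 \<otimes> b0" for a b
    proof -
      have c: "a \<in> carrier G" "b \<in> carrier G" "a0 \<in> carrier G" "b0 \<in> carrier G" using a b a0 b0 AB by auto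
      have "(inv b \<otimes> b0) \<otimes> (inv a \<otimes> a0) = (inv a \<otimes> inv b) \<otimes> (a0 \<otimes> b0)" using c by (simp add: m_ac)
      also have "\<dots> = inv (a \<otimes> b) \<otimes> (a \<otimes> b)" using c by (simp add: inv_mult e[symmetric])
      also have "\<dots> = \<one>" using c by simp
      finally have "inv (inv a \<otimes> a0) = inv b \<otimes> b0" using c by (intro inv_equality) auto
      hence "inv a \<otimes> a0 = \<one>" using C(4)[of "inv a \<otimes> a0"] a0 b0 a b by auto
      hence "a = a0" using c by (metis inv_closed inv_equality inv_inv)
      thus ?thesis using e c by auto
    qed
    thus "\<exists>a\<in>A. \<exists>b\<in>B. \<forall>a'\<in>A. \<forall>b'\<in>B. a' \<otimes> b' = a \<otimes> b --> a' = a & b' = b" using a0 b0 by blast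
  qed
qed

text \<open>A unique product is found first in \<open>Q\<close> and then among the fibres over it,
  which are translated into the kernel. A Foelner set is a lift of one of \<open>Q\<close> times one
  of the kernel, the latter chosen for the finitely many kernel elements by which the section fails
  to be compatible with \<open>S\<close>.\<close>

lemma ore_group_extension:
  fixes \<Gamma> :: "'g monoid" and Q :: "'h monoid"
  assumes G: "group \<Gamma>" and Q: "ore_group Q" and \<pi>: "\<pi> \<in> hom \<Gamma> Q" and surj: "\<pi> ` carrier \<Gamma> = carrier Q"
    and comm: "!!x y. x \<in> kernel \<Gamma> Q \<pi> ==> y \<in> kernel \<Gamma> Q \<pi> ==> x *[\<Gamma>] y = y *[\<Gamma>] x"
    and tf: "!!x n. x \<in> kernel \<Gamma> Q \<pi> ==> n > 0 ==> x [^]\<^bsub>\<Gamma>\<^esub> (n::nat) = 1[\<Gamma>] ==> x = 1[\<Gamma>]"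
  shows "ore_group \<Gamma>"
proof -
  interpret G: group \<Gamma> by fact
  have gQ: "group Q" and upQ: "unique_products Q" and foQ: "foelner Q" using Q unfolding ore_group_def by auto
  interpret Q: group Q by fact
  interpret h: group_hom \<Gamma> Q \<pi> by unfold_locales (rule \<pi>)
  define K where "K = kernel \<Gamma> Q \<pi>"
  have Ksub: "subgroup K \<Gamma>" unfolding K_def by (rule h.subgroup_kernel)
  have Kc: "K <= carrier \<Gamma>" using Ksub by (rule subgroup.subset)
  have memK: "x \<in> K \<longleftrightarrow> x \<in> carrier \<Gamma> & \<pi> x = 1[Q]" for x unfolding K_def kernel_def by auto
  define V where "V = \<Gamma>\<lparr>carrier := K\<rparr>"
  have gV: "group V" unfolding V_def using G.subgroup_imp_group[OF Ksub] .
  interpret V: comm_group V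
    by (rule group.group_comm_groupI[OF gV]) (use comm in \<open>auto simp: V_def K_def\<close>)
  have Vpow: "x [^]\<^bsub>V\<^esub> n = x [^]\<^bsub>\<Gamma>\<^esub> (n::nat)" for x n unfolding V_def by (simp add: nat_pow_def)
  have upV: "unique_products V"
    by (rule unique_products_torsion_free[OF V.comm_group_axioms]) (use tf Vpow in \<open>auto simp: V_def K_def\<close>)
  have foV: "foelner V" by (rule foelner_abelian[OF V.comm_group_axioms])
  have "unique_products \<Gamma>" unfolding unique_products_def
  proof (intro allI impI)
    fix A B assume AB: "finite A & finite B & A ~= {} & B ~= {} & A <= carrier \<Gamma> & B <= carrier \<Gamma>"
    have s: "finite (\<pi> ` A)" "finite (\<pi> ` B)" "\<pi> ` A ~= {}" "\<pi> ` B ~= {}" "\<pi> ` A <= carrier Q" "\<pi> ` B <= carrier Q"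
      using AB h.hom_closed by auto
    obtain a' b' where ab': "a' \<in> \<pi> ` A" "b' \<in> \<pi> ` B"
      "\<forall>x\<in>\<pi> ` A. \<forall>y\<in>\<pi> ` B. x *[Q] y = a' *[Q] b' --> x = a' & y = b'"
      by (rule unique_productsD[OF upQ s])
    from ab' obtain a1 b1 where a1: "a1 \<in> A" "\<pi> a1 = a'" and b1: "b1 \<in> B" "\<pi> b1 = b'" by auto
    have c1: "a1 \<in> carrier \<Gamma>" "b1 \<in> carrier \<Gamma>" using a1 b1 AB by auto
    \<comment> \<open>The fibre of \<open>A\<close> is translated from the left and that of
      \<open>B\<close> from the right, so that products of the translates are
      \<open>inv a1 (a b) inv b1\<close> and coincidences of products are preserved.\<close>
    define A2 where "A2 = (%a. inv[\<Gamma>] a1 *[\<Gamma>] a) ` {a \<in> A. \<pi> a = a'}"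
    define B2 where "B2 = (%b. b *[\<Gamma>] inv[\<Gamma>] b1) ` {b \<in> B. \<pi> b = b'}"
    have "A2 <= K" "B2 <= K" unfolding A2_def B2_def memK subset_iff using AB a1 b1 c1 by (auto simp: subset_iff)
    hence s: "finite A2" "finite B2" "A2 ~= {}" "B2 ~= {}" "A2 <= carrier V" "B2 <= carrier V"
      unfolding A2_def B2_def V_def using AB a1 b1 by auto
    obtain p0 q0 where pq: "p0 \<in> A2" "q0 \<in> B2"
      "\<forall>p\<in>A2. \<forall>q\<in>B2. p *[V] q = p0 *[V] q0 --> p = p0 & q = q0"
      by (rule unique_productsD[OF upV s])
    have Vm: "x *[V] y = x *[\<Gamma>] y" for x y by (simp add: V_def)
    from pq obtain a0 b0 where a0: "a0 \<in> A" "\<pi> a0 = a'" "p0 = inv[\<Gamma>] a1 *[\<Gamma>] a0"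
      and b0: "b0 \<in> B" "\<pi> b0 = b'" "q0 = b0 *[\<Gamma>] inv[\<Gamma>] b1" unfolding A2_def B2_def by auto
    have "a = a0 & b = b0" if a: "a \<in> A" and b: "b \<in> B" and e: "a *[\<Gamma>] b = a0 *[\<Gamma>] b0" for a b
    proof -
      have c: "a \<in> carrier \<Gamma>" "b \<in> carrier \<Gamma>" "a0 \<in> carrier \<Gamma>" "b0 \<in> carrier \<Gamma>" using a b a0 b0 AB by auto
      have "\<pi> a *[Q] \<pi> b = a' *[Q] b'" using arg_cong[OF e, of \<pi>] c a0 b0 by simp
      hence pab: "\<pi> a = a'" "\<pi> b = b'" using ab'(3) a b by auto
      have "(inv[\<Gamma>] a1 *[\<Gamma>] a) *[\<Gamma>] (b *[\<Gamma>] inv[\<Gamma>] b1) = inv[\<Gamma>] a1 *[\<Gamma>] (a *[\<Gamma>] b) *[\<Gamma>] inv[\<Gamma>] b1"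
        using c c1 by (simp add: G.m_assoc)
      also have "\<dots> = p0 *[\<Gamma>] q0" using c c1 a0 b0 by (simp add: e G.m_assoc)
      finally have "inv[\<Gamma>] a1 *[\<Gamma>] a = p0" "b *[\<Gamma>] inv[\<Gamma>] b1 = q0"
        using pq(3)[unfolded Vm, rule_format, of "inv[\<Gamma>] a1 *[\<Gamma>] a" "b *[\<Gamma>] inv[\<Gamma>] b1"] a b pab unfolding A2_def B2_def by auto
      thus ?thesis using a0 b0 c c1 by simp
    qed
    thus "\<exists>a\<in>A. \<exists>b\<in>B. \<forall>a'\<in>A. \<forall>b'\<in>B. a' *[\<Gamma>] b' = a *[\<Gamma>] b --> a' = a & b' = b" using a0 b0 by blast
  qed
  moreover have "foelner \<Gamma>" unfolding foelner_def
  proof (intro allI impI)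
    fix S and e :: real assume S: "finite S & S <= carrier \<Gamma> & e > 0"
    \<comment> \<open>Both factors of the Foelner set lose a factor \<open>1 + d\<close>, and the
      square of this is at most \<open>1 + 3 d\<close> for \<open>d \<le> 1\<close>.\<close>
    define d where "d = min 1 (e / 3)"
    have d: "d > 0" "d \<le> 1" "3 * d \<le> e" using S by (auto simp: d_def)
    have "(1 + d) * (1 + d) = 1 + 2 * d + d * d" by (simp add: algebra_simps)
    also have "d * d \<le> d * 1" using d by (intro mult_left_mono) auto
    finally have dd: "(1 + d) * (1 + d) \<le> 1 + e" using d by linarith
    have pS: "finite (\<pi> ` S)" "\<pi> ` S <= carrier Q" using S h.hom_closed by auto
    obtain F2 where F2: "finite F2" "F2 ~= {}" "F2 <= carrier Q" "card (\<pi> ` S <#>\<^bsub>Q\<^esub> F2) \<le> (1 + d) * card F2"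
      using foelnerD[OF foQ pS d(1)] by blast
    define T where "T = \<pi> ` S <#>\<^bsub>Q\<^esub> F2"
    have Tc: "T <= carrier Q" unfolding T_def using Q.set_mult_closed[OF pS(2) F2(3)] .
    have finT: "finite T" unfolding T_def using pS F2 by (intro finite_set_mult)
    define sec where "sec = inv_into (carrier \<Gamma>) \<pi>"
    have sec: "sec q \<in> carrier \<Gamma>" "\<pi> (sec q) = q" if "q \<in> carrier Q" for q
      using that surj inv_into_into[of q \<pi> "carrier \<Gamma>"] f_inv_into_f[of q \<pi> "carrier \<Gamma>"] by (auto simp: sec_def)
    \<comment> \<open>The deviation of the section \<open>sec\<close> from equivariance:
      \<open>x sec f\<close> is \<open>sec (\<pi> x f)\<close> times an element of \<open>E\<close>.
      It depends only on finitely many pairs.\<close>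
    define E where "E = (%(x, f). inv[\<Gamma>] sec (\<pi> x *[Q] f) *[\<Gamma>] x *[\<Gamma>] sec f) ` (S \<times> F2)"
    have E: "finite E" "E <= carrier V"
    proof -
      show "finite E" unfolding E_def using S F2 by auto
      show "E <= carrier V" unfolding E_def V_def
      proof (clarsimp simp: memK)
        fix x f assume "x \<in> S" "f \<in> F2"
        hence "x \<in> carrier \<Gamma>" "f \<in> carrier Q" using S F2 by auto
        thus "inv[\<Gamma>] sec (\<pi> x *[Q] f) *[\<Gamma>] x *[\<Gamma>] sec f \<in> carrier \<Gamma> &
           \<pi> (inv[\<Gamma>] sec (\<pi> x *[Q] f) *[\<Gamma>] x *[\<Gamma>] sec f) = 1[Q]"
          using sec by (simp add: Q.m_assoc)
      qed
    qed
    obtain F1 where F1: "finite F1" "F1 ~= {}" "F1 <= carrier V" "card (E <#>\<^bsub>V\<^esub> F1) \<le> (1 + d) * card F1"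
      using foelnerD[OF foV E d(1)] by blast
    have F1K: "F1 <= K" and F1c: "F1 <= carrier \<Gamma>" using F1 Kc unfolding V_def by auto
    define F where "F = (%(f, v). sec f *[\<Gamma>] v) ` (F2 \<times> F1)"
    have inj: "inj_on (%(f, v). sec f *[\<Gamma>] v) (F2 \<times> F1)"
    proof (rule inj_onI, clarsimp)
      fix f v f' v' assume *: "f \<in> F2" "v \<in> F1" "f' \<in> F2" "v' \<in> F1" "sec f *[\<Gamma>] v = sec f' *[\<Gamma>] v'"
      have c: "f \<in> carrier Q" "f' \<in> carrier Q" "v \<in> K" "v' \<in> K" using * F2 F1K by auto
      have "\<pi> (sec f *[\<Gamma>] v) = f" "\<pi> (sec f' *[\<Gamma>] v') = f'" using c sec by (auto simp: memK)
      hence "f = f'" using * by simp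
      moreover have "v = v'" using *(5) c sec unfolding \<open>f = f'\<close> by (simp add: memK)
      ultimately show "f = f' & v = v'" by simp
    qed
    have cardF: "card F = card F2 * card F1" unfolding F_def using card_image[OF inj] by (simp add: card_cartesian_product)
    have "S <#>\<^bsub>\<Gamma>\<^esub> F <= (%(t, w). sec t *[\<Gamma>] w) ` (T \<times> (E <#>\<^bsub>V\<^esub> F1))"
    proof
      fix z assume "z \<in> S <#>\<^bsub>\<Gamma>\<^esub> F"
      then obtain x f v where z: "x \<in> S" "f \<in> F2" "v \<in> F1" "z = x *[\<Gamma>] (sec f *[\<Gamma>] v)"
        unfolding set_mult_def F_def by auto
      define t where "t = \<pi> x *[Q] f"
      have c: "x \<in> carrier \<Gamma>" "f \<in> carrier Q" "v \<in> carrier \<Gamma>" using z S F2 F1c by auto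
      have t: "t \<in> T" "t \<in> carrier Q" using z c unfolding t_def T_def set_mult_def by auto
      define w where "w = inv[\<Gamma>] sec t *[\<Gamma>] x *[\<Gamma>] sec f"
      have "w \<in> E" unfolding w_def E_def t_def using z by auto
      hence "w *[\<Gamma>] v \<in> E <#>\<^bsub>V\<^esub> F1" using z unfolding set_mult_def V_def by auto
      moreover have "sec t *[\<Gamma>] (w *[\<Gamma>] v) = z"
        unfolding w_def z(4) using c t sec by (simp add: G.m_assoc) (simp add: G.m_assoc[symmetric])
      ultimately show "z \<in> (%(t, w). sec t *[\<Gamma>] w) ` (T \<times> (E <#>\<^bsub>V\<^esub> F1))" using t by force
    qed
    hence "card (S <#>\<^bsub>\<Gamma>\<^esub> F) \<le> card (T \<times> (E <#>\<^bsub>V\<^esub> F1))"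
      using finT finite_set_mult[OF E(1) F1(1), of V] by (intro surj_card_le) auto
    hence "real (card (S <#>\<^bsub>\<Gamma>\<^esub> F)) \<le> real (card T) * real (card (E <#>\<^bsub>V\<^esub> F1))"
      by (simp add: card_cartesian_product flip: of_nat_mult)
    also have "\<dots> \<le> ((1 + d) * card F2) * ((1 + d) * card F1)"
      using F2(4) F1(4) d unfolding T_def by (intro mult_mono) auto
    also have "\<dots> = (1 + d) * (1 + d) * card F" by (simp add: cardF)
    also have "\<dots> \<le> (1 + e) * card F" using dd by (intro mult_right_mono) auto
    finally have "real (card (S <#>\<^bsub>\<Gamma>\<^esub> F)) \<le> (1 + e) * real (card F)" .
    moreover have "finite F" "F ~= {}" unfolding F_def using F1 F2 by auto
    moreover have "F <= carrier \<Gamma>" unfolding F_def using F2(3) F1c sec by (auto intro!: G.m_closed)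
    ultimately show "\<exists>F. finite F & F ~= {} & F <= carrier \<Gamma> & real (card (S <#>\<^bsub>\<Gamma>\<^esub> F)) \<le> (1 + e) * real (card F)"
      by blast
  qed
  ultimately show ?thesis unfolding ore_group_def using G by auto
qed

section \<open>Group rings\<close>

text \<open>Gaussian elimination with cross multiplication in place of division, so that the
  solution stays integral.\<close>

lemma homogeneous_system:
  fixes M :: "'x => 'y => int"
  assumes "finite U" "finite V" "card V < card U"
  shows "\<exists>w. (\<exists>x\<in>U. w x ~= 0) & (\<forall>y\<in>V. (\<Sum>x\<in>U. M x y * w x) = 0)"
  using assms(2,1,3)
proof (induction V arbitrary: U M rule: finite_induct)
  case empty
  hence "U ~= {}" by auto
  thus ?case by (intro exI[of _ "%_. 1"]) auto
next
  case (insert y V)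
  show ?case
  proof (cases "\<forall>x\<in>U. M x y = 0")
    case True
    have "card V < card U" using insert by simp
    then obtain w where "\<exists>x\<in>U. w x ~= 0" "\<forall>y\<in>V. (\<Sum>x\<in>U. M x y * w x) = 0" using insert.IH[of U M] insert.prems by blast
    thus ?thesis using True by (intro exI[of _ w]) auto
  next
    case False
    then obtain p where p: "p \<in> U" "M p y ~= 0" by blast
    define U' where "U' = U - {p}"
    define M' where "M' x z = M p y * M x z - M x y * M p z" for x z
    have U': "finite U'" "card V < card U'" using insert p unfolding U'_def by (auto simp: card_Diff_singleton)
    then obtain w where w: "\<exists>x\<in>U'. w x ~= 0" "\<forall>z\<in>V. (\<Sum>x\<in>U'. M' x z * w x) = 0"
      using insert.IH[of U' M'] by blast
    \<comment> \<open>The value at the pivot \<open>p\<close> is chosen to satisfy equation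
      \<open>y\<close>. The remaining unknowns are scaled by the pivot entry, which avoids a
      quotient.\<close>
    define w' where "w' x = (if x = p then - (\<Sum>x\<in>U'. M x y * w x) else M p y * w x)" for x
    have s: "(\<Sum>x\<in>U. M x z * w' x) = (\<Sum>x\<in>U'. M' x z * w x)" for z
    proof -
      have "(\<Sum>x\<in>U. M x z * w' x) = M p z * w' p + (\<Sum>x\<in>U'. M x z * w' x)"
        unfolding U'_def using p insert.prems by (simp add: sum.remove)
      also have "(\<Sum>x\<in>U'. M x z * w' x) = (\<Sum>x\<in>U'. M x z * (M p y * w x))"
        by (rule sum.cong) (auto simp: w'_def U'_def)
      also have "M p z * w' p + \<dots> = (\<Sum>x\<in>U'. M' x z * w x)"
        by (simp add: w'_def M'_def sum_distrib_left sum_subtractf algebra_simps)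
      finally show ?thesis .
    qed
    have "M' x y = 0" for x by (simp add: M'_def)
    hence "\<forall>z\<in>insert y V. (\<Sum>x\<in>U. M x z * w' x) = 0" using w(2) unfolding s by auto
    moreover have "\<exists>x\<in>U. w' x ~= 0"
    proof -
      obtain x where "x \<in> U'" "w x ~= 0" using w by blast
      thus ?thesis using p by (intro bexI[of _ x]) (auto simp: w'_def U'_def)
    qed
    ultimately show ?thesis by blast
  qed
qed

section \<open>Convolution in integral group rings\<close>

definition gr_mult :: "'g monoid => ('g \<Rightarrow>\<^sub>0 int) => ('g \<Rightarrow>\<^sub>0 int) => ('g \<Rightarrow>\<^sub>0 int)" where
  "gr_mult \<Gamma> a b = frag_extend (%x. frag_extend (%y. frag_of (x *[\<Gamma>] y)) b) a"

lemma group_ring_simps [simp]: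
  "carrier (group_ring \<Gamma>) = {a. Poly_Mapping.keys a <= carrier \<Gamma>}"
  "a *[group_ring \<Gamma>] b = gr_mult \<Gamma> a b" "1[group_ring \<Gamma>] = frag_of 1[\<Gamma>]"
  "0[group_ring \<Gamma>] = 0" "a +[group_ring \<Gamma>] b = a + b"
  by (simp_all add: group_ring_def gr_mult_def)

lemma frag_cmul_diff: "frag_cmul c (x - y) = frag_cmul c x - frag_cmul c y"
  by (rule poly_mapping_eqI) (simp add: lookup_minus right_diff_distrib)

lemma frag_extend_distrib:
  "frag_extend (%x. f x + g x) a = frag_extend f a + frag_extend g a"
  "frag_extend (%x. f x - g x) a = frag_extend f a - frag_extend g a"
  "frag_extend (%x. frag_cmul c (f x)) a = frag_cmul c (frag_extend f a)"
  "frag_extend (%x. 0) a = 0"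
  by (simp_all add: frag_extend_def sum.distrib frag_cmul_distrib2 frag_cmul_sum mult.commute
      sum_subtractf frag_cmul_diff)

lemma gr_mult_linear:
  "gr_mult \<Gamma> (a + a') b = gr_mult \<Gamma> a b + gr_mult \<Gamma> a' b"
  "gr_mult \<Gamma> (a - a') b = gr_mult \<Gamma> a b - gr_mult \<Gamma> a' b"
  "gr_mult \<Gamma> a (b + b') = gr_mult \<Gamma> a b + gr_mult \<Gamma> a b'"
  "gr_mult \<Gamma> a (b - b') = gr_mult \<Gamma> a b - gr_mult \<Gamma> a b'"
  "gr_mult \<Gamma> a (frag_cmul c b) = frag_cmul c (gr_mult \<Gamma> a b)"
  "gr_mult \<Gamma> 0 b = 0" "gr_mult \<Gamma> a 0 = 0"
  by (simp_all add: gr_mult_def frag_extend_add frag_extend_diff frag_extend_cmul frag_extend_distrib)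

lemma gr_mult_of [simp]: "gr_mult \<Gamma> (frag_of x) (frag_of y) = frag_of (x *[\<Gamma>] y)"
  by (simp add: gr_mult_def)

lemma gr_mult_sum: "finite I ==> gr_mult \<Gamma> a (\<Sum>i\<in>I. f i) = (\<Sum>i\<in>I. gr_mult \<Gamma> a (f i))"
  by (induction I rule: finite_induct) (simp_all add: gr_mult_linear)

lemma keys_gr_mult:
  "Poly_Mapping.keys (gr_mult \<Gamma> a b) <= (\<Union>x\<in>Poly_Mapping.keys a. \<Union>y\<in>Poly_Mapping.keys b. {x *[\<Gamma>] y})"
proof -
  have "Poly_Mapping.keys (frag_extend (%y. frag_of (x *[\<Gamma>] y)) b) <= (\<Union>y\<in>Poly_Mapping.keys b. {x *[\<Gamma>] y})" for x
    using keys_frag_extend[of "%y. frag_of (x *[\<Gamma>] y)" b] by simp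
  hence "(\<Union>x\<in>Poly_Mapping.keys a. Poly_Mapping.keys (frag_extend (%y. frag_of (x *[\<Gamma>] y)) b)) <=
      (\<Union>x\<in>Poly_Mapping.keys a. \<Union>y\<in>Poly_Mapping.keys b. {x *[\<Gamma>] y})"
    by (intro UN_mono) auto
  thus ?thesis unfolding gr_mult_def by (rule order_trans[OF keys_frag_extend])
qed

lemma lookup_gr_mult:
  "poly_mapping.lookup (gr_mult \<Gamma> a b) z = (\<Sum>x\<in>Poly_Mapping.keys a. \<Sum>y\<in>Poly_Mapping.keys b.
     if z = x *[\<Gamma>] y then poly_mapping.lookup a x * poly_mapping.lookup b y else 0)"
proof -
  have "poly_mapping.lookup (gr_mult \<Gamma> a b) z = (\<Sum>x\<in>Poly_Mapping.keys a. poly_mapping.lookup a x *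
     (\<Sum>y\<in>Poly_Mapping.keys b. poly_mapping.lookup b y * (if z = x *[\<Gamma>] y then 1 else 0)))"
    unfolding gr_mult_def frag_extend_def by (simp only: lookup_sum lookup_frag_cmul lookup_frag_of)
  also have "\<dots> = (\<Sum>x\<in>Poly_Mapping.keys a. \<Sum>y\<in>Poly_Mapping.keys b.
     if z = x *[\<Gamma>] y then poly_mapping.lookup a x * poly_mapping.lookup b y else 0)"
    by (auto simp: sum_distrib_left intro!: sum.cong)
  finally show ?thesis .
qed

lemma ring_group_ring:
  assumes "group \<Gamma>"
  shows "ring (group_ring \<Gamma>)"
proof -
  interpret group \<Gamma> by fact
  have closed: "Poly_Mapping.keys (gr_mult \<Gamma> a b) <= carrier \<Gamma>"
    if "Poly_Mapping.keys a <= carrier \<Gamma>" "Poly_Mapping.keys b <= carrier \<Gamma>" for a b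
    using keys_gr_mult[of \<Gamma> a b] that by (auto dest!: subsetD)
  have assoc: "gr_mult \<Gamma> (gr_mult \<Gamma> a b) c = gr_mult \<Gamma> a (gr_mult \<Gamma> b c)"
    if a: "Poly_Mapping.keys a <= carrier \<Gamma>" and b: "Poly_Mapping.keys b <= carrier \<Gamma>" and c: "Poly_Mapping.keys c <= carrier \<Gamma>" for a b c
    using a
  proof (induction a rule: frag_induction)
    case (one x)
    show ?case using b
    proof (induction b rule: frag_induction)
      case (one y)
      show ?case using c
        by (induction c rule: frag_induction) (use \<open>x \<in> carrier \<Gamma>\<close> \<open>y \<in> carrier \<Gamma>\<close> in \<open>simp_all add: gr_mult_linear m_assoc\<close>)
    qed (simp_all add: gr_mult_linear)
  qed (simp_all add: gr_mult_linear)
  have onel: "gr_mult \<Gamma> (frag_of 1[\<Gamma>]) a = a" if "Poly_Mapping.keys a <= carrier \<Gamma>" for a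
    using that by (induction a rule: frag_induction) (simp_all add: gr_mult_linear)
  have oner: "gr_mult \<Gamma> a (frag_of 1[\<Gamma>]) = a" if "Poly_Mapping.keys a <= carrier \<Gamma>" for a
    using that by (induction a rule: frag_induction) (simp_all add: gr_mult_linear)
  show ?thesis
  proof (rule ringI)
    show "abelian_group (group_ring \<Gamma>)"
    proof (rule abelian_groupI)
      fix a b assume ab: "a \<in> carrier (group_ring \<Gamma>)" "b \<in> carrier (group_ring \<Gamma>)"
      thus "a +[group_ring \<Gamma>] b \<in> carrier (group_ring \<Gamma>)" using keys_add[of a b] by auto
      show "\<exists>y\<in>carrier (group_ring \<Gamma>). y +[group_ring \<Gamma>] a = 0[group_ring \<Gamma>]"
        using ab by (intro bexI[of _ "- a"]) auto
    qed (auto simp: add_ac)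
    show "Group.monoid (group_ring \<Gamma>)"
      by unfold_locales (auto simp: assoc onel oner dest: closed[THEN subsetD, rotated 2])
  qed (auto simp: gr_mult_linear)
qed

text \<open>At a unique product of the supports the coefficient of \<open>a b\<close> is a product
  of two nonzero integers.\<close>

lemma gr_mult_eq_zero:
  assumes "unique_products \<Gamma>" "Poly_Mapping.keys a <= carrier \<Gamma>" "Poly_Mapping.keys b <= carrier \<Gamma>" "gr_mult \<Gamma> a b = 0"
  shows "a = 0 \<or> b = 0"
proof (rule ccontr)
  assume "\<not> ?thesis"
  hence "Poly_Mapping.keys a ~= {}" "Poly_Mapping.keys b ~= {}" by auto
  then obtain x y where xy: "x \<in> Poly_Mapping.keys a" "y \<in> Poly_Mapping.keys b"
    "\<forall>x'\<in>Poly_Mapping.keys a. \<forall>y'\<in>Poly_Mapping.keys b. x' *[\<Gamma>] y' = x *[\<Gamma>] y --> x' = x & y' = y"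
    using unique_productsD[OF assms(1) finite_keys[of a] finite_keys[of b] _ _ assms(2,3)] by blast
  have "poly_mapping.lookup (gr_mult \<Gamma> a b) (x *[\<Gamma>] y) =
    (\<Sum>x'\<in>Poly_Mapping.keys a. \<Sum>y'\<in>Poly_Mapping.keys b. if x' = x & y' = y then poly_mapping.lookup a x * poly_mapping.lookup b y else 0)"
    unfolding lookup_gr_mult by (intro sum.cong refl) (use xy(3) in auto)
  also have "\<dots> = (\<Sum>x'\<in>Poly_Mapping.keys a. if x' = x then poly_mapping.lookup a x * poly_mapping.lookup b y else 0)"
    using xy(2) by (intro sum.cong refl) (auto simp: sum.delta)
  also have "\<dots> = poly_mapping.lookup a x * poly_mapping.lookup b y"
    using xy(1) by (simp add: sum.delta)
  finally show False using xy(1,2) assms(4) by (simp add: in_keys_iff)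
qed

text \<open>Tamari's counting argument: with \<open>u\<close> and \<open>v\<close> supported on a
  Foelner set \<open>F\<close> there are \<open>2 card F\<close> unknown coefficients, while
  \<open>s u = a v\<close> imposes at most \<open>3/2 card F\<close> equations. A solution with
  \<open>v = 0\<close> would have \<open>s u = 0\<close>, hence be trivial.\<close>

lemma gr_common_multiple:
  assumes "ore_group \<Gamma>" "Poly_Mapping.keys a <= carrier \<Gamma>" "Poly_Mapping.keys s <= carrier \<Gamma>" "s ~= 0"
  shows "\<exists>u v. Poly_Mapping.keys u <= carrier \<Gamma> & Poly_Mapping.keys v <= carrier \<Gamma> & v ~= 0 & gr_mult \<Gamma> a v = gr_mult \<Gamma> s u"
proof -
  have up: "unique_products \<Gamma>" and fo: "foelner \<Gamma>" using assms unfolding ore_group_def by auto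
  define S where "S = Poly_Mapping.keys s \<union> Poly_Mapping.keys a"
  have S: "finite S" "S <= carrier \<Gamma>" using assms by (auto simp: S_def)
  obtain F where F: "finite F" "F ~= {}" "F <= carrier \<Gamma>" "card (S <#>\<^bsub>\<Gamma>\<^esub> F) \<le> (1 + 1/2) * card F"
    by (rule foelnerD[OF fo S, of "1/2"]) simp_all
  have "card F > 0" using F by (simp add: card_gt_0_iff)
  moreover have "(1 + 1/2) * real (card F) = real (card F) + real (card F) / 2" by (simp add: field_simps)
  ultimately have "real (card (S <#>\<^bsub>\<Gamma>\<^esub> F)) < 2 * real (card F)" using F(4) by linarith
  hence lt: "card (S <#>\<^bsub>\<Gamma>\<^esub> F) < card ((UNIV :: bool set) \<times> F)" by (simp add: card_cartesian_product)
  \<comment> \<open>The unknowns are indexed by \<open>(True, f)\<close> for \<open>u\<close> and by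
    \<open>(False, f)\<close> for \<open>v\<close>; the equations are the coefficients of
    \<open>s u - a v\<close> at the elements of \<open>S F\<close>.\<close>
  define M where "M = (%(i, f) z. poly_mapping.lookup (if i then gr_mult \<Gamma> s (frag_of f) else - gr_mult \<Gamma> a (frag_of f)) z)"
  obtain w where w: "\<exists>x\<in>(UNIV :: bool set) \<times> F. w x ~= 0"
    "\<forall>z\<in>S <#>\<^bsub>\<Gamma>\<^esub> F. (\<Sum>x\<in>(UNIV :: bool set) \<times> F. M x z * w x) = 0"
    using homogeneous_system[of "(UNIV :: bool set) \<times> F" "S <#>\<^bsub>\<Gamma>\<^esub> F" M] lt F S finite_set_mult[of S F \<Gamma>] by auto
  define c where "c i = (\<Sum>f\<in>F. frag_cmul (w (i, f)) (frag_of f))" for i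
  have lc: "poly_mapping.lookup (c i) f = (if f \<in> F then w (i, f) else 0)" for i f
    using F(1) by (simp add: c_def lookup_sum sum.delta' if_distrib[of "%x. _ * x"] cong: if_cong)
  have kc: "Poly_Mapping.keys (c i) <= F" for i using lc[of i] by (auto simp: in_keys_iff split: if_splits)
  have m: "gr_mult \<Gamma> t (c i) = (\<Sum>f\<in>F. frag_cmul (w (i, f)) (gr_mult \<Gamma> t (frag_of f)))" for t i
    unfolding c_def using F(1) by (simp add: gr_mult_sum gr_mult_linear)
  have "poly_mapping.lookup (gr_mult \<Gamma> s (c True) - gr_mult \<Gamma> a (c False)) z = 0" for z
  proof (cases "z \<in> S <#>\<^bsub>\<Gamma>\<^esub> F")
    case True
    have "(\<Sum>x\<in>(UNIV :: bool set) \<times> F. M x z * w x) = (\<Sum>i\<in>UNIV. \<Sum>f\<in>F. M (i, f) z * w (i, f))"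
      by (simp add: sum.cartesian_product)
    also have "\<dots> = poly_mapping.lookup (gr_mult \<Gamma> s (c True) - gr_mult \<Gamma> a (c False)) z"
      by (simp add: UNIV_bool M_def m lookup_minus lookup_sum sum_negf mult.commute)
    finally show ?thesis using w(2) True by simp
  next
    case False
    have "z \<notin> Poly_Mapping.keys (gr_mult \<Gamma> t (c i))" if "Poly_Mapping.keys t <= S" for t i
      using keys_gr_mult[of \<Gamma> t "c i"] kc[of i] that False unfolding set_mult_def by blast
    hence "z \<notin> Poly_Mapping.keys (gr_mult \<Gamma> s (c True))" "z \<notin> Poly_Mapping.keys (gr_mult \<Gamma> a (c False))"
      by (auto simp: S_def)
    thus ?thesis by (simp add: lookup_minus in_keys_iff)
  qed
  hence eq: "gr_mult \<Gamma> s (c True) = gr_mult \<Gamma> a (c False)"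
    by (metis poly_mapping_eqI lookup_zero right_minus_eq)
  have "c False ~= 0"
  proof
    assume 0: "c False = 0"
    hence "gr_mult \<Gamma> s (c True) = 0" using eq by (simp add: gr_mult_linear)
    hence "c True = 0" using gr_mult_eq_zero[OF up assms(3), of "c True"] kc F assms(4) by blast
    have "w (i, f) = 0" if "f \<in> F" for i f
    proof -
      have "c i = 0" using 0 \<open>c True = 0\<close> by (cases i) auto
      thus ?thesis using lc[of i f] that by simp
    qed
    thus False using w(1) by auto
  qed
  thus ?thesis using eq kc F by (intro exI[of _ "c True"] exI[of _ "c False"]) auto
qed

theorem right_ore_group_ring: "ore_group \<Gamma> ==> right_ore (group_ring \<Gamma>)"
proof -
  assume *: "ore_group \<Gamma>"
  hence G: "group \<Gamma>" and up: "unique_products \<Gamma>" unfolding ore_group_def by auto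
  interpret ring "group_ring \<Gamma>" by (rule ring_group_ring[OF G])
  show ?thesis
  proof
    show "1[group_ring \<Gamma>] ~= 0[group_ring \<Gamma>]" by simp
    fix a b assume "a \<in> carrier (group_ring \<Gamma>)" "b \<in> carrier (group_ring \<Gamma>)" "a *[group_ring \<Gamma>] b = 0[group_ring \<Gamma>]"
    thus "a = 0[group_ring \<Gamma>] \<or> b = 0[group_ring \<Gamma>]" using gr_mult_eq_zero[OF up, of a b] by simp
  next
    fix a s assume "a \<in> carrier (group_ring \<Gamma>)" "s \<in> carrier (group_ring \<Gamma>)" "s ~= 0[group_ring \<Gamma>]"
    thus "\<exists>u\<in>carrier (group_ring \<Gamma>). \<exists>v\<in>carrier (group_ring \<Gamma>). v ~= 0[group_ring \<Gamma>] &
      a *[group_ring \<Gamma>] v = s *[group_ring \<Gamma>] u"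
      using gr_common_multiple[OF *, of a s] by auto
  qed
qed

section \<open>Evaluation of group rings in commutative rings\<close>

definition gr_eval :: "('g => 'l::comm_ring_1) => ('g \<Rightarrow>\<^sub>0 int) => 'l" where
  "gr_eval \<chi> a = (\<Sum>x\<in>Poly_Mapping.keys a. of_int (poly_mapping.lookup a x) * \<chi> x)"

lemma gr_eval_superset:
  "finite S ==> Poly_Mapping.keys a <= S ==> gr_eval \<chi> a = (\<Sum>x\<in>S. of_int (poly_mapping.lookup a x) * \<chi> x)"
  unfolding gr_eval_def by (rule sum.mono_neutral_left) (auto simp: in_keys_iff)

lemma gr_eval_linear:
  "gr_eval \<chi> (a + b) = gr_eval \<chi> a + gr_eval \<chi> b"
  "gr_eval \<chi> (a - b) = gr_eval \<chi> a - gr_eval \<chi> b"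
  "gr_eval \<chi> (frag_of x) = \<chi> x" "gr_eval \<chi> 0 = 0"
proof -
  let ?S = "Poly_Mapping.keys a \<union> Poly_Mapping.keys b"
  have "gr_eval \<chi> (a + b) = (\<Sum>x\<in>?S. of_int (poly_mapping.lookup (a + b) x) * \<chi> x)"
    "gr_eval \<chi> (a - b) = (\<Sum>x\<in>?S. of_int (poly_mapping.lookup (a - b) x) * \<chi> x)"
    "gr_eval \<chi> a = (\<Sum>x\<in>?S. of_int (poly_mapping.lookup a x) * \<chi> x)"
    "gr_eval \<chi> b = (\<Sum>x\<in>?S. of_int (poly_mapping.lookup b x) * \<chi> x)"
    using keys_add[of a b] keys_diff[of a b] by (auto intro!: gr_eval_superset)
  thus "gr_eval \<chi> (a + b) = gr_eval \<chi> a + gr_eval \<chi> b" "gr_eval \<chi> (a - b) = gr_eval \<chi> a - gr_eval \<chi> b"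
    by (simp_all add: lookup_add lookup_minus algebra_simps sum.distrib sum_subtractf)
qed (simp_all add: gr_eval_def)

lemma gr_eval_mult:
  assumes "!!x y. x \<in> carrier \<Gamma> ==> y \<in> carrier \<Gamma> ==> \<chi> (x *[\<Gamma>] y) = \<chi> x * \<chi> y"
    and a: "Poly_Mapping.keys a <= carrier \<Gamma>" and b: "Poly_Mapping.keys b <= carrier \<Gamma>"
  shows "gr_eval \<chi> (gr_mult \<Gamma> a b) = gr_eval \<chi> a * gr_eval \<chi> b"
  using a
proof (induction a rule: frag_induction)
  case (one x)
  show ?case using b
    by (induction b rule: frag_induction) (use one assms(1) in \<open>simp_all add: gr_mult_linear gr_eval_linear algebra_simps\<close>)
qed (simp_all add: gr_mult_linear gr_eval_linear algebra_simps)

section \<open>Chains\<close>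

definition additive_map :: "'m ring => 'n ring => ('m => 'n) => bool" where
  "additive_map M A f \<longleftrightarrow> (\<forall>x\<in>carrier M. f x \<in> carrier A) &
     (\<forall>x\<in>carrier M. \<forall>y\<in>carrier M. f (x +[M] y) = f x +[A] f y)"

definition chains_on :: "'m ring => 'x set => ('x => 'm) set" where
  "chains_on M T = {c. finite {x. c x ~= 0[M]} & (\<forall>x. c x \<in> carrier M) & (\<forall>x. c x ~= 0[M] --> x \<in> T)}"

text \<open>A chain \<open>c\<close> is determined by the values of \<open>c \<mapsto> \<Sum>x. \<Phi> x (c x)\<close>; identities between maps of
  chains are checked on these.\<close>

definition chain_eval :: "'m ring => 'n ring => ('x => 'm => 'n) => ('x => 'm) => 'n" where
  "chain_eval M A \<Phi> c = (\<Oplus>\<^bsub>A\<^esub>x\<in>{x. c x ~= 0[M]}. \<Phi> x (c x))"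

text \<open>The common shape of the boundary and of induced maps: the coefficient at
  \<open>x\<close> is sent by \<open>\<theta> x i\<close> to the generator
  \<open>\<phi> x i\<close>, for each \<open>i\<close> in \<open>I x\<close>. Both get their formal
  properties from this one construction.\<close>

definition chain_push :: "'m ring => 'n ring => ('x => nat set) => ('x => nat => 'y) => ('x => nat => 'm => 'n) =>
    ('x => 'm) => 'y => 'n" where
  "chain_push M A I \<phi> \<theta> c y = chain_eval M A (%x m. \<Oplus>\<^bsub>A\<^esub>i\<in>I x. if \<phi> x i = y then \<theta> x i m else 0[A]) c"

definition chain_add :: "'m ring => ('x => 'm) => ('x => 'm) => 'x => 'm" where
  "chain_add M c d = (%x. c x +[M] d x)"

definition chain_single :: "'m ring => 'x => 'm => 'x => 'm" where
  "chain_single M x m = (%y. if y = x then m else 0[M])"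

lemma additive_mapD:
  assumes "additive_map M A f" "x \<in> carrier M"
  shows "f x \<in> carrier A" "y \<in> carrier M ==> f (x +[M] y) = f x +[A] f y"
  using assms unfolding additive_map_def by auto

lemma additive_map_zero:
  assumes "abelian_group M" "abelian_group A" "additive_map M A f"
  shows "f 0[M] = 0[A]"
proof -
  interpret M: abelian_group M by fact
  interpret A: abelian_group A by fact
  have "f 0[M] +[A] f 0[M] = f 0[M]" using additive_mapD[OF assms(3)] by (metis M.zero_closed M.l_zero)
  thus ?thesis using additive_mapD(1)[OF assms(3)] by (metis A.add.r_cancel_one M.zero_closed)
qed

lemma additive_map_minus:
  assumes "abelian_group M" "abelian_group A" "additive_map M A f" "x \<in> carrier M"
  shows "f (-[M] x) = -[A] f x"
proof -
  interpret M: abelian_group M by fact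
  interpret A: abelian_group A by fact
  have "f (-[M] x) +[A] f x = 0[A]"
    using additive_mapD[OF assms(3)] additive_map_zero[OF assms(1-3)] assms(4) by (metis M.a_inv_closed M.l_neg)
  thus ?thesis using additive_mapD(1)[OF assms(3)] assms(4) A.minus_equality by (metis M.a_inv_closed)
qed

lemma additive_map_finsum:
  assumes "abelian_group M" "abelian_group A" "additive_map M A f" "finite I" "!!i. i \<in> I ==> g i \<in> carrier M"
  shows "f (\<Oplus>\<^bsub>M\<^esub>i\<in>I. g i) = (\<Oplus>\<^bsub>A\<^esub>i\<in>I. f (g i))"
proof -
  interpret M: abelian_group M by fact
  interpret A: abelian_group A by fact
  show ?thesis using assms(4,5)
  proof (induction I rule: finite_induct)
    case empty
    thus ?case using additive_map_zero[OF assms(1-3)] by simp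
  next
    case (insert i I)
    have "(%i. f (g i)) \<in> I \<rightarrow> carrier A" "f (g i) \<in> carrier A" using additive_mapD(1)[OF assms(3)] insert by auto
    moreover have "g \<in> I \<rightarrow> carrier M" "g i \<in> carrier M" using insert by auto
    ultimately show ?case using insert additive_mapD(2)[OF assms(3)] by (simp add: M.finsum_closed)
  qed
qed

lemma additive_map_id: "additive_map M M (%x. x)"
  unfolding additive_map_def by auto

lemma additive_map_comp: "additive_map M A f ==> additive_map A B g ==> additive_map M B (%x. g (f x))"
  unfolding additive_map_def by auto

lemma additive_map_const_zero:
  assumes "abelian_group A" shows "additive_map M A (%x. 0[A])"
proof -
  interpret A: abelian_group A by fact
  show ?thesis unfolding additive_map_def by simp
qed

lemma additive_map_uminus:
  assumes "abelian_group A" shows "additive_map A A (%x. -[A] x)"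
proof -
  interpret A: abelian_group A by fact
  show ?thesis unfolding additive_map_def by (simp add: A.minus_add)
qed

lemma additive_map_finsum_fun:
  assumes A: "abelian_group A" and "finite I" "!!i. i \<in> I ==> additive_map M A (f i)"
  shows "additive_map M A (%x. \<Oplus>\<^bsub>A\<^esub>i\<in>I. f i x)"
proof -
  interpret A: abelian_group A by fact
  have c: "(%i. f i x) \<in> I \<rightarrow> carrier A" if "x \<in> carrier M" for x
    using additive_mapD(1)[OF assms(3)] that by auto
  have "(\<Oplus>\<^bsub>A\<^esub>i\<in>I. f i (x +[M] y)) = (\<Oplus>\<^bsub>A\<^esub>i\<in>I. f i x) +[A] (\<Oplus>\<^bsub>A\<^esub>i\<in>I. f i y)"
    if xy: "x \<in> carrier M" "y \<in> carrier M" for x y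
  proof -
    have "(\<Oplus>\<^bsub>A\<^esub>i\<in>I. f i (x +[M] y)) = (\<Oplus>\<^bsub>A\<^esub>i\<in>I. f i x +[A] f i y)"
      by (rule A.finsum_cong') (use additive_mapD[OF assms(3)] xy in auto)
    thus ?thesis using A.finsum_addf[OF c[OF xy(1)] c[OF xy(2)]] by simp
  qed
  thus ?thesis unfolding additive_map_def using A.finsum_closed[OF c] by auto
qed

lemma (in abelian_group) finsum_swap:
  assumes "finite I" "finite J" "!!i j. i \<in> I ==> j \<in> J ==> f i j \<in> carrier G"
  shows "(\<Oplus>i\<in>I. \<Oplus>j\<in>J. f i j) = (\<Oplus>j\<in>J. \<Oplus>i\<in>I. f i j)"
  using assms(1,3)
proof (induction I rule: finite_induct)
  case empty
  have "(\<Oplus>j\<in>J. \<Oplus>i\<in>{}. f i j) = (\<Oplus>j\<in>J. \<zero>)" by (rule finsum_cong') auto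
  thus ?case by (simp add: finsum_zero)
next
  case (insert a I)
  have c: "(%j. f a j) \<in> J \<rightarrow> carrier G" using insert by auto
  have c2: "(%j. \<Oplus>i\<in>I. f i j) \<in> J \<rightarrow> carrier G" using insert by (auto intro!: finsum_closed)
  have c3: "(%i. \<Oplus>j\<in>J. f i j) \<in> I \<rightarrow> carrier G" using insert by (auto intro!: finsum_closed)
  have "(\<Oplus>i\<in>insert a I. \<Oplus>j\<in>J. f i j) = (\<Oplus>j\<in>J. f a j) \<oplus> (\<Oplus>i\<in>I. \<Oplus>j\<in>J. f i j)"
    by (rule finsum_insert) (use insert c c3 in \<open>auto intro!: finsum_closed\<close>)
  also have "(\<Oplus>i\<in>I. \<Oplus>j\<in>J. f i j) = (\<Oplus>j\<in>J. \<Oplus>i\<in>I. f i j)" using insert by auto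
  also have "(\<Oplus>j\<in>J. f a j) \<oplus> \<dots> = (\<Oplus>j\<in>J. f a j \<oplus> (\<Oplus>i\<in>I. f i j))"
    using finsum_addf[OF c c2] by simp
  also have "\<dots> = (\<Oplus>j\<in>J. \<Oplus>i\<in>insert a I. f i j)"
  proof (rule finsum_cong'[OF HOL.refl])
    show "(%j. \<Oplus>i\<in>insert a I. f i j) \<in> J \<rightarrow> carrier G" using insert by (auto intro!: finsum_closed)
    fix j assume j: "j \<in> J"
    have "(%i. f i j) \<in> I \<rightarrow> carrier G" "f a j \<in> carrier G" using insert j by auto
    thus "f a j \<oplus> (\<Oplus>i\<in>I. f i j) = (\<Oplus>i\<in>insert a I. f i j)" using insert by (simp add: finsum_insert)
  qed
  finally show ?case .
qed

lemma (in abelian_group) finsum_delta: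
  assumes "finite I" "a \<in> I" "g \<in> carrier G"
  shows "(\<Oplus>i\<in>I. if a = i then g else \<zero>) = g"
  using finsum_singleton[of a I "%_. g"] assms by simp

locale two_modules = M: abelian_group M + A: abelian_group A for M :: "'m ring" and A :: "'n ring"
begin

lemma eval_superset:
  assumes "c \<in> chains_on M T" "!!x. x \<in> T ==> additive_map M A (\<Phi> x)" "finite S" "{x. c x ~= 0[M]} <= S" "S <= T"
  shows "chain_eval M A \<Phi> c = (\<Oplus>\<^bsub>A\<^esub>x\<in>S. \<Phi> x (c x))"
proof -
  have c: "\<Phi> x (c x) \<in> carrier A" if "x \<in> T" for x
    using additive_mapD(1)[OF assms(2)[OF that]] assms(1) unfolding chains_on_def by auto
  show ?thesis unfolding chain_eval_def
  proof (rule A.add.finprod_mono_neutral_cong_left)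
    show "!!i. i \<in> S - {x. c x ~= 0[M]} ==> \<Phi> i (c i) = 0[A]"
      using additive_map_zero[OF M.abelian_group_axioms A.abelian_group_axioms assms(2)] assms(5) by auto
  qed (use assms c in auto)
qed

lemma eval_closed:
  assumes "c \<in> chains_on M T" "!!x. x \<in> T ==> additive_map M A (\<Phi> x)"
  shows "chain_eval M A \<Phi> c \<in> carrier A"
  unfolding chain_eval_def
proof (rule A.finsum_closed, rule Pi_I)
  fix x assume "x \<in> {x. c x ~= 0[M]}"
  hence "x \<in> T" "c x \<in> carrier M" using assms(1) unfolding chains_on_def by auto
  thus "\<Phi> x (c x) \<in> carrier A" using additive_mapD(1)[OF assms(2)] by blast
qed

lemma eval_cong:
  assumes "c \<in> chains_on M T" "!!x. x \<in> T ==> additive_map M A (\<Psi> x)"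
    "!!x m. x \<in> T ==> m \<in> carrier M ==> \<Phi> x m = \<Psi> x m"
  shows "chain_eval M A \<Phi> c = chain_eval M A \<Psi> c"
  unfolding chain_eval_def
proof (rule A.finsum_cong'[OF HOL.refl])
  have *: "x \<in> T & c x \<in> carrier M" if "x \<in> {x. c x ~= 0[M]}" for x using assms(1) that unfolding chains_on_def by auto
  show "(%x. \<Psi> x (c x)) \<in> {x. c x ~= 0[M]} \<rightarrow> carrier A"
    using additive_mapD(1)[OF assms(2)] * by blast
  show "!!i. i \<in> {x. c x ~= 0[M]} ==> \<Phi> i (c i) = \<Psi> i (c i)" using assms(3) * by blast
qed

lemma eval_zero_fun:
  assumes "c \<in> chains_on M T" "!!x m. x \<in> T ==> m \<in> carrier M ==> \<Phi> x m = 0[A]"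
  shows "chain_eval M A \<Phi> c = 0[A]"
proof -
  have "chain_eval M A \<Phi> c = chain_eval M A (%x m. 0[A]) c"
    using assms additive_map_const_zero[OF A.abelian_group_axioms] by (intro eval_cong) auto
  thus ?thesis unfolding chain_eval_def by (simp add: A.finsum_zero)
qed

lemma eval_add:
  assumes c: "c \<in> chains_on M T" and d: "d \<in> chains_on M T" and \<Phi>: "!!x. x \<in> T ==> additive_map M A (\<Phi> x)"
    and cd: "chain_add M c d \<in> chains_on M T"
  shows "chain_eval M A \<Phi> (chain_add M c d) = chain_eval M A \<Phi> c +[A] chain_eval M A \<Phi> d"
proof -
  define S where "S = {x. c x ~= 0[M]} \<union> {x. d x ~= 0[M]}"
  have S: "finite S" "S <= T" "{x. c x ~= 0[M]} <= S" "{x. d x ~= 0[M]} <= S" "{x. chain_add M c d x ~= 0[M]} <= S"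
    using c d unfolding S_def chains_on_def chain_add_def by auto
  have cc: "c x \<in> carrier M" "d x \<in> carrier M" for x using c d unfolding chains_on_def by auto
  have "chain_eval M A \<Phi> (chain_add M c d) = (\<Oplus>\<^bsub>A\<^esub>x\<in>S. \<Phi> x (chain_add M c d x))"
    by (rule eval_superset[OF cd \<Phi>]) (use S in auto)
  also have "\<dots> = (\<Oplus>\<^bsub>A\<^esub>x\<in>S. \<Phi> x (c x) +[A] \<Phi> x (d x))"
    by (rule A.finsum_cong'[OF HOL.refl]) (use S additive_mapD[OF \<Phi>] cc in \<open>auto simp: chain_add_def subset_iff\<close>)
  also have "\<dots> = (\<Oplus>\<^bsub>A\<^esub>x\<in>S. \<Phi> x (c x)) +[A] (\<Oplus>\<^bsub>A\<^esub>x\<in>S. \<Phi> x (d x))"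
    by (rule A.finsum_addf) (use S additive_mapD[OF \<Phi>] cc in \<open>auto simp: subset_iff\<close>)
  also have "\<dots> = chain_eval M A \<Phi> c +[A] chain_eval M A \<Phi> d"
    using eval_superset[OF c \<Phi> S(1,3,2)] eval_superset[OF d \<Phi> S(1,4,2)] by simp
  finally show ?thesis .
qed

lemma chain_single_closed: "x \<in> T ==> m \<in> carrier M ==> chain_single M x m \<in> chains_on M T"
proof -
  assume *: "x \<in> T" "m \<in> carrier M"
  have "{y. chain_single M x m y ~= 0[M]} <= {x}" unfolding chain_single_def by auto
  hence "finite {y. chain_single M x m y ~= 0[M]}" by (rule finite_subset) simp
  thus ?thesis using * unfolding chains_on_def by (auto simp: chain_single_def)
qed

lemma eval_single:
  assumes "x \<in> T" "m \<in> carrier M" "!!x. x \<in> T ==> additive_map M A (\<Phi> x)"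
  shows "chain_eval M A \<Phi> (chain_single M x m) = \<Phi> x m"
proof -
  have "chain_eval M A \<Phi> (chain_single M x m) = (\<Oplus>\<^bsub>A\<^esub>y\<in>{x}. \<Phi> y (chain_single M x m y))"
    by (rule eval_superset[OF chain_single_closed[OF assms(1,2)] assms(3)]) (use assms in \<open>auto simp: chain_single_def\<close>)
  thus ?thesis using additive_mapD(1)[OF assms(3)[OF assms(1)] assms(2)] by (simp add: chain_single_def)
qed

context
  fixes T :: "'x set" and T' :: "'y set" and I :: "'x => nat set" and \<phi> :: "'x => nat => 'y" and \<theta> :: "'x => nat => 'm => 'n"
  assumes fin: "!!x. x \<in> T ==> finite (I x)"
    and \<phi>: "!!x i. x \<in> T ==> i \<in> I x ==> \<phi> x i \<in> T'"
    and \<theta>: "!!x i. x \<in> T ==> i \<in> I x ==> additive_map M A (\<theta> x i)"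
begin

lemma push_additive:
  assumes "x \<in> T" shows "additive_map M A (%m. \<Oplus>\<^bsub>A\<^esub>i\<in>I x. if \<phi> x i = y then \<theta> x i m else 0[A])"
proof (rule additive_map_finsum_fun[OF A.abelian_group_axioms fin[OF assms]])
  fix i assume "i \<in> I x"
  thus "additive_map M A (%m. if \<phi> x i = y then \<theta> x i m else 0[A])"
    using \<theta>[OF assms] additive_map_const_zero[OF A.abelian_group_axioms] by (cases "\<phi> x i = y") auto
qed

lemma push_support:
  assumes "c \<in> chains_on M T"
  shows "{y. chain_push M A I \<phi> \<theta> c y ~= 0[A]} <= (\<Union>x\<in>{x. c x ~= 0[M]}. \<phi> x ` I x)"
proof (rule subsetI, rule ccontr)
  fix y assume y: "y \<in> {y. chain_push M A I \<phi> \<theta> c y ~= 0[A]}" and n: "y \<notin> (\<Union>x\<in>{x. c x ~= 0[M]}. \<phi> x ` I x)"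
  have "chain_push M A I \<phi> \<theta> c y = (\<Oplus>\<^bsub>A\<^esub>x\<in>{x. c x ~= 0[M]}. 0[A])"
    unfolding chain_push_def chain_eval_def
  proof (rule A.finsum_cong'[OF HOL.refl])
    fix x assume "x \<in> {x. c x ~= 0[M]}"
    hence "(\<Oplus>\<^bsub>A\<^esub>i\<in>I x. if \<phi> x i = y then \<theta> x i (c x) else 0[A]) = (\<Oplus>\<^bsub>A\<^esub>i\<in>I x. 0[A])"
      by (intro A.finsum_cong'[OF HOL.refl]) (use n in auto)
    thus "(\<Oplus>\<^bsub>A\<^esub>i\<in>I x. if \<phi> x i = y then \<theta> x i (c x) else 0[A]) = 0[A]" by (simp add: A.finsum_zero)
  qed auto
  thus False using y by (simp add: A.finsum_zero)
qed

lemma push_closed: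
  assumes "c \<in> chains_on M T" shows "chain_push M A I \<phi> \<theta> c \<in> chains_on A T'"
proof -
  have s: "finite {x. c x ~= 0[M]}" "!!x. c x ~= 0[M] ==> x \<in> T" using assms unfolding chains_on_def by auto
  have "finite (\<Union>x\<in>{x. c x ~= 0[M]}. \<phi> x ` I x)" using s fin by auto
  hence 1: "finite {y. chain_push M A I \<phi> \<theta> c y ~= 0[A]}" by (rule finite_subset[OF push_support[OF assms]])
  have "(\<Union>x\<in>{x. c x ~= 0[M]}. \<phi> x ` I x) <= T'" using s \<phi> by auto
  hence 2: "{y. chain_push M A I \<phi> \<theta> c y ~= 0[A]} <= T'" by (rule order_trans[OF push_support[OF assms]])
  have "chain_push M A I \<phi> \<theta> c y \<in> carrier A" for y
    unfolding chain_push_def by (rule eval_closed[OF assms push_additive])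
  thus ?thesis unfolding chains_on_def using 1 2 by auto
qed

lemma push_add:
  assumes c: "c \<in> chains_on M T" and d: "d \<in> chains_on M T" and cd: "chain_add M c d \<in> chains_on M T"
  shows "chain_push M A I \<phi> \<theta> (chain_add M c d) = chain_add A (chain_push M A I \<phi> \<theta> c) (chain_push M A I \<phi> \<theta> d)"
  unfolding chain_push_def using eval_add[OF c d push_additive cd] by (auto simp: chain_add_def)

text \<open>Evaluation after a push is evaluation before it, with the functional composed on
  generators. With this formula identities between composites, such as that the boundary of a
  boundary vanishes, are checked on one generator at a time.\<close>

lemma eval_push:
  assumes c: "c \<in> chains_on M T" and B: "abelian_group B" and \<Psi>: "!!y. y \<in> T' ==> additive_map A B (\<Psi> y)"
  shows "chain_eval A B \<Psi> (chain_push M A I \<phi> \<theta> c) = chain_eval M B (%x m. \<Oplus>\<^bsub>B\<^esub>i\<in>I x. \<Psi> (\<phi> x i) (\<theta> x i m)) c"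
proof -
  interpret B: abelian_group B by fact
  interpret AB: two_modules A B ..
  define S where "S = {x. c x ~= 0[M]}"
  \<comment> \<open>A finite set that contains the support of the pushed chain. The sums over
    \<open>U\<close> and over the support of \<open>c\<close> can then be exchanged.\<close>
  define U where "U = (\<Union>x\<in>S. \<phi> x ` I x)"
  have S: "finite S" "S <= T" "!!x. c x \<in> carrier M" using c unfolding chains_on_def S_def by auto
  have U: "finite U" "U <= T'" using S fin \<phi> unfolding U_def by auto
  have tc: "\<theta> x i (c x) \<in> carrier A" if "x \<in> S" "i \<in> I x" for x i
    using additive_mapD(1)[OF \<theta>] that S by blast
  have pc: "\<Psi> y (\<theta> x i (c x)) \<in> carrier B" if "x \<in> S" "i \<in> I x" "y \<in> T'" for x i y
    using additive_mapD(1)[OF \<Psi>] that tc by blast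
  have finI: "finite (I x)" if "x \<in> S" for x using that S fin by blast
  have "chain_eval A B \<Psi> (chain_push M A I \<phi> \<theta> c) = (\<Oplus>\<^bsub>B\<^esub>y\<in>U. \<Psi> y (chain_push M A I \<phi> \<theta> c y))"
    by (rule AB.eval_superset[OF push_closed[OF c] \<Psi> U(1) _ U(2)]) (use push_support[OF c] in \<open>auto simp: U_def S_def\<close>)
  also have "\<dots> = (\<Oplus>\<^bsub>B\<^esub>y\<in>U. \<Oplus>\<^bsub>B\<^esub>x\<in>S. \<Oplus>\<^bsub>B\<^esub>i\<in>I x. if \<phi> x i = y then \<Psi> y (\<theta> x i (c x)) else 0[B])"
  proof (rule B.finsum_cong'[OF HOL.refl])
    show "(%y. \<Oplus>\<^bsub>B\<^esub>x\<in>S. \<Oplus>\<^bsub>B\<^esub>i\<in>I x. if \<phi> x i = y then \<Psi> y (\<theta> x i (c x)) else 0[B]) \<in> U \<rightarrow> carrier B"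
      using pc U(2) by (auto intro!: B.finsum_closed)
    fix y assume y: "y \<in> U"
    hence \<Psi>y: "additive_map A B (\<Psi> y)" using U \<Psi> by blast
    have ic: "(if \<phi> x i = y then \<theta> x i (c x) else 0[A]) \<in> carrier A" if "x \<in> S" "i \<in> I x" for x i using tc that by auto
    have "\<Psi> y (chain_push M A I \<phi> \<theta> c y) = (\<Oplus>\<^bsub>B\<^esub>x\<in>S. \<Psi> y (\<Oplus>\<^bsub>A\<^esub>i\<in>I x. if \<phi> x i = y then \<theta> x i (c x) else 0[A]))"
      unfolding chain_push_def chain_eval_def S_def[symmetric]
      by (rule additive_map_finsum[OF A.abelian_group_axioms B \<Psi>y S(1)]) (use ic in \<open>auto intro!: A.finsum_closed\<close>)
    also have "\<dots> = (\<Oplus>\<^bsub>B\<^esub>x\<in>S. \<Oplus>\<^bsub>B\<^esub>i\<in>I x. if \<phi> x i = y then \<Psi> y (\<theta> x i (c x)) else 0[B])"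
    proof (rule B.finsum_cong'[OF HOL.refl])
      show "(%x. \<Oplus>\<^bsub>B\<^esub>i\<in>I x. if \<phi> x i = y then \<Psi> y (\<theta> x i (c x)) else 0[B]) \<in> S \<rightarrow> carrier B"
        using pc U(2) y by (auto intro!: B.finsum_closed)
      fix x assume x: "x \<in> S"
      have "\<Psi> y (\<Oplus>\<^bsub>A\<^esub>i\<in>I x. if \<phi> x i = y then \<theta> x i (c x) else 0[A]) =
        (\<Oplus>\<^bsub>B\<^esub>i\<in>I x. \<Psi> y (if \<phi> x i = y then \<theta> x i (c x) else 0[A]))"
        by (rule additive_map_finsum[OF A.abelian_group_axioms B \<Psi>y finI[OF x] ic[OF x]])
      also have "\<dots> = (\<Oplus>\<^bsub>B\<^esub>i\<in>I x. if \<phi> x i = y then \<Psi> y (\<theta> x i (c x)) else 0[B])"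
        by (rule B.finsum_cong'[OF HOL.refl])
          (use pc[OF x] U(2) y additive_map_zero[OF A.abelian_group_axioms B \<Psi>y] in auto)
      finally show "\<Psi> y (\<Oplus>\<^bsub>A\<^esub>i\<in>I x. if \<phi> x i = y then \<theta> x i (c x) else 0[A]) =
        (\<Oplus>\<^bsub>B\<^esub>i\<in>I x. if \<phi> x i = y then \<Psi> y (\<theta> x i (c x)) else 0[B])" .
    qed
    finally show "\<Psi> y (chain_push M A I \<phi> \<theta> c y) = (\<Oplus>\<^bsub>B\<^esub>x\<in>S. \<Oplus>\<^bsub>B\<^esub>i\<in>I x. if \<phi> x i = y then \<Psi> y (\<theta> x i (c x)) else 0[B])" .
  qed
  also have "\<dots> = (\<Oplus>\<^bsub>B\<^esub>x\<in>S. \<Oplus>\<^bsub>B\<^esub>y\<in>U. \<Oplus>\<^bsub>B\<^esub>i\<in>I x. if \<phi> x i = y then \<Psi> y (\<theta> x i (c x)) else 0[B])"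
    by (rule B.finsum_swap[OF U(1) S(1)]) (use pc U(2) in \<open>auto intro!: B.finsum_closed\<close>)
  also have "\<dots> = (\<Oplus>\<^bsub>B\<^esub>x\<in>S. \<Oplus>\<^bsub>B\<^esub>i\<in>I x. \<Psi> (\<phi> x i) (\<theta> x i (c x)))"
  proof (rule B.finsum_cong'[OF HOL.refl])
    show "(%x. \<Oplus>\<^bsub>B\<^esub>i\<in>I x. \<Psi> (\<phi> x i) (\<theta> x i (c x))) \<in> S \<rightarrow> carrier B"
      using pc S(2) \<phi> by (auto intro!: B.finsum_closed)
    fix x assume x: "x \<in> S"
    have "(\<Oplus>\<^bsub>B\<^esub>y\<in>U. \<Oplus>\<^bsub>B\<^esub>i\<in>I x. if \<phi> x i = y then \<Psi> y (\<theta> x i (c x)) else 0[B]) =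
      (\<Oplus>\<^bsub>B\<^esub>i\<in>I x. \<Oplus>\<^bsub>B\<^esub>y\<in>U. if \<phi> x i = y then \<Psi> y (\<theta> x i (c x)) else 0[B])"
      by (rule B.finsum_swap[OF U(1) finI[OF x]]) (use pc[OF x] U(2) in auto)
    also have "\<dots> = (\<Oplus>\<^bsub>B\<^esub>i\<in>I x. \<Psi> (\<phi> x i) (\<theta> x i (c x)))"
    proof (rule B.finsum_cong'[OF HOL.refl])
      show "(%i. \<Psi> (\<phi> x i) (\<theta> x i (c x))) \<in> I x \<rightarrow> carrier B" using pc[OF x] x S(2) \<phi> by auto
      fix i assume i: "i \<in> I x"
      have "(\<Oplus>\<^bsub>B\<^esub>y\<in>U. if \<phi> x i = y then \<Psi> y (\<theta> x i (c x)) else 0[B]) =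
        (\<Oplus>\<^bsub>B\<^esub>y\<in>U. if \<phi> x i = y then \<Psi> (\<phi> x i) (\<theta> x i (c x)) else 0[B])"
        by (rule B.finsum_cong'[OF HOL.refl]) (use pc[OF x i] U(2) in auto)
      also have "\<dots> = \<Psi> (\<phi> x i) (\<theta> x i (c x))"
        by (rule B.finsum_delta[OF U(1)]) (use x i pc[OF x i] S(2) \<phi> in \<open>auto simp: U_def\<close>)
      finally show "(\<Oplus>\<^bsub>B\<^esub>y\<in>U. if \<phi> x i = y then \<Psi> y (\<theta> x i (c x)) else 0[B]) = \<Psi> (\<phi> x i) (\<theta> x i (c x))" .
    qed
    finally show "(\<Oplus>\<^bsub>B\<^esub>y\<in>U. \<Oplus>\<^bsub>B\<^esub>i\<in>I x. if \<phi> x i = y then \<Psi> y (\<theta> x i (c x)) else 0[B]) =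
      (\<Oplus>\<^bsub>B\<^esub>i\<in>I x. \<Psi> (\<phi> x i) (\<theta> x i (c x)))" .
  qed
  finally show ?thesis unfolding chain_eval_def S_def .
qed

end

end

text \<open>Coordinates are themselves evaluations, so equality of all evaluations gives equality of
  chains.\<close>

lemma chain_coordinate:
  assumes "abelian_group M" "c \<in> chains_on M T"
  shows "c y = chain_eval M M (%x m. if x = y then m else 0[M]) c"
proof -
  interpret abelian_group M by fact
  interpret two_modules M M ..
  have s: "finite {x. c x ~= 0[M]}" "!!x. c x \<in> carrier M" using assms(2) unfolding chains_on_def by auto
  have add: "additive_map M M (%m. if x = y then m else 0[M])" for x
    unfolding additive_map_def by auto
  have "c \<in> chains_on M UNIV" using assms(2) unfolding chains_on_def by auto
  hence "chain_eval M M (%x m. if x = y then m else 0[M]) c =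
    (\<Oplus>\<^bsub>M\<^esub>x\<in>insert y {x. c x ~= 0[M]}. if x = y then c x else 0[M])"
    using s by (intro eval_superset[OF _ add]) auto
  also have "\<dots> = (\<Oplus>\<^bsub>M\<^esub>x\<in>insert y {x. c x ~= 0[M]}. if y = x then c y else 0[M])"
    using s by (intro finsum_cong') auto
  also have "\<dots> = c y" using s by (intro finsum_delta) auto
  finally show ?thesis by simp
qed

section \<open>The bar complex\<close>

definition tuples :: "nat => 'a monoid => 'a list set" where
  "tuples k G = {x. length x = k & set x <= carrier G}"

abbreviation bar_chains :: "nat => 'a monoid => 'm ring => ('a list => 'm) set" where
  "bar_chains k G M == chains_on M (tuples k G)"

lemma chain_group_simps:
  "carrier (chain_group k G M) = bar_chains k G M" "monoid.mult (chain_group k G M) = chain_add M"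
  "1[chain_group k G M] = (%x. 0[M])"
  by (auto simp: chain_group_def chains_on_def tuples_def chain_add_def fun_eq_iff)

lemma tuples_1: "x \<in> tuples (Suc 0) G \<longleftrightarrow> (\<exists>g\<in>carrier G. x = [g])"
  by (auto simp: tuples_def length_Suc_conv)

lemma tuples_2: "x \<in> tuples (Suc (Suc 0)) G \<longleftrightarrow> (\<exists>g\<in>carrier G. \<exists>h\<in>carrier G. x = [g, h])"
  by (auto simp: tuples_def length_Suc_conv)

locale coeff = group G + M: abelian_group M for G :: "'a monoid" and M :: "'m ring" +
  fixes act :: "'a => 'm => 'm"
  assumes act_additive: "g \<in> carrier G ==> additive_map M M (act g)"
    and act_mult: "[|g \<in> carrier G; h \<in> carrier G; m \<in> carrier M|] ==> act (g *[G] h) m = act g (act h m)"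
    and act_one: "m \<in> carrier M ==> act 1[G] m = m"
begin

abbreviation "bd == boundary G M act"

sublocale MM: two_modules M M ..

lemma act_closed: "g \<in> carrier G ==> m \<in> carrier M ==> act g m \<in> carrier M"
  using additive_mapD(1)[OF act_additive] .

lemma add_closed: "c \<in> bar_chains k G M ==> d \<in> bar_chains k G M ==> chain_add M c d \<in> bar_chains k G M"
proof -
  assume c: "c \<in> bar_chains k G M" and d: "d \<in> bar_chains k G M"
  have "{x. chain_add M c d x ~= 0[M]} <= {x. c x ~= 0[M]} \<union> {x. d x ~= 0[M]}" by (auto simp: chain_add_def)
  moreover have "finite ({x. c x ~= 0[M]} \<union> {x. d x ~= 0[M]})" using c d by (auto simp: chains_on_def)
  ultimately have "finite {x. chain_add M c d x ~= 0[M]}" by (rule finite_subset)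
  moreover have "x \<in> tuples k G" if "chain_add M c d x ~= 0[M]" for x
  proof (cases "c x = 0[M]")
    case True
    hence "d x ~= 0[M]" using that by (auto simp: chain_add_def)
    thus ?thesis using d by (auto simp: chains_on_def)
  qed (use c in \<open>auto simp: chains_on_def\<close>)
  ultimately show ?thesis using c d by (auto simp: chains_on_def) (auto simp: chain_add_def)
qed

lemma zero_closed: "(%x. 0[M]) \<in> bar_chains k G M"
  by (auto simp: chains_on_def)

lemma neg_closed: "c \<in> bar_chains k G M ==> (%x. -[M] c x) \<in> bar_chains k G M"
proof -
  assume c: "c \<in> bar_chains k G M"
  have "-[M] c x = 0[M] \<longleftrightarrow> c x = 0[M]" for x using c by (auto simp: chains_on_def)
  thus ?thesis using c by (auto simp: chains_on_def)
qed

lemma comm_group_chains: "comm_group (chain_group k G M)"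
proof (rule comm_groupI)
  fix c d e assume c: "c \<in> carrier (chain_group k G M)" and d: "d \<in> carrier (chain_group k G M)"
  hence cd: "c x \<in> carrier M" "d x \<in> carrier M" for x by (auto simp: chain_group_simps chains_on_def)
  show "c *[chain_group k G M] d \<in> carrier (chain_group k G M)" using add_closed c d by (simp add: chain_group_simps)
  show "c *[chain_group k G M] d = d *[chain_group k G M] c"
    using cd by (simp add: chain_group_simps chain_add_def M.a_comm)
  assume "e \<in> carrier (chain_group k G M)"
  hence "e x \<in> carrier M" for x by (auto simp: chain_group_simps chains_on_def)
  thus "c *[chain_group k G M] d *[chain_group k G M] e = c *[chain_group k G M] (d *[chain_group k G M] e)"
    using cd by (simp add: chain_group_simps chain_add_def M.a_assoc)
next
  show "1[chain_group k G M] \<in> carrier (chain_group k G M)" using zero_closed by (simp add: chain_group_simps)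
  fix c assume c: "c \<in> carrier (chain_group k G M)"
  hence cc: "c x \<in> carrier M" for x by (auto simp: chain_group_simps chains_on_def)
  show "1[chain_group k G M] *[chain_group k G M] c = c" using cc by (simp add: chain_group_simps chain_add_def)
  show "\<exists>d\<in>carrier (chain_group k G M). d *[chain_group k G M] c = 1[chain_group k G M]"
    using neg_closed c cc by (intro bexI[of _ "%x. -[M] c x"]) (simp_all add: chain_group_simps chain_add_def M.l_neg)
qed

lemma inv_chain: "c \<in> bar_chains k G M ==> inv[chain_group k G M] c = (%x. -[M] c x)"
proof -
  assume c: "c \<in> bar_chains k G M"
  interpret C: comm_group "chain_group k G M" by (rule comm_group_chains)
  show ?thesis
    by (rule C.inv_equality) (use c neg_closed in \<open>auto simp: chain_group_simps chain_add_def M.l_neg chains_on_def\<close>)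
qed

lemma face_closed:
  assumes "x \<in> tuples (Suc k) G" "i \<le> Suc k" shows "face G i x \<in> tuples k G"
proof -
  have x: "length x = Suc k" "set x <= carrier G" using assms by (auto simp: tuples_def)
  consider "i = 0" | "i = Suc k" | "0 < i" "i \<le> k" using assms by linarith
  thus ?thesis
  proof cases
    case 1
    thus ?thesis using x list.set_sel(2)[of x] by (cases x) (auto simp: face_def tuples_def)
  next
    case 2
    thus ?thesis using x in_set_butlastD by (fastforce simp: face_def tuples_def)
  next
    case 3
    hence "x ! (i - 1) \<in> carrier G" "x ! i \<in> carrier G" using x by (auto simp: subset_iff)
    hence "set (face G i x) <= carrier G"
      using 3 x set_take_subset[of "i - 1" x] set_drop_subset[of "i + 1" x] by (auto simp: face_def)
    moreover have "length (face G i x) = k" using 3 x by (auto simp: face_def)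
    ultimately show ?thesis by (simp add: tuples_def)
  qed
qed

lemma face_coeff_additive:
  assumes "x \<in> tuples (Suc k) G" shows "additive_map M M (face_coeff G M act i x)"
proof -
  have "hd x \<in> carrier G" using assms by (cases x) (auto simp: tuples_def)
  hence "additive_map M M (act (inv[G] hd x))" by (intro act_additive inv_closed)
  thus ?thesis
    using additive_map_id[of M] additive_map_uminus[OF M.abelian_group_axioms]
    unfolding face_coeff_def by (cases "i = 0"; cases "even i") auto
qed

lemma boundary_push:
  "bd = chain_push M M (%x. {..length x}) (%x i. face G i x) (%x i. face_coeff G M act i x)"
  by (intro ext) (simp add: boundary_def chain_push_def chain_eval_def)

lemma push_conditions:
  "!!x. x \<in> tuples (Suc k) G ==> finite {..length x}"
  "!!x i. x \<in> tuples (Suc k) G ==> i \<in> {..length x} ==> face G i x \<in> tuples k G"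
  "!!x i. x \<in> tuples (Suc k) G ==> i \<in> {..length x} ==> additive_map M M (face_coeff G M act i x)"
  using face_closed face_coeff_additive by (auto simp: tuples_def)

lemma boundary_closed: "c \<in> bar_chains (Suc k) G M ==> bd c \<in> bar_chains k G M"
  unfolding boundary_push
  by (rule MM.push_closed[where T = "tuples (Suc k) G"]) (use push_conditions in blast)+

lemma boundary_add:
  "c \<in> bar_chains (Suc k) G M ==> d \<in> bar_chains (Suc k) G M ==>
    bd (chain_add M c d) = chain_add M (bd c) (bd d)"
  unfolding boundary_push
  by (rule MM.push_add[where T = "tuples (Suc k) G" and T' = "tuples k G"]) (use push_conditions add_closed in blast)+

lemma eval_boundary:
  assumes "c \<in> bar_chains (Suc k) G M" "abelian_group B" "!!y. y \<in> tuples k G ==> additive_map M B (\<Psi> y)"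
  shows "chain_eval M B \<Psi> (bd c) =
    chain_eval M B (%x m. \<Oplus>\<^bsub>B\<^esub>i\<in>{..length x}. \<Psi> (face G i x) (face_coeff G M act i x m)) c"
  unfolding boundary_push
  by (rule MM.eval_push[where T = "tuples (Suc k) G" and T' = "tuples k G"]) (use push_conditions assms in blast)+

lemma boundary_summand_additive:
  assumes "x \<in> tuples (Suc k) G" "abelian_group B" "!!y. y \<in> tuples k G ==> additive_map M B (\<Psi> y)"
  shows "additive_map M B (%m. \<Oplus>\<^bsub>B\<^esub>i\<in>{..length x}. \<Psi> (face G i x) (face_coeff G M act i x m))"
  by (rule additive_map_finsum_fun[OF assms(2)])
    (use assms face_coeff_additive[OF assms(1)] face_closed[OF assms(1)] in \<open>auto simp: tuples_def intro!: additive_map_comp[OF _ assms(3)]\<close>)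

lemma boundary_summand_2:
  assumes g: "g \<in> carrier G" and h: "h \<in> carrier G" and m: "m \<in> carrier M" and B: "abelian_group B"
    and \<Psi>: "!!y. y \<in> tuples (Suc 0) G ==> additive_map M B (\<Psi> y)"
  shows "(\<Oplus>\<^bsub>B\<^esub>i\<in>{..length [g, h]}. \<Psi> (face G i [g, h]) (face_coeff G M act i [g, h] m)) =
    \<Psi> [h] (act (inv[G] g) m) +[B] (\<Psi> [g *[G] h] (-[M] m) +[B] \<Psi> [g] m)"
proof -
  interpret B: abelian_group B by fact
  have s: "{..length [g, h]} = insert 0 (insert 1 (insert 2 {}))" by auto
  have c: "\<Psi> [h] (act (inv[G] g) m) \<in> carrier B" "\<Psi> [g *[G] h] (-[M] m) \<in> carrier B" "\<Psi> [g] m \<in> carrier B"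
    using additive_mapD(1)[OF \<Psi>] g h m act_closed[of "inv[G] g" m] by (auto simp: tuples_1)
  have f: "face G 0 [g, h] = [h]" "face G 1 [g, h] = [g *[G] h]" "face G 2 [g, h] = [g]"
    by (simp_all add: face_def)
  have k: "face_coeff G M act 0 [g, h] m = act (inv[G] g) m" "face_coeff G M act 1 [g, h] m = -[M] m"
    "face_coeff G M act 2 [g, h] m = m" by (simp_all add: face_coeff_def)
  show ?thesis unfolding s using c
    by (subst B.finsum_insert; (subst B.finsum_insert)?; (subst B.finsum_insert)?) (auto simp: f k simp del: One_nat_def)
qed

lemma boundary_summand_1:
  assumes g: "g \<in> carrier G" and m: "m \<in> carrier M" and B: "abelian_group B"
    and \<Psi>: "!!y. y \<in> tuples 0 G ==> additive_map M B (\<Psi> y)"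
  shows "(\<Oplus>\<^bsub>B\<^esub>i\<in>{..length [g]}. \<Psi> (face G i [g]) (face_coeff G M act i [g] m)) =
    \<Psi> [] (act (inv[G] g) m) +[B] \<Psi> [] (-[M] m)"
proof -
  interpret B: abelian_group B by fact
  have s: "{..length [g]} = insert 0 (insert 1 {})" by auto
  have "[] \<in> tuples 0 G" by (simp add: tuples_def)
  hence c: "\<Psi> [] (act (inv[G] g) m) \<in> carrier B" "\<Psi> [] (-[M] m) \<in> carrier B"
    using additive_mapD(1)[OF \<Psi>] g m act_closed[of "inv[G] g" m] by auto
  have f: "face G 0 [g] = []" "face G 1 [g] = []" by (simp_all add: face_def)
  have k: "face_coeff G M act 0 [g] m = act (inv[G] g) m" "face_coeff G M act 1 [g] m = -[M] m"
    by (simp_all add: face_coeff_def)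
  show ?thesis unfolding s using c
    by (subst B.finsum_insert; (subst B.finsum_insert)?) (auto simp: f k simp del: One_nat_def)
qed

lemma chain_eqI:
  assumes "c \<in> bar_chains k G M" "d \<in> bar_chains k G M"
    "!!y. chain_eval M M (%x m. if x = y then m else 0[M]) c = chain_eval M M (%x m. if x = y then m else 0[M]) d"
  shows "c = d"
  using chain_coordinate[OF M.abelian_group_axioms assms(1)] chain_coordinate[OF M.abelian_group_axioms assms(2)] assms(3)
  by (intro ext) metis

lemma proj_additive: "additive_map M M (%m. if x = y then m else 0[M])"
  unfolding additive_map_def by auto

lemma boundary_boundary:
  assumes c: "c \<in> bar_chains (Suc (Suc 0)) G M"
  shows "bd (bd c) = (%y. 0[M])"
proof (rule chain_eqI[where k = 0])
  have bc: "bd c \<in> bar_chains (Suc 0) G M" using boundary_closed[OF c] .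
  show "bd (bd c) \<in> bar_chains 0 G M" using boundary_closed[OF bc] .
  show "(%y. 0[M]) \<in> bar_chains 0 G M" by (rule zero_closed)
  fix y :: "'a list"
  let ?P = "%x m. if x = y then m else 0[M]"
  let ?Q = "%x m. \<Oplus>\<^bsub>M\<^esub>i\<in>{..length x}. ?P (face G i x) (face_coeff G M act i x m)"
  have q: "additive_map M M (?Q x)" if "x \<in> tuples (Suc 0) G" for x
    by (rule boundary_summand_additive[OF that M.abelian_group_axioms proj_additive])
  have qe: "?Q [g] m = ?P [] (act (inv[G] g) m) +[M] ?P [] (-[M] m)" if "g \<in> carrier G" "m \<in> carrier M" for g m
    by (rule boundary_summand_1[OF that M.abelian_group_axioms proj_additive])
  have "chain_eval M M ?P (bd (bd c)) =
    chain_eval M M ?Q (bd c)" by (rule eval_boundary[OF bc M.abelian_group_axioms proj_additive])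
  also have "\<dots> = chain_eval M M (%x m. \<Oplus>\<^bsub>M\<^esub>i\<in>{..length x}. ?Q (face G i x) (face_coeff G M act i x m)) c"
    by (rule eval_boundary[OF c M.abelian_group_axioms q])
  also have "\<dots> = 0[M]"
  proof (rule MM.eval_zero_fun[OF c])
    fix x m assume "x \<in> tuples (Suc (Suc 0)) G" and m: "m \<in> carrier M"
    then obtain g h where gh: "g \<in> carrier G" "h \<in> carrier G" "x = [g, h]" by (auto simp: tuples_2)
    \<comment> \<open>The three faces contribute \<open>b - a\<close>, \<open>m - b\<close> and
      \<open>a - m\<close>, where \<open>b\<close> is the coefficient moved by the inverse of
      \<open>g h\<close>.\<close>
    define a where "a = act (inv[G] g) m"
    define b where "b = act (inv[G] h) a"
    have ab: "a \<in> carrier M" "b \<in> carrier M" using act_closed gh m by (auto simp: a_def b_def)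
    have gha: "act (inv[G] (g *[G] h)) (-[M] m) = -[M] b"
      using additive_map_minus[OF M.abelian_group_axioms M.abelian_group_axioms act_additive m] gh m
      by (simp add: inv_mult_group act_mult a_def b_def)
    have "(\<Oplus>\<^bsub>M\<^esub>i\<in>{..length x}. ?Q (face G i x) (face_coeff G M act i x m)) =
      ?Q [h] a +[M] (?Q [g *[G] h] (-[M] m) +[M] ?Q [g] m)"
      unfolding gh(3) a_def by (rule boundary_summand_2[OF gh(1,2) m M.abelian_group_axioms q])
    also have "?Q [h] a = ?P [] b +[M] ?P [] (-[M] a)" unfolding b_def by (rule qe[OF gh(2) ab(1)])
    also have "?Q [g *[G] h] (-[M] m) = ?P [] (-[M] b) +[M] ?P [] m"
      using qe[of "g *[G] h" "-[M] m"] gh m unfolding gha by simp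
    also have "?Q [g] m = ?P [] a +[M] ?P [] (-[M] m)" unfolding a_def by (rule qe[OF gh(1) m])
    also have "(?P [] b +[M] ?P [] (-[M] a)) +[M] ((?P [] (-[M] b) +[M] ?P [] m) +[M] (?P [] a +[M] ?P [] (-[M] m))) = 0[M]"
    proof (cases "[] = y")
      case True
      have "(b +[M] (-[M] a)) +[M] (((-[M] b) +[M] m) +[M] (a +[M] (-[M] m))) =
        (b +[M] (-[M] b)) +[M] ((a +[M] (-[M] a)) +[M] (m +[M] (-[M] m)))"
        using ab m by (simp add: M.a_ac)
      also have "\<dots> = 0[M]" using ab m by (simp add: M.r_neg)
      finally show ?thesis using True by simp
    qed simp
    finally show "(\<Oplus>\<^bsub>M\<^esub>i\<in>{..length x}. ?Q (face G i x) (face_coeff G M act i x m)) = 0[M]" .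
  qed
  also have "\<dots> = chain_eval M M ?P (%y. 0[M])" using MM.eval_zero_fun[OF zero_closed[of 0], of ?P] by (simp add: chain_eval_def)
  finally show "chain_eval M M ?P (bd (bd c)) = chain_eval M M ?P (%y. 0[M])" .
qed

lemma eval_chain_single:
  assumes "x \<in> tuples k G" "m \<in> carrier M" "abelian_group B" "!!x. x \<in> tuples k G ==> additive_map M B (\<Phi> x)"
  shows "chain_eval M B \<Phi> (chain_single M x m) = \<Phi> x m"
proof -
  interpret B: abelian_group B by fact
  interpret MB: two_modules M B ..
  show ?thesis by (rule MB.eval_single[OF assms(1,2,4)])
qed

lemma boundary_single_2:
  assumes g: "g \<in> carrier G" and h: "h \<in> carrier G" and m: "m \<in> carrier M"
  shows "bd (chain_single M [g, h] m) =
    chain_add M (chain_single M [h] (act (inv[G] g) m)) (chain_add M (chain_single M [g *[G] h] (-[M] m)) (chain_single M [g] m))"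
    (is "_ = ?R")
proof (rule ext)
  fix y :: "'a list"
  let ?P = "%x m. if x = y then m else 0[M]"
  have t: "[g, h] \<in> tuples (Suc (Suc 0)) G" using g h by (auto simp: tuples_2)
  have c: "chain_single M [g, h] m \<in> bar_chains (Suc (Suc 0)) G M" by (rule MM.chain_single_closed[OF t m])
  have "bd (chain_single M [g, h] m) y = chain_eval M M ?P (bd (chain_single M [g, h] m))"
    by (rule chain_coordinate[OF M.abelian_group_axioms boundary_closed[OF c]])
  also have "\<dots> = chain_eval M M (%x m. \<Oplus>\<^bsub>M\<^esub>i\<in>{..length x}. ?P (face G i x) (face_coeff G M act i x m)) (chain_single M [g, h] m)"
    by (rule eval_boundary[OF c M.abelian_group_axioms proj_additive])
  also have "\<dots> = (\<Oplus>\<^bsub>M\<^esub>i\<in>{..length [g, h]}. ?P (face G i [g, h]) (face_coeff G M act i [g, h] m))"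
    by (rule eval_chain_single[OF t m M.abelian_group_axioms boundary_summand_additive[OF _ M.abelian_group_axioms proj_additive]])
  also have "\<dots> = ?P [h] (act (inv[G] g) m) +[M] (?P [g *[G] h] (-[M] m) +[M] ?P [g] m)"
    by (rule boundary_summand_2[OF g h m M.abelian_group_axioms proj_additive])
  also have "\<dots> = ?R y" by (auto simp: chain_add_def chain_single_def)
  finally show "bd (chain_single M [g, h] m) y = ?R y" .
qed

lemma boundary_single_1:
  assumes g: "g \<in> carrier G" and m: "m \<in> carrier M"
  shows "bd (chain_single M [g] m) = chain_single M [] (act (inv[G] g) m +[M] (-[M] m))"
    (is "_ = ?R")
proof (rule ext)
  fix y :: "'a list"
  let ?P = "%x m. if x = y then m else 0[M]"
  have t: "[g] \<in> tuples (Suc 0) G" using g by (auto simp: tuples_1)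
  have c: "chain_single M [g] m \<in> bar_chains (Suc 0) G M" by (rule MM.chain_single_closed[OF t m])
  have "bd (chain_single M [g] m) y = chain_eval M M ?P (bd (chain_single M [g] m))"
    by (rule chain_coordinate[OF M.abelian_group_axioms boundary_closed[OF c]])
  also have "\<dots> = chain_eval M M (%x m. \<Oplus>\<^bsub>M\<^esub>i\<in>{..length x}. ?P (face G i x) (face_coeff G M act i x m)) (chain_single M [g] m)"
    by (rule eval_boundary[OF c M.abelian_group_axioms proj_additive])
  also have "\<dots> = (\<Oplus>\<^bsub>M\<^esub>i\<in>{..length [g]}. ?P (face G i [g]) (face_coeff G M act i [g] m))"
    by (rule eval_chain_single[OF t m M.abelian_group_axioms boundary_summand_additive[OF _ M.abelian_group_axioms proj_additive]])
  also have "\<dots> = ?P [] (act (inv[G] g) m) +[M] ?P [] (-[M] m)"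
    by (rule boundary_summand_1[OF g m M.abelian_group_axioms proj_additive])
  also have "\<dots> = ?R y" by (auto simp: chain_single_def)
  finally show "bd (chain_single M [g] m) y = ?R y" .
qed

section \<open>Cycles, boundaries and homology classes\<close>

lemma boundary_hom: "bd \<in> hom (chain_group (Suc k) G M) (chain_group k G M)"
  using boundary_closed boundary_add by (auto simp: hom_def chain_group_simps)

lemma boundary_group_hom: "group_hom (chain_group (Suc k) G M) (chain_group k G M) (bd)"
  using comm_group_chains boundary_hom by (simp add: group_hom_def group_hom_axioms_def comm_group_def)

lemma subgroup_boundaries: "subgroup (boundaries k G M act) (chain_group k G M)"
  unfolding boundaries_def using group_hom.img_is_subgroup[OF boundary_group_hom] .

lemma cycles_kernel: "cycles (Suc k) G M act = kernel (chain_group (Suc k) G M) (chain_group k G M) (bd)"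
  by (auto simp: cycles_def kernel_def chain_group_simps)

lemma subgroup_cycles: "subgroup (cycles (Suc k) G M act) (chain_group (Suc k) G M)"
  unfolding cycles_kernel using group_hom.subgroup_kernel[OF boundary_group_hom] .

lemma boundaries_cycles: "boundaries (Suc 0) G M act <= cycles (Suc 0) G M act"
  using boundary_boundary boundary_closed by (auto simp: boundaries_def cycles_def chain_group_simps)

abbreviation "cls1 == homology_class 1 G M act"
abbreviation "B1 == boundaries 1 G M act"
abbreviation "Z1 == cycles 1 G M act"

lemma B1_Z1: "B1 <= Z1" using boundaries_cycles by simp

lemma Z1_chains: "Z1 <= bar_chains 1 G M" by (auto simp: cycles_def chain_group_simps)

lemma B1_chains: "boundaries k G M act <= bar_chains k G M"
  using subgroup.subset[OF subgroup_boundaries] by (simp add: chain_group_simps)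

lemma B1_add: "b \<in> boundaries k G M act ==> b' \<in> boundaries k G M act ==> chain_add M b b' \<in> boundaries k G M act"
  using subgroup.m_closed[OF subgroup_boundaries] by (simp add: chain_group_simps)

lemma B1_zero: "(%x. 0[M]) \<in> boundaries k G M act"
  using subgroup.one_closed[OF subgroup_boundaries] by (simp add: chain_group_simps)

lemma B1_neg: "b \<in> boundaries k G M act ==> (%x. -[M] b x) \<in> boundaries k G M act"
  using subgroup.m_inv_closed[OF subgroup_boundaries] inv_chain B1_chains by (metis subsetD)

lemma class_def': "homology_class k G M act c = {chain_add M b c | b. b \<in> boundaries k G M act}"
  by (auto simp: homology_class_def r_coset_def chain_group_simps)

lemma class_self: "c \<in> bar_chains k G M ==> c \<in> homology_class k G M act c"
proof -
  assume c: "c \<in> bar_chains k G M"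
  have "c = chain_add M (%x. 0[M]) c" using c by (auto simp: chain_add_def chains_on_def)
  thus ?thesis unfolding class_def' using B1_zero by blast
qed

lemma class_eq_iff:
  assumes "c \<in> bar_chains k G M" "d \<in> bar_chains k G M"
  shows "homology_class k G M act c = homology_class k G M act d \<longleftrightarrow> (\<exists>b\<in>boundaries k G M act. c = chain_add M b d)"
proof -
  interpret C: comm_group "chain_group k G M" by (rule comm_group_chains)
  show ?thesis
  proof
    assume "homology_class k G M act c = homology_class k G M act d"
    hence "c \<in> homology_class k G M act d" using class_self[OF assms(1)] by simp
    thus "\<exists>b\<in>boundaries k G M act. c = chain_add M b d" unfolding class_def' by auto
  next
    assume "\<exists>b\<in>boundaries k G M act. c = chain_add M b d"
    hence "c \<in> boundaries k G M act #>[chain_group k G M] d" by (auto simp: r_coset_def chain_group_simps)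
    thus "homology_class k G M act c = homology_class k G M act d"
      unfolding homology_class_def
      using C.repr_independence[OF _ _ subgroup_boundaries, of c d] assms by (auto simp: chain_group_simps)
  qed
qed

lemma class_zero_iff:
  assumes "c \<in> bar_chains k G M"
  shows "homology_class k G M act c = boundaries k G M act \<longleftrightarrow> c \<in> boundaries k G M act"
proof -
  have z: "chain_add M b (%x. 0[M]) = b" if "b \<in> bar_chains k G M" for b using that by (auto simp: chain_add_def chains_on_def)
  hence zb: "chain_add M b (%x. 0[M]) = b" if "b \<in> boundaries k G M act" for b using that B1_chains by blast
  have "homology_class k G M act (%x. 0[M]) = {b | b. b \<in> boundaries k G M act}"
    unfolding class_def' by (rule Collect_cong) (use zb in metis)
  hence "homology_class k G M act (%x. 0[M]) = boundaries k G M act" by simp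
  thus ?thesis using class_eq_iff[OF assms zero_closed] zb by auto
qed

abbreviation "H1 == group_homology 1 G M act"

lemma Z1_comm_group: "comm_group ((chain_group 1 G M)\<lparr>carrier := Z1\<rparr>)"
proof -
  interpret C: comm_group "chain_group 1 G M" by (rule comm_group_chains)
  have "group ((chain_group 1 G M)\<lparr>carrier := Z1\<rparr>)" using C.subgroup_imp_group subgroup_cycles[of 0] by simp
  thus ?thesis
    by (rule group.group_comm_groupI) (use C.m_comm Z1_chains in \<open>auto simp: chain_group_simps\<close>)
qed

lemma B1_normal: "B1 \<lhd> (chain_group 1 G M)\<lparr>carrier := Z1\<rparr>"
proof -
  interpret C: comm_group "chain_group 1 G M" by (rule comm_group_chains)
  interpret Z: comm_group "(chain_group 1 G M)\<lparr>carrier := Z1\<rparr>" by (rule Z1_comm_group)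
  show ?thesis
    using Z.subgroup_imp_normal C.subgroup_incl[OF _ _ B1_Z1] subgroup_boundaries subgroup_cycles[of 0] by simp
qed

lemma H1_comm_group: "comm_group H1"
  unfolding group_homology_def
  using comm_group.abelian_FactGroup[OF Z1_comm_group normal_imp_subgroup[OF B1_normal]] .

lemma homology_carrier: "carrier (group_homology k G M act) = homology_class k G M act ` cycles k G M act"
  unfolding group_homology_def FactGroup_def RCOSETS_def homology_class_def r_coset_def by auto

lemma H1_carrier: "carrier H1 = cls1 ` Z1"
  unfolding group_homology_def FactGroup_def RCOSETS_def homology_class_def r_coset_def by auto

lemma H1_mult:
  assumes "c \<in> Z1" "d \<in> Z1" shows "cls1 c *[H1] cls1 d = cls1 (chain_add M c d)"
  using normal.rcos_sum[OF B1_normal, of c d] assms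
  unfolding group_homology_def FactGroup_def homology_class_def
  by (simp add: r_coset_def set_mult_def chain_group_simps)

lemma H1_one: "1[H1] = B1"
  unfolding group_homology_def FactGroup_def by simp

end

section \<open>Functoriality of the bar complex\<close>

lemma chain_map_push:
  assumes "abelian_group M" "abelian_group M'" "c \<in> chains_on M T" "additive_map M M' f"
  shows "chain_map M M' \<alpha> f c = chain_push M M' (%x. {0}) (%x i. map \<alpha> x) (%x i. f) c"
proof
  fix y
  interpret M: abelian_group M by fact
  interpret A: abelian_group M' by fact
  have c: "finite {x. c x ~= 0[M]}" "f (c x) \<in> carrier M'" for x
    using assms(3) additive_mapD(1)[OF assms(4)] unfolding chains_on_def by auto
  have i: "(\<Oplus>\<^bsub>M'\<^esub>i\<in>{0::nat}. if map \<alpha> x = y then f m else 0[M']) = (if map \<alpha> x = y then f m else 0[M'])"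
    if "f m \<in> carrier M'" for x m using that by simp
  have "chain_push M M' (%x. {0}) (%x i. map \<alpha> x) (%x i. f) c y =
    (\<Oplus>\<^bsub>M'\<^esub>x\<in>{x. c x ~= 0[M]}. if map \<alpha> x = y then f (c x) else 0[M'])"
    unfolding chain_push_def chain_eval_def
    by (rule A.finsum_cong'[OF HOL.refl]) (use i c in auto)
  also have "\<dots> = (\<Oplus>\<^bsub>M'\<^esub>x\<in>{x. c x ~= 0[M] & map \<alpha> x = y}. f (c x))"
    by (rule A.add.finprod_mono_neutral_cong_right) (use c in auto)
  finally show "chain_map M M' \<alpha> f c y = chain_push M M' (%x. {0}) (%x i. map \<alpha> x) (%x i. f) c y"
    unfolding chain_map_def by simp
qed

locale coeff_map = C: coeff G M act + D: coeff G' M' act'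
  for G :: "'a monoid" and M :: "'m ring" and act and G' :: "'b monoid" and M' :: "'n ring" and act' +
  fixes \<alpha> :: "'a => 'b" and f :: "'m => 'n"
  assumes hom: "\<alpha> \<in> hom G G'" and additive: "additive_map M M' f"
    and equivariant: "[|g \<in> carrier G; m \<in> carrier M|] ==> f (act g m) = act' (\<alpha> g) (f m)"
begin

sublocale MM': two_modules M M' ..
sublocale h: group_hom G G' \<alpha> by unfold_locales (rule hom)

abbreviation "cm == chain_map M M' \<alpha> f"

lemma map_tuples: "x \<in> tuples k G ==> map \<alpha> x \<in> tuples k G'"
  by (auto simp: tuples_def)

lemma cm_push: "c \<in> bar_chains k G M ==> cm c = chain_push M M' (%x. {0}) (%x i. map \<alpha> x) (%x i. f) c"
  using chain_map_push[OF C.M.abelian_group_axioms D.M.abelian_group_axioms _ additive] .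

lemma cm_closed: "c \<in> bar_chains k G M ==> cm c \<in> bar_chains k G' M'"
  unfolding cm_push by (rule MM'.push_closed[where T = "tuples k G"]) (use map_tuples additive in auto)

lemma cm_add:
  assumes "c \<in> bar_chains k G M" "d \<in> bar_chains k G M" shows "cm (chain_add M c d) = chain_add M' (cm c) (cm d)"
  unfolding cm_push[OF assms(1)] cm_push[OF assms(2)] cm_push[OF C.add_closed[OF assms]]
  by (rule MM'.push_add[where T = "tuples k G" and T' = "tuples k G'"]) (use map_tuples additive assms C.add_closed in auto)

lemma eval_cm:
  assumes c: "c \<in> bar_chains k G M" and B: "abelian_group B" and \<Psi>: "!!y. y \<in> tuples k G' ==> additive_map M' B (\<Psi> y)"
  shows "chain_eval M' B \<Psi> (cm c) = chain_eval M B (%x m. \<Psi> (map \<alpha> x) (f m)) c"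
proof -
  interpret B: abelian_group B by fact
  interpret MB: two_modules M B ..
  have a: "additive_map M B (%m. \<Psi> (map \<alpha> x) (f m))" if "x \<in> tuples k G" for x
    by (rule additive_map_comp[OF additive \<Psi>[OF map_tuples[OF that]]])
  have "chain_eval M' B \<Psi> (cm c) = chain_eval M B (%x m. \<Oplus>\<^bsub>B\<^esub>i\<in>{0::nat}. \<Psi> (map \<alpha> x) (f m)) c"
    unfolding cm_push[OF c]
    by (rule MM'.eval_push[where T = "tuples k G" and T' = "tuples k G'"]) (use map_tuples additive assms in auto)
  also have "\<dots> = chain_eval M B (%x m. \<Psi> (map \<alpha> x) (f m)) c"
    by (rule MB.eval_cong[OF c a]) (use additive_mapD(1)[OF a] in auto)
  finally show ?thesis .
qed

lemma map_face:
  assumes "x \<in> tuples (Suc k) G" "i \<le> Suc k" shows "face G' i (map \<alpha> x) = map \<alpha> (face G i x)"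
proof -
  have x: "length x = Suc k" "set x <= carrier G" using assms by (auto simp: tuples_def)
  consider "i = 0" | "i = Suc k" | "0 < i" "i \<le> k" using assms by linarith
  thus ?thesis
  proof cases
    case 3
    hence "x ! (i - 1) \<in> carrier G" "x ! i \<in> carrier G" using x by (auto simp: subset_iff)
    thus ?thesis using 3 x by (simp add: face_def take_map drop_map)
  qed (use x in \<open>auto simp: face_def map_tl map_butlast\<close>)
qed

lemma map_face_coeff:
  assumes "x \<in> tuples (Suc k) G" "m \<in> carrier M"
  shows "face_coeff G' M' act' i (map \<alpha> x) (f m) = f (face_coeff G M act i x m)"
proof -
  have x: "x ~= []" "hd x \<in> carrier G" using assms by (cases x; auto simp: tuples_def)+
  thus ?thesis using assms(2) equivariant[of "inv[G] hd x" m]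
    additive_map_minus[OF C.M.abelian_group_axioms D.M.abelian_group_axioms additive]
    by (simp add: face_coeff_def hd_map)
qed

lemma cm_boundary:
  assumes c: "c \<in> bar_chains (Suc k) G M"
  shows "cm (C.bd c) = D.bd (cm c)"
proof (rule D.chain_eqI[where k = k])
  show "cm (C.bd c) \<in> bar_chains k G' M'" using cm_closed C.boundary_closed c by blast
  show "D.bd (cm c) \<in> bar_chains k G' M'" using cm_closed D.boundary_closed c by blast
  fix y :: "'b list"
  let ?P = "%x m. if x = y then m else 0[M']"
  have p: "additive_map M M' (%m. ?P (map \<alpha> x) (f m))" for x
    by (rule additive_map_comp[OF additive D.proj_additive])
  have q: "additive_map M' M' (%m. \<Oplus>\<^bsub>M'\<^esub>i\<in>{..length x}. ?P (face G' i x) (face_coeff G' M' act' i x m))"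
    if "x \<in> tuples (Suc k) G'" for x
    by (rule D.boundary_summand_additive[OF that D.M.abelian_group_axioms D.proj_additive])
  have "chain_eval M' M' ?P (cm (C.bd c)) = chain_eval M M' (%x m. ?P (map \<alpha> x) (f m)) (C.bd c)"
    by (rule eval_cm[OF C.boundary_closed[OF c] D.M.abelian_group_axioms D.proj_additive])
  also have "\<dots> = chain_eval M M' (%x m. \<Oplus>\<^bsub>M'\<^esub>i\<in>{..length x}. ?P (map \<alpha> (face G i x)) (f (face_coeff G M act i x m))) c"
    by (rule C.eval_boundary[OF c D.M.abelian_group_axioms p])
  also have "\<dots> = chain_eval M M' (%x m. \<Oplus>\<^bsub>M'\<^esub>i\<in>{..length (map \<alpha> x)}. ?P (face G' i (map \<alpha> x)) (face_coeff G' M' act' i (map \<alpha> x) (f m))) c"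
  proof (rule MM'.eval_cong[OF c])
    fix x assume x: "x \<in> tuples (Suc k) G"
    show "additive_map M M' (%m. \<Oplus>\<^bsub>M'\<^esub>i\<in>{..length (map \<alpha> x)}. ?P (face G' i (map \<alpha> x)) (face_coeff G' M' act' i (map \<alpha> x) (f m)))"
      by (rule additive_map_comp[OF additive q[OF map_tuples[OF x]]])
    fix m assume m: "m \<in> carrier M"
    have l: "length x = Suc k" using x by (simp add: tuples_def)
    have cl: "f (face_coeff G M act i x m) \<in> carrier M'" for i
      using additive_mapD(1)[OF additive additive_mapD(1)[OF C.face_coeff_additive[OF x] m]] .
    show "(\<Oplus>\<^bsub>M'\<^esub>i\<in>{..length x}. ?P (map \<alpha> (face G i x)) (f (face_coeff G M act i x m))) =
      (\<Oplus>\<^bsub>M'\<^esub>i\<in>{..length (map \<alpha> x)}. ?P (face G' i (map \<alpha> x)) (face_coeff G' M' act' i (map \<alpha> x) (f m)))"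
      by (rule D.M.finsum_cong') (use map_face[OF x] map_face_coeff[OF x m] l cl in auto)
  qed
  also have "\<dots> = chain_eval M' M' (%x m. \<Oplus>\<^bsub>M'\<^esub>i\<in>{..length x}. ?P (face G' i x) (face_coeff G' M' act' i x m)) (cm c)"
    by (rule eval_cm[OF c D.M.abelian_group_axioms q, symmetric])
  also have "\<dots> = chain_eval M' M' ?P (D.bd (cm c))"
    by (rule D.eval_boundary[OF cm_closed[OF c] D.M.abelian_group_axioms D.proj_additive, symmetric])
  finally show "chain_eval M' M' ?P (cm (C.bd c)) = chain_eval M' M' ?P (D.bd (cm c))" .
qed

lemma cm_zero: "cm (%x. 0[M]) = (%x. 0[M'])"
  by (simp add: chain_map_def)

lemma cm_boundaries: "b \<in> boundaries k G M act ==> cm b \<in> boundaries k G' M' act'"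
  using cm_boundary cm_closed by (auto simp: boundaries_def chain_group_simps)

lemma cm_cycles: "c \<in> cycles (Suc k) G M act ==> cm c \<in> cycles (Suc k) G' M' act'"
  using cm_boundary[of c k] cm_closed cm_zero by (auto simp: cycles_def chain_group_simps)

text \<open>\<open>homology_map\<close> takes a union over all members of a class. They differ by
  boundaries, which are mapped to boundaries, so the union is the class of any one image.\<close>

lemma homology_map_class:
  assumes c: "c \<in> bar_chains k G M"
  shows "homology_map k M G' M' act' \<alpha> f (homology_class k G M act c) = homology_class k G' M' act' (cm c)"
proof -
  have "homology_class k G' M' act' (cm d) = homology_class k G' M' act' (cm c)" if d: "d \<in> homology_class k G M act c" for d
  proof -
    obtain b where b: "b \<in> boundaries k G M act" "d = chain_add M b c" using d unfolding C.class_def' by blast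
    have "b \<in> bar_chains k G M" using b C.B1_chains by blast
    thus ?thesis using b c cm_add cm_boundaries cm_closed C.add_closed D.add_closed
      by (subst D.class_eq_iff) auto
  qed
  thus ?thesis unfolding homology_map_def using C.class_self[OF c] by blast
qed

lemma cm_single:
  assumes "m \<in> carrier M" shows "cm (chain_single M x m) = chain_single M' (map \<alpha> x) (f m)"
proof
  fix y
  have fm: "f m \<in> carrier M'" using additive_mapD(1)[OF additive assms] .
  have f0: "f 0[M] = 0[M']" using additive_map_zero[OF C.M.abelian_group_axioms D.M.abelian_group_axioms additive] .
  show "cm (chain_single M x m) y = chain_single M' (map \<alpha> x) (f m) y"
  proof (cases "m ~= 0[M] & map \<alpha> x = y")
    case True
    hence "{z. chain_single M x m z ~= 0[M] & map \<alpha> z = y} = {x}" by (auto simp: chain_single_def)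
    thus ?thesis using True fm by (simp add: chain_map_def chain_single_def)
  next
    case False
    hence "{z. chain_single M x m z ~= 0[M] & map \<alpha> z = y} = {}" by (auto simp: chain_single_def)
    thus ?thesis using False f0 by (auto simp: chain_map_def chain_single_def)
  qed
qed

end

section \<open>Rational chains and cocycles\<close>

text \<open>A bridge between ring records and ring types: finite sums in this record are ordinary
  sums, and a field of characteristic zero can serve as a target for chains.\<close>

definition type_ring :: "'k::comm_ring_1 ring" where
  "type_ring = \<lparr>carrier = UNIV, monoid.mult = (*), one = 1, ring.zero = 0, add = (+)\<rparr>"

lemma type_ring_simps [simp]:
  "carrier type_ring = UNIV" "a *[type_ring] b = a * b" "1[type_ring] = 1" "0[type_ring] = 0"
  "a +[type_ring] b = a + b"
  by (simp_all add: type_ring_def)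

lemma rat_ring_type_ring: "rat_ring = type_ring"
  by (simp add: rat_ring_def type_ring_def)

lemma abelian_group_type_ring: "abelian_group (type_ring :: 'k::comm_ring_1 ring)"
  by (rule abelian_groupI) (auto simp: add_ac intro: exI[of _ "- x" for x])

lemma a_inv_type_ring [simp]: "-[type_ring] a = - (a :: 'k::comm_ring_1)"
proof -
  interpret abelian_group "type_ring :: 'k ring" by (rule abelian_group_type_ring)
  show ?thesis by (rule minus_equality) auto
qed

lemma finsum_type_ring: "finite S ==> (\<Oplus>\<^bsub>type_ring\<^esub>x\<in>S. f x) = (\<Sum>x\<in>S. f x :: 'k::comm_ring_1)"
proof (induction S rule: finite_induct)
  case (insert x S)
  interpret abelian_group "type_ring :: 'k ring" by (rule abelian_group_type_ring)
  show ?case using insert by (subst finsum_insert) auto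
next
  case empty
  interpret abelian_group "type_ring :: 'k ring" by (rule abelian_group_type_ring)
  show ?case by simp
qed

abbreviation "rat_chains k G == bar_chains k G rat_ring"
abbreviation "rat_bd G == boundary G rat_ring (%g q. q)"
abbreviation "rat_boundaries k G == boundaries k G rat_ring (%g q. q)"
abbreviation "rat_cycles k G == cycles k G rat_ring (%g q. q)"
abbreviation "rat_map \<alpha> == chain_map rat_ring rat_ring \<alpha> (%q. q)"
abbreviation "rat_add == chain_add rat_ring"
abbreviation "rat_single == chain_single rat_ring"

lemma rat_coeff: "group G ==> coeff G rat_ring (%g q. q)"
  unfolding coeff_def coeff_axioms_def
  using abelian_group_type_ring[where 'k = rat] additive_map_id by (auto simp: rat_ring_type_ring)

lemma rat_coeff_map:
  "group \<pi> ==> group G ==> \<alpha> \<in> hom \<pi> G ==>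
    coeff_map \<pi> rat_ring (%g q. q) G rat_ring (%g q. q) \<alpha> (%q. q)"
  unfolding coeff_map_def coeff_map_axioms_def by (intro conjI rat_coeff additive_map_id) auto

text \<open>A function on bar generators is a cochain with values in a field over the rationals;
  this is its value on a rational chain. Under this pairing \<open>coboundary\<close> is adjoint to
  the boundary for trivial coefficients.\<close>

definition pairing :: "('x => 'k::field_char_0) => ('x => rat) => 'k" where
  "pairing f c = chain_eval rat_ring type_ring (%x q. of_rat q * f x) c"

lemma pairing_additive: "additive_map rat_ring (type_ring :: 'k::field_char_0 ring) (%q. of_rat q * a)"
  by (auto simp: additive_map_def rat_ring_type_ring of_rat_add algebra_simps)

lemma two_modules_rat: "two_modules rat_ring (type_ring :: 'k::field_char_0 ring)"
  unfolding two_modules_def rat_ring_type_ring by (intro conjI abelian_group_type_ring)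

lemma pairing_cong:
  assumes "c \<in> rat_chains k G" "!!x. x \<in> tuples k G ==> f x = (g x :: 'k::field_char_0)" shows "pairing f c = pairing g c"
  unfolding pairing_def
  by (rule two_modules.eval_cong[OF two_modules_rat assms(1) pairing_additive]) (use assms in auto)

lemma pairing_zero:
  assumes "c \<in> rat_chains k G" "!!x. x \<in> tuples k G ==> f x = (0 :: 'k::field_char_0)" shows "pairing f c = 0"
  using two_modules.eval_zero_fun[OF two_modules_rat assms(1), where \<Phi> = "%x q. of_rat q * f x"] assms(2)
  by (auto simp: pairing_def)

lemma pairing_uminus: "pairing (%x. - f x) c = - (pairing f c :: 'k::field_char_0)"
proof -
  have "(\<Oplus>\<^bsub>type_ring\<^esub>x\<in>S. of_rat (c x) * - f x) = - (\<Oplus>\<^bsub>type_ring\<^esub>x\<in>S. of_rat (c x) * f x :: 'k)" if "finite S" for S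
    using that by (simp add: finsum_type_ring sum_negf)
  moreover have "(\<Oplus>\<^bsub>type_ring\<^esub>x\<in>S. of_rat (c x) * - f x) = - (\<Oplus>\<^bsub>type_ring\<^esub>x\<in>S. of_rat (c x) * f x :: 'k)" if "infinite S" for S
  proof -
    interpret abelian_group "type_ring :: 'k ring" by (rule abelian_group_type_ring)
    show ?thesis using that by (simp add: finsum_infinite)
  qed
  ultimately show ?thesis unfolding pairing_def chain_eval_def by blast
qed

lemma pairing_single:
  assumes "group G" "x \<in> tuples k G" shows "pairing f (rat_single x q) = of_rat q * (f x :: 'k::field_char_0)"
  unfolding pairing_def
  by (rule coeff.eval_chain_single[OF rat_coeff[OF assms(1)] assms(2) _ abelian_group_type_ring pairing_additive])
    (simp add: rat_ring_type_ring)

lemma pairing_add: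
  assumes "group G" "c \<in> rat_chains k G" "d \<in> rat_chains k G"
  shows "pairing f (rat_add c d) = pairing f c + (pairing f d :: 'k::field_char_0)"
  using two_modules.eval_add[OF two_modules_rat assms(2,3) pairing_additive coeff.add_closed[OF rat_coeff[OF assms(1)] assms(2,3)]]
  by (simp add: pairing_def)

definition coboundary :: "'a monoid => ('a list => 'k::field_char_0) => 'a list => 'k" where
  "coboundary G f x = (\<Sum>i\<le>length x. (-1) ^ i * f (face G i x))"

lemma coboundary_1: "coboundary G f [g, h] = f [h] - f [g *[G] h] + f [g]"
  by (simp add: coboundary_def face_def numeral_2_eq_2)

lemma coboundary_2: "coboundary G f [g, h, l] = f [h, l] - f [g *[G] h, l] + f [g, h *[G] l] - f [g, h]"
  by (simp add: coboundary_def face_def numeral_2_eq_2 numeral_3_eq_3)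

lemma pairing_boundary:
  assumes "group G" "c \<in> rat_chains (Suc k) G"
  shows "pairing f (rat_bd G c) = pairing (coboundary G f) c"
proof -
  interpret coeff G rat_ring "%g q. q" by (rule rat_coeff[OF assms(1)])
  have "pairing f (rat_bd G c) = chain_eval rat_ring type_ring (%x m. \<Oplus>\<^bsub>type_ring\<^esub>i\<in>{..length x}.
      of_rat (face_coeff G rat_ring (%g q. q) i x m) * f (face G i x)) c"
    unfolding pairing_def by (rule eval_boundary[OF assms(2) abelian_group_type_ring pairing_additive])
  also have "\<dots> = pairing (coboundary G f) c"
    unfolding pairing_def
  proof (rule two_modules.eval_cong[OF two_modules_rat assms(2) pairing_additive])
    fix x and q :: rat
    have "of_rat (face_coeff G rat_ring (%g q. q) i x q) = (of_rat q * (-1) ^ i :: 'b)" for i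
      by (simp add: face_coeff_def rat_ring_type_ring of_rat_minus)
    thus "(\<Oplus>\<^bsub>type_ring\<^esub>i\<in>{..length x}. of_rat (face_coeff G rat_ring (%g q. q) i x q) * f (face G i x)) =
      of_rat q * coboundary G f x"
      by (simp add: finsum_type_ring coboundary_def sum_distrib_left mult.assoc)
  qed
  finally show ?thesis .
qed

lemma pairing_map:
  fixes \<pi> :: "'a monoid" and G :: "'b monoid"
  assumes "group \<pi>" "group G" "\<alpha> \<in> hom \<pi> G" "c \<in> rat_chains k \<pi>"
  shows "pairing f (rat_map \<alpha> c) = pairing (%x. f (map \<alpha> x)) c"
  unfolding pairing_def
  by (rule coeff_map.eval_cm[OF rat_coeff_map[OF assms(1-3)] assms(4) abelian_group_type_ring pairing_additive])

text \<open>Under the trivial action the two faces of \<open>[g]\<close> carry opposite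
  coefficients.\<close>

lemma rat_cycles_1: "group G ==> rat_cycles (Suc 0) G = rat_chains (Suc 0) G"
proof -
  assume G: "group G"
  interpret coeff G rat_ring "%g q. q" by (rule rat_coeff[OF G])
  have "rat_bd G c = (%y. 0)" if c: "c \<in> rat_chains (Suc 0) G" for c
  proof
    fix y
    have "rat_bd G c y = chain_eval rat_ring rat_ring (%x m. if x = y then m else 0[rat_ring]) (rat_bd G c)"
      by (rule chain_coordinate[OF M.abelian_group_axioms boundary_closed[OF c]])
    also have "\<dots> = chain_eval rat_ring rat_ring (%x m. \<Oplus>\<^bsub>rat_ring\<^esub>i\<in>{..length x}.
      (if face G i x = y then face_coeff G rat_ring (%g q. q) i x m else 0[rat_ring])) c"
      by (rule eval_boundary[OF c M.abelian_group_axioms proj_additive])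
    also have "\<dots> = 0[rat_ring]"
    proof (rule MM.eval_zero_fun[OF c])
      fix x and m :: rat assume "x \<in> tuples (Suc 0) G" "m \<in> carrier rat_ring"
      then obtain g where g: "g \<in> carrier G" "x = [g]" by (auto simp: tuples_1)
      show "(\<Oplus>\<^bsub>rat_ring\<^esub>i\<in>{..length x}. (if face G i x = y then face_coeff G rat_ring (%g q. q) i x m else 0[rat_ring])) = 0[rat_ring]"
        unfolding g(2)
        by (subst boundary_summand_1[OF g(1) \<open>m \<in> carrier rat_ring\<close> M.abelian_group_axioms proj_additive])
          (auto simp: rat_ring_type_ring)
    qed
    finally show "rat_bd G c y = 0" by (simp add: rat_ring_type_ring)
  qed
  thus ?thesis by (auto simp: cycles_def chain_group_simps rat_ring_type_ring)
qed

text \<open>Rational 2-connectedness in terms of chains: surjectivity and injectivity in degree one,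
  surjectivity in degree two. It makes sense for groups in different types and imposes no
  finiteness, so that isomorphisms of arbitrary groups qualify.\<close>

definition two_connected :: "'a monoid => 'b monoid => ('a => 'b) => bool" where
  "two_connected \<pi> G \<alpha> \<longleftrightarrow> group \<pi> & group G & \<alpha> \<in> hom \<pi> G &
     (\<forall>c\<in>rat_chains 1 G. \<exists>a\<in>rat_chains 1 \<pi>. \<exists>b\<in>rat_chains 2 G. c = rat_add (rat_bd G b) (rat_map \<alpha> a)) &
     (\<forall>a\<in>rat_chains 1 \<pi>. rat_map \<alpha> a \<in> rat_boundaries 1 G --> a \<in> rat_boundaries 1 \<pi>) &
     (\<forall>z\<in>rat_cycles 2 G. \<exists>z'\<in>rat_cycles 2 \<pi>. \<exists>b\<in>rat_chains 3 G. z = rat_add (rat_bd G b) (rat_map \<alpha> z'))"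

lemma (in coeff) boundary_zero: "boundary G M act (%x. 0[M]) = (%x. 0[M])"
  by (simp add: boundary_def)

lemma in_boundaries: "b \<in> boundaries k G M act \<longleftrightarrow> (\<exists>c\<in>bar_chains (Suc k) G M. b = boundary G M act c)"
  by (auto simp: boundaries_def chain_group_simps)

lemma rationally_2_connected_two_connected:
  assumes "rationally_2_connected \<pi> G \<alpha>" shows "two_connected \<pi> G \<alpha>"
proof -
  have *: "group \<pi>" "group G" "\<alpha> \<in> hom \<pi> G" using assms by (auto simp: rationally_2_connected_def homs_def)
  interpret coeff_map \<pi> rat_ring "%g q. q" G rat_ring "%g q. q" \<alpha> "%q. q"
    by (rule rat_coeff_map[OF *])
  have bij: "bij_betw (rational_homology_map 1 G \<alpha>) (carrier (rational_homology 1 \<pi>)) (carrier (rational_homology 1 G))"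
    and sur: "rational_homology_map 2 G \<alpha> ` carrier (rational_homology 2 \<pi>) = carrier (rational_homology 2 G)"
    using assms by (auto simp: rationally_2_connected_def iso_def)
  have Z: "rat_cycles 1 \<pi> = rat_chains 1 \<pi>" "rat_cycles 1 G = rat_chains 1 G" using rat_cycles_1 * by auto
  have surj: "\<exists>a\<in>rat_chains 1 \<pi>. \<exists>b\<in>rat_chains 2 G. c = rat_add (rat_bd G b) (rat_map \<alpha> a)" if c: "c \<in> rat_chains 1 G" for c
  proof -
    have "D.cls1 c \<in> carrier (rational_homology 1 G)" unfolding D.homology_carrier Z using c by (rule imageI)
    then obtain A where A: "A \<in> carrier (rational_homology 1 \<pi>)" "D.cls1 c = rational_homology_map 1 G \<alpha> A"
      unfolding bij_betw_imp_surj_on[OF bij, symmetric] by blast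
    obtain a where a: "a \<in> rat_chains 1 \<pi>" "A = C.cls1 a" using A(1) unfolding C.homology_carrier Z by blast
    have "D.cls1 c = D.cls1 (rat_map \<alpha> a)" using A(2) unfolding a(2) homology_map_class[OF a(1)] .
    then obtain b where "b \<in> rat_boundaries 1 G" "c = rat_add b (rat_map \<alpha> a)"
      using D.class_eq_iff[OF c cm_closed[OF a(1)]] by auto
    thus ?thesis using a(1) unfolding in_boundaries by (auto simp: numeral_2_eq_2)
  qed
  have inj: "a \<in> rat_boundaries 1 \<pi>" if a: "a \<in> rat_chains 1 \<pi>" and b: "rat_map \<alpha> a \<in> rat_boundaries 1 G" for a
  proof -
    have "rational_homology_map 1 G \<alpha> (C.cls1 a) = rat_boundaries 1 G"
      unfolding homology_map_class[OF a] using D.class_zero_iff[OF cm_closed[OF a]] b by blast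
    moreover have "rational_homology_map 1 G \<alpha> (C.cls1 (%x. 0[rat_ring])) = rat_boundaries 1 G"
      unfolding homology_map_class[OF C.zero_closed] cm_zero using D.class_zero_iff[OF D.zero_closed] D.B1_zero by blast
    moreover have "C.cls1 a \<in> carrier (rational_homology 1 \<pi>)" "C.cls1 (%x. 0[rat_ring]) \<in> carrier (rational_homology 1 \<pi>)"
      unfolding C.homology_carrier Z using a C.zero_closed by blast+
    ultimately have "C.cls1 a = C.cls1 (%x. 0[rat_ring])"
      using inj_onD[OF bij_betw_imp_inj_on[OF bij], of "C.cls1 a" "C.cls1 (%x. 0[rat_ring])"] by metis
    also have "\<dots> = rat_boundaries 1 \<pi>" using C.class_zero_iff[OF C.zero_closed] C.B1_zero by blast
    finally show ?thesis using C.class_zero_iff[OF a] by blast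
  qed
  have surj2: "\<exists>z'\<in>rat_cycles 2 \<pi>. \<exists>b\<in>rat_chains 3 G. z = rat_add (rat_bd G b) (rat_map \<alpha> z')" if z: "z \<in> rat_cycles 2 G" for z
  proof -
    have zc: "z \<in> rat_chains 2 G" using z by (auto simp: cycles_def chain_group_simps)
    have "homology_class 2 G rat_ring (%g q. q) z \<in> carrier (rational_homology 2 G)" unfolding D.homology_carrier using z by (rule imageI)
    then obtain A where A: "A \<in> carrier (rational_homology 2 \<pi>)" "homology_class 2 G rat_ring (%g q. q) z = rational_homology_map 2 G \<alpha> A"
      unfolding sur[symmetric] by blast
    obtain a where a: "a \<in> rat_cycles 2 \<pi>" "A = homology_class 2 \<pi> rat_ring (%g q. q) a" using A(1) unfolding C.homology_carrier by blast
    have ac: "a \<in> rat_chains 2 \<pi>" using a by (auto simp: cycles_def chain_group_simps)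
    have "homology_class 2 G rat_ring (%g q. q) z = homology_class 2 G rat_ring (%g q. q) (rat_map \<alpha> a)"
      using A(2) unfolding a(2) homology_map_class[OF ac] .
    then obtain b where "b \<in> rat_boundaries 2 G" "z = rat_add b (rat_map \<alpha> a)"
      using D.class_eq_iff[OF zc cm_closed[OF ac]] by auto
    thus ?thesis using a(1) unfolding in_boundaries by (auto simp: numeral_3_eq_3 numeral_2_eq_2)
  qed
  show ?thesis unfolding two_connected_def using * surj inj surj2 by blast
qed

lemma rat_map_inverse:
  fixes \<pi> :: "'a monoid" and G :: "'b monoid"
  assumes "group \<pi>" "group G" "\<alpha> \<in> hom \<pi> G" "\<beta> \<in> hom G \<pi>" "!!x. x \<in> carrier \<pi> ==> \<beta> (\<alpha> x) = x" "c \<in> rat_chains k \<pi>"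
  shows "rat_map \<beta> (rat_map \<alpha> c) = c"
proof -
  interpret A: coeff_map \<pi> rat_ring "%g q. q" G rat_ring "%g q. q" \<alpha> "%q. q"
    by (rule rat_coeff_map) fact+
  interpret B: coeff_map G rat_ring "%g q. q" \<pi> rat_ring "%g q. q" \<beta> "%q. q"
    by (rule rat_coeff_map) fact+
  show ?thesis
  proof (rule A.C.chain_eqI[where k = k])
    show "rat_map \<beta> (rat_map \<alpha> c) \<in> rat_chains k \<pi>" using A.cm_closed B.cm_closed assms(6) by blast
    fix y :: "'a list"
    let ?P = "%x m. if x = y then m else 0[rat_ring]"
    have "chain_eval rat_ring rat_ring ?P (rat_map \<beta> (rat_map \<alpha> c)) =
      chain_eval rat_ring rat_ring (%x m. ?P (map \<beta> x) m) (rat_map \<alpha> c)"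
      by (rule B.eval_cm[OF A.cm_closed[OF assms(6)] A.C.M.abelian_group_axioms A.C.proj_additive])
    also have "\<dots> = chain_eval rat_ring rat_ring (%x m. ?P (map \<beta> (map \<alpha> x)) m) c"
      by (rule A.eval_cm[OF assms(6) A.C.M.abelian_group_axioms A.C.proj_additive])
    also have "\<dots> = chain_eval rat_ring rat_ring ?P c"
    proof (rule A.C.MM.eval_cong[OF assms(6) A.C.proj_additive])
      fix x :: "'a list" and m :: rat assume "x \<in> tuples k \<pi>"
      hence "map \<beta> (map \<alpha> x) = x" using assms(5) by (auto simp: tuples_def intro!: map_idI)
      thus "?P (map \<beta> (map \<alpha> x)) m = ?P x m" by simp
    qed
    finally show "chain_eval rat_ring rat_ring ?P (rat_map \<beta> (rat_map \<alpha> c)) = chain_eval rat_ring rat_ring ?P c" .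
  qed fact
qed

text \<open>An I-functor has to be defined on isomorphisms between arbitrary groups, which need not
  belong to \<open>Omega_Q\<close>; through this lemma they are treated by the same
  arguments.\<close>

lemma iso_two_connected:
  fixes \<pi> :: "'a monoid" and G :: "'b monoid"
  assumes "group \<pi>" "group G" "\<alpha> \<in> iso \<pi> G" shows "two_connected \<pi> G \<alpha>"
proof -
  interpret group \<pi> by fact
  define \<beta> where "\<beta> = inv_into (carrier \<pi>) \<alpha>"
  have \<alpha>: "\<alpha> \<in> hom \<pi> G" and bij: "bij_betw \<alpha> (carrier \<pi>) (carrier G)" using assms by (auto simp: iso_def)
  have \<beta>: "\<beta> \<in> hom G \<pi>" unfolding \<beta>_def using iso_set_sym[OF assms(3)] by (simp add: iso_def)
  have inv: "!!x. x \<in> carrier \<pi> ==> \<beta> (\<alpha> x) = x" "!!x. x \<in> carrier G ==> \<alpha> (\<beta> x) = x"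
    unfolding \<beta>_def using bij by (simp_all add: bij_betw_inv_into_left bij_betw_inv_into_right)
  interpret A: coeff_map \<pi> rat_ring "%g q. q" G rat_ring "%g q. q" \<alpha> "%q. q"
    by (rule rat_coeff_map) fact+
  interpret B: coeff_map G rat_ring "%g q. q" \<pi> rat_ring "%g q. q" \<beta> "%q. q"
    by (rule rat_coeff_map) fact+
  have AB: "rat_map \<alpha> (rat_map \<beta> c) = c" if "c \<in> rat_chains k G" for c k
    by (rule rat_map_inverse[OF assms(2,1) \<beta> \<alpha> inv(2) that])
  have BA: "rat_map \<beta> (rat_map \<alpha> c) = c" if "c \<in> rat_chains k \<pi>" for c k
    by (rule rat_map_inverse[OF assms(1,2) \<alpha> \<beta> inv(1) that])
  have zc: "rat_add (rat_bd G (%x. 0[rat_ring])) c = c" for c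
    unfolding A.D.boundary_zero by (simp add: chain_add_def rat_ring_type_ring)
  have Z2: "rat_cycles 2 H = rat_cycles (Suc 1) H" for H by (simp add: numeral_2_eq_2)
  show ?thesis unfolding two_connected_def
  proof (intro conjI ballI impI)
    fix c assume c: "c \<in> rat_chains 1 G"
    show "\<exists>a\<in>rat_chains 1 \<pi>. \<exists>b\<in>rat_chains 2 G. c = rat_add (rat_bd G b) (rat_map \<alpha> a)"
      by (rule bexI[OF bexI[OF _ A.D.zero_closed] B.cm_closed[OF c]]) (simp only: AB[OF c] zc)
  next
    fix a assume a: "a \<in> rat_chains 1 \<pi>" "rat_map \<alpha> a \<in> rat_boundaries 1 G"
    thus "a \<in> rat_boundaries 1 \<pi>" using B.cm_boundaries[OF a(2)] BA[OF a(1)] by simp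
  next
    fix z assume z: "z \<in> rat_cycles 2 G"
    hence zc2: "z \<in> rat_chains 2 G" by (auto simp: cycles_def chain_group_simps)
    have bz: "rat_map \<beta> z \<in> rat_cycles 2 \<pi>" using z unfolding Z2 by (rule B.cm_cycles)
    show "\<exists>z'\<in>rat_cycles 2 \<pi>. \<exists>b\<in>rat_chains 3 G. z = rat_add (rat_bd G b) (rat_map \<alpha> z')"
      by (rule bexI[OF bexI[OF _ A.D.zero_closed] bz]) (simp only: AB[OF zc2] zc)
  qed fact+
qed

section \<open>Additive functions and cochains along two-connected homomorphisms\<close>

definition additive_on :: "'a monoid => ('a => 'k::field_char_0) => bool" where
  "additive_on G \<mu> \<longleftrightarrow> (\<forall>g\<in>carrier G. \<forall>h\<in>carrier G. \<mu> (g *[G] h) = \<mu> g + \<mu> h)"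

abbreviation "pairing1 \<mu> == pairing (%x. \<mu> (x ! 0))"

lemma pairing1_boundary:
  assumes "group G" "additive_on G \<mu>" "b \<in> rat_chains 2 G" shows "pairing1 \<mu> (rat_bd G b) = (0 :: 'k::field_char_0)"
proof -
  have b: "b \<in> rat_chains (Suc (Suc 0)) G" using assms(3) by (simp add: numeral_2_eq_2)
  show ?thesis unfolding pairing_boundary[OF assms(1) b]
  proof (rule pairing_zero[OF b])
    fix x assume "x \<in> tuples (Suc (Suc 0)) G"
    then obtain g h where "g \<in> carrier G" "h \<in> carrier G" "x = [g, h]" by (auto simp: tuples_2)
    thus "coboundary G (%x. \<mu> (x ! 0)) x = 0" using assms(2) by (auto simp: coboundary_1 additive_on_def)
  qed
qed

lemma two_connectedD1:
  assumes "two_connected \<pi> G \<alpha>" "c \<in> rat_chains 1 G"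
  obtains a b where "a \<in> rat_chains 1 \<pi>" "b \<in> rat_chains 2 G" "c = rat_add (rat_bd G b) (rat_map \<alpha> a)"
  using assms unfolding two_connected_def by blast

lemma rat_single_closed: "g \<in> carrier G ==> rat_single [g] q \<in> rat_chains 1 G"
  using two_modules.chain_single_closed[OF two_modules_rat, of "[g]" "tuples 1 G" q] by (simp add: tuples_1 rat_ring_type_ring)

text \<open>An additive function vanishes on boundaries, and surjectivity on first homology writes
  \<open>[g]\<close> as a boundary plus the image of a chain of \<open>\<pi>\<close>.\<close>

lemma two_connected_additive_unique:
  assumes "two_connected \<pi> G \<alpha>" "additive_on G \<mu>" "!!x. x \<in> carrier \<pi> ==> \<mu> (\<alpha> x) = 0" "g \<in> carrier G"
  shows "\<mu> g = (0 :: 'k::field_char_0)"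
proof -
  have *: "group \<pi>" "group G" "\<alpha> \<in> hom \<pi> G" using assms(1) by (auto simp: two_connected_def)
  interpret A: coeff_map \<pi> rat_ring "%g q. q" G rat_ring "%g q. q" \<alpha> "%q. q"
    by (rule rat_coeff_map) fact+
  obtain a b where ab: "a \<in> rat_chains 1 \<pi>" "b \<in> rat_chains 2 G" "rat_single [g] 1 = rat_add (rat_bd G b) (rat_map \<alpha> a)"
    by (rule two_connectedD1[OF assms(1) rat_single_closed[OF assms(4)]])
  have bc: "rat_bd G b \<in> rat_chains 1 G" using A.D.boundary_closed[of b 1] ab(2) by (simp add: numeral_2_eq_2)
  have "\<mu> g = pairing1 \<mu> (rat_single [g] 1)" using pairing_single[OF *(2), where x = "[g]" and k = 1 and q = 1 and f = "%x. \<mu> (x ! 0)"] assms(4) by (simp add: tuples_1)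
  also have "\<dots> = pairing1 \<mu> (rat_bd G b) + pairing1 \<mu> (rat_map \<alpha> a)"
    unfolding ab(3) by (rule pairing_add[OF *(2) bc A.cm_closed[OF ab(1)]])
  also have "pairing1 \<mu> (rat_bd G b) = 0" by (rule pairing1_boundary[OF *(2) assms(2) ab(2)])
  also have "pairing1 \<mu> (rat_map \<alpha> a) = 0" unfolding pairing_map[OF * ab(1)]
    by (rule pairing_zero[OF ab(1)]) (use assms(3) in \<open>auto simp: tuples_1\<close>)
  finally show ?thesis by simp
qed

text \<open>The vanishing of \<open>H\<^sub>i(G, \<pi>; \<rat>)\<close> for \<open>i \<le> 2\<close>: every 1-chain of \<open>G\<close> is \<open>\<partial>b + \<alpha>a\<close>, and \<open>\<nu>(a) - f(b)\<close>
  does not depend on the choice of \<open>a\<close> and \<open>b\<close>.\<close>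

lemma two_connected_lift:
  fixes f :: "'b => 'b => 'k::field_char_0"
  assumes "two_connected \<pi> G \<alpha>"
    and cocycle: "!!g h l. [|g \<in> carrier G; h \<in> carrier G; l \<in> carrier G|] ==>
      f h l - f (g *[G] h) l + f g (h *[G] l) - f g h = 0"
    and \<nu>: "!!x y. [|x \<in> carrier \<pi>; y \<in> carrier \<pi>|] ==> \<nu> (x *[\<pi>] y) = \<nu> x + \<nu> y + f (\<alpha> x) (\<alpha> y)"
  shows "\<exists>\<mu>. (\<forall>g\<in>carrier G. \<forall>h\<in>carrier G. \<mu> (g *[G] h) = \<mu> g + \<mu> h + f g h) & (\<forall>x\<in>carrier \<pi>. \<mu> (\<alpha> x) = \<nu> x)"
proof -
  have *: "group \<pi>" "group G" "\<alpha> \<in> hom \<pi> G" using assms(1) by (auto simp: two_connected_def)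
  interpret A: coeff_map \<pi> rat_ring "%g q. q" G rat_ring "%g q. q" \<alpha> "%q. q"
    by (rule rat_coeff_map) fact+
  define N where "N = (%x. \<nu> (x ! 0))"
  define F where "F = (%x. f (x ! 0) (x ! 1))"
  have two: "(2::nat) = Suc 1" "(3::nat) = Suc 2" by simp_all
  have bdc: "rat_bd H b \<in> rat_chains 1 H" if "group H" "b \<in> rat_chains 2 H" for H :: "'z monoid" and b
    by (rule coeff.boundary_closed[OF rat_coeff[OF that(1)] that(2)[unfolded two(1)]])
  \<comment> \<open>The hypothesis on \<open>\<nu>\<close> says that the pullback of
    \<open>F\<close> to \<open>\<pi>\<close> is minus the coboundary of \<open>N\<close>.\<close>
  have dN: "pairing (%x. F (map \<alpha> x)) c = - pairing N (rat_bd \<pi> c)" if c: "c \<in> rat_chains 2 \<pi>" for c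
  proof -
    have c': "c \<in> rat_chains (Suc 1) \<pi>" using c unfolding two(1) .
    have "pairing (%x. F (map \<alpha> x)) c = pairing (%x. - coboundary \<pi> N x) c"
    proof (rule pairing_cong[OF c])
      fix x assume "x \<in> tuples 2 \<pi>"
      then obtain y z where "y \<in> carrier \<pi>" "z \<in> carrier \<pi>" "x = [y, z]" by (auto simp: tuples_def numeral_2_eq_2 length_Suc_conv)
      thus "F (map \<alpha> x) = - coboundary \<pi> N x" by (simp add: F_def N_def coboundary_1 \<nu>)
    qed
    also have "\<dots> = - pairing N (rat_bd \<pi> c)" by (simp add: pairing_uminus pairing_boundary[OF *(1) c'])
    finally show ?thesis .
  qed
  have dF: "pairing F (rat_bd G e) = 0" if e: "e \<in> rat_chains 3 G" for e
  proof -
    have e': "e \<in> rat_chains (Suc 2) G" using e unfolding two(2) .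
    show ?thesis unfolding pairing_boundary[OF *(2) e']
    proof (rule pairing_zero[OF e])
      fix x assume "x \<in> tuples 3 G"
      then obtain g h l where "g \<in> carrier G" "h \<in> carrier G" "l \<in> carrier G" "x = [g, h, l]"
        by (auto simp: tuples_def numeral_3_eq_3 length_Suc_conv)
      thus "coboundary G F x = 0" using cocycle by (simp add: coboundary_2 F_def)
    qed
  qed
  \<comment> \<open>The independence of choices. If \<open>\<partial>b + \<alpha>a = 0\<close>, then
    \<open>a\<close> bounds some \<open>a2\<close> by injectivity in degree one, and
    \<open>b + \<alpha>a2\<close> is a 2-cycle. It is homologous to the image of a cycle of
    \<open>\<pi>\<close>, on which the pullback of \<open>F\<close>, being a coboundary,
    vanishes.\<close>
  have zero: "pairing N a = pairing F b"
    if a: "a \<in> rat_chains 1 \<pi>" and b: "b \<in> rat_chains 2 G" and 0: "rat_add (rat_bd G b) (rat_map \<alpha> a) = (%x. 0)" for a b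
  proof -
    have eq: "rat_map \<alpha> a = (%x. -[rat_ring] rat_bd G b x)"
    proof
      fix x
      have "rat_bd G b x + rat_map \<alpha> a x = 0" using fun_cong[OF 0, of x] by (simp add: chain_add_def rat_ring_type_ring)
      thus "rat_map \<alpha> a x = -[rat_ring] rat_bd G b x" by (simp add: rat_ring_type_ring)
    qed
    have "rat_bd G b \<in> rat_boundaries 1 G" unfolding in_boundaries using b by (auto simp: numeral_2_eq_2)
    hence "rat_map \<alpha> a \<in> rat_boundaries 1 G" unfolding eq by (rule A.D.B1_neg)
    hence "a \<in> rat_boundaries 1 \<pi>" using assms(1) a unfolding two_connected_def by blast
    then obtain a2 where a2: "a2 \<in> rat_chains 2 \<pi>" "a = rat_bd \<pi> a2" unfolding in_boundaries by (auto simp: numeral_2_eq_2)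
    define z where "z = rat_add b (rat_map \<alpha> a2)"
    have ma2: "rat_map \<alpha> a2 \<in> rat_chains 2 G" by (rule A.cm_closed[OF a2(1)])
    have zc: "z \<in> rat_chains 2 G" unfolding z_def by (rule A.D.add_closed[OF b ma2])
    have "rat_bd G z = rat_add (rat_bd G b) (rat_bd G (rat_map \<alpha> a2))"
      unfolding z_def by (rule A.D.boundary_add[OF b[unfolded two(1)] ma2[unfolded two(1)]])
    also have "rat_bd G (rat_map \<alpha> a2) = rat_map \<alpha> a" unfolding a2(2) by (rule A.cm_boundary[OF a2(1)[unfolded two(1)], symmetric])
    finally have "rat_bd G z = (%x. 0)" using 0 by simp
    hence "z \<in> rat_cycles 2 G" using zc by (simp add: cycles_def chain_group_simps rat_ring_type_ring)
    then obtain z' e where z': "z' \<in> rat_cycles 2 \<pi>" "e \<in> rat_chains 3 G" "z = rat_add (rat_bd G e) (rat_map \<alpha> z')"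
      using assms(1) unfolding two_connected_def by blast
    have z'c: "z' \<in> rat_chains 2 \<pi>" and z'0: "rat_bd \<pi> z' = (%x. 0)"
      using z'(1) by (auto simp: cycles_def chain_group_simps rat_ring_type_ring)
    have ec: "rat_bd G e \<in> rat_chains 2 G" by (rule A.D.boundary_closed[OF z'(2)[unfolded two(2)]])
    have "pairing F z = pairing F (rat_bd G e) + pairing F (rat_map \<alpha> z')"
      unfolding z'(3) by (rule pairing_add[OF *(2) ec A.cm_closed[OF z'c]])
    also have "\<dots> = - pairing N (%x. 0)" using dF[OF z'(2)] dN[OF z'c] by (simp add: pairing_map[OF * z'c] z'0)
    also have "\<dots> = 0" by (simp add: pairing_def chain_eval_def rat_ring_type_ring finsum_type_ring)
    finally have "pairing F z = 0" .
    moreover have "pairing F z = pairing F b - pairing N a"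
      unfolding z_def pairing_add[OF *(2) b ma2] pairing_map[OF * a2(1)] dN[OF a2(1)] a2(2) by simp
    ultimately show ?thesis by simp
  qed
  \<comment> \<open>A relation at first, because \<open>c\<close> has many decompositions. It is
    additive and relates the zero chain only to 0, hence is single-valued.\<close>
  define val where "val c v \<longleftrightarrow> (\<exists>a\<in>rat_chains 1 \<pi>. \<exists>b\<in>rat_chains 2 G.
    c = rat_add (rat_bd G b) (rat_map \<alpha> a) & v = pairing N a - pairing F b)" for c v
  have val_ex: "\<exists>v. val c v" if "c \<in> rat_chains 1 G" for c
    using assms(1) that unfolding two_connected_def val_def by blast
  have val_add: "val (rat_add c c') (v + v')" if v: "val c v" and v': "val c' v'" for c c' v v'
  proof -
    obtain a b where ab: "a \<in> rat_chains 1 \<pi>" "b \<in> rat_chains 2 G" "c = rat_add (rat_bd G b) (rat_map \<alpha> a)" "v = pairing N a - pairing F b"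
      using v unfolding val_def by blast
    obtain a' b' where ab': "a' \<in> rat_chains 1 \<pi>" "b' \<in> rat_chains 2 G" "c' = rat_add (rat_bd G b') (rat_map \<alpha> a')" "v' = pairing N a' - pairing F b'"
      using v' unfolding val_def by blast
    have 1: "rat_bd G (rat_add b b') = rat_add (rat_bd G b) (rat_bd G b')"
      by (rule A.D.boundary_add[OF ab(2)[unfolded two(1)] ab'(2)[unfolded two(1)]])
    have 2: "rat_map \<alpha> (rat_add a a') = rat_add (rat_map \<alpha> a) (rat_map \<alpha> a')" by (rule A.cm_add[OF ab(1) ab'(1)])
    have "rat_add c c' = rat_add (rat_bd G (rat_add b b')) (rat_map \<alpha> (rat_add a a'))"
      unfolding 1 2 ab(3) ab'(3) by (simp add: chain_add_def rat_ring_type_ring add_ac)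
    moreover have "v + v' = pairing N (rat_add a a') - pairing F (rat_add b b')"
      unfolding pairing_add[OF *(1) ab(1) ab'(1)] pairing_add[OF *(2) ab(2) ab'(2)] ab(4) ab'(4) by simp
    ultimately show ?thesis unfolding val_def using A.C.add_closed[OF ab(1) ab'(1)] A.D.add_closed[OF ab(2) ab'(2)] by blast
  qed
  have val_bd: "val (rat_bd G b) (- pairing F b)" if b: "b \<in> rat_chains 2 G" for b
  proof -
    have "rat_bd G b = rat_add (rat_bd G b) (rat_map \<alpha> (%x. 0[rat_ring]))"
      unfolding A.cm_zero by (simp add: chain_add_def rat_ring_type_ring)
    moreover have "- pairing F b = pairing N (%x. 0[rat_ring]) - pairing F b"
      by (simp add: pairing_def chain_eval_def rat_ring_type_ring finsum_type_ring)
    ultimately show ?thesis unfolding val_def using A.C.zero_closed[of 1] b by blast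
  qed
  have val_map: "val (rat_map \<alpha> a) (pairing N a)" if a: "a \<in> rat_chains 1 \<pi>" for a
  proof -
    have "rat_map \<alpha> a = rat_add (rat_bd G (%x. 0[rat_ring])) (rat_map \<alpha> a)"
      unfolding A.D.boundary_zero by (simp add: chain_add_def rat_ring_type_ring)
    moreover have "pairing N a = pairing N a - pairing F (%x. 0[rat_ring])"
      by (simp add: pairing_def chain_eval_def rat_ring_type_ring finsum_type_ring)
    ultimately show ?thesis unfolding val_def using A.D.zero_closed[of 2] a by blast
  qed
  have val_zero: "v = 0" if "val (%x. 0) v" for v
    using that zero unfolding val_def by (metis right_minus_eq)
  have val_unique: "v = v'" if v: "val c v" and v': "val c v'" for c v v'
  proof -
    obtain a b where ab: "a \<in> rat_chains 1 \<pi>" "b \<in> rat_chains 2 G" "c = rat_add (rat_bd G b) (rat_map \<alpha> a)"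
      using v unfolding val_def by blast
    have c: "c \<in> rat_chains 1 G" unfolding ab(3) by (rule A.D.add_closed[OF bdc[OF *(2) ab(2)] A.cm_closed[OF ab(1)]])
    obtain w where w: "val (%x. -[rat_ring] c x) w" using val_ex[OF A.D.neg_closed[OF c]] by blast
    have z: "rat_add c (%x. -[rat_ring] c x) = (%x. 0)" by (simp add: chain_add_def rat_ring_type_ring)
    have "v + w = 0" "v' + w = 0" using val_zero val_add[OF v w] val_add[OF v' w] unfolding z by auto
    thus ?thesis by (metis add_right_cancel)
  qed
  define \<mu> where "\<mu> g = (THE v. val (rat_single [g] 1) v)" for g
  have \<mu>: "val (rat_single [g] 1) v ==> \<mu> g = v" for g v unfolding \<mu>_def using val_unique by blast
  have \<mu>_val: "val (rat_single [g] 1) (\<mu> g)" if "g \<in> carrier G" for g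
    using val_ex[OF rat_single_closed[OF that]] \<mu> by metis
  show ?thesis
  proof (intro exI[of _ \<mu>] conjI ballI)
    fix g h assume g: "g \<in> carrier G" and h: "h \<in> carrier G"
    have t: "[g, h] \<in> tuples 2 G" using g h by (simp add: tuples_def)
    have c2: "rat_single [g, h] (- 1) \<in> rat_chains 2 G"
      using two_modules.chain_single_closed[OF two_modules_rat t] by (simp add: rat_ring_type_ring)
    \<comment> \<open>With coefficient -1 the boundary of \<open>[g, h]\<close> is
      \<open>[g h] - [g] - [h]\<close>, and \<open>val_bd\<close> turns it into the summand
      \<open>f g h\<close>.\<close>
    have "rat_single [g *[G] h] 1 = rat_add (rat_add (rat_single [g] 1) (rat_single [h] 1)) (rat_bd G (rat_single [g, h] (-1)))"
      using A.D.boundary_single_2[OF g h, of "-1"] by (auto simp: fun_eq_iff chain_add_def chain_single_def rat_ring_type_ring)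
    hence "val (rat_single [g *[G] h] 1) (\<mu> g + \<mu> h + - pairing F (rat_single [g, h] (-1)))"
      using val_add[OF val_add[OF \<mu>_val[OF g] \<mu>_val[OF h]] val_bd[OF c2]] by simp
    hence "\<mu> (g *[G] h) = \<mu> g + \<mu> h + - pairing F (rat_single [g, h] (-1))" by (rule \<mu>)
    thus "\<mu> (g *[G] h) = \<mu> g + \<mu> h + f g h" using pairing_single[OF *(2) t, where f = F and q = "-1"] by (simp add: F_def)
  next
    fix x assume x: "x \<in> carrier \<pi>"
    have "rat_map \<alpha> (rat_single [x] 1) = rat_single [\<alpha> x] 1" using A.cm_single[of 1 "[x]"] by (simp add: rat_ring_type_ring)
    hence "val (rat_single [\<alpha> x] 1) (pairing N (rat_single [x] 1))" using val_map[OF rat_single_closed[OF x, of 1]] by simp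
    hence "\<mu> (\<alpha> x) = pairing N (rat_single [x] 1)" by (rule \<mu>)
    thus "\<mu> (\<alpha> x) = \<nu> x" using pairing_single[OF *(1), where x = "[x]" and k = 1 and f = N and q = 1] x by (simp add: N_def tuples_1)
  qed
qed

text \<open>Every rational 1-chain is a cycle, so for an additive \<open>\<mu>\<close> this is
  injectivity of the induced map from the first rational homology to the field.\<close>

definition injective_on_H1 :: "'a monoid => ('a => 'k::field_char_0) => bool" where
  "injective_on_H1 G \<mu> \<longleftrightarrow> (\<forall>c\<in>rat_chains 1 G. pairing1 \<mu> c = 0 --> c \<in> rat_boundaries 1 G)"

lemma injective_on_H1_transfer:
  assumes "two_connected \<pi> G \<alpha>" "additive_on G \<mu>" "!!x. x \<in> carrier \<pi> ==> \<nu> x = \<mu> (\<alpha> x)"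
  shows "injective_on_H1 \<pi> \<nu> \<longleftrightarrow> injective_on_H1 G (\<mu> :: 'b => 'k::field_char_0)"
proof -
  have *: "group \<pi>" "group G" "\<alpha> \<in> hom \<pi> G" using assms(1) by (auto simp: two_connected_def)
  interpret A: coeff_map \<pi> rat_ring "%g q. q" G rat_ring "%g q. q" \<alpha> "%q. q"
    by (rule rat_coeff_map) fact+
  have p: "pairing1 \<mu> (rat_map \<alpha> a) = pairing1 \<nu> a" if "a \<in> rat_chains 1 \<pi>" for a
    unfolding pairing_map[OF * that] by (rule pairing_cong[OF that]) (use assms(3) in \<open>auto simp: tuples_1\<close>)
  show ?thesis
  proof
    assume i: "injective_on_H1 \<pi> \<nu>"
    show "injective_on_H1 G \<mu>" unfolding injective_on_H1_def
    proof (intro ballI impI)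
      fix c assume c: "c \<in> rat_chains 1 G" "pairing1 \<mu> c = 0"
      obtain a b where ab: "a \<in> rat_chains 1 \<pi>" "b \<in> rat_chains 2 G" "c = rat_add (rat_bd G b) (rat_map \<alpha> a)"
        by (rule two_connectedD1[OF assms(1) c(1)])
      have bc: "rat_bd G b \<in> rat_chains 1 G" using A.D.boundary_closed[of b 1] ab(2) by (simp add: numeral_2_eq_2)
      have "pairing1 \<mu> c = pairing1 \<mu> (rat_bd G b) + pairing1 \<mu> (rat_map \<alpha> a)"
        unfolding ab(3) by (rule pairing_add[OF *(2) bc A.cm_closed[OF ab(1)]])
      hence "pairing1 \<nu> a = 0" using c(2) pairing1_boundary[OF *(2) assms(2) ab(2)] p[OF ab(1)] by simp
      hence "a \<in> rat_boundaries 1 \<pi>" using i ab(1) unfolding injective_on_H1_def by blast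
      hence "rat_map \<alpha> a \<in> rat_boundaries 1 G" by (rule A.cm_boundaries)
      moreover have "rat_bd G b \<in> rat_boundaries 1 G" unfolding in_boundaries using ab(2) by (auto simp: numeral_2_eq_2)
      ultimately show "c \<in> rat_boundaries 1 G" unfolding ab(3) by (intro A.D.B1_add)
    qed
  next
    assume i: "injective_on_H1 G \<mu>"
    show "injective_on_H1 \<pi> \<nu>" unfolding injective_on_H1_def
    proof (intro ballI impI)
      fix a assume a: "a \<in> rat_chains 1 \<pi>" "pairing1 \<nu> a = 0"
      hence "rat_map \<alpha> a \<in> rat_boundaries 1 G" using i A.cm_closed[OF a(1)] p[OF a(1)] unfolding injective_on_H1_def by auto
      thus "a \<in> rat_boundaries 1 \<pi>" using assms(1) a(1) unfolding two_connected_def by blast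
    qed
  qed
qed

declare One_nat_def [simp del] one_FactGroup [simp del] mult_FactGroup [simp del]

section \<open>Homology with coefficients in the skew field of a group\<close>

text \<open>The quotient of all 1-chains by the boundaries: \<open>g \<mapsto> 1 \<cdot> [g]\<close> is a derivation into it, although
  \<open>1 \<cdot> [g]\<close> is rarely a cycle.\<close>

context coeff begin

abbreviation "C1 == chain_group 1 G M Mod B1"

lemma B1_normal_chains: "B1 \<lhd> chain_group 1 G M"
  using comm_group.normal_iff_subgroup[OF comm_group_chains] subgroup_boundaries by blast

lemma C1_comm_group: "comm_group C1"
  using comm_group.abelian_FactGroup[OF comm_group_chains subgroup_boundaries] .

lemma C1_carrier: "carrier C1 = cls1 ` bar_chains 1 G M"
  by (auto simp: FactGroup_def RCOSETS_def homology_class_def chain_group_simps)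

lemma C1_mult: "c \<in> bar_chains 1 G M ==> d \<in> bar_chains 1 G M ==> cls1 c *[C1] cls1 d = cls1 (chain_add M c d)"
  using normal.rcos_sum[OF B1_normal_chains, of c d] by (simp add: FactGroup_def homology_class_def chain_group_simps)

lemma C1_one: "1[C1] = B1"
  by (simp add: FactGroup_def)

lemma cls1_C1_one_iff: "c \<in> bar_chains 1 G M ==> cls1 c = 1[C1] \<longleftrightarrow> c \<in> B1"
  unfolding C1_one using class_zero_iff .

lemma H1_mult_C1: "x *[H1] y = x *[C1] y" and H1_one_C1: "1[H1] = 1[C1]"
  by (simp_all add: group_homology_def FactGroup_def set_mult_def)

lemma H1_carrier_C1: "carrier H1 <= carrier C1"
  unfolding H1_carrier C1_carrier using Z1_chains by auto

lemma single_closed: "g \<in> carrier G ==> m \<in> carrier M ==> chain_single M [g] m \<in> bar_chains 1 G M"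
  by (rule MM.chain_single_closed) (auto simp: tuples_def)

definition single_class :: "'a => 'm => ('a list => 'm) set" where
  "single_class g m = cls1 (chain_single M [g] m)"

lemma single_class_closed: "g \<in> carrier G ==> m \<in> carrier M ==> single_class g m \<in> carrier C1"
  unfolding single_class_def C1_carrier using single_closed by blast

text \<open>The boundary of \<open>[g, h]\<close> with coefficient \<open>-m\<close> is the
  difference of the two sides.\<close>

lemma single_class_mult:
  assumes g: "g \<in> carrier G" and h: "h \<in> carrier G" and m: "m \<in> carrier M"
  shows "single_class (g *[G] h) m = single_class g m *[C1] single_class h (act (inv[G] g) m)"
proof -
  have m': "act (inv[G] g) m \<in> carrier M" using act_closed g m by simp
  have t: "[g, h] \<in> tuples (Suc 1) G" using g h by (simp add: tuples_def)
  have "chain_single M [g, h] (-[M] m) \<in> bar_chains (Suc 1) G M"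
    using m by (intro MM.chain_single_closed[OF t]) simp
  hence b: "boundary G M act (chain_single M [g, h] (-[M] m)) \<in> B1" unfolding in_boundaries by blast
  have neg: "act (inv[G] g) (-[M] m) = -[M] act (inv[G] g) m"
    using additive_map_minus[OF M.abelian_group_axioms M.abelian_group_axioms act_additive] g m by simp
  have "chain_single M [g *[G] h] m = chain_add M (boundary G M act (chain_single M [g, h] (-[M] m)))
    (chain_add M (chain_single M [g] m) (chain_single M [h] (act (inv[G] g) m)))"
    unfolding boundary_single_2[OF g h M.a_inv_closed[OF m]] neg
  proof
    fix x
    let ?a = "act (inv[G] g) m"
    define p where "p = chain_single M [h] ?a x"
    define q where "q = chain_single M [g] m x"
    define r where "r = chain_single M [g *[G] h] m x"
    have c: "p \<in> carrier M" "q \<in> carrier M" "r \<in> carrier M" using m m' by (auto simp: p_def q_def r_def chain_single_def)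
    have n: "chain_single M y (-[M] k) x = -[M] chain_single M y k x" for y k
    proof -
      have "0[M] = -[M] 0[M]" by (rule M.minus_equality[symmetric]) auto
      thus ?thesis unfolding chain_single_def by (metis (full_types))
    qed
    have "r = (-[M] p +[M] (r +[M] -[M] q)) +[M] (q +[M] p)"
    proof -
      have "(-[M] p +[M] (r +[M] -[M] q)) +[M] (q +[M] p) = r +[M] ((-[M] p +[M] p) +[M] (-[M] q +[M] q))"
        using c by (simp add: M.a_ac)
      thus ?thesis using c by (simp add: M.l_neg)
    qed
    thus "chain_single M [g *[G] h] m x = chain_add M
        (chain_add M (chain_single M [h] (-[M] ?a)) (chain_add M (chain_single M [g *[G] h] (-[M] (-[M] m))) (chain_single M [g] (-[M] m))))
        (chain_add M (chain_single M [g] m) (chain_single M [h] ?a)) x"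
      unfolding chain_add_def n p_def[symmetric] q_def[symmetric] using c m by (simp add: r_def n)
  qed
  hence "cls1 (chain_single M [g *[G] h] m) = cls1 (chain_add M (chain_single M [g] m) (chain_single M [h] (act (inv[G] g) m)))"
    using b class_eq_iff[OF single_closed[OF m_closed[OF g h] m] add_closed[OF single_closed[OF g m] single_closed[OF h m']]] by blast
  thus ?thesis unfolding single_class_def using C1_mult[OF single_closed[OF g m] single_closed[OF h m']] by simp
qed

end

section \<open>Coefficients in the skew field of a group ring\<close>

lemma chain_map_id:
  assumes "abelian_group M" "abelian_group M'" "c \<in> chains_on M T" "additive_map M M' f"
  shows "chain_map M M' (%g. g) f c = (%x. f (c x))"
proof
  fix y
  interpret M': abelian_group M' by fact
  have c: "c y \<in> carrier M" using assms(3) by (auto simp: chains_on_def)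
  have f0: "f 0[M] = 0[M']" using additive_map_zero[OF assms(1,2,4)] .
  show "chain_map M M' (%g. g) f c y = f (c y)"
  proof (cases "c y = 0[M]")
    case True
    hence e: "{x. c x ~= 0[M] & map (%g. g) x = y} = {}" by auto
    show ?thesis unfolding chain_map_def e using True f0 by simp
  next
    case False
    hence e: "{x. c x ~= 0[M] & map (%g. g) x = y} = {y}" by auto
    show ?thesis unfolding chain_map_def e using additive_mapD(1)[OF assms(4) c] by simp
  qed
qed

text \<open>The homomorphism \<open>\<rho>\<close> is not assumed to be surjective:
  \<open>\<Gamma>\<close> is a quotient of \<open>G\<close> in the derived series and a tower group
  \<open>\<F>_k(G)\<close> later on.\<close>

locale skew_coeff = G: group G for G :: "'a monoid" +
  fixes \<Gamma> :: "'g monoid" and \<rho> :: "'a => 'g"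
  assumes ore_group: "ore_group \<Gamma>" and rho: "\<rho> \<in> hom G \<Gamma>"
begin

sublocale R: right_ore "group_ring \<Gamma>" by (rule right_ore_group_ring[OF ore_group])
sublocale \<Gamma>: group \<Gamma> using ore_group by (simp add: ore_group_def)
sublocale rho: group_hom G \<Gamma> \<rho> by unfold_locales (rule rho)

abbreviation "K == quot_field \<Gamma>"
abbreviation "emb \<gamma> == quot_incl \<Gamma> (frag_of \<gamma>)"

sublocale K: ring K unfolding quot_field_def by (rule R.ring_Q)

abbreviation "ZG == carrier (group_ring \<Gamma>)"

lemma quot_incl_cls: "quot_incl \<Gamma> a = R.cls a (frag_of 1[\<Gamma>])"
  by (simp add: quot_incl_def R.cls_def)

lemma one_nz: "frag_of 1[\<Gamma>] \<in> R.NZ"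
  by simp

lemma quot_incl_closed: "a \<in> ZG ==> quot_incl \<Gamma> a \<in> carrier K"
  unfolding quot_incl_cls quot_field_def by (rule R.cls_closed[OF _ one_nz])

lemma quot_incl_add:
  "a \<in> ZG ==> b \<in> ZG ==> quot_incl \<Gamma> (a +[group_ring \<Gamma>] b) = quot_incl \<Gamma> a +[K] quot_incl \<Gamma> b"
  unfolding quot_incl_cls quot_field_def using R.add_cls[OF _ _ one_nz] by simp

lemma quot_incl_mult:
  assumes "a \<in> ZG" "b \<in> ZG"
  shows "quot_incl \<Gamma> (a *[group_ring \<Gamma>] b) = quot_incl \<Gamma> a *[K] quot_incl \<Gamma> b"
  unfolding quot_incl_cls quot_field_def using R.mult_cls[OF assms(1) one_nz assms(2) one_nz] R.l_one[OF assms(2)] by simp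

lemma quot_incl_one: "quot_incl \<Gamma> (frag_of 1[\<Gamma>]) = 1[K]"
  unfolding quot_incl_cls quot_field_def using R.one_Q by simp

lemma quot_incl_zero_iff: "a \<in> ZG ==> quot_incl \<Gamma> a = 0[K] \<longleftrightarrow> a = 0"
  unfolding quot_incl_cls quot_field_def using R.cls_zero_iff[OF _ one_nz] by simp

lemma K_inverse: "q \<in> carrier K ==> q ~= 0[K] ==> \<exists>p\<in>carrier K. q *[K] p = 1[K] & p *[K] q = 1[K]"
  unfolding quot_field_def using R.inverse_Q by metis

lemma K_one_not_zero: "1[K] ~= 0[K]"
  unfolding quot_field_def by (rule R.one_neq_zero_Q)

lemma emb_closed: "\<gamma> \<in> carrier \<Gamma> ==> emb \<gamma> \<in> carrier K"
  by (rule quot_incl_closed) simp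

lemma emb_mult: "\<gamma> \<in> carrier \<Gamma> ==> \<delta> \<in> carrier \<Gamma> ==> emb (\<gamma> *[\<Gamma>] \<delta>) = emb \<gamma> *[K] emb \<delta>"
  using quot_incl_mult[of "frag_of \<gamma>" "frag_of \<delta>"] by simp

lemma emb_inj: "\<gamma> \<in> carrier \<Gamma> ==> \<delta> \<in> carrier \<Gamma> ==> emb \<gamma> = emb \<delta> ==> \<gamma> = \<delta>"
  unfolding quot_incl_cls using R.cls_same_denom[OF _ _ one_nz, of "frag_of \<gamma>" "frag_of \<delta>"] by (simp add: frag_of_eq)

lemma emb_diff_nonzero: "\<gamma> \<in> carrier \<Gamma> ==> \<delta> \<in> carrier \<Gamma> ==> \<gamma> ~= \<delta> ==> emb \<gamma> -[K] emb \<delta> ~= 0[K]"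
  using emb_inj[of \<gamma> \<delta>] K.r_right_minus_eq[OF emb_closed emb_closed, of \<gamma> \<delta>] by auto

lemma act_def: "KG_act \<Gamma> \<rho> g m = emb (\<rho> g) *[K] m"
  by (simp add: KG_act_def)

sublocale coeff G K "KG_act \<Gamma> \<rho>"
proof
  fix g h m assume g: "g \<in> carrier G"
  have eg: "emb (\<rho> g) \<in> carrier K" using emb_closed g by simp
  thus "additive_map K K (KG_act \<Gamma> \<rho> g)" unfolding additive_map_def act_def by (simp add: K.r_distr)
  assume h: "h \<in> carrier G" and m: "m \<in> carrier K"
  show "KG_act \<Gamma> \<rho> (g *[G] h) m = KG_act \<Gamma> \<rho> g (KG_act \<Gamma> \<rho> h m)"
    unfolding act_def using g h m emb_closed by (simp add: emb_mult K.m_assoc)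
next
  fix m assume "m \<in> carrier K"
  thus "KG_act \<Gamma> \<rho> 1[G] m = m" unfolding act_def by (simp add: quot_incl_one)
qed

lemma H1K_eq: "H1K G \<Gamma> \<rho> = H1"
  by (simp add: H1K_def)

text \<open>The formula of \<open>H1K_act\<close> with an arbitrary element of the skew field. It
  makes sense on classes of all 1-chains, thus on \<open>C1\<close>, where the universal derivation
  takes its values.\<close>

definition rmul :: "'g qelem => ('a list => 'g qelem) set => ('a list => 'g qelem) set" where
  "rmul q = homology_map 1 K G K (KG_act \<Gamma> \<rho>) (%g. g) (%k. k *[K] q)"

lemma H1K_act_eq: "H1K_act G \<Gamma> \<rho> \<gamma> = rmul (emb (inv[\<Gamma>] \<gamma>))"
  by (simp add: H1K_act_def rmul_def)

lemma rmul_coeff_map: "q \<in> carrier K ==> coeff_map G K (KG_act \<Gamma> \<rho>) G K (KG_act \<Gamma> \<rho>) (%g. g) (%k. k *[K] q)"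
proof -
  assume q: "q \<in> carrier K"
  show ?thesis
  proof
    show "(%g. g) \<in> hom G G" by (simp add: hom_def)
    show "additive_map K K (%k. k *[K] q)" using q by (simp add: additive_map_def K.l_distr)
    fix g m assume "g \<in> carrier G" "m \<in> carrier K"
    thus "KG_act \<Gamma> \<rho> g m *[K] q = KG_act \<Gamma> \<rho> g (m *[K] q)"
      unfolding act_def using q emb_closed by (simp add: K.m_assoc)
  qed
qed

lemma rmul_additive: "q \<in> carrier K ==> additive_map K K (%k. k *[K] q)"
  by (simp add: additive_map_def K.l_distr)

lemma rmul_chain:
  assumes q: "q \<in> carrier K" and c: "c \<in> bar_chains k G K"
  shows "chain_map K K (%g. g) (%k. k *[K] q) c = (%x. c x *[K] q)" "(%x. c x *[K] q) \<in> bar_chains k G K"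
proof -
  show 1: "chain_map K K (%g. g) (%k. k *[K] q) c = (%x. c x *[K] q)"
    by (rule chain_map_id[OF K.abelian_group_axioms K.abelian_group_axioms c rmul_additive[OF q]])
  show "(%x. c x *[K] q) \<in> bar_chains k G K"
    using coeff_map.cm_closed[OF rmul_coeff_map[OF q] c] unfolding 1 .
qed

lemma rmul_cls1:
  assumes q: "q \<in> carrier K" and c: "c \<in> bar_chains 1 G K"
  shows "rmul q (cls1 c) = cls1 (%x. c x *[K] q)"
  unfolding rmul_def coeff_map.homology_map_class[OF rmul_coeff_map[OF q] c] rmul_chain(1)[OF q c] ..

lemma C1_cases: assumes "x \<in> carrier C1" obtains c where "c \<in> bar_chains 1 G K" "x = cls1 c"
  using assms unfolding C1_carrier by blast

lemma H1_cases: assumes "x \<in> carrier H1" obtains c where "c \<in> Z1" "c \<in> bar_chains 1 G K" "x = cls1 c"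
  using assms Z1_chains unfolding H1_carrier by blast

lemma rmul_closed: "q \<in> carrier K ==> x \<in> carrier C1 ==> rmul q x \<in> carrier C1"
  by (elim C1_cases) (auto simp: rmul_cls1 C1_carrier rmul_chain(2))

lemma rmul_closed_H1: "q \<in> carrier K ==> x \<in> carrier H1 ==> rmul q x \<in> carrier H1"
proof -
  assume q: "q \<in> carrier K" and x: "x \<in> carrier H1"
  obtain c where c: "c \<in> Z1" "c \<in> bar_chains 1 G K" "x = cls1 c" using x by (rule H1_cases)
  have "chain_map K K (%g. g) (%k. k *[K] q) c \<in> Z1"
    using coeff_map.cm_cycles[OF rmul_coeff_map[OF q], of c 0] c(1) by (simp add: One_nat_def)
  thus ?thesis unfolding c(3) rmul_cls1[OF q c(2)] H1_carrier rmul_chain(1)[OF q c(2)] by blast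
qed

lemma cell: "c \<in> bar_chains k G K ==> c x \<in> carrier K"
  by (auto simp: chains_on_def)

lemma rmul_mult:
  assumes q: "q \<in> carrier K" and "x \<in> carrier C1" "y \<in> carrier C1"
  shows "rmul q (x *[C1] y) = rmul q x *[C1] rmul q y"
proof -
  obtain c where c: "c \<in> bar_chains 1 G K" "x = cls1 c" using assms(2) by (rule C1_cases)
  obtain d where d: "d \<in> bar_chains 1 G K" "y = cls1 d" using assms(3) by (rule C1_cases)
  show ?thesis unfolding c(2) d(2) C1_mult[OF c(1) d(1)] rmul_cls1[OF q c(1)] rmul_cls1[OF q d(1)]
      rmul_cls1[OF q add_closed[OF c(1) d(1)]] C1_mult[OF rmul_chain(2)[OF q c(1)] rmul_chain(2)[OF q d(1)]]
    using cell[OF c(1)] cell[OF d(1)] q by (simp add: chain_add_def K.l_distr)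
qed

lemma rmul_add:
  assumes q: "q \<in> carrier K" "p \<in> carrier K" and "x \<in> carrier C1"
  shows "rmul (q +[K] p) x = rmul q x *[C1] rmul p x"
proof -
  obtain c where c: "c \<in> bar_chains 1 G K" "x = cls1 c" using assms(3) by (rule C1_cases)
  show ?thesis unfolding c(2) rmul_cls1[OF q(1) c(1)] rmul_cls1[OF q(2) c(1)] rmul_cls1[OF K.a_closed[OF q] c(1)]
      C1_mult[OF rmul_chain(2)[OF q(1) c(1)] rmul_chain(2)[OF q(2) c(1)]]
    using cell[OF c(1)] q by (simp add: chain_add_def K.r_distr)
qed

lemma rmul_rmul:
  assumes q: "q \<in> carrier K" "p \<in> carrier K" and "x \<in> carrier C1"
  shows "rmul p (rmul q x) = rmul (q *[K] p) x"
proof -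
  obtain c where c: "c \<in> bar_chains 1 G K" "x = cls1 c" using assms(3) by (rule C1_cases)
  show ?thesis unfolding c(2) rmul_cls1[OF q(1) c(1)] rmul_cls1[OF q(2) rmul_chain(2)[OF q(1) c(1)]] rmul_cls1[OF K.m_closed[OF q] c(1)]
    using cell[OF c(1)] q by (simp add: K.m_assoc)
qed

lemma rmul_one:
  assumes "x \<in> carrier C1" shows "rmul 1[K] x = x"
proof -
  obtain c where c: "c \<in> bar_chains 1 G K" "x = cls1 c" using assms by (rule C1_cases)
  show ?thesis unfolding c(2) rmul_cls1[OF K.one_closed c(1)] using cell[OF c(1)] by simp
qed

lemma rmul_hom: "q \<in> carrier K ==> rmul q \<in> hom C1 C1"
  using rmul_closed rmul_mult by (auto simp: hom_def)

lemma rmul_group_hom: "q \<in> carrier K ==> group_hom C1 C1 (rmul q)"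
  using rmul_hom C1_comm_group by (simp add: group_hom_def group_hom_axioms_def comm_group_def)

lemma rmul_one_class: "q \<in> carrier K ==> rmul q 1[C1] = 1[C1]"
  using group_hom.hom_one[OF rmul_group_hom] .

lemma rmul_zero:
  assumes "x \<in> carrier C1" shows "rmul 0[K] x = 1[C1]"
proof -
  interpret C: comm_group C1 by (rule C1_comm_group)
  have "rmul 0[K] x *[C1] rmul 0[K] x = rmul 0[K] x" using rmul_add[of "0[K]" "0[K]" x] assms by simp
  thus ?thesis using rmul_closed[OF K.zero_closed assms] C.r_cancel_one by blast
qed

lemma rmul_minus:
  assumes "q \<in> carrier K" "x \<in> carrier C1" shows "rmul (-[K] q) x = inv[C1] rmul q x"
proof -
  interpret C: comm_group C1 by (rule C1_comm_group)
  have "rmul (-[K] q) x *[C1] rmul q x = 1[C1]"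
    using rmul_add[of "-[K] q" q x] assms by (simp add: K.l_neg rmul_zero)
  thus ?thesis using C.inv_equality rmul_closed assms by auto
qed

lemma rmul_cancel:
  assumes "q \<in> carrier K" "q ~= 0[K]" "x \<in> carrier C1" "rmul q x = 1[C1]" shows "x = 1[C1]"
proof -
  obtain p where p: "p \<in> carrier K" "q *[K] p = 1[K]" using K_inverse assms by blast
  have "x = rmul p (rmul q x)" using rmul_rmul[OF assms(1) p(1) assms(3)] p(2) rmul_one[OF assms(3)] by simp
  thus ?thesis unfolding assms(4) rmul_one_class[OF p(1)] .
qed

definition nat_emb :: "nat => 'g qelem" where
  "nat_emb n = quot_incl \<Gamma> (frag_cmul (int n) (frag_of 1[\<Gamma>]))"

lemma nat_emb_closed: "nat_emb n \<in> carrier K"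
  unfolding nat_emb_def by (rule quot_incl_closed) (use keys_cmul[of "int n" "frag_of 1[\<Gamma>]"] in auto)

lemma nat_emb_Suc: "nat_emb (Suc n) = nat_emb n +[K] 1[K]"
proof -
  have "frag_cmul (int (Suc n)) (frag_of 1[\<Gamma>]) = frag_cmul (int n) (frag_of 1[\<Gamma>]) + frag_of 1[\<Gamma>]"
    by (rule poly_mapping_eqI) (simp add: lookup_add algebra_simps)
  moreover have "frag_cmul (int n) (frag_of 1[\<Gamma>]) \<in> ZG" "frag_of 1[\<Gamma>] \<in> ZG"
    using keys_cmul[of "int n" "frag_of 1[\<Gamma>]"] by auto
  ultimately show ?thesis unfolding nat_emb_def quot_incl_one[symmetric]
    using quot_incl_add[of "frag_cmul (int n) (frag_of 1[\<Gamma>])" "frag_of 1[\<Gamma>]"] by simp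
qed

lemma nat_emb_nonzero: "n > 0 ==> nat_emb n ~= 0[K]"
  unfolding nat_emb_def using quot_incl_zero_iff[of "frag_cmul (int n) (frag_of 1[\<Gamma>])"] keys_cmul[of "int n" "frag_of 1[\<Gamma>]"] by auto

lemma rmul_nat:
  assumes "x \<in> carrier C1" shows "rmul (nat_emb n) x = x [^]\<^bsub>C1\<^esub> n"
proof (induction n)
  case 0
  have "nat_emb 0 = 0[K]" using quot_incl_zero_iff[of 0] by (simp add: nat_emb_def)
  thus ?case using rmul_zero assms by simp
next
  case (Suc n)
  thus ?case using rmul_add[OF nat_emb_closed K.one_closed assms] assms by (simp add: nat_emb_Suc rmul_one)
qed

text \<open>The \<open>n\<close>-th power is multiplication by the integer \<open>n\<close>, which
  is invertible in the skew field.\<close>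

lemma C1_torsion_free: "x \<in> carrier C1 ==> n > 0 ==> x [^]\<^bsub>C1\<^esub> (n::nat) = 1[C1] ==> x = 1[C1]"
  using rmul_cancel[OF nat_emb_closed nat_emb_nonzero] rmul_nat by metis

definition universal_derivation :: "'a => ('a list => 'g qelem) set" where
  "universal_derivation g = single_class g 1[K]"

lemma universal_derivation_closed: "g \<in> carrier G ==> universal_derivation g \<in> carrier C1"
  unfolding universal_derivation_def by (simp add: single_class_closed)

lemma universal_derivation_mult:
  assumes "g \<in> carrier G" "h \<in> carrier G"
  shows "universal_derivation (g *[G] h) = universal_derivation g *[C1] rmul (emb (inv[\<Gamma>] \<rho> g)) (universal_derivation h)"
proof -
  let ?e = "emb (inv[\<Gamma>] \<rho> g)"
  have e: "?e \<in> carrier K" using emb_closed assms by simp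
  have a: "KG_act \<Gamma> \<rho> (inv[G] g) 1[K] = ?e" unfolding act_def using assms e by simp
  have s: "(%x. chain_single K [h] 1[K] x *[K] ?e) = chain_single K [h] ?e"
    by (rule ext) (simp add: chain_single_def e)
  have "rmul ?e (universal_derivation h) = single_class h ?e"
    unfolding universal_derivation_def single_class_def rmul_cls1[OF e single_closed[OF assms(2) K.one_closed]] s ..
  thus ?thesis unfolding universal_derivation_def using single_class_mult[OF assms K.one_closed] by (simp add: a)
qed

lemma universal_derivation_one: "universal_derivation 1[G] = 1[C1]"
proof -
  interpret C: comm_group C1 by (rule C1_comm_group)
  have "universal_derivation 1[G] *[C1] universal_derivation 1[G] = universal_derivation 1[G]"
    using universal_derivation_mult[OF G.one_closed G.one_closed] universal_derivation_closed[OF G.one_closed]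
    by (simp add: quot_incl_one rmul_one)
  thus ?thesis using universal_derivation_closed[OF G.one_closed] C.r_cancel_one by blast
qed

lemma universal_derivation_kernel_mult:
  assumes "g \<in> carrier G" "h \<in> carrier G" "\<rho> g = 1[\<Gamma>]"
  shows "universal_derivation (g *[G] h) = universal_derivation g *[C1] universal_derivation h"
  using universal_derivation_mult[OF assms(1,2)] universal_derivation_closed[OF assms(2)] by (simp add: assms(3) quot_incl_one rmul_one)

lemma universal_derivation_conj:
  assumes g: "g \<in> carrier G" and n: "n \<in> carrier G" "\<rho> n = 1[\<Gamma>]"
  shows "universal_derivation (g *[G] n *[G] inv[G] g) = rmul (emb (inv[\<Gamma>] \<rho> g)) (universal_derivation n)"
proof -
  interpret C: comm_group C1 by (rule C1_comm_group)
  let ?D = universal_derivation and ?r = "rmul (emb (inv[\<Gamma>] \<rho> g))"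
  have e: "emb (inv[\<Gamma>] \<rho> g) \<in> carrier K" using emb_closed g by simp
  have c: "?D g \<in> carrier C1" "?r (?D n) \<in> carrier C1" "?r (?D (inv[G] g)) \<in> carrier C1"
    using universal_derivation_closed rmul_closed[OF e] g n by auto
  have 1: "?D g *[C1] ?r (?D (inv[G] g)) = 1[C1]"
    using universal_derivation_mult[OF g G.inv_closed[OF g]] g by (simp add: universal_derivation_one)
  have "?D (g *[G] n *[G] inv[G] g) = ?D (g *[G] n) *[C1] ?r (?D (inv[G] g))"
    using universal_derivation_mult[of "g *[G] n" "inv[G] g"] g n by simp
  also have "\<dots> = ?r (?D n) *[C1] (?D g *[C1] ?r (?D (inv[G] g)))"
    unfolding universal_derivation_mult[OF g n(1)] using c by (simp add: C.m_ac)
  finally show ?thesis unfolding 1 using c by simp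
qed

lemma universal_derivation_one_iff:
  "g \<in> carrier G ==> universal_derivation g = 1[C1] \<longleftrightarrow> chain_single K [g] 1[K] \<in> B1"
  unfolding universal_derivation_def single_class_def using cls1_C1_one_iff[OF single_closed] by simp

lemma universal_derivation_pow:
  assumes "g \<in> carrier G" "\<rho> g = 1[\<Gamma>]"
  shows "universal_derivation (g [^]\<^bsub>G\<^esub> (n::nat)) = universal_derivation g [^]\<^bsub>C1\<^esub> n"
proof (induction n)
  case (Suc n)
  have "\<rho> (g [^]\<^bsub>G\<^esub> n) = 1[\<Gamma>]" using assms by (simp add: rho.hom_nat_pow)
  thus ?case using universal_derivation_kernel_mult[of "g [^]\<^bsub>G\<^esub> n" g] assms Suc by simp
qed (simp add: universal_derivation_one)

text \<open>The extension of \<open>\<chi>\<close> from the group ring to the fractions. It is well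
  defined if \<open>\<chi>\<close> is multiplicative and no nonzero element of the group ring
  evaluates to 0; the choice of the representative is then irrelevant.\<close>

definition quot_eval :: "('g => 'l::field) => 'g qelem => 'l" where
  "quot_eval \<chi> A = (SOME v. \<exists>(a, s)\<in>A. v = gr_eval \<chi> a / gr_eval \<chi> s)"

context
  fixes \<chi> :: "'g => 'l::field"
  assumes chi: "!!x y. x \<in> carrier \<Gamma> ==> y \<in> carrier \<Gamma> ==> \<chi> (x *[\<Gamma>] y) = \<chi> x * \<chi> y"
    and inj: "!!a. a \<in> ZG ==> gr_eval \<chi> a = 0 ==> a = 0"
begin

lemma quot_eval_cls:
  assumes "a \<in> ZG" "s \<in> R.NZ"
  shows "quot_eval \<chi> (R.cls a s) = gr_eval \<chi> a / gr_eval \<chi> s"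
proof -
  have val: "gr_eval \<chi> b / gr_eval \<chi> t = gr_eval \<chi> a / gr_eval \<chi> s" if "(b, t) \<in> R.cls a s" for b t
  proof -
    have "((a, s), (b, t)) \<in> frac_rel (group_ring \<Gamma>)" using that R.mem_cls by simp
    then obtain u v where *: "a \<in> ZG" "b \<in> ZG"
      "s \<in> R.NZ" "t \<in> R.NZ"
      "u \<in> R.NZ" "v \<in> R.NZ"
      "s *[group_ring \<Gamma>] u = t *[group_ring \<Gamma>] v" "a *[group_ring \<Gamma>] u = b *[group_ring \<Gamma>] v"
      by (rule R.relE)
    have m: "gr_eval \<chi> (gr_mult \<Gamma> x y) = gr_eval \<chi> x * gr_eval \<chi> y"
      if "x \<in> ZG" "y \<in> ZG" for x y
      using gr_eval_mult[OF chi, of x y] that by simp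
    have 1: "gr_eval \<chi> s * gr_eval \<chi> u = gr_eval \<chi> t * gr_eval \<chi> v" "gr_eval \<chi> a * gr_eval \<chi> u = gr_eval \<chi> b * gr_eval \<chi> v"
      using m[of s u] m[of t v] m[of a u] m[of b v] * by auto
    have 2: "gr_eval \<chi> s ~= 0" "gr_eval \<chi> t ~= 0" "gr_eval \<chi> u ~= 0" "gr_eval \<chi> v ~= 0" using inj * by auto
    have "gr_eval \<chi> b * gr_eval \<chi> s * gr_eval \<chi> u * gr_eval \<chi> v = gr_eval \<chi> a * gr_eval \<chi> t * gr_eval \<chi> u * gr_eval \<chi> v"
    proof -
      have "gr_eval \<chi> b * gr_eval \<chi> s * gr_eval \<chi> u * gr_eval \<chi> v = (gr_eval \<chi> b * gr_eval \<chi> v) * (gr_eval \<chi> s * gr_eval \<chi> u)"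
        by (simp add: mult_ac)
      also have "\<dots> = (gr_eval \<chi> a * gr_eval \<chi> u) * (gr_eval \<chi> t * gr_eval \<chi> v)" by (simp only: 1)
      also have "\<dots> = gr_eval \<chi> a * gr_eval \<chi> t * gr_eval \<chi> u * gr_eval \<chi> v" by (simp add: mult_ac)
      finally show ?thesis .
    qed
    hence "gr_eval \<chi> b * gr_eval \<chi> s = gr_eval \<chi> a * gr_eval \<chi> t" using 2 by simp
    thus ?thesis using 2 by (simp add: frac_eq_eq)
  qed
  show ?thesis unfolding quot_eval_def
  proof (rule some_equality)
    show "\<exists>(b, t)\<in>R.cls a s. gr_eval \<chi> a / gr_eval \<chi> s = gr_eval \<chi> b / gr_eval \<chi> t"
      by (rule bexI[OF _ R.cls_self[OF assms]]) simp
    fix v assume "\<exists>(b, t)\<in>R.cls a s. v = gr_eval \<chi> b / gr_eval \<chi> t"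
    then obtain b t where "(b, t) \<in> R.cls a s" "v = gr_eval \<chi> b / gr_eval \<chi> t" by blast
    thus "v = gr_eval \<chi> a / gr_eval \<chi> s" using val by simp
  qed
qed

lemma quot_eval_additive: "additive_map K type_ring (quot_eval \<chi>)"
  unfolding additive_map_def
proof (intro conjI ballI)
  fix A B assume "A \<in> carrier K" "B \<in> carrier K"
  then obtain a b s where *: "a \<in> ZG" "b \<in> ZG"
    "s \<in> R.NZ" "A = R.cls a s" "B = R.cls b s"
    unfolding quot_field_def by (rule R.Q_cases2)
  have ab: "a +[group_ring \<Gamma>] b \<in> ZG" by (rule R.a_closed[OF *(1,2)])
  have "quot_eval \<chi> (A +[K] B) = gr_eval \<chi> (a +[group_ring \<Gamma>] b) / gr_eval \<chi> s"
    unfolding *(4,5) quot_field_def R.add_cls[OF *(1-3)] by (rule quot_eval_cls[OF ab *(3)])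
  thus "quot_eval \<chi> (A +[K] B) = quot_eval \<chi> A +[type_ring] quot_eval \<chi> B"
    unfolding *(4,5) quot_eval_cls[OF *(1,3)] quot_eval_cls[OF *(2,3)] by (simp add: gr_eval_linear add_divide_distrib)
qed simp

lemma quot_eval_one: "quot_eval \<chi> 1[K] = 1"
proof -
  have "gr_eval \<chi> (frag_of 1[\<Gamma>]) ~= 0" using inj[of "frag_of 1[\<Gamma>]"] by auto
  thus ?thesis
    using quot_eval_cls[of "frag_of 1[\<Gamma>]" "frag_of 1[\<Gamma>]"] by (simp flip: quot_incl_one add: quot_incl_cls)
qed

lemma quot_eval_emb:
  assumes "\<gamma> \<in> carrier \<Gamma>" "A \<in> carrier K"
  shows "quot_eval \<chi> (emb \<gamma> *[K] A) = \<chi> \<gamma> * quot_eval \<chi> A"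
proof -
  obtain a s where *: "a \<in> ZG" "s \<in> R.NZ" "A = R.cls a s"
    by (rule R.Q_cases[OF assms(2)[unfolded quot_field_def]])
  have g: "frag_of \<gamma> \<in> ZG" using assms by simp
  have "emb \<gamma> *[K] A = R.cls (frag_of \<gamma> *[group_ring \<Gamma>] a) s"
    unfolding quot_incl_cls quot_field_def using R.mult_cls[OF g one_nz *(1,2)] R.l_one[OF *(1)] *(3) by simp
  hence "quot_eval \<chi> (emb \<gamma> *[K] A) = gr_eval \<chi> (frag_of \<gamma> *[group_ring \<Gamma>] a) / gr_eval \<chi> s"
    using quot_eval_cls[OF R.m_closed[OF g *(1)] *(2)] by simp
  also have "\<dots> = \<chi> \<gamma> * (gr_eval \<chi> a / gr_eval \<chi> s)"
    using gr_eval_mult[OF chi, of "frag_of \<gamma>" a] assms *(1) by (simp add: gr_eval_linear)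
  finally show ?thesis unfolding *(3) quot_eval_cls[OF *(1,2)] .
qed

text \<open>Every such derivation \<open>d\<close> factors through the universal one: the functional
  \<open>m [h] \<mapsto> quot_eval \<chi> m * d h\<close> kills boundaries by the derivation rule,
  and its value on \<open>1 [g]\<close> is \<open>d g\<close>. The argument of \<open>\<chi>\<close>
  is inverted because a left module is turned into a right one in the bar complex.\<close>

lemma derivation_vanishes:
  assumes d: "!!g h. g \<in> carrier G ==> h \<in> carrier G ==> d (g *[G] h) = d g + \<chi> (inv[\<Gamma>] \<rho> g) * d h"
    and g: "g \<in> carrier G" and B: "chain_single K [g] 1[K] \<in> B1"
  shows "d g = 0"
proof -
  let ?\<Phi> = "%x m. quot_eval \<chi> m * d (x ! 0)"
  have \<Phi>: "additive_map K type_ring (?\<Phi> x)" for x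
    using quot_eval_additive by (simp add: additive_map_def distrib_right)
  interpret L: abelian_group "type_ring :: 'l ring" by (rule abelian_group_type_ring)
  interpret KL: two_modules K "type_ring :: 'l ring" ..
  obtain b where b: "b \<in> bar_chains (Suc 1) G K" "chain_single K [g] 1[K] = bd b"
    using B unfolding in_boundaries by blast
  have "d g = ?\<Phi> [g] 1[K]" by (simp add: quot_eval_one)
  also have "\<dots> = chain_eval K type_ring ?\<Phi> (chain_single K [g] 1[K])"
    by (rule eval_chain_single[where k = 1, OF _ K.one_closed abelian_group_type_ring \<Phi>, symmetric]) (use g in \<open>simp add: tuples_def\<close>)
  also have "\<dots> = chain_eval K type_ring (%x m. \<Oplus>\<^bsub>type_ring\<^esub>i\<in>{..length x}. ?\<Phi> (face G i x) (face_coeff G K (KG_act \<Gamma> \<rho>) i x m)) b"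
    unfolding b(2) by (rule eval_boundary[OF b(1) abelian_group_type_ring \<Phi>])
  also have "\<dots> = 0[type_ring]"
  proof (rule KL.eval_zero_fun[OF b(1)])
    fix x m assume "x \<in> tuples (Suc 1) G" and m: "m \<in> carrier K"
    then obtain p h where ph: "p \<in> carrier G" "h \<in> carrier G" "x = [p, h]"
      unfolding One_nat_def tuples_2 by blast
    have "(\<Oplus>\<^bsub>type_ring\<^esub>i\<in>{..length x}. ?\<Phi> (face G i x) (face_coeff G K (KG_act \<Gamma> \<rho>) i x m)) =
      ?\<Phi> [h] (KG_act \<Gamma> \<rho> (inv[G] p) m) +[type_ring] (?\<Phi> [p *[G] h] (-[K] m) +[type_ring] ?\<Phi> [p] m)"
      unfolding ph(3) by (rule boundary_summand_2[OF ph(1,2) m abelian_group_type_ring \<Phi>])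
    also have "\<dots> = 0"
      using additive_map_minus[OF K.abelian_group_axioms abelian_group_type_ring quot_eval_additive m]
        quot_eval_emb[of "inv[\<Gamma>] \<rho> p" m] d[OF ph(1,2)] ph m
      by (simp add: act_def algebra_simps)
    finally show "(\<Oplus>\<^bsub>type_ring\<^esub>i\<in>{..length x}. ?\<Phi> (face G i x) (face_coeff G K (KG_act \<Gamma> \<rho>) i x m)) = 0[type_ring]" by simp
  qed
  finally show ?thesis by simp
qed

end

end

section \<open>The torsion-free derived series\<close>

lemma group_Mod_hom: "N \<lhd> G ==> (%h. N #>[G] h) \<in> hom G (G Mod N)"
  by (rule normal.r_coset_hom_Mod)

lemma skew_coeff_Mod: "group G ==> N \<lhd> G ==> ore_group (G Mod N) ==> skew_coeff G (G Mod N) (%h. N #>[G] h)"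
  unfolding skew_coeff_def skew_coeff_axioms_def using group_Mod_hom by auto

context skew_coeff begin

lemma ZG_coeff: "coeff G (group_ring \<Gamma>) (ZG_act \<Gamma> \<rho>)"
proof -
  have act: "ZG_act \<Gamma> \<rho> g m = frag_of (\<rho> g) *[group_ring \<Gamma>] m" for g m by (simp add: ZG_act_def)
  have f: "frag_of \<gamma> \<in> ZG" if "\<gamma> \<in> carrier \<Gamma>" for \<gamma> using that by simp
  have fm: "frag_of (\<gamma> *[\<Gamma>] \<delta>) = frag_of \<gamma> *[group_ring \<Gamma>] frag_of \<delta>" for \<gamma> \<delta> by simp
  show ?thesis
  proof
    fix g h m assume g: "g \<in> carrier G"
    thus "additive_map (group_ring \<Gamma>) (group_ring \<Gamma>) (ZG_act \<Gamma> \<rho> g)"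
      unfolding additive_map_def act using f[of "\<rho> g"] by (metis R.m_closed R.r_distr rho.hom_closed)
    assume h: "h \<in> carrier G" and m: "m \<in> ZG"
    show "ZG_act \<Gamma> \<rho> (g *[G] h) m = ZG_act \<Gamma> \<rho> g (ZG_act \<Gamma> \<rho> h m)"
      unfolding act rho.hom_mult[OF g h] fm by (rule R.m_assoc[OF f f m]) (use g h in auto)
  next
    fix m assume m: "m \<in> ZG"
    show "ZG_act \<Gamma> \<rho> 1[G] m = m" unfolding act using R.l_one[OF m] by simp
  qed
qed

lemma incl_coeff_map: "coeff_map G (group_ring \<Gamma>) (ZG_act \<Gamma> \<rho>) G K (KG_act \<Gamma> \<rho>) (%h. h) (quot_incl \<Gamma>)"
  unfolding coeff_map_def coeff_map_axioms_def
proof (intro conjI allI impI)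
  show "coeff G (group_ring \<Gamma>) (ZG_act \<Gamma> \<rho>)" by (rule ZG_coeff)
  show "coeff G K (KG_act \<Gamma> \<rho>)" by unfold_locales
  show "(%h. h) \<in> hom G G" by (simp add: hom_def)
  show "additive_map (group_ring \<Gamma>) K (quot_incl \<Gamma>)"
    unfolding additive_map_def using quot_incl_closed quot_incl_add by blast
  fix g m assume "g \<in> carrier G" "m \<in> ZG"
  thus "quot_incl \<Gamma> (ZG_act \<Gamma> \<rho> g m) = KG_act \<Gamma> \<rho> g (quot_incl \<Gamma> m)"
    unfolding act_def ZG_act_def by (intro quot_incl_mult) auto
qed

text \<open>Removes the detour through the integral group ring in the definition of the series: the
  map out of \<open>N\<close> is the restriction of the universal derivation.\<close>

lemma class_of_integral_single:
  assumes g: "g \<in> carrier G"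
  shows "homology_map 1 (group_ring \<Gamma>) G K (KG_act \<Gamma> \<rho>) (%h. h) (quot_incl \<Gamma>)
    (homology_class 1 G (group_ring \<Gamma>) (ZG_act \<Gamma> \<rho>) (chain_single (group_ring \<Gamma>) [g] 1[group_ring \<Gamma>])) = universal_derivation g"
proof -
  interpret I: coeff_map G "group_ring \<Gamma>" "ZG_act \<Gamma> \<rho>" G K "KG_act \<Gamma> \<rho>" "%h. h" "quot_incl \<Gamma>"
    by (rule incl_coeff_map)
  have c: "chain_single (group_ring \<Gamma>) [g] 1[group_ring \<Gamma>] \<in> bar_chains 1 G (group_ring \<Gamma>)"
    by (rule I.C.single_closed[OF g R.one_closed])
  have e: "chain_map (group_ring \<Gamma>) K (%h. h) (quot_incl \<Gamma>) (chain_single (group_ring \<Gamma>) [g] 1[group_ring \<Gamma>]) = chain_single K [g] 1[K]"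
    using I.cm_single[OF R.one_closed, of "[g]"] by (simp add: quot_incl_one)
  show ?thesis unfolding I.homology_map_class[OF c] e universal_derivation_def single_class_def ..
qed

definition int_emb :: "int => 'g \<Rightarrow>\<^sub>0 int" where
  "int_emb n = frag_cmul n (frag_of 1[\<Gamma>])"

lemma int_emb:
  "int_emb n \<in> ZG" "n ~= 0 ==> int_emb n \<in> R.NZ"
  "int_emb (n + m) = int_emb n +[group_ring \<Gamma>] int_emb m"
  "int_emb (n * m) = int_emb n *[group_ring \<Gamma>] int_emb m"
proof -
  have k: "Poly_Mapping.keys (int_emb n) <= carrier \<Gamma>" for n
    unfolding int_emb_def using keys_cmul[of n "frag_of 1[\<Gamma>]"] by auto
  show "int_emb n \<in> ZG" using k by simp
  show "n ~= 0 ==> int_emb n \<in> R.NZ" using k by (simp add: int_emb_def)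
  show "int_emb (n + m) = int_emb n +[group_ring \<Gamma>] int_emb m" by (simp add: int_emb_def frag_cmul_distrib)
  have "frag_extend (%x. frag_of (x *[\<Gamma>] 1[\<Gamma>])) (int_emb n) = int_emb n"
    by (simp add: int_emb_def frag_extend_cmul)
  thus "int_emb (n * m) = int_emb n *[group_ring \<Gamma>] int_emb m"
    by (simp add: int_emb_def gr_mult_linear gr_mult_def frag_extend_cmul mult.commute)
qed

text \<open>The inclusion of the rationals in the skew field, which exists because nonzero integers
  are nonzero in the group ring. It links rational homology with the first step of the
  series.\<close>

definition rat_emb :: "rat => 'g qelem" where
  "rat_emb q = R.cls (int_emb (fst (quotient_of q))) (int_emb (snd (quotient_of q)))"

lemma rat_emb_eq:
  assumes "d ~= 0" "q = of_int n / of_int d" shows "rat_emb q = R.cls (int_emb n) (int_emb d)"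
proof -
  obtain n' d' where q: "quotient_of q = (n', d')" by (cases "quotient_of q")
  have d': "d' > 0" "q = of_int n' / of_int d'" using quotient_of_denom_pos[OF q] quotient_of_div[OF q] by auto
  have "of_int (n * d') = (of_int (n' * d) :: rat)" using assms d' by (simp add: field_simps)
  hence nd: "n * d' = n' * d" by (simp only: of_int_eq_iff)
  have "R.cls (int_emb n) (int_emb d) = R.cls (int_emb (n * d')) (int_emb (d * d'))"
    using R.cls_expand[OF int_emb(1,2,2), of d d' n] assms(1) d' by (simp add: int_emb(4) del: group_ring_simps)
  also have "\<dots> = R.cls (int_emb (n' * d)) (int_emb (d' * d))" by (simp only: nd mult.commute[of d d'])
  also have "\<dots> = R.cls (int_emb n') (int_emb d')"
    using R.cls_expand[OF int_emb(1,2,2), of d' d n'] assms(1) d' by (simp add: int_emb(4) del: group_ring_simps)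
  finally show ?thesis by (simp add: rat_emb_def q)
qed

lemma rat_emb_additive: "additive_map rat_ring K rat_emb"
  unfolding additive_map_def
proof (intro conjI ballI)
  fix q r :: rat
  obtain n d where q: "quotient_of q = (n, d)" by (cases "quotient_of q")
  obtain n' d' where r: "quotient_of r = (n', d')" by (cases "quotient_of r")
  have d: "d ~= 0" "q = of_int n / of_int d" using quotient_of_denom_pos[OF q] quotient_of_div[OF q] by auto
  have d': "d' ~= 0" "r = of_int n' / of_int d'" using quotient_of_denom_pos[OF r] quotient_of_div[OF r] by auto
  have dd: "d * d' ~= 0" using d d' by simp
  show "rat_emb q \<in> carrier K" unfolding rat_emb_eq[OF d] quot_field_def using int_emb d(1) by (intro R.cls_closed)
  have 1: "rat_emb q = R.cls (int_emb (n * d')) (int_emb (d * d'))" by (rule rat_emb_eq[OF dd]) (use d d' in simp)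
  have 2: "rat_emb r = R.cls (int_emb (n' * d)) (int_emb (d * d'))" by (rule rat_emb_eq[OF dd]) (use d d' in simp)
  have "rat_emb (q + r) = R.cls (int_emb (n * d' + n' * d)) (int_emb (d * d'))"
    by (rule rat_emb_eq[OF dd]) (use d d' in \<open>simp add: field_simps\<close>)
  also have "\<dots> = rat_emb q +[K] rat_emb r"
    unfolding 1 2 quot_field_def R.add_cls[OF int_emb(1) int_emb(1) int_emb(2)[OF dd]] int_emb(3) ..
  finally show "rat_emb (q +[rat_ring] r) = rat_emb q +[K] rat_emb r" by (simp add: rat_ring_type_ring)
qed

lemma rat_emb_one: "rat_emb 1 = 1[K]"
  using rat_emb_eq[of 1 1 1] quot_incl_one by (simp add: int_emb_def quot_incl_cls)

text \<open>If \<open>\<rho>\<close> is trivial, the inclusion of the rationals is equivariant for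
  the trivial action and so induces a chain map.\<close>

lemma rational_boundary:
  assumes "!!g. g \<in> carrier G ==> \<rho> g = 1[\<Gamma>]" "rat_single [g] 1 \<in> rat_boundaries 1 G"
  shows "chain_single K [g] 1[K] \<in> B1"
proof -
  have "coeff_map G rat_ring (%g q. q) G K (KG_act \<Gamma> \<rho>) (%g. g) rat_emb"
    unfolding coeff_map_def coeff_map_axioms_def
  proof (intro conjI allI impI)
    show "coeff G rat_ring (%g q. q)" by (rule rat_coeff) unfold_locales
    show "coeff G K (KG_act \<Gamma> \<rho>)" by unfold_locales
    show "(%h. h) \<in> hom G G" by (simp add: hom_def)
    show "additive_map rat_ring K rat_emb" by (rule rat_emb_additive)
    fix g m assume "g \<in> carrier G" "m \<in> carrier rat_ring"
    thus "rat_emb m = KG_act \<Gamma> \<rho> g (rat_emb m)"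
      using assms(1) additive_mapD(1)[OF rat_emb_additive] by (simp add: act_def quot_incl_one)
  qed
  then interpret I: coeff_map G rat_ring "%g q. q" G K "KG_act \<Gamma> \<rho>" "%g. g" rat_emb .
  have "chain_map rat_ring K (%g. g) rat_emb (rat_single [g] 1) = chain_single K [g] 1[K]"
    using I.cm_single[of 1 "[g]"] by (simp add: rat_emb_one rat_ring_type_ring)
  thus ?thesis using I.cm_boundaries[OF assms(2)] by simp
qed

end

section \<open>The series in terms of the universal derivation\<close>

lemma series_map_eq:
  assumes "skew_coeff G (G Mod N) (%h. N #>[G] h)" "g \<in> carrier G"
  shows "series_map G N g = skew_coeff.universal_derivation G (G Mod N) (%h. N #>[G] h) g"
  unfolding skew_coeff.class_of_integral_single[OF assms, symmetric]
  by (simp only: series_map_def abelianization_map_def chain_single_def)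

lemma tf_derived_Suc:
  assumes S: "skew_coeff G (G Mod tf_derived G k) (%h. tf_derived G k #>[G] h)" and sub: "tf_derived G k <= carrier G"
  shows "tf_derived G (Suc k) = {g \<in> tf_derived G k.
    skew_coeff.universal_derivation G (G Mod tf_derived G k) (%h. tf_derived G k #>[G] h) g =
    boundaries 1 G (quot_field (G Mod tf_derived G k)) (KG_act (G Mod tf_derived G k) (%h. tf_derived G k #>[G] h))}"
proof -
  interpret skew_coeff G "G Mod tf_derived G k" "%h. tf_derived G k #>[G] h" by (rule S)
  have "series_map G (tf_derived G k) g = universal_derivation g" if "g \<in> tf_derived G k" for g
    using series_map_eq[OF S] that sub by auto
  thus ?thesis by (auto simp: kernel_def H1K_eq H1_one)
qed

lemma tf_derived_subset: "tf_derived G (Suc k) <= tf_derived G k"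
  by (auto simp: kernel_def)

lemma tf_derived_mono: "j \<le> k ==> tf_derived G k <= tf_derived G j"
  by (rule lift_Suc_antimono_le[where f = "tf_derived G"]) (rule tf_derived_subset)

lemma tf_derived_carrier: "tf_derived G k <= carrier G"
  using tf_derived_mono[of 0 k G] by simp

lemma Mod_eq_iff:
  assumes "group G" "N \<lhd> G" "x \<in> carrier G" "y \<in> carrier G"
  shows "N #>[G] x = N #>[G] y \<longleftrightarrow> x *[G] inv[G] y \<in> N"
proof -
  interpret group G by fact
  interpret N: normal N G by fact
  have s: "subgroup N G" by (rule N.subgroup_axioms)
  have "x *[G] inv[G] y \<in> N \<longleftrightarrow> x \<in> N #>[G] y" using subgroup.rcos_module[OF s is_group assms(4,3)] by simp
  also have "\<dots> \<longleftrightarrow> N #>[G] x = N #>[G] y"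
    using repr_independence[OF _ assms(4) s, of x] rcos_self[OF assms(3) s] by auto
  finally show ?thesis by simp
qed

text \<open>The two claims are proved together, as each step of the series presupposes the skew
  field of the preceding quotient. The universal derivation is a homomorphism on \<open>N\<close>
  with kernel \<open>N'\<close>, and embeds \<open>N / N'\<close> into the torsion-free abelian
  group \<open>C1\<close>.\<close>

lemma tf_derived_normal_ore:
  fixes G :: "'a monoid"
  assumes G: "group G"
  shows "tf_derived G k \<lhd> G & ore_group (G Mod tf_derived G k)"
proof (induction k)
  case 0
  interpret group G by fact
  have n: "carrier G \<lhd> G" unfolding normal_inv_iff using subgroup_self by auto
  interpret N: normal "carrier G" G by (rule n)
  have "ore_group (G Mod carrier G)"
  proof (rule ore_group_trivial)
    show "group (G Mod carrier G)" by (rule N.factorgroup_is_group)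
    have "carrier G #>[G] x = carrier G" if "x \<in> carrier G" for x using coset_join2[OF that subgroup_self that] .
    thus "carrier (G Mod carrier G) = {1[G Mod carrier G]}" by (auto simp: FactGroup_def RCOSETS_def)
  qed
  with n show ?case by simp
next
  case (Suc k)
  define N where "N = tf_derived G k"
  define N' where "N' = tf_derived G (Suc k)"
  have nN: "N \<lhd> G" and oN: "ore_group (G Mod N)" using Suc by (auto simp: N_def)
  interpret group G by fact
  interpret N: normal N G by (rule nN)
  interpret S: skew_coeff G "G Mod N" "%h. N #>[G] h" by (rule skew_coeff_Mod[OF G nN oN])
  interpret C: comm_group S.C1 by (rule S.C1_comm_group)
  let ?D = S.universal_derivation
  have mem: "g \<in> N' \<longleftrightarrow> g \<in> N & ?D g = 1[S.C1]" for g
    unfolding N'_def N_def using tf_derived_Suc[OF S.skew_coeff_axioms[unfolded N_def] tf_derived_carrier] by (auto simp: FactGroup_def)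
  have Nc: "g \<in> carrier G" if "g \<in> N" for g using that N.subset by blast
  have rN: "N #>[G] g = 1[G Mod N] \<longleftrightarrow> g \<in> N" if "g \<in> carrier G" for g
    using coset_join1[OF _ that N.subgroup_axioms] coset_join2[OF that N.subgroup_axioms] by (auto simp: FactGroup_def)
  have Dm: "?D (g *[G] h) = ?D g *[S.C1] ?D h" if "g \<in> N" "h \<in> N" for g h
    by (rule S.universal_derivation_kernel_mult) (use that Nc rN in auto)
  have Dc: "?D g \<in> carrier S.C1" if "g \<in> N" for g using that Nc S.universal_derivation_closed by auto
  have Di: "?D (inv[G] g) = inv[S.C1] ?D g" if "g \<in> N" for g
    using Dm[of "inv[G] g" g] that Nc S.universal_derivation_one Dc C.inv_equality[of "?D (inv[G] g)" "?D g"] by simp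
  have nN': "N' \<lhd> G" unfolding normal_inv_iff
  proof (intro conjI ballI)
    show "subgroup N' G"
    proof (rule subgroupI)
      show "N' <= carrier G" using mem Nc by auto
      have "1[G] \<in> N'" unfolding mem using S.universal_derivation_one by simp
      thus "N' ~= {}" by blast
    qed (use mem Dm Di Dc in auto)
    \<comment> \<open>Conjugation by \<open>g\<close> acts on the values of the derivation as right
      multiplication by a group element, which fixes the zero class.\<close>
    fix g n assume g: "g \<in> carrier G" and n: "n \<in> N'"
    have "?D (g *[G] n *[G] inv[G] g) = S.rmul (S.emb (inv[G Mod N] (N #>[G] g))) (?D n)"
      by (rule S.universal_derivation_conj[OF g]) (use n mem Nc rN in auto)
    also have "\<dots> = 1[S.C1]" using n mem S.rmul_one_class[OF S.emb_closed] g by simp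
    finally show "g *[G] n *[G] inv[G] g \<in> N'" unfolding mem using N.inv_op_closed2[OF g] n mem by auto
  qed
  interpret N': normal N' G by (rule nN')
  \<comment> \<open>The projection from \<open>G / N'\<close> to \<open>G / N\<close>; multiplying a
    coset by \<open>N\<close> avoids a choice of representatives.\<close>
  define p where "p = (%A. N <#>\<^bsub>G\<^esub> A)"
  have p: "p (N' #>[G] g) = N #>[G] g" if g: "g \<in> carrier G" for g
  proof -
    have "N <#>\<^bsub>G\<^esub> (N' #>[G] g) = (N <#>\<^bsub>G\<^esub> N') #>[G] g"
      using setmult_rcos_assoc[OF N.subset N'.subset g] .
    also have "N <#>\<^bsub>G\<^esub> N' = N"
    proof
      have sub: "N' <= N" using mem by blast
      show "N <#>\<^bsub>G\<^esub> N' <= N" using subsetD[OF sub] by (auto simp: set_mult_def)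
      have "n = n *[G] 1[G]" if "n \<in> N" for n using that Nc by simp
      thus "N <= N <#>\<^bsub>G\<^esub> N'" using N'.one_closed unfolding set_mult_def by blast
    qed
    finally show ?thesis by (simp add: p_def)
  qed
  have car: "A \<in> carrier (G Mod H) \<longleftrightarrow> (\<exists>g\<in>carrier G. A = H #>[G] g)" for A H
    by (auto simp: FactGroup_def RCOSETS_def)
  have mult: "(H #>[G] g) *[G Mod H] (H #>[G] h) = H #>[G] (g *[G] h)" if "H \<lhd> G" "g \<in> carrier G" "h \<in> carrier G" for H g h
    using normal.rcos_sum[OF that] by (simp add: FactGroup_def)
  have pow: "(N' #>[G] g) [^]\<^bsub>G Mod N'\<^esub> (n::nat) = N' #>[G] (g [^]\<^bsub>G\<^esub> n)" if g: "g \<in> carrier G" for g n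
  proof (induction n)
    case 0
    show ?case using coset_mult_one[OF N'.subset] by (simp add: one_FactGroup)
  next
    case (Suc n)
    thus ?case using g by (simp add: mult[OF nN'])
  qed
  have ker: "\<exists>g\<in>N. A = N' #>[G] g" if A: "A \<in> kernel (G Mod N') (G Mod N) p" for A
  proof -
    obtain g where g: "g \<in> carrier G" "A = N' #>[G] g" "p A = 1[G Mod N]" using A by (auto simp: kernel_def car)
    thus ?thesis using p rN by auto
  qed
  have one': "N' #>[G] g = 1[G Mod N'] \<longleftrightarrow> g \<in> N'" if "g \<in> carrier G" for g
    using coset_join1[OF _ that N'.subgroup_axioms] coset_join2[OF that N'.subgroup_axioms] by (auto simp: FactGroup_def)
  have "ore_group (G Mod N')"
  proof (rule ore_group_extension[OF N'.factorgroup_is_group oN])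
    show "p \<in> hom (G Mod N') (G Mod N)"
    proof (rule homI)
      fix A B assume "A \<in> carrier (G Mod N')" "B \<in> carrier (G Mod N')"
      then obtain g h where gh: "g \<in> carrier G" "h \<in> carrier G" "A = N' #>[G] g" "B = N' #>[G] h" by (auto simp: car)
      show "p A \<in> carrier (G Mod N)" unfolding gh(3) p[OF gh(1)] car using gh(1) by blast
      show "p (A *[G Mod N'] B) = p A *[G Mod N] p B"
        unfolding gh(3,4) mult[OF nN' gh(1,2)] p[OF m_closed[OF gh(1,2)]] p[OF gh(1)] p[OF gh(2)] mult[OF nN gh(1,2)] ..
    qed
    show "p ` carrier (G Mod N') = carrier (G Mod N)"
    proof
      show "p ` carrier (G Mod N') <= carrier (G Mod N)"
      proof (rule image_subsetI)
        fix A assume "A \<in> carrier (G Mod N')"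
        then obtain g where g: "g \<in> carrier G" "A = N' #>[G] g" by (auto simp: car)
        show "p A \<in> carrier (G Mod N)" unfolding g(2) p[OF g(1)] car using g(1) by blast
      qed
      show "carrier (G Mod N) <= p ` carrier (G Mod N')"
      proof
        fix B assume "B \<in> carrier (G Mod N)"
        then obtain g where g: "g \<in> carrier G" "B = N #>[G] g" by (auto simp: car)
        have "N' #>[G] g \<in> carrier (G Mod N')" unfolding car using g(1) by blast
        moreover have "B = p (N' #>[G] g)" unfolding p[OF g(1)] by (rule g(2))
        ultimately show "B \<in> p ` carrier (G Mod N')" by blast
      qed
    qed
  next
    fix A B assume A: "A \<in> kernel (G Mod N') (G Mod N) p" and B: "B \<in> kernel (G Mod N') (G Mod N) p"
    obtain g h where gh: "g \<in> N" "h \<in> N" "A = N' #>[G] g" "B = N' #>[G] h" using ker[OF A] ker[OF B] by blast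
    have c: "g \<in> carrier G" "h \<in> carrier G" using gh Nc by auto
    have m: "g *[G] h \<in> N" "inv[G] (h *[G] g) \<in> N" "h *[G] g \<in> N" using gh by auto
    \<comment> \<open>On \<open>N\<close> the derivation is a homomorphism to a commutative group,
      hence kills commutators.\<close>
    have "?D (g *[G] h *[G] inv[G] (h *[G] g)) = 1[S.C1]"
      unfolding Dm[OF m(1,2)] Di[OF m(3)] Dm[OF gh(1,2)] Dm[OF gh(2,1)] C.m_comm[OF Dc[OF gh(2)] Dc[OF gh(1)]]
      using Dc gh by (simp add: C.r_inv)
    hence "g *[G] h *[G] inv[G] (h *[G] g) \<in> N'" unfolding mem using N.m_closed[OF m(1,2)] by simp
    hence "N' #>[G] (g *[G] h) = N' #>[G] (h *[G] g)" using Mod_eq_iff[OF G nN'] c by simp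
    thus "A *[G Mod N'] B = B *[G Mod N'] A" using gh c by (simp add: mult[OF nN'])
  next
    fix A and n :: nat assume A: "A \<in> kernel (G Mod N') (G Mod N) p" and n: "n > 0" and e: "A [^]\<^bsub>G Mod N'\<^esub> n = 1[G Mod N']"
    obtain g where g: "g \<in> N" "A = N' #>[G] g" using ker[OF A] by blast
    have c: "g \<in> carrier G" using g Nc by auto
    have "g [^]\<^bsub>G\<^esub> n \<in> N'" using e one' c unfolding g(2) pow[OF c] by auto
    hence "?D g [^]\<^bsub>S.C1\<^esub> n = 1[S.C1]" using S.universal_derivation_pow[OF c] rN c g(1) unfolding mem by simp
    hence "?D g = 1[S.C1]" using S.C1_torsion_free[OF Dc[OF g(1)] n] by blast
    hence "g \<in> N'" using g(1) unfolding mem by simp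
    thus "A = 1[G Mod N']" unfolding g(2) using one' c by blast
  qed
  thus ?case using nN' by (simp only: N'_def)
qed

lemma tf_derived_skew_coeff:
  "group G ==> skew_coeff G (G Mod tf_derived G k) (%h. tf_derived G k #>[G] h)"
  using skew_coeff_Mod tf_derived_normal_ore by blast

text \<open>In this form, that the chain \<open>1 [g]\<close> bounds, membership can be moved from
  one coefficient field to another.\<close>

lemma mem_tf_derived_Suc:
  assumes "group G"
  shows "g \<in> tf_derived G (Suc k) \<longleftrightarrow> g \<in> tf_derived G k &
    chain_single (quot_field (G Mod tf_derived G k)) [g] 1[quot_field (G Mod tf_derived G k)] \<in>
    boundaries 1 G (quot_field (G Mod tf_derived G k)) (KG_act (G Mod tf_derived G k) (%h. tf_derived G k #>[G] h))"
proof -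
  interpret S: skew_coeff G "G Mod tf_derived G k" "%h. tf_derived G k #>[G] h" by (rule tf_derived_skew_coeff[OF assms])
  show ?thesis
    using tf_derived_Suc[OF S.skew_coeff_axioms tf_derived_carrier] S.universal_derivation_one_iff tf_derived_carrier[of G k]
    by (auto simp: S.C1_one)
qed

text \<open>The coefficients of the series show that \<open>c\<close> is orthogonal to all powers of
  the exponents, hence to all polynomials. A polynomial that vanishes at all exponents but
  \<open>\<nu>\<close> isolates \<open>c \<nu>\<close>.\<close>

lemma exponentials_independent:
  fixes c :: "'k::field_char_0 => 'k"
  assumes "finite S" "(\<Sum>\<mu>\<in>S. fps_const (c \<mu>) * fps_exp \<mu>) = 0" "\<nu> \<in> S"
  shows "c \<nu> = 0"
proof -
  have n: "(\<Sum>\<mu>\<in>S. c \<mu> * \<mu> ^ n) = 0" for n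
  proof -
    have "(\<Sum>\<mu>\<in>S. c \<mu> * (\<mu> ^ n / fact n)) = 0" using arg_cong[OF assms(2), of "%f. fps_nth f n"] by (simp add: fps_sum_nth)
    hence "(\<Sum>\<mu>\<in>S. c \<mu> * \<mu> ^ n) / fact n = 0" by (simp add: sum_divide_distrib)
    thus ?thesis by simp
  qed
  have p: "(\<Sum>\<mu>\<in>S. c \<mu> * poly q \<mu>) = 0" for q
  proof -
    have "(\<Sum>\<mu>\<in>S. c \<mu> * poly q \<mu>) = (\<Sum>i\<le>degree q. \<Sum>\<mu>\<in>S. Polynomial.coeff q i * (c \<mu> * \<mu> ^ i))"
      by (subst sum.swap) (simp add: poly_altdef sum_distrib_left mult_ac)
    thus ?thesis by (simp add: sum_distrib_left[symmetric] n)
  qed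
  define q where "q = (\<Prod>\<mu>\<in>S - {\<nu>}. [:- \<mu>, 1:])"
  have "poly q \<mu> = 0" if "\<mu> \<in> S - {\<nu>}" for \<mu> using that assms(1) by (auto simp: q_def poly_prod prod_zero_iff)
  hence "(\<Sum>\<mu>\<in>S. c \<mu> * poly q \<mu>) = c \<nu> * poly q \<nu>"
    using assms(1,3) by (simp add: sum.remove[of S \<nu>])
  moreover have "poly q \<nu> ~= 0" using assms(1) by (auto simp: q_def poly_prod prod_zero_iff)
  ultimately show ?thesis using p[of q] by simp
qed

lemma additive_on_simps:
  assumes "group G" "additive_on G lam"
  shows "lam 1[G] = 0" "g \<in> carrier G ==> lam (inv[G] g) = - lam g"
proof -
  interpret group G by fact
  have "lam 1[G] = lam 1[G] + lam 1[G]" using assms(2) unfolding additive_on_def by (metis l_one one_closed)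
  thus 0: "lam 1[G] = 0" by simp
  assume g: "g \<in> carrier G"
  have "lam (inv[G] g *[G] g) = lam (inv[G] g) + lam g" using assms(2) g unfolding additive_on_def by blast
  hence "lam (inv[G] g) + lam g = 0" using g 0 by simp
  thus "lam (inv[G] g) = - lam g" by (rule eq_neg_iff_add_eq_0[THEN iffD2])
qed

text \<open>The first term of the series consists of the elements that die in rational homology, and
  \<open>lam\<close> detects these.\<close>

lemma tf_derived_1_iff:
  assumes G: "group G" and lam: "additive_on G lam" and inj: "injective_on_H1 G (lam :: 'a => 'k::field_char_0)"
    and g: "g \<in> carrier G"
  shows "g \<in> tf_derived G 1 \<longleftrightarrow> lam g = 0"
proof -
  interpret group G by fact
  interpret S: skew_coeff G "G Mod carrier G" "%h. carrier G #>[G] h" using tf_derived_skew_coeff[OF G, of 0] by simp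
  have e: "carrier G #>[G] x = carrier G" if "x \<in> carrier G" for x using coset_join2[OF that subgroup_self that] .
  have mem: "g \<in> tf_derived G 1 \<longleftrightarrow> chain_single S.K [g] 1[S.K] \<in> S.B1"
    using mem_tf_derived_Suc[OF G, of g 0] g by (simp add: One_nat_def)
  show ?thesis
  proof
    assume "g \<in> tf_derived G 1"
    hence B: "chain_single S.K [g] 1[S.K] \<in> S.B1" using mem by simp
    show "lam g = 0"
    \<comment> \<open>The quotient is the trivial group, its group ring is that of the integers, and
      these embed in a field of characteristic zero. For the trivial character a derivation is just
      an additive function.\<close>
    proof (rule S.derivation_vanishes[where \<chi> = "%_. 1", OF _ _ _ g B])
      fix a assume a: "a \<in> carrier (group_ring (G Mod carrier G))" "gr_eval (%_. 1 :: 'k) a = 0"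
      have "carrier (G Mod carrier G) <= {carrier G}" using e by (auto simp: FactGroup_def RCOSETS_def)
      hence k: "Poly_Mapping.keys a <= {carrier G}" using a(1) by auto
      have "of_int (poly_mapping.lookup a (carrier G)) = (0 :: 'k)"
        using a(2) gr_eval_superset[of "{carrier G}" a "%_. 1 :: 'k"] k by simp
      hence "carrier G \<notin> Poly_Mapping.keys a" by (simp add: in_keys_iff)
      thus "a = 0" using k by (metis keys_eq_empty subset_singletonD singletonI)
    qed (use lam in \<open>auto simp: additive_on_def\<close>)
  next
    assume 0: "lam g = 0"
    have "pairing1 lam (rat_single [g] 1) = 0"
      using pairing_single[OF G, where x = "[g]" and k = 1 and q = 1 and f = "%x. lam (x ! 0)"] g 0 by (simp add: tuples_def)
    hence "rat_single [g] 1 \<in> rat_boundaries 1 G" using inj rat_single_closed[OF g, of 1] unfolding injective_on_H1_def by blast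
    hence "chain_single S.K [g] 1[S.K] \<in> S.B1" by (rule S.rational_boundary[rotated]) (simp add: e FactGroup_def)
    thus "g \<in> tf_derived G 1" using mem by simp
  qed
qed

text \<open>\<open>(p, lam)\<close> is a homomorphism from \<open>G\<close> to the semidirect product of the power series ring by its
  additive group of constants, which acts through the exponential.\<close>

definition exp_derivation :: "'a monoid => ('a => 'k::field_char_0) => ('a => 'k fps) => bool" where
  "exp_derivation G lam p \<longleftrightarrow> (\<forall>g\<in>carrier G. \<forall>h\<in>carrier G. p (g *[G] h) = p g + fps_exp (lam g) * p h)"

lemma fps_to_fls_sum_distrib: "fps_to_fls (sum f S) = (\<Sum>x\<in>S. fps_to_fls (f x :: 'c::comm_ring_1 fps))"
  by (induction S rule: infinite_finite_induct) simp_all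

text \<open>By \<open>tf_derived_1_iff\<close> the function \<open>lam\<close> separates the cosets
  of \<open>G_H^(1)\<close>. So distinct elements of \<open>G / G_H^(1)\<close> act by distinct
  exponentials, the group ring embeds in the Laurent series, and \<open>p\<close> is a derivation to
  which \<open>derivation_vanishes\<close> applies.\<close>

lemma exp_derivation_kernel:
  fixes G :: "'a monoid"
  assumes G: "group G" and lam: "additive_on G lam" and inj: "injective_on_H1 G (lam :: 'a => 'k::field_char_0)"
    and p: "exp_derivation G lam p" and g: "g \<in> tf_derived G 2"
  shows "lam g = 0 & p g = 0"
proof -
  interpret group G by fact
  define N where "N = tf_derived G 1"
  have nN: "N \<lhd> G" using tf_derived_normal_ore[OF G] by (simp add: N_def)
  interpret N: normal N G by (rule nN)
  interpret S: skew_coeff G "G Mod N" "%h. N #>[G] h" unfolding N_def by (rule tf_derived_skew_coeff[OF G])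
  have gN: "g \<in> N" and B: "chain_single S.K [g] 1[S.K] \<in> S.B1"
    using g mem_tf_derived_Suc[OF G, of g 1] by (auto simp: N_def Suc_1)
  have gc: "g \<in> carrier G" using gN N.subset by blast
  have lamN: "x \<in> N \<longleftrightarrow> lam x = 0" if "x \<in> carrier G" for x unfolding N_def by (rule tf_derived_1_iff[OF G lam inj that])
  have lamm: "lam (x *[G] y) = lam x + lam y" if "x \<in> carrier G" "y \<in> carrier G" for x y using lam that by (simp add: additive_on_def)
  have coset: "N #>[G] x = N #>[G] y \<longleftrightarrow> lam x = lam y" if "x \<in> carrier G" "y \<in> carrier G" for x y
    unfolding Mod_eq_iff[OF G nN that] using lamN[of "x *[G] inv[G] y"] that by (simp add: lamm additive_on_simps[OF G lam])
  define r where "r A = lam (SOME x. x \<in> carrier G & A = N #>[G] x)" for A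
  have r: "r (N #>[G] x) = lam x" if x: "x \<in> carrier G" for x
  proof -
    define y where "y = (SOME y. y \<in> carrier G & N #>[G] x = N #>[G] y)"
    have "y \<in> carrier G & N #>[G] x = N #>[G] y" unfolding y_def by (rule someI[of _ x]) (use x in simp)
    thus ?thesis using coset[OF x, of y] by (simp add: r_def y_def)
  qed
  have car: "A \<in> carrier (G Mod N) ==> \<exists>x\<in>carrier G. A = N #>[G] x" for A by (auto simp: FactGroup_def RCOSETS_def)
  \<comment> \<open>The sign compensates for the inverse at which \<open>derivation_vanishes\<close>
    evaluates its character. Laurent series are used because the target has to be a field.\<close>
  define \<chi> where "\<chi> A = fps_to_fls (fps_exp (- r A))" for A
  have "fps_to_fls (p g) = 0"
  proof (rule S.derivation_vanishes[where \<chi> = \<chi> and d = "%g. fps_to_fls (p g)", OF _ _ _ gc B])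
    fix A A' assume A: "A \<in> carrier (G Mod N)" and A': "A' \<in> carrier (G Mod N)"
    obtain x where x: "x \<in> carrier G" "A = N #>[G] x" using car[OF A] by (rule bexE)
    obtain y where y: "y \<in> carrier G" "A' = N #>[G] y" using car[OF A'] by (rule bexE)
    note xy = x(1) y(1) x(2) y(2)
    have "A *[G Mod N] A' = N #>[G] (x *[G] y)" unfolding xy(3,4) mult_FactGroup by (rule N.rcos_sum[OF xy(1,2)])
    hence "\<chi> (A *[G Mod N] A') = fps_to_fls (fps_exp (- (lam x + lam y)))"
      using r[OF m_closed[OF xy(1,2)]] lamm[OF xy(1,2)] by (simp only: \<chi>_def)
    also have "\<dots> = fps_to_fls (fps_exp (- lam x)) * fps_to_fls (fps_exp (- lam y))"
      by (simp only: minus_add_distrib fps_exp_add_mult fls_times_fps_to_fls)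
    finally show "\<chi> (A *[G Mod N] A') = \<chi> A * \<chi> A'"
      unfolding \<chi>_def xy(3,4) r[OF xy(1)] r[OF xy(2)] .
  next
    fix x y assume xy: "x \<in> carrier G" "y \<in> carrier G"
    have i: "inv[G Mod N] (N #>[G] x) = N #>[G] inv[G] x" using S.rho.hom_inv[OF xy(1)] by simp
    have "r (inv[G Mod N] (N #>[G] x)) = - lam x"
      unfolding i using r[OF inv_closed[OF xy(1)]] additive_on_simps(2)[OF G lam xy(1)] by simp
    hence "\<chi> (inv[G Mod N] (N #>[G] x)) = fps_to_fls (fps_exp (lam x))"
      by (simp add: \<chi>_def)
    thus "fps_to_fls (p (x *[G] y)) = fps_to_fls (p x) + \<chi> (inv[G Mod N] (N #>[G] x)) * fps_to_fls (p y)"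
      using p xy by (simp add: exp_derivation_def fls_times_fps_to_fls)
  next
    fix a assume a: "a \<in> carrier (group_ring (G Mod N))" "gr_eval \<chi> a = 0"
    \<comment> \<open>The exponents belonging to different keys of \<open>a\<close> are different,
      so the value of \<open>a\<close> is a linear combination of independent exponentials, with the
      coefficients of \<open>a\<close>.\<close>
    define S where "S = (%A. - r A) ` Poly_Mapping.keys a"
    have kc: "Poly_Mapping.keys a <= carrier (G Mod N)" using a(1) by simp
    have inj: "inj_on (%A. - r A) (Poly_Mapping.keys a)"
    proof (rule inj_onI)
      fix A A' assume A: "A \<in> Poly_Mapping.keys a" and A': "A' \<in> Poly_Mapping.keys a" and e: "- r A = - r A'"
      have c: "A \<in> carrier (G Mod N)" "A' \<in> carrier (G Mod N)" using A A' kc by blast+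
      obtain x where x: "x \<in> carrier G" "A = N #>[G] x" using car[OF c(1)] by (rule bexE)
      obtain y where y: "y \<in> carrier G" "A' = N #>[G] y" using car[OF c(2)] by (rule bexE)
      note xy = x(1) y(1) x(2) y(2)
      hence "lam x = lam y" using e r[of x] r[of y] by simp
      thus "A = A'" using coset[OF xy(1,2)] xy(3,4) by simp
    qed
    define c where "c \<mu> = (of_int (poly_mapping.lookup a (inv_into (Poly_Mapping.keys a) (%A. - r A) \<mu>)) :: 'k)" for \<mu>
    have c: "c (- r A) = of_int (poly_mapping.lookup a A)" if "A \<in> Poly_Mapping.keys a" for A
      unfolding c_def using inv_into_f_f[OF inj that] by simp
    have "fps_to_fls (\<Sum>\<mu>\<in>S. fps_const (c \<mu>) * fps_exp \<mu>) = gr_eval \<chi> a"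
    proof -
      have "(\<Sum>\<mu>\<in>S. fps_const (c \<mu>) * fps_exp \<mu>) = (\<Sum>A\<in>Poly_Mapping.keys a. fps_const (c (- r A)) * fps_exp (- r A))"
        unfolding S_def by (simp add: sum.reindex[OF inj])
      also have "\<dots> = (\<Sum>A\<in>Poly_Mapping.keys a. of_int (poly_mapping.lookup a A) * fps_exp (- r A))"
        by (intro sum.cong) (auto simp: c fps_of_int)
      finally show ?thesis
        by (simp add: gr_eval_def \<chi>_def fps_to_fls_sum_distrib fls_times_fps_to_fls fps_to_fls_of_int)
    qed
    hence "(\<Sum>\<mu>\<in>S. fps_const (c \<mu>) * fps_exp \<mu>) = 0" using a(2) by (simp add: fps_to_fls_eq_0_iff)
    hence "c \<mu> = 0" if "\<mu> \<in> S" for \<mu> using exponentials_independent[OF _ _ that] by (simp add: S_def)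
    hence "poly_mapping.lookup a A = 0" if "A \<in> Poly_Mapping.keys a" for A using c[OF that] that by (auto simp: S_def)
    hence "poly_mapping.lookup a A = poly_mapping.lookup 0 A" for A by (cases "A \<in> Poly_Mapping.keys a") (simp_all add: in_keys_iff)
    thus "a = 0" by (rule poly_mapping_eqI)
  qed
  moreover have "lam g = 0" using lamN[OF gc] gN by simp
  ultimately show ?thesis by (simp add: fps_to_fls_eq_0_iff)
qed

section \<open>The Cochran--Harvey tower\<close>

lemma image_group_inj:
  assumes "group G" "inj_on e (carrier G)"
  shows "group (image_group e G)" "e \<in> hom G (image_group e G)"
    "!!x y. x \<in> carrier G ==> y \<in> carrier G ==> e x *[image_group e G] e y = e (x *[G] y)"
    "carrier (image_group e G) = e ` carrier G" "1[image_group e G] = e 1[G]"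
proof -
  interpret group G by fact
  show c: "carrier (image_group e G) = e ` carrier G" and o: "1[image_group e G] = e 1[G]"
    by (simp_all add: image_group_def)
  have m: "e x *[image_group e G] e y = e (x *[G] y)" if "x \<in> carrier G" "y \<in> carrier G" for x y
    using that assms(2) by (simp add: image_group_def inv_into_f_f)
  thus "!!x y. x \<in> carrier G ==> y \<in> carrier G ==> e x *[image_group e G] e y = e (x *[G] y)" .
  show "e \<in> hom G (image_group e G)" by (rule homI) (auto simp: c m)
  show "group (image_group e G)"
  proof (rule groupI)
    fix x assume "x \<in> carrier (image_group e G)"
    then obtain a where a: "a \<in> carrier G" "x = e a" by (auto simp: c)
    thus "\<exists>y\<in>carrier (image_group e G). y *[image_group e G] x = 1[image_group e G]"
      by (intro bexI[of _ "e (inv[G] a)"]) (auto simp: c o m)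
  qed (auto simp: c o m m_assoc)
qed

lemma group_semidirect:
  assumes V: "group V" and G: "group \<Gamma>" and act: "!!\<gamma>. \<gamma> \<in> carrier \<Gamma> ==> act \<gamma> \<in> hom V V"
    and act1: "!!x. x \<in> carrier V ==> act 1[\<Gamma>] x = x"
    and actm: "!!\<gamma> \<delta> x. \<gamma> \<in> carrier \<Gamma> ==> \<delta> \<in> carrier \<Gamma> ==> x \<in> carrier V ==> act (\<gamma> *[\<Gamma>] \<delta>) x = act \<gamma> (act \<delta> x)"
  shows "group (semidirect V \<Gamma> act)"
proof -
  interpret V: group V by fact
  interpret G: group \<Gamma> by fact
  have c: "act \<gamma> x \<in> carrier V" if "\<gamma> \<in> carrier \<Gamma>" "x \<in> carrier V" for \<gamma> x using act[OF that(1)] that(2) by (auto simp: hom_def)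
  have m: "act \<gamma> (x *[V] y) = act \<gamma> x *[V] act \<gamma> y" if "\<gamma> \<in> carrier \<Gamma>" "x \<in> carrier V" "y \<in> carrier V" for \<gamma> x y
    using act[OF that(1)] that by (auto simp: hom_def)
  have o: "act \<gamma> 1[V] = 1[V]" if "\<gamma> \<in> carrier \<Gamma>" for \<gamma>
    using V.one_closed act[OF that] hom_one[OF _ V V] by blast
  show ?thesis
  proof (rule groupI)
    fix x assume "x \<in> carrier (semidirect V \<Gamma> act)"
    then obtain v \<gamma> where x: "x = (v, \<gamma>)" "v \<in> carrier V" "\<gamma> \<in> carrier \<Gamma>" by (auto simp: semidirect_def)
    have "act (inv[\<Gamma>] \<gamma>) (inv[V] v) *[V] act (inv[\<Gamma>] \<gamma>) v = 1[V]"
      using m[of "inv[\<Gamma>] \<gamma>" "inv[V] v" v] o x by simp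
    thus "\<exists>y\<in>carrier (semidirect V \<Gamma> act). y *[semidirect V \<Gamma> act] x = 1[semidirect V \<Gamma> act]"
      using x c by (intro bexI[of _ "(act (inv[\<Gamma>] \<gamma>) (inv[V] v), inv[\<Gamma>] \<gamma>)"]) (auto simp: semidirect_def)
  qed (auto simp: semidirect_def c m act1 actm o V.m_assoc G.m_assoc)
qed

text \<open>A chain is determined by its finite graph over the support. Countability is carried up
  the tower over a countable group, where it provides the injection that \<open>CH_code\<close>
  selects.\<close>

lemma countable_chains_on:
  fixes M :: "'m ring"
  assumes "countable T" "countable (carrier M)" shows "countable (chains_on M T)"
proof -
  define gr where "gr c = {(x, c x) | x. c x ~= 0[M]}" for c :: "'a => 'm"
  have "inj_on gr (chains_on M T)"
  proof (rule inj_onI, rule ext)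
    fix c d x assume "gr c = gr d"
    hence "(x, v) \<in> gr c \<longleftrightarrow> (x, v) \<in> gr d" for v by simp
    hence "(c x ~= 0[M] & v = c x) \<longleftrightarrow> (d x ~= 0[M] & v = d x)" for v by (auto simp: gr_def)
    thus "c x = d x" by metis
  qed
  moreover have "gr ` chains_on M T <= {A. finite A & A <= T \<times> carrier M}"
  proof (rule image_subsetI)
    fix c assume c: "c \<in> chains_on M T"
    have "gr c = (%x. (x, c x)) ` {x. c x ~= 0[M]}" by (auto simp: gr_def)
    thus "gr c \<in> {A. finite A & A <= T \<times> carrier M}" using c by (auto simp: chains_on_def)
  qed
  hence "countable (gr ` chains_on M T)"
    by (rule countable_subset) (intro countable_Collect_finite_subset countable_SIGMA assms)
  ultimately show ?thesis using countable_image_inj_on by blast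
qed

lemma countable_group_ring:
  assumes "countable (carrier \<Gamma>)" shows "countable (carrier (group_ring \<Gamma>))"
proof -
  have "countable (chains_on (type_ring :: int ring) (carrier \<Gamma>))" by (rule countable_chains_on) (use assms in auto)
  moreover have "poly_mapping.lookup ` carrier (group_ring \<Gamma>) <= chains_on (type_ring :: int ring) (carrier \<Gamma>)"
    by (auto simp: chains_on_def in_keys_iff)
  ultimately have "countable (poly_mapping.lookup ` carrier (group_ring \<Gamma>))" using countable_subset by blast
  moreover have "inj_on poly_mapping.lookup (carrier (group_ring \<Gamma>))" by (rule inj_onI) (simp add: poly_mapping_eqI)
  ultimately show ?thesis using countable_image_inj_on by blast
qed

lemma countable_injection:
  assumes "countable S" "infinite (UNIV :: 'c set)" shows "\<exists>e :: 'b => 'c. inj_on e S"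
proof -
  obtain f :: "nat => 'c" where f: "inj f" using infinite_countable_subset[OF assms(2)] by blast
  have "inj_on (%x. f (to_nat_on S x)) S"
    using inj_on_to_nat_on[OF assms(1)] f by (auto simp: inj_on_def)
  thus ?thesis by blast
qed

lemma countable_tuples: "countable (carrier G) ==> countable (tuples k G)"
  by (rule countable_subset[of _ "lists (carrier G)"]) (auto simp: tuples_def)

context skew_coeff begin

lemma countable_K: assumes "countable (carrier \<Gamma>)" shows "countable (carrier K)"
proof -
  have "carrier K = (%(a, s). R.cls a s) ` (ZG \<times> (R.NZ))"
    unfolding quot_field_def R.carrier_Q by auto
  moreover have "countable (ZG \<times> (R.NZ))"
    using countable_group_ring[OF assms] by (intro countable_SIGMA) auto
  ultimately show ?thesis by simp
qed

lemma countable_H1: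
  assumes "countable (carrier \<Gamma>)" "countable (carrier G)" shows "countable (carrier H1)"
proof -
  have "countable (bar_chains 1 G K)" by (rule countable_chains_on[OF countable_tuples[OF assms(2)] countable_K[OF assms(1)]])
  thus ?thesis unfolding H1_carrier using countable_subset[OF Z1_chains] by auto
qed

definition V_act :: "'g => ('a list => 'g qelem) set => ('a list => 'g qelem) set" where
  "V_act \<gamma> = rmul (emb (inv[\<Gamma>] \<gamma>))"

lemma CH_semidirect_eq: "CH_semidirect G \<Gamma> \<rho> = semidirect H1 \<Gamma> V_act"
proof -
  have "H1K_act G \<Gamma> \<rho> = V_act" by (rule ext) (simp add: V_act_def H1K_act_eq)
  thus ?thesis by (simp add: CH_semidirect_def H1K_eq)
qed

lemma V_act_closed: "\<gamma> \<in> carrier \<Gamma> ==> x \<in> carrier H1 ==> V_act \<gamma> x \<in> carrier H1"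
  unfolding V_act_def by (rule rmul_closed_H1) (auto intro: emb_closed)

lemma V_act_one: "x \<in> carrier C1 ==> V_act 1[\<Gamma>] x = x"
  by (simp add: V_act_def quot_incl_one rmul_one)

lemma group_CH_semidirect: "group (semidirect H1 \<Gamma> V_act)"
proof (rule group_semidirect)
  show "group H1" using H1_comm_group by (simp add: comm_group_def)
  show "group \<Gamma>" by (rule \<Gamma>.is_group)
  fix \<gamma> assume g: "\<gamma> \<in> carrier \<Gamma>"
  have e: "emb (inv[\<Gamma>] \<gamma>) \<in> carrier K" using emb_closed g by simp
  show "V_act \<gamma> \<in> hom H1 H1"
    by (rule homI) (use V_act_closed[OF g] rmul_mult[OF e] H1_carrier_C1 in \<open>auto simp: H1_mult_C1 V_act_def subset_iff\<close>)
  fix \<delta> x assume d: "\<delta> \<in> carrier \<Gamma>" and x: "x \<in> carrier H1"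
  have x': "x \<in> carrier C1" using x H1_carrier_C1 by blast
  show "V_act (\<gamma> *[\<Gamma>] \<delta>) x = V_act \<gamma> (V_act \<delta> x)"
    using rmul_rmul[of "emb (inv[\<Gamma>] \<delta>)" "emb (inv[\<Gamma>] \<gamma>)" x] emb_mult[of "inv[\<Gamma>] \<delta>" "inv[\<Gamma>] \<gamma>"] emb_closed g d x'
    by (simp add: V_act_def \<Gamma>.inv_mult_group)
qed (use V_act_one H1_carrier_C1 in blast)

lemma H1_pow_C1: "x [^]\<^bsub>H1\<^esub> (n::nat) = x [^]\<^bsub>C1\<^esub> n"
  by (induction n) (simp_all add: H1_mult_C1 H1_one_C1)

text \<open>The kernel of the projection to \<open>\<Gamma>\<close> is the homology group, which is
  abelian and torsion-free. Thus the next group of the tower has a skew field of fractions as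
  well.\<close>

lemma ore_group_CH_semidirect: "ore_group (semidirect H1 \<Gamma> V_act)"
proof (rule ore_group_extension[OF group_CH_semidirect ore_group, of snd])
  interpret H: comm_group H1 by (rule H1_comm_group)
  show "snd \<in> hom (semidirect H1 \<Gamma> V_act) \<Gamma>" by (auto simp: hom_def semidirect_def)
  show "snd ` carrier (semidirect H1 \<Gamma> V_act) = carrier \<Gamma>" using H.one_closed by (force simp: semidirect_def)
  have ker: "\<exists>x\<in>carrier H1. z = (x, 1[\<Gamma>])" if "z \<in> kernel (semidirect H1 \<Gamma> V_act) \<Gamma> snd" for z
    using that by (cases z) (auto simp: kernel_def semidirect_def)
  have C: "x \<in> carrier C1" if "x \<in> carrier H1" for x using that H1_carrier_C1 by blast
  have m: "(x, 1[\<Gamma>]) *[semidirect H1 \<Gamma> V_act] (y, 1[\<Gamma>]) = (x *[H1] y, 1[\<Gamma>])" if "y \<in> carrier H1" for x y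
    using V_act_one[OF C[OF that]] by (simp add: semidirect_def)
  { fix z z' assume z: "z \<in> kernel (semidirect H1 \<Gamma> V_act) \<Gamma> snd" and z': "z' \<in> kernel (semidirect H1 \<Gamma> V_act) \<Gamma> snd"
    obtain x where x: "x \<in> carrier H1" "z = (x, 1[\<Gamma>])" using ker[OF z] by (rule bexE)
    obtain y where y: "y \<in> carrier H1" "z' = (y, 1[\<Gamma>])" using ker[OF z'] by (rule bexE)
    show "z *[semidirect H1 \<Gamma> V_act] z' = z' *[semidirect H1 \<Gamma> V_act] z"
      unfolding x(2) y(2) m[OF x(1)] m[OF y(1)] using H.m_comm[OF x(1) y(1)] by simp }
  { fix z and n :: nat assume z: "z \<in> kernel (semidirect H1 \<Gamma> V_act) \<Gamma> snd" and n: "n > 0"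
      and e: "z [^]\<^bsub>semidirect H1 \<Gamma> V_act\<^esub> n = 1[semidirect H1 \<Gamma> V_act]"
    obtain x where x: "x \<in> carrier H1" "z = (x, 1[\<Gamma>])" using ker[OF z] by (rule bexE)
    have o: "1[semidirect H1 \<Gamma> V_act] = (1[H1], 1[\<Gamma>])" by (simp add: semidirect_def)
    have "z [^]\<^bsub>semidirect H1 \<Gamma> V_act\<^esub> n = (x [^]\<^bsub>H1\<^esub> n, 1[\<Gamma>])"
      unfolding x(2) by (induction n) (simp_all add: o m[OF x(1)])
    hence "x [^]\<^bsub>C1\<^esub> n = 1[C1]" using e by (simp add: o H1_pow_C1 H1_one_C1)
    hence "x = 1[H1]" unfolding H1_one_C1 by (rule C1_torsion_free[OF C[OF x(1)] n])
    thus "z = 1[semidirect H1 \<Gamma> V_act]" using x(2) by (simp add: o) }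
qed

text \<open>Subtracting an inner derivation turns the universal derivation into one with values in the cycles.\<close>

lemma exists_cycle_derivation:
  "\<exists>d. d \<in> carrier G \<rightarrow> carrier H1 &
     (\<forall>g\<in>carrier G. \<forall>h\<in>carrier G. d (g *[G] h) = d g *[H1] V_act (\<rho> g) (d h)) &
     (\<forall>g\<in>carrier G. \<rho> g = 1[\<Gamma>] --> d g = universal_derivation g)"
proof -
  interpret C: comm_group C1 by (rule C1_comm_group)
  \<comment> \<open>The boundary of \<open>m [g]\<close> is \<open>u g * m\<close> at the empty
    tuple; \<open>u\<close> measures how far \<open>universal_derivation g\<close> is from being a
    cycle.\<close>
  define u where "u g = emb (inv[\<Gamma>] \<rho> g) +[K] (-[K] 1[K])" for g
  have e: "emb (inv[\<Gamma>] \<rho> g) \<in> carrier K" if "g \<in> carrier G" for g using that by (intro emb_closed) simp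
  have u: "u g \<in> carrier K" if "g \<in> carrier G" for g using e[OF that] by (simp add: u_def)
  have u1: "u g = 0[K]" if "\<rho> g = 1[\<Gamma>]" for g by (simp add: u_def that quot_incl_one K.r_neg)
  have bs: "bd (chain_single K [g] m) = chain_single K [] (u g *[K] m)" if "g \<in> carrier G" "m \<in> carrier K" for g m
    unfolding boundary_single_1[OF that] using that e by (simp add: act_def u_def K.l_distr K.l_minus)
  \<comment> \<open>If some \<open>u g0\<close> is nonzero, it is invertible and a multiple of
    \<open>[g0]\<close> has boundary 1 at the empty tuple. Otherwise all \<open>u g\<close> vanish
    and the zero chain does.\<close>
  have "\<exists>x0\<in>bar_chains 1 G K. \<forall>g\<in>carrier G. bd (%x. x0 x *[K] u g) = chain_single K [] (u g)"
  proof (cases "\<forall>g\<in>carrier G. \<rho> g = 1[\<Gamma>]")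
    case True
    have z: "(%x. 0[K] *[K] u g) = (%x. 0[K])" "chain_single K [] (u g) = (%x. 0[K])" if "g \<in> carrier G" for g
      using u[OF that] u1[of g] True that by (auto simp: chain_single_def)
    thus ?thesis using zero_closed[of 1] boundary_zero by (intro bexI[of _ "%x. 0[K]"] ballI) (auto simp: z)
  next
    case False
    then obtain g0 where g0: "g0 \<in> carrier G" "\<rho> g0 ~= 1[\<Gamma>]" by blast
    have "inv[\<Gamma>] \<rho> g0 ~= 1[\<Gamma>]" using g0 by (metis \<Gamma>.inv_inv \<Gamma>.inv_one rho.hom_closed)
    hence "u g0 ~= 0[K]"
      using emb_diff_nonzero[of "inv[\<Gamma>] \<rho> g0" "1[\<Gamma>]"] g0 by (simp add: u_def quot_incl_one a_minus_def)
    then obtain m where m: "m \<in> carrier K" "u g0 *[K] m = 1[K]" using K_inverse[OF u[OF g0(1)]] by blast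
    let ?x = "chain_single K [g0] m"
    have "bd (%x. ?x x *[K] u g) = chain_single K [] (u g)" if g: "g \<in> carrier G" for g
    proof -
      have "(%x. ?x x *[K] u g) = chain_single K [g0] (m *[K] u g)" by (rule ext) (simp add: chain_single_def u[OF g])
      thus ?thesis using bs[OF g0(1), of "m *[K] u g"] m u[OF g] u[OF g0(1)] by (simp add: K.m_assoc[symmetric])
    qed
    thus ?thesis using single_closed[OF g0(1) m(1)] by blast
  qed
  then obtain x0 where x0: "x0 \<in> bar_chains 1 G K"
    "\<forall>g\<in>carrier G. bd (%x. x0 x *[K] u g) = chain_single K [] (u g)" by blast
  let ?X = "cls1 x0"
  have X: "?X \<in> carrier C1" using x0(1) unfolding C1_carrier by blast
  \<comment> \<open>Both terms have boundary \<open>u g\<close>. The subtracted term is an inner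
    derivation, because \<open>u (g h)\<close> is \<open>u h\<close> times the inverse of
    \<open>\<rho> g\<close>, plus \<open>u g\<close>; it vanishes where \<open>\<rho>\<close> is
    trivial.\<close>
  define d where "d g = universal_derivation g *[C1] inv[C1] rmul (u g) ?X" for g
  have dH: "d g \<in> carrier H1" if g: "g \<in> carrier G" for g
  proof -
    let ?c = "chain_single K [g] 1[K]" and ?y = "%x. x0 x *[K] -[K] u g"
    have mu: "-[K] u g \<in> carrier K" using u[OF g] by simp
    have cc: "?c \<in> bar_chains 1 G K" by (rule single_closed[OF g K.one_closed])
    have yc: "?y \<in> bar_chains 1 G K" by (rule rmul_chain(2)[OF mu x0(1)])
    have "d g = cls1 ?c *[C1] cls1 ?y"
      unfolding d_def rmul_minus[OF u[OF g] X, symmetric] rmul_cls1[OF mu x0(1)] universal_derivation_def single_class_def ..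
    hence dg: "d g = cls1 (chain_add K ?c ?y)" unfolding C1_mult[OF cc yc] .
    have yb: "bd ?y = (%x. -[K] chain_single K [] (u g) x)"
    proof -
      have z: "(%x. x0 x *[K] u g) \<in> bar_chains 1 G K" by (rule rmul_chain(2)[OF u[OF g] x0(1)])
      have "?y = (%x. -[K] (x0 x *[K] u g))" using cell[OF x0(1)] u[OF g] by (simp add: K.r_minus)
      also have "\<dots> = (%x. (x0 x *[K] u g) *[K] -[K] 1[K])" using cell[OF z] by (simp add: K.r_minus)
      finally have y: "?y = chain_map K K (%g. g) (%k. k *[K] -[K] 1[K]) (%x. x0 x *[K] u g)"
        using rmul_chain(1)[OF _ z, of "-[K] 1[K]"] by simp
      have m1: "-[K] 1[K] \<in> carrier K" by simp
      have bz: "bd (%x. x0 x *[K] u g) \<in> bar_chains 0 G K"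
        by (rule boundary_closed[OF z[unfolded One_nat_def]])
      have "bd ?y = chain_map K K (%g. g) (%k. k *[K] -[K] 1[K]) (bd (%x. x0 x *[K] u g))"
        unfolding y by (rule coeff_map.cm_boundary[OF rmul_coeff_map[OF m1] z[unfolded One_nat_def], symmetric])
      also have "\<dots> = (%x. bd (%x. x0 x *[K] u g) x *[K] -[K] 1[K])"
        by (rule rmul_chain(1)[OF m1 bz])
      also have "\<dots> = (%x. -[K] chain_single K [] (u g) x)"
        using bspec[OF x0(2) g] cell[OF bz] by (simp add: K.r_minus)
      finally show ?thesis .
    qed
    have "bd (chain_add K ?c ?y) = chain_add K (bd ?c) (bd ?y)"
      by (rule boundary_add[OF cc[unfolded One_nat_def] yc[unfolded One_nat_def]])
    also have "\<dots> = (%x. 0[K])"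
      unfolding bs[OF g K.one_closed] yb using u[OF g] by (auto simp: chain_add_def chain_single_def K.r_neg)
    finally have "chain_add K ?c ?y \<in> Z1" using add_closed[OF cc yc] by (simp add: cycles_def chain_group_simps)
    thus ?thesis unfolding dg H1_carrier by blast
  qed
  have dm: "d (g *[G] h) = d g *[H1] V_act (\<rho> g) (d h)" if g: "g \<in> carrier G" and h: "h \<in> carrier G" for g h
  proof -
    let ?r = "rmul (emb (inv[\<Gamma>] \<rho> g))"
    interpret r: group_hom C1 C1 ?r by (rule rmul_group_hom[OF e[OF g]])
    have ugh: "u (g *[G] h) = (u h *[K] emb (inv[\<Gamma>] \<rho> g)) +[K] u g"
    proof -
      let ?a = "emb (inv[\<Gamma>] \<rho> h)" and ?b = "emb (inv[\<Gamma>] \<rho> g)"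
      have ab: "?a \<in> carrier K" "?b \<in> carrier K" using e g h by auto
      have "u (g *[G] h) = ?a *[K] ?b +[K] -[K] 1[K]"
        unfolding u_def using g h by (simp add: \<Gamma>.inv_mult_group emb_mult)
      moreover have "(u h *[K] ?b) +[K] u g = (?a *[K] ?b +[K] -[K] ?b) +[K] (?b +[K] -[K] 1[K])"
        unfolding u_def using ab by (simp add: K.l_distr K.l_minus)
      moreover have "\<dots> = ?a *[K] ?b +[K] ((-[K] ?b +[K] ?b) +[K] -[K] 1[K])"
        using ab by (simp add: K.a_assoc)
      ultimately show ?thesis using ab by (simp add: K.l_neg)
    qed
    have c: "universal_derivation g \<in> carrier C1" "universal_derivation h \<in> carrier C1" "rmul (u g) ?X \<in> carrier C1" "rmul (u h) ?X \<in> carrier C1"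
      using universal_derivation_closed g h rmul_closed[OF u X] by auto
    have 1: "rmul (u (g *[G] h)) ?X = ?r (rmul (u h) ?X) *[C1] rmul (u g) ?X"
      unfolding ugh rmul_rmul[OF u[OF h] e[OF g] X] by (rule rmul_add[OF K.m_closed[OF u[OF h] e[OF g]] u[OF g] X])
    have 2: "V_act (\<rho> g) (d h) = ?r (universal_derivation h) *[C1] inv[C1] ?r (rmul (u h) ?X)"
      unfolding V_act_def d_def using c by simp
    have 3: "d (g *[G] h) = (universal_derivation g *[C1] ?r (universal_derivation h)) *[C1] inv[C1] (?r (rmul (u h) ?X) *[C1] rmul (u g) ?X)"
      unfolding d_def 1 universal_derivation_mult[OF g h] ..
    have 4: "?r (universal_derivation h) \<in> carrier C1" "?r (rmul (u h) ?X) \<in> carrier C1" using c by auto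
    show ?thesis unfolding H1_mult_C1 2 3 unfolding d_def using c 4 by (simp add: C.inv_mult C.m_ac)
  qed
  have "d g = universal_derivation g" if "g \<in> carrier G" "\<rho> g = 1[\<Gamma>]" for g
    unfolding d_def u1[OF that(2)] rmul_zero[OF X] using universal_derivation_closed[OF that(1)] by simp
  thus ?thesis using dH dm by (intro exI[of _ d]) auto
qed

end

text \<open>Faithful flatness of an extension of skew fields: a finite system that is solvable over the larger
  field is solvable over the smaller one, by means of a linear retraction.\<close>

lemma linear_retraction:
  assumes K: "ring K" and L: "ring L" and inv: "!!q. q \<in> carrier K ==> q ~= 0[K] ==> \<exists>p\<in>carrier K. p *[K] q = 1[K]"
    and f: "additive_map K L f" and fm: "!!x y. x \<in> carrier K ==> y \<in> carrier K ==> f (x *[K] y) = f x *[L] f y"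
    and f1: "f 1[K] = 1[L]" and finj: "inj_on f (carrier K)" and Y: "finite Y" "Y <= carrier L"
  shows "\<exists>W r. W <= carrier L & Y <= W & f ` carrier K <= W & (\<forall>x\<in>W. \<forall>y\<in>W. x +[L] y \<in> W) & (\<forall>x\<in>W. -[L] x \<in> W) &
    (\<forall>k\<in>carrier K. \<forall>x\<in>W. f k *[L] x \<in> W & r (f k *[L] x) = k *[K] r x) & (\<forall>x\<in>W. r x \<in> carrier K) &
    (\<forall>x\<in>W. \<forall>y\<in>W. r (x +[L] y) = r x +[K] r y) & r 1[L] = 1[K]"
  using Y
proof (induction Y rule: finite_induct)
  interpret K: ring K by fact
  interpret L: ring L by fact
  have fc: "f k \<in> carrier L" if "k \<in> carrier K" for k using additive_mapD(1)[OF f that] .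
  have fa: "f (x +[K] y) = f x +[L] f y" if "x \<in> carrier K" "y \<in> carrier K" for x y using additive_mapD(2)[OF f that] .
  have fn: "f (-[K] x) = -[L] f x" if "x \<in> carrier K" for x
    by (rule additive_map_minus[OF K.abelian_group_axioms L.abelian_group_axioms f that])
  have f0: "f 0[K] = 0[L]" by (rule additive_map_zero[OF K.abelian_group_axioms L.abelian_group_axioms f])
  { case empty
    define g where "g = inv_into (carrier K) f"
    have g: "g (f k) = k" if "k \<in> carrier K" for k unfolding g_def by (rule inv_into_f_f[OF finj that])
    have "g (f x +[L] f y) = x +[K] y" "g (f x *[L] f y) = x *[K] y" if "x \<in> carrier K" "y \<in> carrier K" for x y
      using g[OF K.a_closed[OF that]] g[OF K.m_closed[OF that]] fa[OF that] fm[OF that] by auto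
    moreover have "f x +[L] f y \<in> f ` carrier K" "f x *[L] f y \<in> f ` carrier K" "-[L] f x \<in> f ` carrier K"
      if "x \<in> carrier K" "y \<in> carrier K" for x y
      using fa[OF that] fm[OF that] fn[OF that(1)] imageI[OF K.a_closed[OF that], of f] imageI[OF K.m_closed[OF that], of f]
        imageI[OF K.a_inv_closed[OF that(1)], of f] by auto
    moreover have "g 1[L] = 1[K]" using g[OF K.one_closed] by (simp add: f1)
    ultimately show ?case using fc g by (intro exI[of _ "f ` carrier K"] exI[of _ g]) auto }
  { case (insert x Y)
    hence YL: "Y <= carrier L" by simp
    obtain W r where W: "W <= carrier L" "Y <= W" "f ` carrier K <= W"
      and Wa0: "\<forall>x\<in>W. \<forall>y\<in>W. x +[L] y \<in> W" and Wn0: "\<forall>x\<in>W. -[L] x \<in> W"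
      and Wm0: "\<forall>k\<in>carrier K. \<forall>x\<in>W. f k *[L] x \<in> W & r (f k *[L] x) = k *[K] r x"
      and rc0: "\<forall>x\<in>W. r x \<in> carrier K"
      and ra0: "\<forall>x\<in>W. \<forall>y\<in>W. r (x +[L] y) = r x +[K] r y" and r1: "r 1[L] = 1[K]"
      using insert(3)[OF YL] by (elim exE conjE)
    have Wa: "x +[L] y \<in> W" if "x \<in> W" "y \<in> W" for x y using bspec[OF bspec[OF Wa0 that(1)] that(2)] .
    have Wn: "-[L] x \<in> W" if "x \<in> W" for x using bspec[OF Wn0 that] .
    have Wm: "f k *[L] x \<in> W" and rm: "r (f k *[L] x) = k *[K] r x" if "k \<in> carrier K" "x \<in> W" for k x
      using bspec[OF bspec[OF Wm0 that(1)] that(2)] by auto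
    have rc: "r x \<in> carrier K" if "x \<in> W" for x using bspec[OF rc0 that] .
    have ra: "r (x +[L] y) = r x +[K] r y" if "x \<in> W" "y \<in> W" for x y using bspec[OF bspec[OF ra0 that(1)] that(2)] .
    have x: "x \<in> carrier L" using insert by auto
    have wL: "w \<in> carrier L" if "w \<in> W" for w using that W by blast
    show ?case
    proof (cases "x \<in> W")
      case True
      thus ?thesis using W Wa Wn Wm rm rc ra r1 by (intro exI[of _ W] exI[of _ r]) auto
    next
      case False
      \<comment> \<open>\<open>x\<close> is adjoined as a new independent vector, on which the
        retraction is set to 0.\<close>
      define W' where "W' = {w +[L] f k *[L] x | w k. w \<in> W & k \<in> carrier K}"
      \<comment> \<open>If \<open>k\<close> and \<open>k'\<close> differed, division by their
        difference would express \<open>x\<close> by elements of \<open>W\<close>.\<close>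
      have uniq: "w = w'" if w: "w \<in> W" "w' \<in> W" and k: "k \<in> carrier K" "k' \<in> carrier K"
        and e: "w +[L] f k *[L] x = w' +[L] f k' *[L] x" for w w' k k'
      proof -
        have c: "w \<in> carrier L" "w' \<in> carrier L" "f k *[L] x \<in> carrier L" "f k' *[L] x \<in> carrier L" using w k wL fc x by auto
        have "f (k +[K] -[K] k') *[L] x = f k *[L] x +[L] -[L] (f k' *[L] x)"
          using k fc x by (simp add: fa fn L.l_distr L.l_minus)
        also have "\<dots> = -[L] w +[L] ((w +[L] f k *[L] x) +[L] -[L] (f k' *[L] x))"
          using c by (simp add: L.a_assoc[symmetric] L.l_neg)
        also have "\<dots> = -[L] w +[L] w'" unfolding e using c by (simp add: L.a_assoc L.r_neg)
        finally have fx: "f (k +[K] -[K] k') *[L] x = -[L] w +[L] w'" .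
        have "k +[K] -[K] k' = 0[K]"
        proof (rule ccontr)
          assume nz: "k +[K] -[K] k' ~= 0[K]"
          have kk: "k +[K] -[K] k' \<in> carrier K" using k by simp
          obtain p where p: "p \<in> carrier K" "p *[K] (k +[K] -[K] k') = 1[K]" using inv[OF kk nz] by blast
          have "x = f (p *[K] (k +[K] -[K] k')) *[L] x" using x by (simp add: p f1)
          also have "\<dots> = f p *[L] (-[L] w +[L] w')" unfolding fm[OF p(1) kk] fx[symmetric] using fc[OF p(1)] fc[OF kk] x by (simp add: L.m_assoc)
          also have "\<dots> \<in> W" by (rule Wm[OF p(1) Wa[OF Wn[OF w(1)] w(2)]])
          finally show False using False by simp
        qed
        hence "-[L] w +[L] w' = 0[L]" using fx x by (simp add: f0)
        hence "w' = w" using c by (metis L.minus_equality L.a_comm L.minus_minus L.a_inv_closed)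
        thus ?thesis ..
      qed
      define r' where "r' y = r (SOME w. w \<in> W & (\<exists>k\<in>carrier K. y = w +[L] f k *[L] x))" for y
      have r': "r' (w +[L] f k *[L] x) = r w" if w: "w \<in> W" and k: "k \<in> carrier K" for w k
      proof -
        define v where "v = (SOME v. v \<in> W & (\<exists>k'\<in>carrier K. w +[L] f k *[L] x = v +[L] f k' *[L] x))"
        have "v \<in> W & (\<exists>k'\<in>carrier K. w +[L] f k *[L] x = v +[L] f k' *[L] x)"
          unfolding v_def by (rule someI[of _ w]) (use w k in blast)
        hence "w = v" using uniq[OF w _ k] by blast
        thus ?thesis unfolding r'_def v_def[symmetric] by simp
      qed
      have 0: "w +[L] f 0[K] *[L] x = w" if "w \<in> W" for w using wL[OF that] x by (simp add: f0)
      have WW': "w \<in> W'" if "w \<in> W" for w unfolding W'_def using 0[OF that] that K.zero_closed by (metis (mono_tags, lifting) CollectI)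
      have rr': "r' w = r w" if "w \<in> W" for w using r'[OF that K.zero_closed] unfolding 0[OF that] .
      have x0: "x = f 0[K] +[L] f 1[K] *[L] x" using x by (simp add: f0 f1)
      have xW': "x \<in> W'" unfolding W'_def using x0 W(3) K.zero_closed K.one_closed by blast
      have 1: "1[L] \<in> W" using W(3) f1 K.one_closed by (metis imageI subsetD)
      have add: "y +[L] z \<in> W' & r' (y +[L] z) = r' y +[K] r' z" if yz: "y \<in> W'" "z \<in> W'" for y z
      proof -
        obtain w k w' k' where y: "w \<in> W" "k \<in> carrier K" "y = w +[L] f k *[L] x"
          and z: "w' \<in> W" "k' \<in> carrier K" "z = w' +[L] f k' *[L] x" using yz unfolding W'_def by blast
        have "y +[L] z = (w +[L] w') +[L] f (k +[K] k') *[L] x"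
          unfolding y(3) z(3) using y z wL fc x by (simp add: fa L.l_distr L.a_ac)
        thus ?thesis unfolding y(3) z(3) r'[OF y(1,2)] r'[OF z(1,2)]
          using r'[OF Wa[OF y(1) z(1)] K.a_closed[OF y(2) z(2)]] ra[OF y(1) z(1)] Wa[OF y(1) z(1)] K.a_closed[OF y(2) z(2)]
          unfolding W'_def by auto
      qed
      have neg: "-[L] y \<in> W'" if yz: "y \<in> W'" for y
      proof -
        obtain w k where y: "w \<in> W" "k \<in> carrier K" "y = w +[L] f k *[L] x" using yz unfolding W'_def by blast
        have "-[L] y = -[L] w +[L] f (-[K] k) *[L] x" unfolding y(3) using y wL fc x by (simp add: fn L.minus_add L.l_minus)
        thus ?thesis unfolding W'_def using Wn[OF y(1)] K.a_inv_closed[OF y(2)] by blast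
      qed
      have mul: "f l *[L] y \<in> W' & r' (f l *[L] y) = l *[K] r' y" if l: "l \<in> carrier K" and yz: "y \<in> W'" for l y
      proof -
        obtain w k where y: "w \<in> W" "k \<in> carrier K" "y = w +[L] f k *[L] x" using yz unfolding W'_def by blast
        have "f l *[L] y = f l *[L] w +[L] f (l *[K] k) *[L] x"
          unfolding y(3) using y l wL fc x by (simp add: fm L.r_distr L.m_assoc)
        thus ?thesis unfolding y(3) r'[OF y(1,2)]
          using r'[OF Wm[OF l y(1)] K.m_closed[OF l y(2)]] rm[OF l y(1)] Wm[OF l y(1)] K.m_closed[OF l y(2)]
          unfolding W'_def by auto
      qed
      have clos: "r' y \<in> carrier K & y \<in> carrier L" if yz: "y \<in> W'" for y
      proof -
        obtain w k where y: "w \<in> W" "k \<in> carrier K" "y = w +[L] f k *[L] x" using yz unfolding W'_def by blast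
        show ?thesis unfolding y(3) r'[OF y(1,2)] using rc[OF y(1)] wL[OF y(1)] fc[OF y(2)] x by simp
      qed
      have s: "W <= W'" using WW' by (rule subsetI)
      show ?thesis
      proof (intro exI[of _ W'] exI[of _ r'] conjI ballI)
        show "W' <= carrier L" by (rule subsetI) (simp add: clos)
        show "insert x Y <= W'" using xW' order_trans[OF W(2) s] by (rule insert_subsetI)
        show "f ` carrier K <= W'" by (rule order_trans[OF W(3) s])
        show "r' 1[L] = 1[K]" using rr'[OF 1] r1 by simp
      qed (simp_all only: add neg mul clos)
    qed }
qed

lemma group_ring_map_linear:
  "group_ring_map \<psi> (a + b) = group_ring_map \<psi> a + group_ring_map \<psi> b"
  "group_ring_map \<psi> (a - b) = group_ring_map \<psi> a - group_ring_map \<psi> b"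
  "group_ring_map \<psi> (frag_of x) = frag_of (\<psi> x)" "group_ring_map \<psi> 0 = 0"
  by (simp_all add: group_ring_map_def frag_extend_add frag_extend_diff)

context skew_coeff begin

lemma K_left_inverse:
  assumes q: "q \<in> carrier K" "q ~= 0[K]" shows "\<exists>p\<in>carrier K. p *[K] q = 1[K]"
proof -
  obtain p where p: "p \<in> carrier K" "q *[K] p = 1[K]" using K_inverse[OF q] by blast
  have "p ~= 0[K]" using p(2) K.r_null[OF q(1)] K_one_not_zero by metis
  then obtain r where r: "r \<in> carrier K" "p *[K] r = 1[K]" using K_inverse[OF p(1)] by blast
  have "q = q *[K] (p *[K] r)" unfolding r(2) using q(1) by simp
  also have "\<dots> = r" unfolding K.m_assoc[OF q(1) p(1) r(1), symmetric] p(2) using r(1) by simp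
  finally show ?thesis using p(1) r(2) by blast
qed

text \<open>The difference of the two actions is right multiplication by the difference of the
  inverses of \<open>\<gamma>\<close> and \<open>\<delta>\<close>, which is a nonzero element of a
  skew field. All equations in the tower are solved by this.\<close>

lemma V_act_solve:
  assumes g: "\<gamma> \<in> carrier \<Gamma>" "\<delta> \<in> carrier \<Gamma>" "\<gamma> ~= \<delta>" and x: "x \<in> carrier H1"
  shows "\<exists>y\<in>carrier H1. V_act \<gamma> y = x *[H1] V_act \<delta> y"
proof -
  let ?a = "emb (inv[\<Gamma>] \<gamma>)" and ?b = "emb (inv[\<Gamma>] \<delta>)"
  let ?q = "?a -[K] ?b"
  have c: "?a \<in> carrier K" "?b \<in> carrier K" using g emb_closed by auto
  have "inv[\<Gamma>] \<gamma> ~= inv[\<Gamma>] \<delta>" using g by (metis \<Gamma>.inv_inv)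
  hence nz: "?q ~= 0[K]" using emb_diff_nonzero g by simp
  have qc: "?q \<in> carrier K" using c by simp
  obtain p where p: "p \<in> carrier K" "p *[K] ?q = 1[K]" using K_left_inverse[OF qc nz] by (rule bexE)
  have xc: "x \<in> carrier C1" using x H1_carrier_C1 by blast
  let ?y = "rmul p x"
  have y: "?y \<in> carrier C1" by (rule rmul_closed[OF p(1) xc])
  have "rmul ?q ?y = x" unfolding rmul_rmul[OF p(1) qc xc] p(2) by (rule rmul_one[OF xc])
  moreover have "rmul (?q +[K] ?b) ?y = rmul ?q ?y *[C1] rmul ?b ?y" by (rule rmul_add[OF qc c(2) y])
  moreover have "?q +[K] ?b = ?a" using c by (simp add: a_minus_def K.a_assoc K.l_neg)
  ultimately have "V_act \<gamma> ?y = x *[H1] V_act \<delta> ?y" by (simp add: V_act_def H1_mult_C1)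
  thus ?thesis using rmul_closed_H1[OF p(1) x] by blast
qed

end

section \<open>Change of the skew field along an injective homomorphism\<close>

locale skew_map = S: skew_coeff G \<Gamma> \<rho> + T: skew_coeff G \<Gamma>' \<rho>'
  for G :: "'a monoid" and \<Gamma> :: "'g monoid" and \<rho> and \<Gamma>' :: "'h monoid" and \<rho>' +
  fixes \<psi> :: "'g => 'h"
  assumes psi: "\<psi> \<in> hom \<Gamma> \<Gamma>'" and psi_inj: "inj_on \<psi> (carrier \<Gamma>)"
    and psi_rho: "g \<in> carrier G ==> \<psi> (\<rho> g) = \<rho>' g"
begin

abbreviation "gm == group_ring_map \<psi>"
abbreviation "qm == quot_map \<Gamma>' \<psi>"

sublocale psi: group_hom \<Gamma> \<Gamma>' \<psi> by unfold_locales (rule psi)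

lemma gm_closed: "a \<in> S.ZG ==> gm a \<in> T.ZG"
proof -
  assume "a \<in> S.ZG"
  hence "Poly_Mapping.keys a <= carrier \<Gamma>" by simp
  hence "Poly_Mapping.keys (gm a) <= carrier \<Gamma>'"
  proof (induction a rule: frag_induction)
    case (diff a b)
    thus ?case using keys_diff[of "gm a" "gm b"] by (auto simp: group_ring_map_linear)
  qed (simp_all add: group_ring_map_linear)
  thus ?thesis by simp
qed

lemma gm_mult:
  assumes "a \<in> S.ZG" "b \<in> S.ZG"
  shows "gm (a *[group_ring \<Gamma>] b) = gm a *[group_ring \<Gamma>'] gm b"
proof -
  have a: "Poly_Mapping.keys a <= carrier \<Gamma>" and b: "Poly_Mapping.keys b <= carrier \<Gamma>" using assms by auto
  have "gm (gr_mult \<Gamma> a b) = gr_mult \<Gamma>' (gm a) (gm b)"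
    using a
  proof (induction a rule: frag_induction)
    case (one x)
    show ?case using b
      by (induction b rule: frag_induction) (use one in \<open>simp_all add: gr_mult_linear group_ring_map_linear\<close>)
  qed (simp_all add: gr_mult_linear group_ring_map_linear)
  thus ?thesis by simp
qed

lemma gm_add: "gm (a +[group_ring \<Gamma>] b) = gm a +[group_ring \<Gamma>'] gm b"
  by (simp add: group_ring_map_linear)

text \<open>Here injectivity of \<open>\<psi>\<close> enters: an inverse function gives a left
  inverse of the map of group rings, so denominators stay nonzero and fractions can be
  mapped.\<close>

lemma gm_nonzero:
  assumes "s \<in> S.R.NZ"
  shows "gm s \<in> T.R.NZ"
proof -
  have "group_ring_map (inv_into (carrier \<Gamma>) \<psi>) (gm a) = a" if "Poly_Mapping.keys a <= carrier \<Gamma>" for a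
    using that by (induction a rule: frag_induction) (simp_all add: group_ring_map_linear inv_into_f_f[OF psi_inj])
  hence "s = group_ring_map (inv_into (carrier \<Gamma>) \<psi>) (gm s)" using assms by simp
  hence "gm s ~= 0" using assms by (metis DiffD2 group_ring_map_linear(4) group_ring_simps(4) singletonI)
  thus ?thesis using gm_closed[of s] assms by simp
qed

lemma qm_cls:
  assumes a: "a \<in> S.ZG" and s: "s \<in> S.R.NZ"
  shows "qm (S.R.cls a s) = T.R.cls (gm a) (gm s)"
proof -
  have val: "T.R.cls (gm b) (gm t) = T.R.cls (gm a) (gm s)" if bt: "(b, t) \<in> S.R.cls a s" for b t
  proof -
    have "((a, s), (b, t)) \<in> frac_rel (group_ring \<Gamma>)" using bt S.R.mem_cls by simp
    then obtain u v where *: "a \<in> S.ZG" "b \<in> S.ZG"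
      "s \<in> S.R.NZ" "t \<in> S.R.NZ"
      "u \<in> S.R.NZ" "v \<in> S.R.NZ"
      "s *[group_ring \<Gamma>] u = t *[group_ring \<Gamma>] v" "a *[group_ring \<Gamma>] u = b *[group_ring \<Gamma>] v"
      by (rule S.R.relE)
    have c: "s \<in> S.ZG" "t \<in> S.ZG" "u \<in> S.ZG" "v \<in> S.ZG"
      using *(3-6) by blast+
    have "T.R.cls (gm a) (gm s) = T.R.cls (gm a *[group_ring \<Gamma>'] gm u) (gm s *[group_ring \<Gamma>'] gm u)"
      by (rule T.R.cls_expand[OF gm_closed[OF *(1)] gm_nonzero[OF *(3)] gm_nonzero[OF *(5)], symmetric])
    also have "\<dots> = T.R.cls (gm b *[group_ring \<Gamma>'] gm v) (gm t *[group_ring \<Gamma>'] gm v)"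
      unfolding gm_mult[OF *(1) c(3), symmetric] gm_mult[OF c(1,3), symmetric] *(7,8)
      unfolding gm_mult[OF *(2) c(4)] gm_mult[OF c(2,4)] ..
    also have "\<dots> = T.R.cls (gm b) (gm t)"
      by (rule T.R.cls_expand[OF gm_closed[OF *(2)] gm_nonzero[OF *(4)] gm_nonzero[OF *(6)]])
    finally show ?thesis ..
  qed
  have "qm (S.R.cls a s) = (\<Union>(b, t)\<in>S.R.cls a s. T.R.cls (gm b) (gm t))"
    by (simp add: quot_map_def T.R.cls_def)
  also have "\<dots> = (\<Union>(b, t)\<in>S.R.cls a s. T.R.cls (gm a) (gm s))"
    by (rule SUP_cong) (use val in auto)
  also have "\<dots> = T.R.cls (gm a) (gm s)" using S.R.cls_self[OF a s] by auto
  finally show ?thesis .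
qed

lemma qm_additive: "additive_map S.K T.K qm"
  unfolding additive_map_def
proof (intro conjI ballI)
  fix A assume "A \<in> carrier S.K"
  then obtain a s where *: "a \<in> S.ZG" "s \<in> S.R.NZ" "A = S.R.cls a s"
    unfolding quot_field_def by (rule S.R.Q_cases)
  show "qm A \<in> carrier T.K" unfolding *(3) qm_cls[OF *(1,2)] quot_field_def
    by (rule T.R.cls_closed[OF gm_closed[OF *(1)] gm_nonzero[OF *(2)]])
next
  fix A B assume "A \<in> carrier S.K" "B \<in> carrier S.K"
  then obtain a b s where *: "a \<in> S.ZG" "b \<in> S.ZG"
    "s \<in> S.R.NZ" "A = S.R.cls a s" "B = S.R.cls b s"
    unfolding quot_field_def by (rule S.R.Q_cases2)
  show "qm (A +[S.K] B) = qm A +[T.K] qm B"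
    unfolding *(4,5) quot_field_def S.R.add_cls[OF *(1-3)] qm_cls[OF *(1,3)] qm_cls[OF *(2,3)]
      qm_cls[OF S.R.a_closed[OF *(1,2)] *(3)] T.R.add_cls[OF gm_closed[OF *(1)] gm_closed[OF *(2)] gm_nonzero[OF *(3)]] gm_add ..
qed

lemma qm_mult:
  assumes "A \<in> carrier S.K" "B \<in> carrier S.K" shows "qm (A *[S.K] B) = qm A *[T.K] qm B"
proof -
  obtain a s where a: "a \<in> S.ZG" "s \<in> S.R.NZ" "A = S.R.cls a s"
    by (rule S.R.Q_cases[OF assms(1)[unfolded quot_field_def]])
  obtain c t where c: "c \<in> S.ZG" "t \<in> S.R.NZ" "B = S.R.cls (s *[group_ring \<Gamma>] c) t"
    by (rule S.R.Q_numer[OF assms(2)[unfolded quot_field_def] a(2)])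
  have s: "s \<in> S.ZG" using a(2) by blast
  show ?thesis
    unfolding a(3) c(3) quot_field_def S.R.mult_cls[OF a(1,2) c(1,2)] qm_cls[OF a(1,2)] qm_cls[OF S.R.m_closed[OF s c(1)] c(2)]
      qm_cls[OF S.R.m_closed[OF a(1) c(1)] c(2)] gm_mult[OF s c(1)] gm_mult[OF a(1) c(1)]
      T.R.mult_cls[OF gm_closed[OF a(1)] gm_nonzero[OF a(2)] gm_closed[OF c(1)] gm_nonzero[OF c(2)]] ..
qed

lemma qm_incl: "a \<in> S.ZG ==> qm (quot_incl \<Gamma> a) = quot_incl \<Gamma>' (gm a)"
  unfolding S.quot_incl_cls T.quot_incl_cls by (simp add: qm_cls[OF _ S.one_nz] group_ring_map_linear del: group_ring_simps)

lemma qm_emb: "\<gamma> \<in> carrier \<Gamma> ==> qm (S.emb \<gamma>) = T.emb (\<psi> \<gamma>)"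
  by (simp add: qm_incl group_ring_map_linear)

lemma qm_one: "qm 1[S.K] = 1[T.K]"
  unfolding S.quot_incl_one[symmetric] T.quot_incl_one[symmetric] using qm_emb[of "1[\<Gamma>]"] by simp

lemma qm_zero: "qm 0[S.K] = 0[T.K]"
  by (rule additive_map_zero[OF S.K.abelian_group_axioms T.K.abelian_group_axioms qm_additive])

lemma qm_inj: "inj_on qm (carrier S.K)"
proof (rule inj_onI)
  fix x y assume x: "x \<in> carrier S.K" and y: "y \<in> carrier S.K" and e: "qm x = qm y"
  let ?d = "x +[S.K] -[S.K] y"
  have qc: "qm y \<in> carrier T.K" by (rule additive_mapD(1)[OF qm_additive y])
  have "qm ?d = qm x +[T.K] -[T.K] qm y"
    using additive_mapD(2)[OF qm_additive x, of "-[S.K] y"] y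
      additive_map_minus[OF S.K.abelian_group_axioms T.K.abelian_group_axioms qm_additive y] by simp
  hence d0: "qm ?d = 0[T.K]" using e qc by (simp add: T.K.r_neg)
  have dc: "?d \<in> carrier S.K" using x y by simp
  have "?d = 0[S.K]"
  proof (rule ccontr)
    assume "?d ~= 0[S.K]"
    then obtain p where p: "p \<in> carrier S.K" "?d *[S.K] p = 1[S.K]" using S.K_inverse[OF dc] by blast
    have "1[T.K] = qm ?d *[T.K] qm p" using qm_mult[OF dc p(1)] p(2) qm_one by simp
    also have "\<dots> = 0[T.K]" unfolding d0 using additive_mapD(1)[OF qm_additive p(1)] by simp
    finally show False using T.K_one_not_zero by simp
  qed
  thus "x = y" using x y S.K.minus_equality[of x "-[S.K] y"] by simp
qed

lemma qm_coeff_map: "coeff_map G S.K (KG_act \<Gamma> \<rho>) G T.K (KG_act \<Gamma>' \<rho>') (%h. h) qm"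
proof
  show "(%h. h) \<in> hom G G" by (simp add: hom_def)
  show "additive_map S.K T.K qm" by (rule qm_additive)
  fix g m assume g: "g \<in> carrier G" and m: "m \<in> carrier S.K"
  have r: "\<rho> g \<in> carrier \<Gamma>" using g by simp
  show "qm (KG_act \<Gamma> \<rho> g m) = KG_act \<Gamma>' \<rho>' g (qm m)"
    unfolding S.act_def T.act_def qm_mult[OF S.emb_closed[OF r] m] qm_emb[OF r] psi_rho[OF g] ..
qed

lemma H1K_map_universal_derivation:
  assumes g: "g \<in> carrier G"
  shows "H1K_map \<Gamma> G \<Gamma>' \<rho>' (%h. h) \<psi> (S.universal_derivation g) = T.universal_derivation g"
proof -
  interpret I: coeff_map G S.K "KG_act \<Gamma> \<rho>" G T.K "KG_act \<Gamma>' \<rho>'" "%h. h" qm by (rule qm_coeff_map)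
  have e: "chain_map S.K T.K (%h. h) qm (chain_single S.K [g] 1[S.K]) = chain_single T.K [g] 1[T.K]"
    using I.cm_single[OF S.K.one_closed, of "[g]"] by (simp add: qm_one)
  show ?thesis
    unfolding H1K_map_def S.universal_derivation_def S.single_class_def
      I.homology_map_class[OF S.single_closed[OF g S.K.one_closed]] e T.universal_derivation_def T.single_class_def ..
qed

lemma single_boundary_ascent:
  assumes "chain_single S.K [g] 1[S.K] \<in> S.B1" shows "chain_single T.K [g] 1[T.K] \<in> T.B1"
proof -
  interpret I: coeff_map G S.K "KG_act \<Gamma> \<rho>" G T.K "KG_act \<Gamma>' \<rho>'" "%h. h" qm by (rule qm_coeff_map)
  have "chain_map S.K T.K (%h. h) qm (chain_single S.K [g] 1[S.K]) = chain_single T.K [g] 1[T.K]"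
    using I.cm_single[OF S.K.one_closed, of "[g]"] by (simp add: qm_one)
  thus ?thesis using I.cm_boundaries[OF assms] by (simp only:)
qed

text \<open>A bounding chain over the larger field has finitely many coefficients. A retraction
  defined on a subspace \<open>W\<close> containing them is linear for the left multiplications,
  hence equivariant, and carries the chain to a bounding chain over the smaller field. This keeps
  the kernel of \<open>G \<rightarrow> \<F>_k(G)\<close> from outgrowing the series.\<close>

lemma single_boundary_descent:
  assumes B: "chain_single T.K [g] 1[T.K] \<in> T.B1" shows "chain_single S.K [g] 1[S.K] \<in> S.B1"
proof -
  obtain b where b: "b \<in> bar_chains (Suc 1) G T.K" "chain_single T.K [g] 1[T.K] = boundary G T.K (KG_act \<Gamma>' \<rho>') b"
    using B unfolding in_boundaries by blast
  define Y where "Y = b ` {x. b x ~= 0[T.K]}"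
  have Y: "finite Y" "Y <= carrier T.K" using b(1) by (auto simp: Y_def chains_on_def)
  obtain W r where W: "W <= carrier T.K" "Y <= W" "qm ` carrier S.K <= W"
      and Wa0: "\<forall>x\<in>W. \<forall>y\<in>W. x +[T.K] y \<in> W" and Wn0: "\<forall>x\<in>W. -[T.K] x \<in> W"
      and Wm0: "\<forall>k\<in>carrier S.K. \<forall>x\<in>W. qm k *[T.K] x \<in> W & r (qm k *[T.K] x) = k *[S.K] r x"
      and rc0: "\<forall>x\<in>W. r x \<in> carrier S.K"
      and ra0: "\<forall>x\<in>W. \<forall>y\<in>W. r (x +[T.K] y) = r x +[S.K] r y" and r1: "r 1[T.K] = 1[S.K]"
    by (rule linear_retraction[OF S.K.ring_axioms T.K.ring_axioms _ qm_additive _ qm_one qm_inj Y, THEN exE], erule (1) S.K_left_inverse, erule (1) qm_mult)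
      (elim exE conjE, rule that; assumption)
  \<comment> \<open>The subspace \<open>W\<close> as a coefficient module in its own right:
    \<open>b\<close> is a chain over it, and both the inclusion and the retraction induce chain
    maps.\<close>
  define M where "M = T.K\<lparr>carrier := W\<rparr>"
  have Ms: "carrier M = W" "0[M] = 0[T.K]" "x +[M] y = x +[T.K] y" for x y by (simp_all add: M_def)
  have wK: "x \<in> carrier T.K" if "x \<in> W" for x using that W(1) by blast
  have W0: "0[T.K] \<in> W" using imageI[OF S.K.zero_closed, of qm] W(3) by (auto simp: qm_zero)
  have W1: "1[T.K] \<in> W" using imageI[OF S.K.one_closed, of qm] W(3) by (auto simp: qm_one)
  have abM: "abelian_group M"
  proof (rule abelian_groupI)
    fix x assume x: "x \<in> carrier M"
    hence "-[T.K] x +[T.K] x = 0[T.K]" using wK by (simp add: Ms T.K.l_neg)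
    thus "\<exists>y\<in>carrier M. y +[M] x = 0[M]" using x bspec[OF Wn0] unfolding Ms by blast
  qed (simp_all add: Ms wK Wa0 W0 T.K.a_ac)
  interpret M: abelian_group M by (rule abM)
  have act: "KG_act \<Gamma>' \<rho>' h m = qm (S.emb (\<rho> h)) *[T.K] m" if "h \<in> carrier G" for h m
    unfolding T.act_def using qm_emb[of "\<rho> h"] psi_rho[OF that] that by simp
  have er: "S.emb (\<rho> h) \<in> carrier S.K" if "h \<in> carrier G" for h using S.emb_closed that by simp
  have actW: "KG_act \<Gamma>' \<rho>' h m \<in> W" if "h \<in> carrier G" "m \<in> W" for h m
    unfolding act[OF that(1)] using bspec[OF bspec[OF Wm0 er[OF that(1)]] that(2)] by simp
  have aa: "KG_act \<Gamma>' \<rho>' h (x +[T.K] y) = KG_act \<Gamma>' \<rho>' h x +[T.K] KG_act \<Gamma>' \<rho>' h y" if "h \<in> carrier G" "x \<in> W" "y \<in> W" for h x y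
    by (rule additive_mapD(2)[OF T.act_additive[OF that(1)] wK[OF that(2)] wK[OF that(3)]])
  have cM: "coeff G M (KG_act \<Gamma>' \<rho>')"
  proof
    show "additive_map M M (KG_act \<Gamma>' \<rho>' h)" if "h \<in> carrier G" for h
      using actW[OF that] aa[OF that] by (simp add: additive_map_def Ms)
    show "KG_act \<Gamma>' \<rho>' (g *[G] h) m = KG_act \<Gamma>' \<rho>' g (KG_act \<Gamma>' \<rho>' h m)" if "g \<in> carrier G" "h \<in> carrier G" "m \<in> carrier M" for g h m
      by (rule T.act_mult[OF that(1,2) wK[OF that(3)[unfolded Ms]]])
    show "KG_act \<Gamma>' \<rho>' 1[G] m = m" if "m \<in> carrier M" for m by (rule T.act_one[OF wK[OF that[unfolded Ms]]])
  qed
  have addI: "additive_map M T.K (%w. w)" using wK by (simp add: additive_map_def Ms)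
  have idh: "(%h. h) \<in> hom G G" by (simp add: hom_def)
  have I: "coeff_map G M (KG_act \<Gamma>' \<rho>') G T.K (KG_act \<Gamma>' \<rho>') (%h. h) (%w. w)"
    by (rule coeff_map.intro[OF cM T.coeff_axioms coeff_map_axioms.intro[OF idh addI HOL.refl]])
  have Rm: "coeff_map G M (KG_act \<Gamma>' \<rho>') G S.K (KG_act \<Gamma> \<rho>) (%h. h) r"
  proof (rule coeff_map.intro[OF cM S.coeff_axioms coeff_map_axioms.intro])
    show "(%h. h) \<in> hom G G" by (simp add: hom_def)
    show "additive_map M S.K r" using rc0 ra0 by (simp add: additive_map_def Ms)
    fix h m assume h: "h \<in> carrier G" and m: "m \<in> carrier M"
    show "r (KG_act \<Gamma>' \<rho>' h m) = KG_act \<Gamma> \<rho> h (r m)"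
      unfolding act[OF h] S.act_def using bspec[OF bspec[OF Wm0 er[OF h]] m[unfolded Ms]] by simp
  qed
  have bM: "b \<in> bar_chains (Suc 1) G M"
  proof -
    have "b x \<in> W" for x using W(2) W0 by (cases "b x = 0[T.K]") (auto simp: Y_def)
    thus ?thesis using b(1) by (simp add: chains_on_def Ms)
  qed
  have bdM: "boundary G M (KG_act \<Gamma>' \<rho>') b \<in> bar_chains 1 G M" by (rule coeff.boundary_closed[OF cM bM])
  have "boundary G M (KG_act \<Gamma>' \<rho>') b = chain_map M T.K (%h. h) (%w. w) (boundary G M (KG_act \<Gamma>' \<rho>') b)"
    using chain_map_id[OF abM T.K.abelian_group_axioms bdM addI] by simp
  also have "\<dots> = boundary G T.K (KG_act \<Gamma>' \<rho>') (chain_map M T.K (%h. h) (%w. w) b)" by (rule coeff_map.cm_boundary[OF I bM])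
  also have "\<dots> = chain_single T.K [g] 1[T.K]"
    using chain_map_id[OF abM T.K.abelian_group_axioms bM addI] b(2) by simp
  also have "\<dots> = chain_single M [g] 1[T.K]" unfolding chain_single_def Ms ..
  finally have 1: "boundary G M (KG_act \<Gamma>' \<rho>') b = chain_single M [g] 1[T.K]" .
  have "boundary G S.K (KG_act \<Gamma> \<rho>) (chain_map M S.K (%h. h) r b) = chain_map M S.K (%h. h) r (chain_single M [g] 1[T.K])"
    using coeff_map.cm_boundary[OF Rm bM] unfolding 1 by simp
  also have "\<dots> = chain_single S.K [g] 1[S.K]" using coeff_map.cm_single[OF Rm, of "1[T.K]" "[g]"] W1 by (simp add: Ms r1)
  finally show ?thesis unfolding in_boundaries using coeff_map.cm_closed[OF Rm bM] by metis
qed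

end

section \<open>The stages of the tower\<close>

lemma ore_group_image:
  assumes O: "ore_group G" and e: "inj_on e (carrier G)" shows "ore_group (image_group e G)"
proof -
  have G: "group G" using O by (simp add: ore_group_def)
  interpret G: group G by (rule G)
  note I = image_group_inj[OF G e]
  let ?p = "inv_into (carrier G) e"
  have p: "?p (e x) = x" if "x \<in> carrier G" for x using inv_into_f_f[OF e that] .
  have ker: "x = 1[image_group e G]" if x: "x \<in> kernel (image_group e G) G ?p" for x
  proof -
    obtain a where a: "a \<in> carrier G" "x = e a" using x unfolding kernel_def I(4) by blast
    have "a = 1[G]" using x p[OF a(1)] unfolding kernel_def a(2) by simp
    thus ?thesis using a(2) I(5) by simp
  qed
  show ?thesis
  \<comment> \<open>The inverse of \<open>e\<close> exhibits the copy as an extension of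
    \<open>G\<close> by the trivial group.\<close>
  proof (rule ore_group_extension[OF I(1) O, of ?p])
    show "?p \<in> hom (image_group e G) G" by (rule homI) (auto simp: I(4) p I(3))
    show "?p ` carrier (image_group e G) = carrier G" unfolding I(4) image_image using p by simp
    fix x assume x: "x \<in> kernel (image_group e G) G ?p"
    { fix y assume y: "y \<in> kernel (image_group e G) G ?p"
      show "x *[image_group e G] y = y *[image_group e G] x" unfolding ker[OF x] ker[OF y] .. }
    fix n :: nat show "x = 1[image_group e G]" by (rule ker[OF x])
  qed
qed

text \<open>The invariant of the tower. The Ore property provides the next skew field, countability
  the coding, and the condition on the kernel makes \<open>\<sigma>_k\<close> injective, so that
  skew fields can be compared.\<close>

definition tower_stage :: "'a monoid => nat => 'a monoid => ('a => 'a) => bool" where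
  "tower_stage G k \<Gamma> \<rho> \<longleftrightarrow> ore_group \<Gamma> & countable (carrier \<Gamma>) & \<rho> \<in> hom G \<Gamma> &
     (\<forall>g\<in>carrier G. \<rho> g = 1[\<Gamma>] \<longleftrightarrow> g \<in> tf_derived G k)"

lemma CH_code_inj:
  fixes G :: "'a monoid"
  assumes "group G" "countable (carrier G)" "infinite (UNIV :: 'a set)" "tower_stage G k \<Gamma> \<rho>"
  shows "inj_on (CH_code G \<Gamma> \<rho>) (carrier (CH_semidirect G \<Gamma> \<rho>))"
proof -
  interpret group G by fact
  interpret T: skew_coeff G \<Gamma> \<rho> by unfold_locales (use assms(4) in \<open>simp_all add: tower_stage_def\<close>)
  have c: "countable (carrier \<Gamma>)" using assms(4) by (simp add: tower_stage_def)
  have "countable (carrier (CH_semidirect G \<Gamma> \<rho>))"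
    unfolding T.CH_semidirect_eq using T.countable_H1[OF c assms(2)] c by (simp add: semidirect_def)
  hence "\<exists>e :: _ => 'a. inj_on e (carrier (CH_semidirect G \<Gamma> \<rho>))" by (rule countable_injection[OF _ assms(3)])
  thus ?thesis unfolding CH_code_def by (rule someI_ex)
qed

text \<open>As \<open>\<rho>\<close> has kernel \<open>G_H^(k)\<close>, the induced
  \<open>\<sigma>_k\<close> is injective, and the skew field of \<open>G / G_H^(k)\<close> maps to
  that of \<open>\<F>_k(G)\<close>.\<close>

lemma on_cosets_stage:
  fixes G :: "'a monoid"
  assumes G: "group G" and st: "tower_stage G k \<Gamma> \<rho>"
  shows "skew_map G (G Mod tf_derived G k) (%g. tf_derived G k #>[G] g) \<Gamma> \<rho> (on_cosets \<rho>)"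
proof -
  let ?N = "tf_derived G k"
  interpret group G by fact
  have N: "?N \<lhd> G" using tf_derived_normal_ore[OF G] by blast
  interpret N: normal ?N G by (rule N)
  interpret S: skew_coeff G "G Mod ?N" "%g. ?N #>[G] g" by (rule tf_derived_skew_coeff[OF G])
  interpret T: skew_coeff G \<Gamma> \<rho> by unfold_locales (use st in \<open>simp_all add: tower_stage_def\<close>)
  have ker: "\<rho> g = 1[\<Gamma>] \<longleftrightarrow> g \<in> ?N" if "g \<in> carrier G" for g using st that by (simp add: tower_stage_def)
  have oc: "on_cosets \<rho> (?N #>[G] g) = \<rho> g" if g: "g \<in> carrier G" for g
  proof -
    have "\<rho> ` (?N #>[G] g) = {\<rho> g}"
    proof
      show "\<rho> ` (?N #>[G] g) <= {\<rho> g}"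
      proof (rule image_subsetI)
        fix x assume "x \<in> ?N #>[G] g"
        then obtain n where n: "n \<in> ?N" "x = n *[G] g" unfolding r_coset_def by blast
        have nc: "n \<in> carrier G" using N.mem_carrier[OF n(1)] .
        show "\<rho> x \<in> {\<rho> g}" unfolding n(2) T.rho.hom_mult[OF nc g] using ker[OF nc] n(1) g by simp
      qed
      show "{\<rho> g} <= \<rho> ` (?N #>[G] g)" using rcos_self[OF g N.subgroup_axioms] by blast
    qed
    thus ?thesis by (simp add: on_cosets_def)
  qed
  have car: "\<exists>x\<in>carrier G. A = ?N #>[G] x" if "A \<in> carrier (G Mod ?N)" for A
    using that by (auto simp: FactGroup_def RCOSETS_def)
  show ?thesis
  proof unfold_locales
    show "on_cosets \<rho> \<in> hom (G Mod ?N) \<Gamma>"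
    proof (rule homI)
      fix A assume A: "A \<in> carrier (G Mod ?N)"
      obtain x where x: "x \<in> carrier G" "A = ?N #>[G] x" using car[OF A] by (rule bexE)
      show "on_cosets \<rho> A \<in> carrier \<Gamma>" unfolding x(2) oc[OF x(1)] using x(1) by simp
      fix B assume B: "B \<in> carrier (G Mod ?N)"
      obtain y where y: "y \<in> carrier G" "B = ?N #>[G] y" using car[OF B] by (rule bexE)
      show "on_cosets \<rho> (A *[G Mod ?N] B) = on_cosets \<rho> A *[\<Gamma>] on_cosets \<rho> B"
        unfolding x(2) y(2) mult_FactGroup N.rcos_sum[OF x(1) y(1)] oc[OF x(1)] oc[OF y(1)] oc[OF m_closed[OF x(1) y(1)]]
        by (rule T.rho.hom_mult[OF x(1) y(1)])
    qed
    show "inj_on (on_cosets \<rho>) (carrier (G Mod ?N))"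
    proof (rule inj_onI)
      fix A B assume A: "A \<in> carrier (G Mod ?N)" and B: "B \<in> carrier (G Mod ?N)" and e: "on_cosets \<rho> A = on_cosets \<rho> B"
      obtain x where x: "x \<in> carrier G" "A = ?N #>[G] x" using car[OF A] by (rule bexE)
      obtain y where y: "y \<in> carrier G" "B = ?N #>[G] y" using car[OF B] by (rule bexE)
      have "\<rho> x = \<rho> y" using e unfolding x(2) y(2) oc[OF x(1)] oc[OF y(1)] .
      hence "\<rho> (x *[G] inv[G] y) = 1[\<Gamma>]" using x(1) y(1) by simp
      hence "x *[G] inv[G] y \<in> ?N" using ker[of "x *[G] inv[G] y"] x(1) y(1) by blast
      thus "A = B" unfolding x(2) y(2) using Mod_eq_iff[OF G N x(1) y(1)] by simp
    qed
    fix g assume "g \<in> carrier G"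
    thus "on_cosets \<rho> (?N #>[G] g) = \<rho> g" by (rule oc)
  qed
qed

lemma tower_stage_Suc:
  fixes G :: "'a monoid"
  assumes G: "group G" "countable (carrier G)" "infinite (UNIV :: 'a set)" and st: "tower_stage G k \<Gamma> \<rho>"
  shows "tower_stage G (Suc k) (image_group (CH_code G \<Gamma> \<rho>) (CH_semidirect G \<Gamma> \<rho>))
    (%g. CH_code G \<Gamma> \<rho> (CH_derivation G k \<Gamma> \<rho> g, \<rho> g))"
proof -
  let ?N = "tf_derived G k" and ?e = "CH_code G \<Gamma> \<rho>" and ?d = "CH_derivation G k \<Gamma> \<rho>"
  interpret group G by fact
  interpret T: skew_coeff G \<Gamma> \<rho> by unfold_locales (use st in \<open>simp_all add: tower_stage_def\<close>)
  interpret M: skew_map G "G Mod ?N" "%g. ?N #>[G] g" \<Gamma> \<rho> "on_cosets \<rho>" by (rule on_cosets_stage[OF G(1) st])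
  have ker: "\<rho> g = 1[\<Gamma>] \<longleftrightarrow> g \<in> ?N" if "g \<in> carrier G" for g
    using st that by (simp add: tower_stage_def)
  have cG: "countable (carrier \<Gamma>)" using st by (simp add: tower_stage_def)
  have Nc: "g \<in> carrier G" if "g \<in> ?N" for g using subsetD[OF tf_derived_carrier that] .
  have act: "H1K_act G \<Gamma> \<rho> = T.V_act" by (rule ext) (simp add: T.V_act_def T.H1K_act_eq)
  have phi: "CH_phi G k \<Gamma> \<rho> g = T.universal_derivation g" if g: "g \<in> ?N" for g
    unfolding CH_phi_def series_map_eq[OF M.S.skew_coeff_axioms Nc[OF g]] by (rule M.H1K_map_universal_derivation[OF Nc[OF g]])
  \<comment> \<open>\<open>CH_derivation\<close> is a choice and has its properties only if some
    candidate exists. On \<open>G_H^(k)\<close> the prescribed map is the universal derivation over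
    the larger field, with which the cycle derivation agrees there.\<close>
  have ex: "\<exists>d. d \<in> carrier G \<rightarrow> carrier (H1K G \<Gamma> \<rho>) &
        (\<forall>g\<in>carrier G. \<forall>h\<in>carrier G. d (g *[G] h) = d g *[H1K G \<Gamma> \<rho>] H1K_act G \<Gamma> \<rho> (\<rho> g) (d h)) &
        (\<forall>g\<in>?N. d g = CH_phi G k \<Gamma> \<rho> g)"
  proof -
    obtain d where d: "d \<in> carrier G \<rightarrow> carrier T.H1"
      "\<forall>g\<in>carrier G. \<forall>h\<in>carrier G. d (g *[G] h) = d g *[T.H1] T.V_act (\<rho> g) (d h)"
      "\<forall>g\<in>carrier G. \<rho> g = 1[\<Gamma>] --> d g = T.universal_derivation g" using T.exists_cycle_derivation by (elim exE conjE)
    have "\<forall>g\<in>?N. d g = CH_phi G k \<Gamma> \<rho> g"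
    proof
      fix g assume g: "g \<in> ?N"
      show "d g = CH_phi G k \<Gamma> \<rho> g" unfolding phi[OF g] using bspec[OF d(3) Nc[OF g]] ker[OF Nc[OF g]] g by simp
    qed
    thus ?thesis unfolding T.H1K_eq act using d(1,2) by (intro exI[of _ d] conjI)
  qed
  have D: "?d \<in> carrier G \<rightarrow> carrier (H1K G \<Gamma> \<rho>) &
        (\<forall>g\<in>carrier G. \<forall>h\<in>carrier G. ?d (g *[G] h) = ?d g *[H1K G \<Gamma> \<rho>] H1K_act G \<Gamma> \<rho> (\<rho> g) (?d h)) &
        (\<forall>g\<in>?N. ?d g = CH_phi G k \<Gamma> \<rho> g)"
    unfolding CH_derivation_def by (rule someI_ex[OF ex])
  note d = conjunct1[OF D[unfolded T.H1K_eq act]]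
  note dm = conjunct1[OF conjunct2[OF D[unfolded T.H1K_eq act]]]
  note dN = conjunct2[OF conjunct2[OF D[unfolded T.H1K_eq act]]]
  have inj: "inj_on ?e (carrier (semidirect T.H1 \<Gamma> T.V_act))"
    using CH_code_inj[OF G st] unfolding T.CH_semidirect_eq .
  have gs: "group (semidirect T.H1 \<Gamma> T.V_act)" by (rule T.group_CH_semidirect)
  note I = image_group_inj[OF gs inj]
  have pc: "(?d g, \<rho> g) \<in> carrier (semidirect T.H1 \<Gamma> T.V_act)" if "g \<in> carrier G" for g
    using d that by (auto simp: semidirect_def)
  let ?I = "image_group ?e (semidirect T.H1 \<Gamma> T.V_act)"
  have "ore_group ?I" by (rule ore_group_image[OF T.ore_group_CH_semidirect inj])
  moreover have "countable (carrier ?I)"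
    unfolding I(4) using T.countable_H1[OF cG G(2)] cG by (simp add: semidirect_def)
  moreover have "(%g. ?e (?d g, \<rho> g)) \<in> hom G ?I"
  proof (rule homI)
    fix g assume g: "g \<in> carrier G"
    thus "?e (?d g, \<rho> g) \<in> carrier ?I" unfolding I(4) using pc by blast
    fix h assume h: "h \<in> carrier G"
    show "?e (?d (g *[G] h), \<rho> (g *[G] h)) = ?e (?d g, \<rho> g) *[?I] ?e (?d h, \<rho> h)"
      unfolding I(3)[OF pc[OF g] pc[OF h]] bspec[OF bspec[OF dm g] h] T.rho.hom_mult[OF g h] by (simp add: semidirect_def)
  qed
  moreover have "?e (?d g, \<rho> g) = 1[?I] \<longleftrightarrow> g \<in> tf_derived G (Suc k)" if g: "g \<in> carrier G" for g
  proof -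
    interpret s: group "semidirect T.H1 \<Gamma> T.V_act" by (rule gs)
    have "?e (?d g, \<rho> g) = 1[?I] \<longleftrightarrow> (?d g, \<rho> g) = 1[semidirect T.H1 \<Gamma> T.V_act]"
      unfolding I(5) using inj_on_eq_iff[OF inj pc[OF g] s.one_closed] .
    also have "\<dots> \<longleftrightarrow> ?d g = 1[T.H1] & g \<in> ?N" by (simp add: semidirect_def ker[OF g])
    also have "\<dots> \<longleftrightarrow> T.universal_derivation g = 1[T.C1] & g \<in> ?N" using dN phi[of g] by (auto simp: T.H1_one_C1)
    \<comment> \<open>The left side says that \<open>1 [g]\<close> bounds over the skew field of
      \<open>\<Gamma>\<close>, the right side that it bounds over that of the quotient of
      \<open>G\<close>.\<close>
    also have "\<dots> \<longleftrightarrow> g \<in> tf_derived G (Suc k)"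
      unfolding T.universal_derivation_one_iff[OF g] mem_tf_derived_Suc[OF G(1)]
      using M.single_boundary_ascent[of g] M.single_boundary_descent[of g] by blast
    finally show ?thesis .
  qed
  ultimately show ?thesis unfolding tower_stage_def T.CH_semidirect_eq by blast
qed

lemma tower_stages:
  fixes G :: "'a monoid"
  assumes G: "group G" "countable (carrier G)" "infinite (UNIV :: 'a set)"
  shows "tower_stage G k (CH_group G k) (CH_unit G k)"
proof (induction k)
  case 0
  have g: "group (singleton_group (undefined :: 'a))" by simp
  have "ore_group (singleton_group (undefined :: 'a))" by (rule ore_group_trivial[OF g]) (simp add: singleton_group_def)
  thus ?case by (simp add: tower_stage_def hom_def singleton_group_def)
next
  case (Suc k)
  have "CH_tower G (Suc k) = (image_group (CH_code G (CH_group G k) (CH_unit G k)) (CH_semidirect G (CH_group G k) (CH_unit G k)),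
      %g. CH_code G (CH_group G k) (CH_unit G k) (CH_derivation G k (CH_group G k) (CH_unit G k) g, CH_unit G k g))"
    by (simp add: case_prod_beta)
  thus ?case using tower_stage_Suc[OF G Suc] by simp
qed

section \<open>Commutators in the tower\<close>

declare CH_tower.simps [simp del]

text \<open>Each commutator \<open>z\<close> equals \<open>[\<gamma>, w]\<close> with
  \<open>w = [\<gamma>, v]\<close>. The equations are written without inverses, so that they can be
  read off componentwise in a semidirect product.\<close>

definition double_commutators :: "'a monoid => bool" where
  "double_commutators C \<longleftrightarrow> (\<forall>x\<in>carrier C. \<forall>y\<in>carrier C. \<forall>z\<in>carrier C.
     x *[C] y = z *[C] y *[C] x -->
     (\<exists>\<gamma>\<in>carrier C. \<exists>w\<in>carrier C. \<exists>v\<in>carrier C.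
        \<gamma> *[C] w = z *[C] w *[C] \<gamma> & \<gamma> *[C] v = w *[C] v *[C] \<gamma>))"

locale ch_tower = group G for G :: "'a monoid" +
  assumes countable_G: "countable (carrier G)" and inf: "infinite (UNIV :: 'a set)"
begin

abbreviation "C k == CH_group G k"
abbreviation "V k == CH_module G k"
abbreviation "P k == CH_pair G k"

lemma stage: "tower_stage G k (C k) (CH_unit G k)"
  by (rule tower_stages[OF is_group countable_G inf])

lemma skew: "skew_coeff G (C k) (CH_unit G k)"
  by unfold_locales (use stage[of k] in \<open>simp_all add: tower_stage_def\<close>)

abbreviation "act k == H1K_act G (C k) (CH_unit G k)"

lemma act_eq: "act k = skew_coeff.V_act G (C k) (CH_unit G k)"
  by (rule ext) (simp add: skew_coeff.V_act_def[OF skew] skew_coeff.H1K_act_eq[OF skew])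

lemma group_CH: "group (C k)"
  using stage[of k] by (simp add: tower_stage_def ore_group_def)

lemma group_V: "comm_group (V k)"
proof -
  interpret S: skew_coeff G "C k" "CH_unit G k" by (rule skew)
  show ?thesis unfolding S.H1K_eq by (rule S.H1_comm_group)
qed

lemma act_closed: "\<gamma> \<in> carrier (C k) ==> x \<in> carrier (V k) ==> act k \<gamma> x \<in> carrier (V k)"
  unfolding act_eq skew_coeff.H1K_eq[OF skew] by (rule skew_coeff.V_act_closed[OF skew])

lemma act_one: "x \<in> carrier (V k) ==> act k 1[C k] x = x"
proof -
  interpret S: skew_coeff G "C k" "CH_unit G k" by (rule skew)
  show "x \<in> carrier (V k) ==> act k 1[C k] x = x"
    unfolding act_eq S.H1K_eq by (rule S.V_act_one) (rule subsetD[OF S.H1_carrier_C1])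
qed

lemma act_solve:
  "[|\<gamma> \<in> carrier (C k); \<delta> \<in> carrier (C k); \<gamma> ~= \<delta>; x \<in> carrier (V k)|] ==>
    \<exists>y\<in>carrier (V k). act k \<gamma> y = x *[V k] act k \<delta> y"
  unfolding act_eq skew_coeff.H1K_eq[OF skew] by (rule skew_coeff.V_act_solve[OF skew])

lemma group_sd: "group (semidirect (V k) (C k) (act k))"
  unfolding act_eq skew_coeff.H1K_eq[OF skew] by (rule skew_coeff.group_CH_semidirect[OF skew])

lemma pair_inj_on: "inj_on (P k) (carrier (semidirect (V k) (C k) (act k)))"
  using CH_code_inj[OF is_group countable_G inf stage] by (simp add: CH_semidirect_def)

lemma CH_group_Suc: "C (Suc k) = image_group (P k) (semidirect (V k) (C k) (act k))"
  by (simp add: case_prod_beta CH_semidirect_def CH_tower.simps)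

text \<open>Read off from the unit law of the semidirect product.\<close>

lemma act_1: "\<gamma> \<in> carrier (C k) ==> act k \<gamma> 1[V k] = 1[V k]"
proof -
  assume g: "\<gamma> \<in> carrier (C k)"
  interpret V: comm_group "V k" by (rule group_V)
  interpret C: group "C k" by (rule group_CH)
  interpret s: group "semidirect (V k) (C k) (act k)" by (rule group_sd)
  have "(1[V k], \<gamma>) *[semidirect (V k) (C k) (act k)] (1[V k], 1[C k]) = (1[V k], \<gamma>)"
    using s.r_one[of "(1[V k], \<gamma>)"] g by (simp add: semidirect_def)
  thus ?thesis using act_closed[OF g V.one_closed] by (simp add: semidirect_def)
qed

lemma CH_Suc_cases:
  assumes "z \<in> carrier (C (Suc k))"
  obtains x \<gamma> where "x \<in> carrier (V k)" "\<gamma> \<in> carrier (C k)" "z = P k (x, \<gamma>)"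
  using assms unfolding CH_group_Suc image_group_inj(4)[OF group_sd pair_inj_on] by (auto simp: semidirect_def)

lemma pair_closed: "x \<in> carrier (V k) ==> \<gamma> \<in> carrier (C k) ==> P k (x, \<gamma>) \<in> carrier (C (Suc k))"
  unfolding CH_group_Suc image_group_inj(4)[OF group_sd pair_inj_on] by (auto simp: semidirect_def)

lemma pair_mult:
  "[|x \<in> carrier (V k); \<gamma> \<in> carrier (C k); y \<in> carrier (V k); \<delta> \<in> carrier (C k)|] ==>
   P k (x, \<gamma>) *[C (Suc k)] P k (y, \<delta>) =
   P k (x *[V k] act k \<gamma> y, \<gamma> *[C k] \<delta>)"
  unfolding CH_group_Suc by (subst image_group_inj(3)[OF group_sd pair_inj_on]) (auto simp: semidirect_def)

lemma pair_one: "1[C (Suc k)] = P k (1[V k], 1[C k])"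
  unfolding CH_group_Suc image_group_inj(5)[OF group_sd pair_inj_on] by (simp add: semidirect_def)

lemma pair_eq_iff:
  "[|x \<in> carrier (V k); \<gamma> \<in> carrier (C k); y \<in> carrier (V k); \<delta> \<in> carrier (C k)|] ==>
   P k (x, \<gamma>) = P k (y, \<delta>) \<longleftrightarrow> x = y & \<gamma> = \<delta>"
  using inj_on_eq_iff[OF pair_inj_on[of k], of "(x, \<gamma>)" "(y, \<delta>)"] by (simp add: semidirect_def)

lemma carrier_0: "carrier (C 0) = {1[C 0]}"
  by (simp add: singleton_group_def CH_tower.simps)

text \<open>The elements over \<open>1 \<in> \<F>\<^sub>1(G)\<close> and a lift of a nontrivial element of \<open>\<F>\<^sub>1(G)\<close>, with the index shifted by one.\<close>

primrec wset :: "nat => 'a set" where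
  "wset 0 = {1[C (Suc 0)]}"
| "wset (Suc j) = {P (Suc j) (x, z) | x z. x \<in> carrier (V (Suc j)) & z \<in> wset j}"

primrec gam :: "('a list => 'a qelem) set => nat => 'a" where
  "gam x 0 = P 0 (x, 1[C 0])"
| "gam x (Suc j) = P (Suc j) (1[V (Suc j)], gam x j)"

lemma one_V: "1[V k] \<in> carrier (V k)"
  using group_V[of k] by (simp add: comm_group_def monoid.one_closed group.is_monoid)

lemma one_CH: "1[C k] \<in> carrier (C k)"
  using group_CH[of k] by (simp add: monoid.one_closed group.is_monoid)

lemma wset_sub: "z \<in> wset j ==> z \<in> carrier (C (Suc j))"
proof (induction j arbitrary: z)
  case 0
  thus ?case using one_CH[of "Suc 0"] by simp
next
  case (Suc j)
  obtain x y where "x \<in> carrier (V (Suc j))" "y \<in> wset j" "z = P (Suc j) (x, y)"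
    using Suc.prems by auto
  thus ?case using pair_closed[OF _ Suc.IH] by simp
qed

lemma gam_closed: "x \<in> carrier (V 0) ==> gam x j \<in> carrier (C (Suc j))"
  by (induction j) (simp_all only: gam.simps pair_closed one_V one_CH)

lemma gam_not_wset:
  assumes x: "x \<in> carrier (V 0)" "x ~= 1[V 0]" shows "gam x j \<notin> wset j"
proof (induction j)
  case 0
  show ?case unfolding gam.simps wset.simps pair_one using pair_eq_iff[OF x(1) one_CH one_V one_CH] x(2) by simp
next
  case (Suc j)
  show ?case
  proof
    assume "gam x (Suc j) \<in> wset (Suc j)"
    then obtain y z where yz: "y \<in> carrier (V (Suc j))" "z \<in> wset j"
      "P (Suc j) (1[V (Suc j)], gam x j) = P (Suc j) (y, z)" by auto
    hence "gam x j = z" using pair_eq_iff[OF one_V gam_closed[OF x(1)] yz(1) wset_sub[OF yz(2)]] by simp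
    thus False using Suc yz(2) by simp
  qed
qed

text \<open>Over the trivial group \<open>\<F>_0(G)\<close> the action is trivial, so
  \<open>\<F>_1(G)\<close> is abelian and commutators map to 1 there. Further up the relation is
  inherited by the second components.\<close>

lemma commutator_wset:
  assumes "a \<in> carrier (C (Suc j))" "b \<in> carrier (C (Suc j))" "z \<in> carrier (C (Suc j))"
    and "a *[C (Suc j)] b = z *[C (Suc j)] b *[C (Suc j)] a"
  shows "z \<in> wset j"
  using assms
proof (induction j arbitrary: a b z)
  case (0 a b z)
  interpret V: comm_group "V 0" by (rule group_V)
  have *: "\<exists>x\<in>carrier (V 0). u = P 0 (x, 1[C 0])" if u: "u \<in> carrier (C (Suc 0))" for u
  proof -
    obtain x \<gamma> where x: "x \<in> carrier (V 0)" "\<gamma> \<in> carrier (C 0)" "u = P 0 (x, \<gamma>)"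
      by (rule CH_Suc_cases[OF u])
    have "\<gamma> = 1[C 0]" using x(2) unfolding carrier_0 by (rule singletonD)
    thus ?thesis using x by blast
  qed
  have m: "P 0 (x, 1[C 0]) *[C (Suc 0)] P 0 (y, 1[C 0]) =
    P 0 (x *[V 0] y, 1[C 0])"
    if "x \<in> carrier (V 0)" "y \<in> carrier (V 0)" for x y
    unfolding pair_mult[OF that(1) one_CH that(2) one_CH] act_one[OF that(2)] monoid.l_one[OF group.is_monoid[OF group_CH] one_CH] ..
  obtain x where x: "x \<in> carrier (V 0)" "a = P 0 (x, 1[C 0])" using *[OF 0(1)] by (rule bexE)
  obtain y where y: "y \<in> carrier (V 0)" "b = P 0 (y, 1[C 0])" using *[OF 0(2)] by (rule bexE)
  obtain c where c: "c \<in> carrier (V 0)" "z = P 0 (c, 1[C 0])" using *[OF 0(3)] by (rule bexE)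
  have "x *[V 0] y = c *[V 0] y *[V 0] x"
    using 0(4) unfolding x(2) y(2) c(2) m[OF x(1) y(1)] m[OF c(1) y(1)] m[OF V.m_closed[OF c(1) y(1)] x(1)]
      pair_eq_iff[OF V.m_closed[OF x(1) y(1)] one_CH V.m_closed[OF V.m_closed[OF c(1) y(1)] x(1)] one_CH] by simp
  also have "\<dots> = c *[V 0] (x *[V 0] y)"
    unfolding V.m_assoc[OF c(1) y(1) x(1)] V.m_comm[OF y(1) x(1)] ..
  finally have e: "1[V 0] *[V 0] (x *[V 0] y) = c *[V 0] (x *[V 0] y)"
    using x(1) y(1) by simp
  have "1[V 0] = c" by (rule V.r_cancel[OF e V.one_closed c(1) V.m_closed[OF x(1) y(1)]])
  thus ?case unfolding c(2) wset.simps pair_one by simp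
next
  case (Suc j a b z)
  let ?P = "P (Suc j)"
  obtain x \<alpha> where a: "x \<in> carrier (V (Suc j))" "\<alpha> \<in> carrier (C (Suc j))" "a = ?P (x, \<alpha>)" by (rule CH_Suc_cases[OF Suc.prems(1)])
  obtain y \<beta> where b: "y \<in> carrier (V (Suc j))" "\<beta> \<in> carrier (C (Suc j))" "b = ?P (y, \<beta>)" by (rule CH_Suc_cases[OF Suc.prems(2)])
  obtain w \<zeta> where z: "w \<in> carrier (V (Suc j))" "\<zeta> \<in> carrier (C (Suc j))" "z = ?P (w, \<zeta>)" by (rule CH_Suc_cases[OF Suc.prems(3)])
  interpret V: comm_group "V (Suc j)" by (rule group_V)
  interpret C: group "C (Suc j)" by (rule group_CH)
  have "\<alpha> *[C (Suc j)] \<beta> = \<zeta> *[C (Suc j)] \<beta> *[C (Suc j)] \<alpha>"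
    using Suc.prems(4) unfolding a(3) b(3) z(3) pair_mult[OF a(1,2) b(1,2)] pair_mult[OF z(1,2) b(1,2)]
      pair_mult[OF V.m_closed[OF z(1) act_closed[OF z(2) b(1)]] C.m_closed[OF z(2) b(2)] a(1,2)]
      pair_eq_iff[OF V.m_closed[OF a(1) act_closed[OF a(2) b(1)]] C.m_closed[OF a(2) b(2)]
        V.m_closed[OF V.m_closed[OF z(1) act_closed[OF z(2) b(1)]] act_closed[OF C.m_closed[OF z(2) b(2)] a(1)]]
        C.m_closed[OF C.m_closed[OF z(2) b(2)] a(2)]] by (rule conjunct2)
  hence "\<zeta> \<in> wset j" by (rule Suc.IH[OF a(2) b(2) z(2)])
  thus ?case unfolding wset.simps z(3) using z(1) by blast
qed

text \<open>The second components solve the equation by assumption. As the lift of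
  \<open>gam\<close> has trivial module component, what remains is the linear equation
  \<open>act \<gamma> y = x + act z y\<close>. It is solvable since \<open>\<gamma>\<close> differs
  from \<open>z\<close>, their images in \<open>\<F>_1(G)\<close> being different.\<close>

lemma solve_step:
  assumes x0: "x0 \<in> carrier (V 0)" "x0 ~= 1[V 0]"
    and z: "z \<in> wset j" and w: "w \<in> wset j" and e: "gam x0 j *[C (Suc j)] w = z *[C (Suc j)] w *[C (Suc j)] gam x0 j"
    and x: "x \<in> carrier (V (Suc j))"
  shows "\<exists>y\<in>carrier (V (Suc j)).
    gam x0 (Suc j) *[C (Suc (Suc j))] P (Suc j) (y, w) =
    P (Suc j) (x, z) *[C (Suc (Suc j))] P (Suc j) (y, w) *[C (Suc (Suc j))] gam x0 (Suc j)"
proof -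
  let ?V = "V (Suc j)" and ?g = "gam x0 j"
  interpret V: comm_group ?V by (rule group_V)
  interpret C: group "C (Suc j)" by (rule group_CH)
  have g: "?g \<in> carrier (C (Suc j))" by (rule gam_closed[OF x0(1)])
  have zc: "z \<in> carrier (C (Suc j))" and wc: "w \<in> carrier (C (Suc j))" using wset_sub z w by blast+
  have ne: "?g ~= z" using gam_not_wset[OF x0, of j] z by blast
  obtain y where y: "y \<in> carrier ?V" "act (Suc j) ?g y = x *[?V] act (Suc j) z y" using act_solve[OF g zc ne x] by (rule bexE)
  have zy: "x *[?V] act (Suc j) z y \<in> carrier ?V" by (rule V.m_closed[OF x act_closed[OF zc y(1)]])
  show ?thesis
  proof (rule bexI[OF _ y(1)])
    show "gam x0 (Suc j) *[C (Suc (Suc j))] P (Suc j) (y, w) =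
      P (Suc j) (x, z) *[C (Suc (Suc j))] P (Suc j) (y, w) *[C (Suc (Suc j))] gam x0 (Suc j)"
      unfolding gam.simps pair_mult[OF V.one_closed g y(1) wc] pair_mult[OF x zc y(1) wc]
        pair_mult[OF zy C.m_closed[OF zc wc] V.one_closed g] act_1[OF C.m_closed[OF zc wc]] y(2) e V.r_one[OF zy] V.l_one[OF zy] ..
  qed
qed

lemma solve_base:
  assumes x0: "x0 \<in> carrier (V 0)" and z: "z \<in> wset 0"
  shows "gam x0 0 *[C (Suc 0)] 1[C (Suc 0)] = z *[C (Suc 0)] 1[C (Suc 0)] *[C (Suc 0)] gam x0 0"
proof -
  interpret C: group "C (Suc 0)" by (rule group_CH)
  have "z = 1[C (Suc 0)]" using z unfolding wset.simps by (rule singletonD)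
  thus ?thesis using gam_closed[OF x0, of 0] by (simp del: gam.simps)
qed

lemma solve:
  assumes x0: "x0 \<in> carrier (V 0)" "x0 ~= 1[V 0]" and z: "z \<in> wset j"
  shows "\<exists>w\<in>wset j. gam x0 j *[C (Suc j)] w = z *[C (Suc j)] w *[C (Suc j)] gam x0 j"
  using z
proof (induction j arbitrary: z)
  case (0 z)
  have "1[C (Suc 0)] \<in> wset 0" unfolding wset.simps by (rule singletonI)
  thus ?case using solve_base[OF x0(1) 0] by (rule bexI[rotated])
next
  case (Suc j z)
  obtain x y where xy: "x \<in> carrier (V (Suc j))" "y \<in> wset j" "z = P (Suc j) (x, y)"
    using Suc.prems unfolding wset.simps by blast
  obtain w where w: "w \<in> wset j" "gam x0 j *[C (Suc j)] w = y *[C (Suc j)] w *[C (Suc j)] gam x0 j"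
    using Suc.IH[OF xy(2)] by (rule bexE)
  obtain v where v: "v \<in> carrier (V (Suc j))" "gam x0 (Suc j) *[C (Suc (Suc j))] P (Suc j) (v, w) =
    P (Suc j) (x, y) *[C (Suc (Suc j))] P (Suc j) (v, w) *[C (Suc (Suc j))] gam x0 (Suc j)"
    using solve_step[OF x0 xy(2) w xy(1)] by (rule bexE)
  have "P (Suc j) (v, w) \<in> wset (Suc j)" unfolding wset.simps using v(1) w(1) by blast
  thus ?case unfolding xy(3) using v(2) by (rule bexI[rotated])
qed

text \<open>The solution \<open>w\<close> lies again over 1 in \<open>\<F>_1(G)\<close>, so the
  equation can be solved a second time with \<open>w\<close> in place of \<open>z\<close>.\<close>

lemma double_commutators_CH:
  assumes x0: "x0 \<in> carrier (V 0)" "x0 ~= 1[V 0]"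
  shows "double_commutators (C (Suc j))"
  unfolding double_commutators_def
proof (intro ballI impI)
  fix x y z
  assume c: "x \<in> carrier (C (Suc j))" "y \<in> carrier (C (Suc j))" "z \<in> carrier (C (Suc j))"
    "x *[C (Suc j)] y = z *[C (Suc j)] y *[C (Suc j)] x"
  have z: "z \<in> wset j" by (rule commutator_wset[OF c])
  obtain w where w: "w \<in> wset j" "gam x0 j *[C (Suc j)] w = z *[C (Suc j)] w *[C (Suc j)] gam x0 j"
    using solve[OF x0 z] by (rule bexE)
  obtain v where v: "v \<in> wset j" "gam x0 j *[C (Suc j)] v = w *[C (Suc j)] v *[C (Suc j)] gam x0 j"
    using solve[OF x0 w(1)] by (rule bexE)
  show "\<exists>\<gamma>\<in>carrier (C (Suc j)). \<exists>w\<in>carrier (C (Suc j)). \<exists>v\<in>carrier (C (Suc j)).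
    \<gamma> *[C (Suc j)] w = z *[C (Suc j)] w *[C (Suc j)] \<gamma> &
    \<gamma> *[C (Suc j)] v = w *[C (Suc j)] v *[C (Suc j)] \<gamma>"
    by (intro bexI[of _ "gam x0 j"] bexI[of _ w] bexI[of _ v] conjI w(2) v(2) gam_closed[OF x0(1)] wset_sub[OF w(1)] wset_sub[OF v(1)])
qed

section \<open>The inverse limit of the tower\<close>

lemma omega_carrier: "z \<in> carrier (CH_group_omega G) \<longleftrightarrow> (\<forall>k. z k \<in> carrier (C k) & (\<exists>x\<in>carrier (V k). z (Suc k) = P k (x, z k)))"
  by (simp add: CH_group_omega_def)

lemma omega_mult: "(x *[CH_group_omega G] y) k = x k *[C k] y k"
  by (simp add: CH_group_omega_def product_group_def)

definition gam_omega :: "('a list => 'a qelem) set => nat => 'a" where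
  "gam_omega x k = (case k of 0 => 1[C 0] | Suc j => gam x j)"

lemma gam_omega_simps: "gam_omega x 0 = 1[C 0]" "gam_omega x (Suc j) = gam x j"
  by (simp_all add: gam_omega_def)

lemma gam_omega_closed:
  assumes x: "x \<in> carrier (V 0)" shows "gam_omega x \<in> carrier (CH_group_omega G)"
  unfolding omega_carrier
proof
  fix k
  show "gam_omega x k \<in> carrier (C k) & (\<exists>y\<in>carrier (V k). gam_omega x (Suc k) = P k (y, gam_omega x k))"
  proof (cases k)
    case 0
    show ?thesis unfolding 0 gam_omega_simps gam.simps using x one_CH by blast
  next
    case (Suc j)
    show ?thesis unfolding Suc gam_omega_simps gam.simps using gam_closed[OF x] one_V by blast
  qed
qed

text \<open>Solutions at the separate stages need not be compatible. As \<open>solve_step\<close>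
  lifts any given solution, a compatible sequence is obtained by dependent choice.\<close>

lemma omega_solve:
  assumes x0: "x0 \<in> carrier (V 0)" "x0 ~= 1[V 0]"
    and z: "z \<in> carrier (CH_group_omega G)" and zw: "\<forall>j. z (Suc j) \<in> wset j"
  shows "\<exists>w\<in>carrier (CH_group_omega G). (\<forall>j. w (Suc j) \<in> wset j) &
    gam_omega x0 *[CH_group_omega G] w = z *[CH_group_omega G] w *[CH_group_omega G] gam_omega x0"
proof -
  \<comment> \<open>The sequence starts at stage one. Fixing the value 1 there makes it lie over the
    element 1 of \<open>\<F>_0(G)\<close> that is put in front.\<close>
  let ?good = "%j w. w \<in> wset j & (j = 0 --> w = 1[C (Suc 0)]) &
    gam x0 j *[C (Suc j)] w = z (Suc j) *[C (Suc j)] w *[C (Suc j)] gam x0 j"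
  have "\<exists>W. \<forall>j. ?good j (W j) & (\<exists>y\<in>carrier (V (Suc j)). W (Suc j) = P (Suc j) (y, W j))"
  proof (rule dependent_nat_choice)
    show "\<exists>w. ?good 0 w"
      by (intro exI[of _ "1[C (Suc 0)]"] conjI impI HOL.refl solve_base[OF x0(1) spec[OF zw]])
        (simp only: wset.simps singleton_iff)
    fix w j assume w: "?good j w"
    obtain x where x: "x \<in> carrier (V (Suc j))" "z (Suc (Suc j)) = P (Suc j) (x, z (Suc j))"
      using z unfolding omega_carrier by blast
    obtain y where y: "y \<in> carrier (V (Suc j))"
      "gam x0 (Suc j) *[C (Suc (Suc j))] P (Suc j) (y, w) =
       P (Suc j) (x, z (Suc j)) *[C (Suc (Suc j))] P (Suc j) (y, w) *[C (Suc (Suc j))] gam x0 (Suc j)"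
      using solve_step[OF x0 spec[OF zw] conjunct1[OF w] conjunct2[OF conjunct2[OF w]] x(1)] by (rule bexE)
    have "P (Suc j) (y, w) \<in> wset (Suc j)" unfolding wset.simps using y(1) conjunct1[OF w] by blast
    hence "?good (Suc j) (P (Suc j) (y, w))" unfolding x(2) using y(2) by (intro conjI) simp_all
    thus "\<exists>v. ?good (Suc j) v & (\<exists>y\<in>carrier (V (Suc j)). v = P (Suc j) (y, w))" using y(1) by blast
  qed
  then obtain W where W: "\<forall>j. ?good j (W j) & (\<exists>y\<in>carrier (V (Suc j)). W (Suc j) = P (Suc j) (y, W j))" by (rule exE)
  note g = spec[OF W, THEN conjunct1]
  define w where "w k = (case k of 0 => 1[C 0] | Suc j => W j)" for k
  have ws: "w 0 = 1[C 0]" "w (Suc j) = W j" for j by (simp_all add: w_def)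
  have "w \<in> carrier (CH_group_omega G)"
    unfolding omega_carrier
  proof
    fix k
    show "w k \<in> carrier (C k) & (\<exists>y\<in>carrier (V k). w (Suc k) = P k (y, w k))"
    proof (cases k)
      case 0
      have "W 0 = P 0 (1[V 0], 1[C 0])" using g[of 0] pair_one[of 0] by simp
      thus ?thesis unfolding 0 ws using one_CH one_V by blast
    next
      case (Suc j)
      show ?thesis unfolding Suc ws using wset_sub[OF conjunct1[OF g[of j]]] conjunct2[OF spec[OF W, of j]] by blast
    qed
  qed
  moreover have "\<forall>j. w (Suc j) \<in> wset j" unfolding ws using g by blast
  moreover have "gam_omega x0 *[CH_group_omega G] w = z *[CH_group_omega G] w *[CH_group_omega G] gam_omega x0"
  proof
    fix k
    show "(gam_omega x0 *[CH_group_omega G] w) k = (z *[CH_group_omega G] w *[CH_group_omega G] gam_omega x0) k"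
    proof (cases k)
      case 0
      interpret C: group "C 0" by (rule group_CH)
      have "z 0 = 1[C 0]" using z unfolding omega_carrier carrier_0[symmetric] using carrier_0 by (metis singletonD)
      thus ?thesis unfolding 0 omega_mult gam_omega_simps ws by simp
    next
      case (Suc j)
      show ?thesis unfolding Suc omega_mult gam_omega_simps ws by (rule conjunct2[OF conjunct2[OF g[of j]]])
    qed
  qed
  ultimately show ?thesis by (intro bexI[of _ w] conjI)
qed

lemma double_commutators_omega:
  assumes x0: "x0 \<in> carrier (V 0)" "x0 ~= 1[V 0]"
  shows "double_commutators (CH_group_omega G)"
  unfolding double_commutators_def
proof (intro ballI impI)
  fix x y z
  assume c: "x \<in> carrier (CH_group_omega G)" "y \<in> carrier (CH_group_omega G)" "z \<in> carrier (CH_group_omega G)"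
    "x *[CH_group_omega G] y = z *[CH_group_omega G] y *[CH_group_omega G] x"
  have z: "\<forall>j. z (Suc j) \<in> wset j"
  proof
    fix j
    have "(x *[CH_group_omega G] y) (Suc j) = (z *[CH_group_omega G] y *[CH_group_omega G] x) (Suc j)" by (simp only: c(4))
    thus "z (Suc j) \<in> wset j" unfolding omega_mult
      by (rule commutator_wset[rotated 3]) (use c(1-3) omega_carrier in blast)+
  qed
  obtain w where w: "w \<in> carrier (CH_group_omega G)" "(\<forall>j. w (Suc j) \<in> wset j) &
    gam_omega x0 *[CH_group_omega G] w = z *[CH_group_omega G] w *[CH_group_omega G] gam_omega x0"
    using omega_solve[OF x0 c(3) z] by (rule bexE)
  obtain v where v: "v \<in> carrier (CH_group_omega G)" "(\<forall>j. v (Suc j) \<in> wset j) &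
    gam_omega x0 *[CH_group_omega G] v = w *[CH_group_omega G] v *[CH_group_omega G] gam_omega x0"
    using omega_solve[OF x0 w(1) conjunct1[OF w(2)]] by (rule bexE)
  show "\<exists>\<gamma>\<in>carrier (CH_group_omega G). \<exists>w\<in>carrier (CH_group_omega G). \<exists>v\<in>carrier (CH_group_omega G).
    \<gamma> *[CH_group_omega G] w = z *[CH_group_omega G] w *[CH_group_omega G] \<gamma> &
    \<gamma> *[CH_group_omega G] v = w *[CH_group_omega G] v *[CH_group_omega G] \<gamma>"
    by (intro bexI[of _ "gam_omega x0"] bexI[of _ w] bexI[of _ v] conjI conjunct2[OF w(2)] conjunct2[OF v(2)] gam_omega_closed[OF x0(1)] w(1) v(1))
qed

end

section \<open>Homomorphisms to a nilpotent group\<close>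

type_synonym 'k triple = "'k \<times> 'k \<times> 'k"

text \<open>The Heisenberg group in symmetric coordinates, in which every automorphism fixing the centre up to
  a factor has the simple form \<open>nil_map\<close>.\<close>

definition nil :: "'k::field_char_0 triple monoid" where
  "nil = \<lparr>carrier = UNIV,
     monoid.mult = (%(x, y, z) (x', y', z'). (x + x', y + y', z + z' + (x * y' - y * x') / 2)),
     one = (0, 0, 0)\<rparr>"

text \<open>The \<open>K\<close>-linear endomorphism that sends \<open>(1, 0, 0)\<close> and
  \<open>(0, 1, 0)\<close> to the two given triples. On the centre it is multiplication by the
  determinant of their first two coordinates, as commutators demand.\<close>

definition nil_map :: "'k::field_char_0 triple \<times> 'k triple => 'k triple => 'k triple" where
  "nil_map = (%((u1, u2, u3), (v1, v2, v3)) (x, y, z).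
     (x * u1 + y * v1, x * u2 + y * v2, x * u3 + y * v3 + z * (u1 * v2 - u2 * v1)))"

lemma nil_simps [simp]:
  "carrier nil = UNIV" "(x, y, z) *[nil] (x', y', z') = (x + x', y + y', z + z' + (x * y' - y * x') / 2)"
  "1[nil] = (0, 0, 0)"
  by (simp_all add: nil_def)

lemma group_nil: "group (nil :: 'k::field_char_0 triple monoid)"
proof (rule groupI)
  fix a :: "'k triple"
  obtain x y z where "a = (x, y, z)" by (cases a)
  thus "\<exists>b\<in>carrier nil. b *[nil] a = 1[nil]" by (intro bexI[of _ "(- x, - y, - z)"]) simp_all
qed (auto simp: field_simps)

text \<open>The hypothesis makes \<open>z\<close> a commutator, and the group is nilpotent of class
  two.\<close>

lemma nil_central:
  fixes x y z :: "'k::field_char_0 triple"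
  assumes "x *[nil] y = z *[nil] y *[nil] x" shows "z *[nil] w = w *[nil] z"
  using assms by (cases x; cases y; cases z; cases w) auto

lemma nil_map_hom: "nil_map UV (a *[nil] b) = nil_map UV a *[nil] nil_map UV b"
proof -
  obtain u1 u2 u3 v1 v2 v3 where "UV = ((u1, u2, u3), (v1, v2, v3))" by (metis surj_pair)
  moreover obtain a1 a2 a3 where "a = (a1, a2, a3)" by (metis surj_pair)
  moreover obtain b1 b2 b3 where "b = (b1, b2, b3)" by (metis surj_pair)
  ultimately show ?thesis by (simp add: nil_map_def field_simps)
qed

lemma nil_map_comp: "nil_map (U, V) (nil_map UV a) = nil_map (nil_map (U, V) (fst UV), nil_map (U, V) (snd UV)) a"
  by (cases U; cases V; cases UV; cases a) (auto simp: nil_map_def algebra_simps)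

lemma nil_map_id: "nil_map ((1, 0, 0), (0, 1, 0)) a = a"
  by (cases a) (simp add: nil_map_def)

text \<open>Two additive functions and a third one whose defect from additivity is an alternating
  bilinear expression in them: exactly the data to which \<open>two_connected_lift\<close>
  applies.\<close>

lemma hom_nil_iff:
  "h \<in> hom G (nil :: 'k::field_char_0 triple monoid) \<longleftrightarrow>
    additive_on G (%g. fst (h g)) & additive_on G (%g. fst (snd (h g))) &
    (\<forall>g\<in>carrier G. \<forall>k\<in>carrier G. snd (snd (h (g *[G] k))) = snd (snd (h g)) + snd (snd (h k)) +
      (fst (h g) * fst (snd (h k)) - fst (snd (h g)) * fst (h k)) / 2)" (is "?L = ?R")
proof
  have m: "a *[nil] b = (fst a + fst b, fst (snd a) + fst (snd b), snd (snd a) + snd (snd b) + (fst a * fst (snd b) - fst (snd a) * fst b) / 2)"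
    for a b :: "'k triple" by (cases a; cases b) simp
  { assume ?L thus ?R unfolding hom_def additive_on_def by (auto simp: m) }
  { assume ?R thus ?L unfolding hom_def additive_on_def by (auto simp: m prod_eq_iff) }
qed

text \<open>The first two coordinates are additive. Once they agree, the defects of the third
  coordinates agree too, and their difference is additive.\<close>

lemma nil_hom_unique:
  fixes h h' :: "'b => 'k::field_char_0 triple"
  assumes c: "two_connected \<pi> G \<alpha>" and h: "h \<in> hom G nil" "h' \<in> hom G nil"
    and e: "!!x. x \<in> carrier \<pi> ==> h (\<alpha> x) = h' (\<alpha> x)" and g: "g \<in> carrier G"
  shows "h g = h' g"
proof -
  have 1: "fst (h g) - fst (h' g) = 0" if g: "g \<in> carrier G" for g
    by (rule two_connected_additive_unique[OF c _ _ g, where \<mu> = "%g. fst (h g) - fst (h' g)"])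
      (use h e in \<open>auto simp: hom_nil_iff additive_on_def\<close>)
  have 2: "fst (snd (h g)) - fst (snd (h' g)) = 0" if g: "g \<in> carrier G" for g
    by (rule two_connected_additive_unique[OF c _ _ g, where \<mu> = "%g. fst (snd (h g)) - fst (snd (h' g))"])
      (use h e in \<open>auto simp: hom_nil_iff additive_on_def\<close>)
  have "snd (snd (h g)) - snd (snd (h' g)) = 0"
    by (rule two_connected_additive_unique[OF c _ _ g, where \<mu> = "%g. snd (snd (h g)) - snd (snd (h' g))"])
      (use h e 1 2 in \<open>auto simp: hom_nil_iff additive_on_def\<close>)
  thus ?thesis using 1[OF g] 2[OF g] by (simp add: prod_eq_iff)
qed

lemma additive_on_lift:
  fixes \<nu> :: "'a => 'k::field_char_0"
  assumes c: "two_connected \<pi> G \<alpha>" and \<nu>: "additive_on \<pi> \<nu>"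
  shows "\<exists>\<mu>. additive_on G \<mu> & (\<forall>x\<in>carrier \<pi>. \<mu> (\<alpha> x) = \<nu> x)"
  using two_connected_lift[OF c, where f = "%_ _. 0" and \<nu> = \<nu>] \<nu> unfolding additive_on_def by simp

lemma nil_hom_lift:
  fixes \<nu> :: "'a => 'k::field_char_0 triple"
  assumes c: "two_connected \<pi> G \<alpha>" and \<nu>: "\<nu> \<in> hom \<pi> nil"
  shows "\<exists>h\<in>hom G nil. \<forall>x\<in>carrier \<pi>. h (\<alpha> x) = \<nu> x"
proof -
  note n = \<nu>[unfolded hom_nil_iff]
  obtain a where a: "additive_on G a" "\<forall>x\<in>carrier \<pi>. a (\<alpha> x) = fst (\<nu> x)" using additive_on_lift[OF c conjunct1[OF n]] by (elim exE conjE)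
  obtain b where b: "additive_on G b" "\<forall>x\<in>carrier \<pi>. b (\<alpha> x) = fst (snd (\<nu> x))"
    using additive_on_lift[OF c conjunct1[OF conjunct2[OF n]]] by (elim exE conjE)
  have "\<exists>\<mu>. (\<forall>g\<in>carrier G. \<forall>h\<in>carrier G. \<mu> (g *[G] h) = \<mu> g + \<mu> h + (a g * b h - b g * a h) / 2) & (\<forall>x\<in>carrier \<pi>. \<mu> (\<alpha> x) = snd (snd (\<nu> x)))"
  proof (rule two_connected_lift[OF c])
    fix g h l assume "g \<in> carrier G" "h \<in> carrier G" "l \<in> carrier G"
    hence "a (g *[G] h) = a g + a h" "b (g *[G] h) = b g + b h" "a (h *[G] l) = a h + a l" "b (h *[G] l) = b h + b l"
      using a(1) b(1) by (auto simp: additive_on_def)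
    thus "(a h * b l - b h * a l) / 2 - (a (g *[G] h) * b l - b (g *[G] h) * a l) / 2 +
        (a g * b (h *[G] l) - b g * a (h *[G] l)) / 2 - (a g * b h - b g * a h) / 2 = 0"
      by (simp add: field_simps)
  next
    fix x y assume "x \<in> carrier \<pi>" "y \<in> carrier \<pi>"
    thus "snd (snd (\<nu> (x *[\<pi>] y))) = snd (snd (\<nu> x)) + snd (snd (\<nu> y)) + (a (\<alpha> x) * b (\<alpha> y) - b (\<alpha> x) * a (\<alpha> y)) / 2"
      using n a(2) b(2) by simp
  qed
  then obtain m where m: "\<forall>g\<in>carrier G. \<forall>h\<in>carrier G. m (g *[G] h) = m g + m h + (a g * b h - b g * a h) / 2"
    "\<forall>x\<in>carrier \<pi>. m (\<alpha> x) = snd (snd (\<nu> x))" by (elim exE conjE)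
  have "(%g. (a g, b g, m g)) \<in> hom G nil" unfolding hom_nil_iff using a(1) b(1) m(1) by simp
  moreover have "\<forall>x\<in>carrier \<pi>. (a (\<alpha> x), b (\<alpha> x), m (\<alpha> x)) = \<nu> x" using a(2) b(2) m(2) by simp
  ultimately show ?thesis by (intro bexI[of _ "%g. (a g, b g, m g)"])
qed

section \<open>Lifting derivations into power series\<close>

lemma fps_mult_nth_cong:
  assumes "!!m. m \<le> n ==> fps_nth a m = fps_nth b m" shows "fps_nth (c * a) n = fps_nth (c * b) n"
  unfolding fps_mult_nth by (rule sum.cong) (use assms in auto)

lemma fps_mult_nth_cong_less:
  fixes c :: "'k::comm_ring_1 fps"
  assumes "fps_nth c 0 = 0" "!!m. m < n ==> fps_nth a m = fps_nth b m" shows "fps_nth (c * a) n = fps_nth (c * b) n"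
  unfolding fps_mult_nth
proof (rule sum.cong)
  fix i assume "i \<in> {0..n}"
  thus "fps_nth c i * fps_nth a (n - i) = fps_nth c i * fps_nth b (n - i)"
    using assms by (cases "i = 0") auto
qed simp

text \<open>As \<open>E g\<close>, which is \<open>exp (lam g t) - 1\<close>, has no constant term,
  the coefficient of \<open>t^n\<close> in the derivation rule is additive up to an expression in
  lower coefficients. These are known already and form a 2-cocycle with trivial action, so
  \<open>two_connected_lift\<close> provides the next coefficient.\<close>

lemma exp_derivation_extend:
  fixes p :: "'a => 'k::field_char_0 fps"
  assumes c: "two_connected \<pi> G \<alpha>" and lam: "additive_on G lam" and p: "exp_derivation \<pi> (%x. lam (\<alpha> x)) p"
    and P: "\<forall>g\<in>carrier G. \<forall>h\<in>carrier G. \<forall>m<n. fps_nth (P (g *[G] h)) m = fps_nth (P g + fps_exp (lam g) * P h) m"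
    "\<forall>x\<in>carrier \<pi>. \<forall>m<n. fps_nth (P (\<alpha> x)) m = fps_nth (p x) m"
  shows "\<exists>P'. (\<forall>g\<in>carrier G. \<forall>h\<in>carrier G. \<forall>m<Suc n. fps_nth (P' (g *[G] h)) m = fps_nth (P' g + fps_exp (lam g) * P' h) m) &
    (\<forall>x\<in>carrier \<pi>. \<forall>m<Suc n. fps_nth (P' (\<alpha> x)) m = fps_nth (p x) m) & (\<forall>g. \<forall>m<n. fps_nth (P' g) m = fps_nth (P g) m)"
proof -
  have gr: "group \<pi>" "group G" and hom: "\<alpha> \<in> hom \<pi> G" using c by (auto simp: two_connected_def)
  interpret h: group_hom \<pi> G \<alpha> using gr hom by (simp add: group_hom_def group_hom_axioms_def)
  define E where "E g = fps_exp (lam g) - 1" for g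
  have E0: "fps_nth (E g) 0 = 0" for g by (simp add: E_def)
  have E1: "fps_exp (lam g) = 1 + E g" for g by (simp add: E_def)
  have "\<exists>\<mu>. (\<forall>g\<in>carrier G. \<forall>h\<in>carrier G. \<mu> (g *[G] h) = \<mu> g + \<mu> h + fps_nth (E g * P h) n) & (\<forall>x\<in>carrier \<pi>. \<mu> (\<alpha> x) = fps_nth (p x) n)"
  proof (rule two_connected_lift[OF c])
    fix g h l assume ghl: "g \<in> carrier G" "h \<in> carrier G" "l \<in> carrier G"
    have e: "fps_exp (lam (g *[G] h)) = fps_exp (lam g) * fps_exp (lam h)" using lam ghl by (simp add: additive_on_def fps_exp_add_mult)
    \<comment> \<open>The derivation rule is available below degree \<open>n\<close> only, which
      suffices behind the factor \<open>E g\<close>.\<close>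
    have "fps_nth (E g * P (h *[G] l)) n = fps_nth (E g * (P h + fps_exp (lam h) * P l)) n"
      by (rule fps_mult_nth_cong_less[OF E0]) (use P(1) ghl in blast)
    moreover have "fps_nth (E h * P l) n - fps_nth (E (g *[G] h) * P l) n + fps_nth (E g * (P h + fps_exp (lam h) * P l)) n - fps_nth (E g * P h) n =
      fps_nth (E h * P l - E (g *[G] h) * P l + E g * (P h + fps_exp (lam h) * P l) - E g * P h) n" by simp
    moreover have "E h * P l - E (g *[G] h) * P l + E g * (P h + fps_exp (lam h) * P l) - E g * P h = 0"
      unfolding E_def e by (simp add: algebra_simps)
    ultimately show "fps_nth (E h * P l) n - fps_nth (E (g *[G] h) * P l) n + fps_nth (E g * P (h *[G] l)) n - fps_nth (E g * P h) n = 0"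
      by (simp only: fps_zero_nth)
  next
    fix x y assume xy: "x \<in> carrier \<pi>" "y \<in> carrier \<pi>"
    have "fps_nth (E (\<alpha> x) * P (\<alpha> y)) n = fps_nth (E (\<alpha> x) * p y) n"
      by (rule fps_mult_nth_cong_less[OF E0]) (use P(2) xy in blast)
    moreover have "p (x *[\<pi>] y) = p x + p y + E (\<alpha> x) * p y"
      using p xy unfolding exp_derivation_def by (simp add: E1 algebra_simps)
    ultimately show "fps_nth (p (x *[\<pi>] y)) n = fps_nth (p x) n + fps_nth (p y) n + fps_nth (E (\<alpha> x) * P (\<alpha> y)) n" by simp
  qed
  then obtain \<mu> where \<mu>: "\<forall>g\<in>carrier G. \<forall>h\<in>carrier G. \<mu> (g *[G] h) = \<mu> g + \<mu> h + fps_nth (E g * P h) n"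
    "\<forall>x\<in>carrier \<pi>. \<mu> (\<alpha> x) = fps_nth (p x) n" by (elim exE conjE)
  define P' where "P' g = Abs_fps (%m. if m = n then \<mu> g else fps_nth (P g) m)" for g
  have P': "fps_nth (P' g) n = \<mu> g" "m ~= n ==> fps_nth (P' g) m = fps_nth (P g) m" for g m by (simp_all add: P'_def)
  have "fps_nth (P' (g *[G] h)) m = fps_nth (P' g + fps_exp (lam g) * P' h) m" if gh: "g \<in> carrier G" "h \<in> carrier G" and m: "m < Suc n" for g h m
  proof (cases "m = n")
    case True
    have "fps_nth (E g * P' h) n = fps_nth (E g * P h) n" by (rule fps_mult_nth_cong_less[OF E0]) (use P' in auto)
    thus ?thesis using \<mu>(1) gh by (simp add: True P' E1 distrib_right)
  next
    case False
    have "fps_nth (fps_exp (lam g) * P' h) m = fps_nth (fps_exp (lam g) * P h) m" by (rule fps_mult_nth_cong) (use P' m False in auto)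
    thus ?thesis using P(1) gh m False by (simp add: P')
  qed
  moreover have "fps_nth (P' (\<alpha> x)) m = fps_nth (p x) m" if "x \<in> carrier \<pi>" "m < Suc n" for x m
    using P' \<mu>(2) P(2) that by (cases "m = n") auto
  moreover have "fps_nth (P' g) m = fps_nth (P g) m" if "m < n" for g m using P' that by simp
  ultimately show ?thesis by (intro exI[of _ P'] conjI) simp_all
qed

lemma exp_derivation_lift:
  fixes p :: "'a => 'k::field_char_0 fps"
  assumes c: "two_connected \<pi> G \<alpha>" and lam: "additive_on G lam" and p: "exp_derivation \<pi> (%x. lam (\<alpha> x)) p"
  shows "\<exists>p'. exp_derivation G lam p' & (\<forall>x\<in>carrier \<pi>. p' (\<alpha> x) = p x)"
proof -
  let ?good = "%n P. (\<forall>g\<in>carrier G. \<forall>h\<in>carrier G. \<forall>m<n. fps_nth (P (g *[G] h)) m = fps_nth (P g + fps_exp (lam g) * P h) m) &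
    (\<forall>x\<in>carrier \<pi>. \<forall>m<n. fps_nth (P (\<alpha> x)) m = fps_nth (p x) m)"
  have "\<exists>P. \<forall>n. ?good n (P n) & (\<forall>g. \<forall>m<n. fps_nth (P (Suc n) g) m = fps_nth (P n g) m)"
  proof (rule dependent_nat_choice)
    show "\<exists>P. ?good 0 P" by simp
    fix P n assume g: "?good n P"
    show "\<exists>P'. ?good (Suc n) P' & (\<forall>g. \<forall>m<n. fps_nth (P' g) m = fps_nth (P g) m)"
      using exp_derivation_extend[OF c lam p conjunct1[OF g] conjunct2[OF g]] by (simp only: conj_assoc)
  qed
  then obtain P where P: "\<forall>n. ?good n (P n) & (\<forall>g. \<forall>m<n. fps_nth (P (Suc n) g) m = fps_nth (P n g) m)" by (rule exE)
  have step: "fps_nth (P (Suc n) g) m = fps_nth (P n g) m" if "m < n" for n g m using P that by blast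
  have stable: "fps_nth (P (Suc m + j) g) m = fps_nth (P (Suc m) g) m" for m j g
  proof (induction j)
    case (Suc j)
    show ?case using step[of m "Suc m + j" g] Suc by simp
  qed simp
  \<comment> \<open>Coefficient \<open>m\<close> is settled at stage \<open>Suc m\<close> and never
    changes afterwards.\<close>
  define p' where "p' g = Abs_fps (%m. fps_nth (P (Suc m) g) m)" for g
  have p': "fps_nth (p' g) m = fps_nth (P n g) m" if m: "m < n" for g m n
  proof -
    obtain j where "n = Suc m + j" using m less_iff_Suc_add by (metis add_Suc)
    thus ?thesis using stable[of m j g] by (simp add: p'_def)
  qed
  have "exp_derivation G lam p'"
    unfolding exp_derivation_def
  proof (intro ballI fps_ext)
    fix g h m assume gh: "g \<in> carrier G" "h \<in> carrier G"
    have "fps_nth (P (Suc m) (g *[G] h)) m = fps_nth (P (Suc m) g + fps_exp (lam g) * P (Suc m) h) m" using P gh by blast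
    moreover have "fps_nth (fps_exp (lam g) * p' h) m = fps_nth (fps_exp (lam g) * P (Suc m) h) m"
      by (rule fps_mult_nth_cong) (rule p', simp)
    ultimately show "fps_nth (p' (g *[G] h)) m = fps_nth (p' g + fps_exp (lam g) * p' h) m" by (simp add: p'[of m "Suc m"])
  qed
  moreover have "\<forall>x\<in>carrier \<pi>. p' (\<alpha> x) = p x"
  proof (intro ballI fps_ext)
    fix x m assume "x \<in> carrier \<pi>"
    hence "fps_nth (P (Suc m) (\<alpha> x)) m = fps_nth (p x) m" using P by blast
    thus "fps_nth (p' (\<alpha> x)) m = fps_nth (p x) m" by (simp add: p'[of m "Suc m"])
  qed
  ultimately show ?thesis by (intro exI[of _ p'] conjI)
qed

text \<open>The quotient of the group of pairs \<open>(p, lam)\<close> by the elements with \<open>lam = 0\<close> and \<open>p\<close> divisible by \<open>X\<^sup>2\<close>.\<close>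

definition jet :: "'k::field_char_0 fps => 'k => 'k triple" where
  "jet p lam = (lam, fps_nth p 0, fps_nth p 1 - lam * fps_nth p 0 / 2)"

text \<open>In the product the linear coefficients acquire the term
  \<open>lam g * fps_nth (p h) 0\<close>. Subtracting half of the product of the first two
  coordinates, as \<open>jet\<close> does, makes this term alternating.\<close>

lemma jet_hom:
  assumes "additive_on G lam" "exp_derivation G lam p" shows "(%g. jet (p g) (lam g)) \<in> hom G nil"
  unfolding hom_nil_iff
proof (intro conjI ballI)
  show "additive_on G (%g. fst (jet (p g) (lam g)))" using assms(1) by (simp add: jet_def)
  show "additive_on G (%g. fst (snd (jet (p g) (lam g))))"
    using assms(2) by (simp add: jet_def additive_on_def exp_derivation_def)
  fix g h assume g: "g \<in> carrier G" "h \<in> carrier G"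
  have "lam (g *[G] h) = lam g + lam h" "p (g *[G] h) = p g + fps_exp (lam g) * p h"
    using assms g by (auto simp: additive_on_def exp_derivation_def)
  thus "snd (snd (jet (p (g *[G] h)) (lam (g *[G] h)))) = snd (snd (jet (p g) (lam g))) + snd (snd (jet (p h) (lam h))) +
    (fst (jet (p g) (lam g)) * fst (snd (jet (p h) (lam h))) - fst (snd (jet (p g) (lam g))) * fst (jet (p h) (lam h))) / 2"
    by (simp add: jet_def fps_mult_nth_1 field_simps)
qed

text \<open>The first half forces \<open>h\<close> to vanish on \<open>G_H^(2)\<close>; for this all
  coefficients of \<open>p\<close> have to exist, though \<open>jet\<close> shows only two. The
  second half determines \<open>h\<close> up to an invertible \<open>nil_map\<close>, so that an
  arbitrary choice of \<open>h\<close> still yields a functor.\<close>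

definition generic :: "'a monoid => ('a => 'k::field_char_0 triple) => bool" where
  "generic G h \<longleftrightarrow>
     (\<exists>lam p. additive_on G lam & injective_on_H1 G lam & exp_derivation G lam p & (\<forall>g\<in>carrier G. h g = jet (p g) (lam g))) &
     (\<forall>h'\<in>hom G nil. \<exists>!UV. \<forall>g\<in>carrier G. h' g = nil_map UV (h g))"

lemma hom_nil_cong:
  fixes h :: "'a => 'k::field_char_0 triple"
  assumes "group G" "!!g. g \<in> carrier G ==> h g = h' g" "h' \<in> hom G nil" shows "h \<in> hom G nil"
proof (rule homI)
  interpret group G by fact
  fix x y assume "x \<in> carrier G" "y \<in> carrier G"
  thus "h (x *[G] y) = h x *[nil] h y" using assms(2) hom_mult[OF assms(3)] by simp
qed simp

lemma generic_hom:
  fixes h :: "'a => 'k::field_char_0 triple"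
  assumes G: "group G" and h: "generic G h" shows "h \<in> hom G nil"
proof -
  obtain lam p where *: "additive_on G lam" "exp_derivation G lam p" "\<forall>g\<in>carrier G. h g = jet (p g) (lam g)"
    using h unfolding generic_def by (elim conjE exE)
  show ?thesis by (rule hom_nil_cong[OF G _ jet_hom[OF *(1,2)]]) (rule bspec[OF *(3)])
qed

lemma generic_kernel:
  fixes h :: "'a => 'k::field_char_0 triple"
  assumes G: "group G" and h: "generic G h" and g: "g \<in> tf_derived G 2" shows "h g = (0, 0, 0)"
proof -
  obtain lam p where *: "additive_on G lam" "injective_on_H1 G lam" "exp_derivation G lam p" "\<forall>g\<in>carrier G. h g = jet (p g) (lam g)"
    using h unfolding generic_def by (elim conjE exE)
  have gc: "g \<in> carrier G" using subsetD[OF tf_derived_carrier g] .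
  have "lam g = 0 & p g = 0" by (rule exp_derivation_kernel[OF G *(1-3) g])
  thus ?thesis using bspec[OF *(4) gc] by (simp add: jet_def)
qed

lemma generic_unique:
  "generic G h ==> h' \<in> hom G nil ==> \<exists>!UV. \<forall>g\<in>carrier G. h' g = nil_map UV (h g)"
  unfolding generic_def by (drule conjunct2) (erule (1) bspec)

text \<open>Homomorphisms from \<open>\<pi>\<close> extend uniquely to \<open>G\<close>, so a
  factorisation over \<open>\<pi>\<close> is the same as one over \<open>G\<close>.\<close>

lemma generic_pull:
  fixes h :: "'b => 'k::field_char_0 triple"
  assumes c: "two_connected \<pi> G \<alpha>" and h: "generic G h" shows "generic \<pi> (%x. h (\<alpha> x))"
proof -
  have gr: "group \<pi>" "group G" and hom: "\<alpha> \<in> hom \<pi> G" using c by (auto simp: two_connected_def)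
  interpret h: group_hom \<pi> G \<alpha> using gr hom by (simp add: group_hom_def group_hom_axioms_def)
  obtain lam p where *: "additive_on G lam" "injective_on_H1 G lam" "exp_derivation G lam p" "\<forall>g\<in>carrier G. h g = jet (p g) (lam g)"
    using h unfolding generic_def by (elim conjE exE)
  have hh: "h \<in> hom G nil" by (rule generic_hom[OF gr(2) h])
  show ?thesis unfolding generic_def
  proof (intro conjI exI[of _ "%x. lam (\<alpha> x)"] exI[of _ "%x. p (\<alpha> x)"] ballI)
    show "additive_on \<pi> (%x. lam (\<alpha> x))" using *(1) by (simp add: additive_on_def)
    show "injective_on_H1 \<pi> (%x. lam (\<alpha> x))" using injective_on_H1_transfer[OF c *(1), of "%x. lam (\<alpha> x)"] *(2) by simp
    show "exp_derivation \<pi> (%x. lam (\<alpha> x)) (%x. p (\<alpha> x))" using *(3) by (simp add: exp_derivation_def)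
    fix x assume "x \<in> carrier \<pi>"
    thus "h (\<alpha> x) = jet (p (\<alpha> x)) (lam (\<alpha> x))" using *(4) by simp
  next
    fix k :: "'a => 'k triple" assume k: "k \<in> hom \<pi> nil"
    obtain k' where k': "k' \<in> hom G nil" "\<forall>x\<in>carrier \<pi>. k' (\<alpha> x) = k x" using nil_hom_lift[OF c k] by (rule bexE)
    have "(\<forall>x\<in>carrier \<pi>. k x = nil_map UV (h (\<alpha> x))) \<longleftrightarrow> (\<forall>g\<in>carrier G. k' g = nil_map UV (h g))" for UV
    proof
      assume a: "\<forall>x\<in>carrier \<pi>. k x = nil_map UV (h (\<alpha> x))"
      have n: "(%g. nil_map UV (h g)) \<in> hom G nil" using hom_mult[OF hh] by (simp add: hom_def nil_map_hom)
      show "\<forall>g\<in>carrier G. k' g = nil_map UV (h g)"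
      proof
        fix g assume g: "g \<in> carrier G"
        show "k' g = nil_map UV (h g)" by (rule nil_hom_unique[OF c k'(1) n _ g]) (use k'(2) a in simp)
      qed
    next
      assume a: "\<forall>g\<in>carrier G. k' g = nil_map UV (h g)"
      show "\<forall>x\<in>carrier \<pi>. k x = nil_map UV (h (\<alpha> x))"
      proof
        fix x assume x: "x \<in> carrier \<pi>"
        show "k x = nil_map UV (h (\<alpha> x))" using bspec[OF k'(2) x] bspec[OF a h.hom_closed[OF x]] by simp
      qed
    qed
    thus "\<exists>!UV. \<forall>x\<in>carrier \<pi>. k x = nil_map UV (h (\<alpha> x))" using generic_unique[OF h k'(1)] by simp
  qed
qed

text \<open>The data that are lifted are \<open>lam\<close> and the whole series \<open>p\<close>,
  not merely the triple \<open>h\<close>, since genericity over \<open>G\<close> again asks for a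
  power series.\<close>

lemma generic_push:
  fixes h :: "'a => 'k::field_char_0 triple"
  assumes c: "two_connected \<pi> G \<alpha>" and h: "generic \<pi> h"
  shows "\<exists>h'. generic G h' & (\<forall>x\<in>carrier \<pi>. h' (\<alpha> x) = h x)"
proof -
  have gr: "group \<pi>" "group G" and hom: "\<alpha> \<in> hom \<pi> G" using c by (auto simp: two_connected_def)
  interpret h: group_hom \<pi> G \<alpha> using gr hom by (simp add: group_hom_def group_hom_axioms_def)
  obtain lam p where *: "additive_on \<pi> lam" "injective_on_H1 \<pi> lam" "exp_derivation \<pi> lam p" "\<forall>g\<in>carrier \<pi>. h g = jet (p g) (lam g)"
    using h unfolding generic_def by (elim conjE exE)
  obtain lam' where l: "additive_on G lam'" "\<forall>x\<in>carrier \<pi>. lam' (\<alpha> x) = lam x" using additive_on_lift[OF c *(1)] by (elim exE conjE)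
  have "exp_derivation \<pi> (%x. lam' (\<alpha> x)) p" using *(3) l(2) by (simp add: exp_derivation_def)
  then obtain p' where p': "exp_derivation G lam' p'" "\<forall>x\<in>carrier \<pi>. p' (\<alpha> x) = p x" using exp_derivation_lift[OF c l(1)] by blast
  define h' where "h' g = jet (p' g) (lam' g)" for g
  have hh: "h' \<in> hom G nil" unfolding h'_def by (rule jet_hom[OF l(1) p'(1)])
  have e: "h' (\<alpha> x) = h x" if "x \<in> carrier \<pi>" for x
    unfolding h'_def bspec[OF *(4) that] bspec[OF l(2) that] bspec[OF p'(2) that] ..
  have "generic G h'" unfolding generic_def
  proof (intro conjI exI[of _ lam'] exI[of _ p'] ballI l(1) p'(1) h'_def)
    show "injective_on_H1 G lam'" using injective_on_H1_transfer[OF c l(1), of lam] l(2) *(2) by simp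
    fix k :: "'b => 'k triple" assume k: "k \<in> hom G nil"
    have ka: "(%x. k (\<alpha> x)) \<in> hom \<pi> nil" using hom_mult[OF k] by (simp add: hom_def)
    have "(\<forall>x\<in>carrier \<pi>. k (\<alpha> x) = nil_map UV (h x)) \<longleftrightarrow> (\<forall>g\<in>carrier G. k g = nil_map UV (h' g))" for UV
    proof
      assume a: "\<forall>x\<in>carrier \<pi>. k (\<alpha> x) = nil_map UV (h x)"
      have n: "(%g. nil_map UV (h' g)) \<in> hom G nil" using hom_mult[OF hh] by (simp add: hom_def nil_map_hom)
      show "\<forall>g\<in>carrier G. k g = nil_map UV (h' g)"
      proof
        fix g assume g: "g \<in> carrier G"
        show "k g = nil_map UV (h' g)" by (rule nil_hom_unique[OF c k n _ g]) (use a e in simp)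
      qed
    next
      assume a: "\<forall>g\<in>carrier G. k g = nil_map UV (h' g)"
      show "\<forall>x\<in>carrier \<pi>. k (\<alpha> x) = nil_map UV (h x)" using a e by (metis h.hom_closed)
    qed
    thus "\<exists>!UV. \<forall>g\<in>carrier G. k g = nil_map UV (h' g)" using generic_unique[OF h ka] by simp
  qed
  thus ?thesis using e by (intro exI[of _ h'] conjI) auto
qed

section \<open>Presented groups\<close>

context
  fixes m :: nat and R :: "word set"
begin

abbreviation "word_class u == word_cong m R `` {u}"

lemma words_append [simp]: "u @ v \<in> words m \<longleftrightarrow> u \<in> words m & v \<in> words m"
  by (auto simp: words_def)

lemma words_simps [simp]: "[] \<in> words m" "(i, b) # u \<in> words m \<longleftrightarrow> i < m & u \<in> words m"
  by (auto simp: words_def)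

lemma word_cong_words: "(u, v) \<in> word_cong m R ==> u \<in> words m & v \<in> words m"
  by (induction rule: word_cong.induct) auto

lemma equiv_word_cong: "equiv (words m) (word_cong m R)"
proof (rule equivI)
  show "word_cong m R <= words m \<times> words m" using word_cong_words by auto
  show "refl_on (words m) (word_cong m R)"
    unfolding refl_on_def using word_cong_words by (auto intro: word_cong.refl)
  show "sym (word_cong m R)" by (rule symI) (rule word_cong.sym)
  show "trans (word_cong m R)" by (rule transI) (rule word_cong.trans)
qed

lemma word_cong_append_left: "(u, v) \<in> word_cong m R ==> w \<in> words m ==> (w @ u, w @ v) \<in> word_cong m R"
proof (induction rule: word_cong.induct)
  case (cancel u v i b)
  thus ?case using word_cong.cancel[of "w @ u" m v i b R] by simp
next
  case (relator u v r)
  thus ?case using word_cong.relator[of "w @ u" m v r R] by simp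
next
  case (trans u v x)
  show ?case by (rule word_cong.trans[OF trans.IH(1)[OF trans.prems] trans.IH(2)[OF trans.prems]])
qed (auto intro: word_cong.refl word_cong.sym)

lemma word_cong_append_right: "(u, v) \<in> word_cong m R ==> w \<in> words m ==> (u @ w, v @ w) \<in> word_cong m R"
proof (induction rule: word_cong.induct)
  case (cancel u v i b)
  thus ?case using word_cong.cancel[of u m "v @ w" i b R] by simp
next
  case (relator u v r)
  thus ?case using word_cong.relator[of u m "v @ w" r R] by simp
next
  case (trans u v x)
  show ?case by (rule word_cong.trans[OF trans.IH(1)[OF trans.prems] trans.IH(2)[OF trans.prems]])
qed (auto intro: word_cong.refl word_cong.sym)

lemma word_cong_append: "(u, u') \<in> word_cong m R ==> (v, v') \<in> word_cong m R ==> (u @ v, u' @ v') \<in> word_cong m R"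
  using word_cong.trans[OF word_cong_append_right[of u u' v] word_cong_append_left[of v v' u']] word_cong_words by blast

lemma word_class_eq_iff: "u \<in> words m ==> v \<in> words m ==> word_class u = word_class v \<longleftrightarrow> (u, v) \<in> word_cong m R"
  by (rule eq_equiv_class_iff[OF equiv_word_cong])

lemma presented_carrier: "carrier (presented_group m R) = word_class ` words m"
  by (auto simp: presented_group_def quotient_def)

lemma presented_one: "1[presented_group m R] = word_class []"
  by (simp add: presented_group_def)

lemma presented_mult:
  assumes "u \<in> words m" "v \<in> words m"
  shows "word_class u *[presented_group m R] word_class v = word_class (u @ v)"
proof -
  have "word_class (u' @ v') = word_class (u @ v)" if "(u, u') \<in> word_cong m R" "(v, v') \<in> word_cong m R" for u' v'
    using word_cong_append[OF that] word_cong_words[OF that(1)] word_cong_words[OF that(2)] assms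
    by (subst word_class_eq_iff) (auto intro: word_cong.sym)
  hence "(\<Union>u'\<in>word_class u. \<Union>v'\<in>word_class v. word_class (u' @ v')) = (\<Union>u'\<in>word_class u. \<Union>v'\<in>word_class v. word_class (u @ v))"
    by (intro SUP_cong) auto
  also have "\<dots> = word_class (u @ v)" using word_cong.refl[OF assms(1), of R] word_cong.refl[OF assms(2), of R] by auto
  finally show ?thesis by (simp add: presented_group_def)
qed

lemma letter_cancel: "i < m ==> word_class [(i, \<not> b)] *[presented_group m R] word_class [(i, b)] = 1[presented_group m R]"
  using word_cong.cancel[of "[]" m "[]" i "\<not> b" R] by (simp add: presented_mult presented_one word_class_eq_iff)

lemma group_presented: "group (presented_group m R)"
proof (rule groupI)
  fix A assume "A \<in> carrier (presented_group m R)"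
  then obtain w where w: "w \<in> words m" "A = word_class w" unfolding presented_carrier by blast
  have "\<exists>v\<in>words m. (v @ w, []) \<in> word_cong m R" using w(1)
  proof (induction w)
    case Nil
    show ?case by (rule bexI[of _ "[]"]) (auto intro: word_cong.refl)
  next
    case (Cons l w)
    obtain i b where l: "l = (i, b)" by (cases l)
    have iw: "i < m" "w \<in> words m" using Cons.prems by (simp_all add: l)
    obtain v where v: "v \<in> words m" "(v @ w, []) \<in> word_cong m R" using Cons.IH[OF iw(2)] by (rule bexE)
    have "((v @ [(i, \<not> b)]) @ l # w, v @ w) \<in> word_cong m R"
      using word_cong.cancel[OF v(1) iw(2,1), of "\<not> b" R] by (simp add: l)
    hence "((v @ [(i, \<not> b)]) @ l # w, []) \<in> word_cong m R" using v(2) by (rule word_cong.trans)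
    thus ?case using v(1) iw(1) by (intro bexI[of _ "v @ [(i, \<not> b)]"]) simp_all
  qed
  then obtain v where v: "v \<in> words m" "(v @ w, []) \<in> word_cong m R" by (rule bexE)
  show "\<exists>B\<in>carrier (presented_group m R). B *[presented_group m R] A = 1[presented_group m R]"
    by (rule bexI[of _ "word_class v"]) (use v w in \<open>simp_all add: presented_mult presented_one presented_carrier word_class_eq_iff\<close>)
qed (auto simp: presented_carrier presented_mult presented_one)

lemma letter_closed: "i < m ==> word_class [(i, b)] \<in> carrier (presented_group m R)"
  unfolding presented_carrier by (rule imageI) simp

lemma letter_inv: "i < m ==> word_class [(i, False)] = inv[presented_group m R] word_class [(i, True)]"
  using group.inv_equality[OF group_presented letter_cancel[of i True] letter_closed letter_closed] by simp

lemma presented_induct: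
  assumes A: "A \<in> carrier (presented_group m R)" and 1: "P 1[presented_group m R]"
    and step: "!!i b A. i < m ==> A \<in> carrier (presented_group m R) ==> P A ==> P (word_class [(i, b)] *[presented_group m R] A)"
  shows "P A"
proof -
  obtain w where w: "w \<in> words m" "A = word_class w" using A unfolding presented_carrier by blast
  have "P (word_class w)" using w(1)
  proof (induction w)
    case Nil
    show ?case using 1 by (simp add: presented_one)
  next
    case (Cons l w)
    obtain i b where l: "l = (i, b)" by (cases l)
    have iw: "i < m" "w \<in> words m" using Cons.prems by (simp_all add: l)
    have "P (word_class [(i, b)] *[presented_group m R] word_class w)"
      by (rule step[OF iw(1) _ Cons.IH[OF iw(2)]]) (use iw in \<open>simp add: presented_carrier\<close>)
    thus ?case using iw by (simp add: presented_mult l)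
  qed
  thus ?thesis by (simp add: w(2))
qed

lemma finitely_generated_presented: "finitely_generated_group (presented_group m R)"
proof -
  let ?P = "presented_group m R" and ?S = "(%i. word_class [(i, True)]) ` {..<m}"
  interpret group ?P by (rule group_presented)
  have S: "?S <= carrier ?P" using letter_closed by auto
  have "A \<in> generate ?P ?S" if "A \<in> carrier ?P" for A
  proof (rule presented_induct[where P = "%A. A \<in> generate ?P ?S", OF that generate.one])
    fix i b A assume i: "i < m" and A: "A \<in> generate ?P ?S"
    have "word_class [(i, b)] \<in> generate ?P ?S"
    proof (cases b)
      case True
      thus ?thesis using i by (auto intro: generate.incl)
    next
      case False
      have "inv[?P] word_class [(i, True)] \<in> generate ?P ?S" by (rule generate.inv) (use i in blast)
      thus ?thesis using False letter_inv[OF i] by simp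
    qed
    thus "word_class [(i, b)] *[?P] A \<in> generate ?P ?S" using A by (rule generate.eng)
  qed
  hence "generate ?P ?S = carrier ?P" using generate_incl[OF S] by blast
  thus ?thesis unfolding finitely_generated_group_def using S is_group by blast
qed

definition word_val :: "'q monoid => (nat => 'q) => word => 'q" where
  "word_val Q x w = foldr (%(i, b) a. (if b then x i else inv[Q] x i) *[Q] a) w 1[Q]"

lemma presented_universal:
  assumes Q: "group Q" and x: "!!i. i < m ==> x i \<in> carrier Q" and r: "!!r. r \<in> R ==> r \<in> words m ==> word_val Q x r = 1[Q]"
  shows "\<exists>h\<in>hom (presented_group m R) Q. \<forall>i<m. h (word_class [(i, True)]) = x i"
proof -
  interpret Q: group Q by fact
  have s: "word_val Q x [] = 1[Q]" "word_val Q x ((i, b) # w) = (if b then x i else inv[Q] x i) *[Q] word_val Q x w" for i b w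
    by (simp_all add: word_val_def)
  have c: "word_val Q x w \<in> carrier Q" if "w \<in> words m" for w
    using that by (induction w) (auto simp: s x)
  have a: "word_val Q x (u @ v) = word_val Q x u *[Q] word_val Q x v" if "u \<in> words m" "v \<in> words m" for u v
    using that by (induction u) (auto simp: s x c Q.m_assoc)
  have e: "word_val Q x u = word_val Q x v" if "(u, v) \<in> word_cong m R" for u v
    using that
  proof (induction rule: word_cong.induct)
    case (cancel u v i b)
    have 1: "word_val Q x ([(i, b), (i, \<not> b)]) = 1[Q]" using x[OF cancel(3)] by (cases b) (simp_all add: s)
    have w: "[(i, b), (i, \<not> b)] \<in> words m" using cancel(3) by simp
    have wv: "[(i, b), (i, \<not> b)] @ v \<in> words m" using cancel by simp
    show ?case unfolding a[OF cancel(1) wv] a[OF w cancel(2)] a[OF cancel(1,2)] 1 Q.l_one[OF c[OF cancel(2)]] ..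
  next
    case (relator u v w)
    have wv: "w @ v \<in> words m" using relator by simp
    show ?case unfolding a[OF relator(1) wv] a[OF relator(4,2)] a[OF relator(1,2)] r[OF relator(3,4)] Q.l_one[OF c[OF relator(2)]] ..
  qed simp_all
  define h where "h = on_cosets (word_val Q x)"
  have h: "h (word_class u) = word_val Q x u" if u: "u \<in> words m" for u
  proof -
    have "word_val Q x ` word_class u = {word_val Q x u}"
    proof
      show "word_val Q x ` word_class u <= {word_val Q x u}"
      proof (rule image_subsetI)
        fix v assume "v \<in> word_class u"
        hence "(u, v) \<in> word_cong m R" by simp
        thus "word_val Q x v \<in> {word_val Q x u}" using e by simp
      qed
      show "{word_val Q x u} <= word_val Q x ` word_class u" using word_cong.refl[OF u, of R] by blast
    qed
    thus ?thesis by (simp add: h_def on_cosets_def)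
  qed
  have "h \<in> hom (presented_group m R) Q"
  proof (rule homI)
    fix A assume "A \<in> carrier (presented_group m R)"
    then obtain u where u: "u \<in> words m" "A = word_class u" unfolding presented_carrier by blast
    show "h A \<in> carrier Q" using h[OF u(1)] c[OF u(1)] u(2) by simp
    fix B assume "B \<in> carrier (presented_group m R)"
    then obtain v where v: "v \<in> words m" "B = word_class v" unfolding presented_carrier by blast
    show "h (A *[presented_group m R] B) = h A *[Q] h B"
      unfolding u(2) v(2) presented_mult[OF u(1) v(1)] h[OF u(1)] h[OF v(1)] a[OF u(1) v(1), symmetric] by (rule h) (simp add: u v)
  qed
  moreover have "\<forall>i<m. h (word_class [(i, True)]) = x i" using h x by (simp add: s)
  ultimately show ?thesis by (intro bexI[of _ h])
qed

end

text \<open>Morphisms of I-functors are natural for maps between finitely presented groups, whereas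
  \<open>Omega_Q\<close> asks for a finitely generated source. This places the former maps in
  \<open>Omega_Q\<close>.\<close>

lemma finitely_presented_generated:
  assumes "finitely_presented_group G" shows "finitely_generated_group G"
proof -
  obtain m R where G: "group G" and i: "G \<cong> presented_group m R" using assms unfolding finitely_presented_group_def by blast
  interpret G: group G by fact
  interpret P: group "presented_group m R" by (rule group_presented)
  have "presented_group m R \<cong> G" by (rule G.iso_sym[OF i])
  then obtain f where f: "f \<in> iso (presented_group m R) G" unfolding is_iso_def by blast
  obtain S where S: "finite S" "S <= carrier (presented_group m R)" "generate (presented_group m R) S = carrier (presented_group m R)"
    using finitely_generated_presented[of m R] unfolding finitely_generated_group_def by blast
  have fh: "f \<in> hom (presented_group m R) G" using f by (simp add: iso_def)
  interpret f: group_hom "presented_group m R" G f by (rule group_hom.intro[OF group_presented G group_hom_axioms.intro[OF fh]])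
  have b: "f ` carrier (presented_group m R) = carrier G" using f by (simp add: iso_def bij_betw_def)
  have "generate G (f ` S) = carrier G" using f.generate_img[OF S(2)] S(3) b by simp
  moreover have "f ` S <= carrier G" using image_mono[OF S(2), of f] b by simp
  ultimately show ?thesis unfolding finitely_generated_group_def using finite_imageI[OF S(1), of f] G by (intro conjI exI[of _ "f ` S"])
qed

text \<open>The free group of rank two, copied into the type on whose groups the I-functors
  live.\<close>

definition free2 :: "(word set => 'a) => 'a monoid" where
  "free2 e = image_group e (presented_group 2 {})"

definition gen :: "nat => word set" where
  "gen i = word_cong 2 {} `` {[(i, True)]}"

lemma countable_presented: "countable (carrier (presented_group m R))"
  unfolding presented_carrier by (rule countable_image) simp

context
  fixes e :: "word set => 'a"
  assumes e: "inj_on e (carrier (presented_group 2 {}))"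
begin

lemmas free2_image = image_group_inj[OF group_presented e, folded free2_def]

lemma gen_closed: "i < 2 ==> gen i \<in> carrier (presented_group 2 {})"
  unfolding gen_def by (rule letter_closed)

lemma free2_gen: "e (gen 0) \<in> carrier (free2 e)" "e (gen 1) \<in> carrier (free2 e)"
  using gen_closed by (auto simp: free2_image)

lemma free2_universal:
  fixes Q :: "'q monoid"
  assumes Q: "group Q" and xy: "x \<in> carrier Q" "y \<in> carrier Q"
  shows "\<exists>h\<in>hom (free2 e) Q. h (e (gen 0)) = x & h (e (gen 1)) = y"
proof -
  have "\<exists>h\<in>hom (presented_group 2 {}) Q. \<forall>i<2. h (gen i) = (if i = 0 then x else y)"
    unfolding gen_def by (rule presented_universal[OF Q]) (use xy in auto)
  then obtain h where h: "h \<in> hom (presented_group 2 {}) Q" "\<forall>i<2. h (gen i) = (if i = 0 then x else y)" by (rule bexE)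
  let ?p = "inv_into (carrier (presented_group 2 {})) e"
  have p: "?p (e A) = A" if "A \<in> carrier (presented_group 2 {})" for A by (rule inv_into_f_f[OF e that])
  interpret P: group "presented_group 2 {}" by (rule group_presented)
  have "(%z. h (?p z)) \<in> hom (free2 e) Q"
    by (rule homI) (use h(1) in \<open>auto simp: free2_image p hom_def\<close>)
  moreover have "h (?p (e (gen 0))) = x" "h (?p (e (gen 1))) = y"
    using p[OF gen_closed[of 0]] p[OF gen_closed[of 1]] h(2) by simp_all
  ultimately show ?thesis by (intro bexI[of _ "%z. h (?p z)"]) auto
qed

lemma free2_induct:
  assumes g: "g \<in> carrier (free2 e)" and 1: "P 1[free2 e]"
    and a: "!!g i. g \<in> carrier (free2 e) ==> i < 2 ==> P g ==> P (e (gen i) *[free2 e] g) & P (inv[free2 e] e (gen i) *[free2 e] g)"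
  shows "P g"
proof -
  interpret P: group "presented_group 2 {}" by (rule group_presented)
  interpret e: group_hom "presented_group 2 {}" "free2 e" e
    by (rule group_hom.intro[OF group_presented free2_image(1) group_hom_axioms.intro[OF free2_image(2)]])
  obtain A where A: "A \<in> carrier (presented_group 2 {})" "g = e A" using g unfolding free2_image by blast
  have "P (e A)"
  proof (rule presented_induct[where P = "%A. P (e A)", OF A(1)])
    show "P (e 1[presented_group 2 {}])" using 1 by simp
    fix i :: nat and b :: bool and B assume i: "i < 2" and B: "B \<in> carrier (presented_group 2 {})" and PB: "P (e B)"
    have l: "word_cong 2 {} `` {[(i, b)]} = (if b then gen i else inv[presented_group 2 {}] gen i)"
      using letter_inv[OF i, of "{}"] by (simp add: gen_def)
    show "P (e (word_cong 2 {} `` {[(i, b)]} *[presented_group 2 {}] B))"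
      unfolding l using a[OF e.hom_closed[OF B] i PB] gen_closed[OF i] B by simp
  qed
  thus ?thesis using A(2) by simp
qed

lemma group_free2: "group (free2 e)"
  by (rule free2_image)

lemma countable_free2: "countable (carrier (free2 e))"
  unfolding free2_image by (intro countable_image countable_presented)

lemma finitely_presented_free2: "finitely_presented_group (free2 e)"
proof -
  have "e \<in> iso (presented_group 2 {}) (free2 e)" using free2_image e by (simp add: iso_def bij_betw_def)
  hence "presented_group 2 {} \<cong> free2 e" by (auto simp: is_iso_def)
  hence "free2 e \<cong> presented_group 2 {}" by (rule group.iso_sym[OF group_presented])
  thus ?thesis unfolding finitely_presented_group_def
    by (intro conjI group_free2 exI[of _ 2] exI[of _ "{}"]) simp_all
qed

end

section \<open>A second container\<close>

text \<open>Countable, so that pairs with entries in it can be coded in any infinite type, and of infinite degree over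
  \<open>\<rat>\<close>, so that it contains the first rational homology of every finitely generated group.\<close>

type_synonym coef = "rat poly fract"

definition nil_type :: "'a monoid => bool" where
  "nil_type G \<longleftrightarrow> (\<exists>h :: 'a => coef triple. generic G h)"

definition nil_part :: "'a monoid => coef triple monoid" where
  "nil_part G = nil\<lparr>carrier := (if nil_type G then UNIV else {(0, 0, 0)})\<rparr>"

text \<open>One generic homomorphism is chosen for each group, with no compatibility between groups;
  \<open>nil_trans\<close> corrects for the choices.\<close>

definition nil_unit :: "'a monoid => 'a => coef triple" where
  "nil_unit G = (if nil_type G then SOME h. generic G h else (%g. (0, 0, 0)))"

text \<open>Along a two-connected map the pullback of \<open>nil_unit G\<close> is a homomorphism
  from \<open>\<pi>\<close>, and genericity of \<open>nil_unit \<pi>\<close> makes the parameters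
  unique. Without generic homomorphisms both nilpotent parts are trivial, and the identity
  serves.\<close>

definition nil_trans :: "'a monoid => 'b monoid => ('a => 'b) => coef triple => coef triple" where
  "nil_trans \<pi> G \<alpha> = (if nil_type \<pi> then nil_map (THE UV. \<forall>x\<in>carrier \<pi>. nil_unit G (\<alpha> x) = nil_map UV (nil_unit \<pi> x)) else (%z. z))"

lemma nil_unit_generic: "nil_type G ==> generic G (nil_unit G)"
  unfolding nil_unit_def nil_type_def by (simp add: someI_ex[of "generic G"])

lemma nil_unit_trivial: "\<not> nil_type G ==> nil_unit G g = (0, 0, 0)"
  by (simp add: nil_unit_def)

lemma nil_part_mult: "a *[nil_part G] b = a *[nil] b"
  by (simp add: nil_part_def)

lemma group_nil_part: "group (nil_part G)"
proof (cases "nil_type G")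
  case True
  hence "nil_part G = nil" by (simp add: nil_part_def nil_def)
  thus ?thesis using group_nil by simp
next
  case False
  interpret N: group "nil :: coef triple monoid" by (rule group_nil)
  have "subgroup {1[nil]} (nil :: coef triple monoid)" by (rule N.triv_subgroup)
  hence "group (nil\<lparr>carrier := {1[nil :: coef triple monoid]}\<rparr>)" by (rule N.subgroup_imp_group)
  thus ?thesis using False by (simp add: nil_part_def)
qed

lemma nil_unit_hom:
  assumes G: "group G" shows "nil_unit G \<in> hom G (nil_part G)"
proof (cases "nil_type G")
  case True
  thus ?thesis using generic_hom[OF G nil_unit_generic[OF True]] by (simp add: nil_part_def hom_def)
next
  case False
  thus ?thesis by (simp add: nil_part_def hom_def nil_unit_trivial)
qed

lemma nil_type_transfer: "two_connected \<pi> G \<alpha> ==> nil_type \<pi> \<longleftrightarrow> nil_type G"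
  unfolding nil_type_def using generic_pull generic_push by metis

text \<open>The image of a generic homomorphism is large enough to determine the parameters of a
  \<open>nil_map\<close>. Functoriality of \<open>nil_trans\<close> follows from this.\<close>

lemma nil_map_eqI:
  assumes "group G" "generic G h" "!!g. g \<in> carrier G ==> nil_map A (h g) = nil_map B (h g)"
  shows "A = (B :: 'k::field_char_0 triple \<times> 'k triple)"
proof -
  have "(%g. nil_map A (h g)) \<in> hom G nil" using hom_mult[OF generic_hom[OF assms(1,2)]] by (simp add: hom_def nil_map_hom)
  hence "\<exists>!UV. \<forall>g\<in>carrier G. nil_map A (h g) = nil_map UV (h g)" by (rule generic_unique[OF assms(2)])
  thus ?thesis using assms(3) by blast
qed

lemma generic_fixed:
  fixes h :: "'a => 'k::field_char_0 triple"
  assumes G: "group G" and h: "generic G h" and e: "!!g. g \<in> carrier G ==> nil_map UV (h g) = h g"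
  shows "nil_map UV a = a"
proof -
  have "UV = ((1, 0, 0), (0, 1, 0))" by (rule nil_map_eqI[OF G h]) (simp add: e nil_map_id)
  thus ?thesis by (simp add: nil_map_id)
qed

lemma nil_trans_eq:
  assumes c: "two_connected \<pi> G \<alpha>" and t: "nil_type \<pi>"
  shows "\<exists>UV. nil_trans \<pi> G \<alpha> = nil_map UV & (\<forall>x\<in>carrier \<pi>. nil_unit G (\<alpha> x) = nil_map UV (nil_unit \<pi> x))"
proof -
  have gr: "group \<pi>" "group G" using c by (auto simp: two_connected_def)
  have t': "nil_type G" using nil_type_transfer[OF c] t by simp
  have "(%x. nil_unit G (\<alpha> x)) \<in> hom \<pi> nil" by (rule generic_hom[OF gr(1) generic_pull[OF c nil_unit_generic[OF t']]])
  hence "\<exists>!UV. \<forall>x\<in>carrier \<pi>. nil_unit G (\<alpha> x) = nil_map UV (nil_unit \<pi> x)" by (rule generic_unique[OF nil_unit_generic[OF t]])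
  note u = theI'[OF this]
  have "nil_trans \<pi> G \<alpha> = nil_map (THE UV. \<forall>x\<in>carrier \<pi>. nil_unit G (\<alpha> x) = nil_map UV (nil_unit \<pi> x))"
    unfolding nil_trans_def using t by (rule if_P)
  thus ?thesis using u by (intro exI conjI)
qed

lemma nil_trans_trivial: "\<not> nil_type \<pi> ==> nil_trans \<pi> G \<alpha> z = z"
  by (simp add: nil_trans_def)

lemma nil_trans_unit:
  assumes c: "two_connected \<pi> G \<alpha>" and x: "x \<in> carrier \<pi>"
  shows "nil_trans \<pi> G \<alpha> (nil_unit \<pi> x) = nil_unit G (\<alpha> x)"
proof (cases "nil_type \<pi>")
  case True
  thus ?thesis using nil_trans_eq[OF c True] x by auto
next
  case False
  thus ?thesis using nil_type_transfer[OF c] by (simp add: nil_trans_trivial nil_unit_trivial)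
qed

lemma nil_trans_hom:
  assumes c: "two_connected \<pi> G \<alpha>" shows "nil_trans \<pi> G \<alpha> \<in> hom (nil_part \<pi>) (nil_part G)"
proof (cases "nil_type \<pi>")
  case True
  hence "nil_type G" using nil_type_transfer[OF c] by simp
  hence "carrier (nil_part G) = UNIV" by (simp add: nil_part_def)
  moreover obtain UV where "nil_trans \<pi> G \<alpha> = nil_map UV" using nil_trans_eq[OF c True] by blast
  ultimately show ?thesis by (intro homI) (simp_all only: nil_part_mult nil_map_hom UNIV_I)
next
  case False
  thus ?thesis using nil_type_transfer[OF c] by (simp add: nil_part_def hom_def nil_trans_trivial)
qed

text \<open>Both \<open>nil_unit \<pi>\<close> and the pullback of \<open>nil_unit G\<close> are
  generic on \<open>\<pi>\<close>, so each factors through the other. The two composites fix a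
  generic homomorphism, hence are the identity.\<close>

lemma nil_trans_bij:
  assumes c: "two_connected \<pi> G \<alpha>" shows "bij_betw (nil_trans \<pi> G \<alpha>) (carrier (nil_part \<pi>)) (carrier (nil_part G))"
proof (cases "nil_type \<pi>")
  case True
  have gr: "group \<pi>" "group G" using c by (auto simp: two_connected_def)
  have t': "nil_type G" using nil_type_transfer[OF c] True by simp
  have g1: "generic \<pi> (nil_unit \<pi>)" by (rule nil_unit_generic[OF True])
  have g2: "generic \<pi> (%x. nil_unit G (\<alpha> x))" by (rule generic_pull[OF c nil_unit_generic[OF t']])
  obtain UV where UV: "nil_trans \<pi> G \<alpha> = nil_map UV" "\<forall>x\<in>carrier \<pi>. nil_unit G (\<alpha> x) = nil_map UV (nil_unit \<pi> x)"
    using nil_trans_eq[OF c True] by (elim exE conjE)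
  obtain W where W: "\<forall>x\<in>carrier \<pi>. nil_unit \<pi> x = nil_map W (nil_unit G (\<alpha> x))"
    using generic_unique[OF g2 generic_hom[OF gr(1) g1]] by blast
  have comp: "\<exists>Z. \<forall>a. nil_map A (nil_map B a) = nil_map Z a" for A B :: "coef triple \<times> coef triple"
    by (intro exI[of _ "(nil_map A (fst B), nil_map A (snd B))"] allI) (use nil_map_comp[of "fst A" "snd A" B] in simp)
  obtain Z where Z: "\<forall>a. nil_map W (nil_map UV a) = nil_map Z a" using comp by blast
  obtain Z' where Z': "\<forall>a. nil_map UV (nil_map W a) = nil_map Z' a" using comp by blast
  have 1: "nil_map W (nil_map UV a) = a" for a
    unfolding spec[OF Z] by (rule generic_fixed[OF gr(1) g1]) (use UV(2) W Z in metis)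
  have 2: "nil_map UV (nil_map W a) = a" for a
    unfolding spec[OF Z'] by (rule generic_fixed[OF gr(1) g2]) (use UV(2) W Z' in metis)
  have "bij (nil_map UV)" by (rule o_bij[of "nil_map W"]) (simp_all add: fun_eq_iff 1 2)
  thus ?thesis using True t' UV(1) by (simp add: nil_part_def)
next
  case False
  thus ?thesis using nil_type_transfer[OF c] by (simp add: nil_part_def bij_betw_def nil_trans_trivial)
qed

lemma nil_trans_comp:
  assumes c: "two_connected \<pi> G \<alpha>" "two_connected G P \<beta>" "two_connected \<pi> P \<gamma>"
    and e: "!!x. x \<in> carrier \<pi> ==> \<gamma> x = \<beta> (\<alpha> x)"
  shows "nil_trans \<pi> P \<gamma> z = nil_trans G P \<beta> (nil_trans \<pi> G \<alpha> z)"
proof (cases "nil_type \<pi>")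
  case True
  have gr: "group \<pi>" and ha: "\<alpha> \<in> hom \<pi> G" using c(1) by (auto simp: two_connected_def)
  have t': "nil_type G" using nil_type_transfer[OF c(1)] True by simp
  obtain A where A: "nil_trans \<pi> G \<alpha> = nil_map A" using nil_trans_eq[OF c(1) True] by (elim exE conjE)
  obtain B where B: "nil_trans G P \<beta> = nil_map B" using nil_trans_eq[OF c(2) t'] by (elim exE conjE)
  obtain C where C: "nil_trans \<pi> P \<gamma> = nil_map C" using nil_trans_eq[OF c(3) True] by (elim exE conjE)
  define D where "D = (nil_map B (fst A), nil_map B (snd A))"
  have D: "nil_map B (nil_map A a) = nil_map D a" for a unfolding D_def using nil_map_comp[of "fst B" "snd B" A a] by simp
  have "C = D"
  proof (rule nil_map_eqI[OF gr nil_unit_generic[OF True]])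
    fix x assume x: "x \<in> carrier \<pi>"
    have "\<alpha> x \<in> carrier G" using ha x by (auto simp: hom_def)
    thus "nil_map C (nil_unit \<pi> x) = nil_map D (nil_unit \<pi> x)"
      unfolding D[symmetric] A[symmetric] B[symmetric] C[symmetric]
      using nil_trans_unit[OF c(1) x] nil_trans_unit[OF c(2)] nil_trans_unit[OF c(3) x] e[OF x] by simp
  qed
  thus ?thesis by (simp add: A B C D)
next
  case False
  thus ?thesis using nil_type_transfer[OF c(1)] by (simp add: nil_trans_trivial)
qed

lemma nil_trans_id:
  assumes c: "two_connected G G \<gamma>" and e: "!!x. x \<in> carrier G ==> \<gamma> x = x"
  shows "nil_trans G G \<gamma> z = z"
proof (cases "nil_type G")
  case True
  have gr: "group G" using c by (auto simp: two_connected_def)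
  obtain A where A: "nil_trans G G \<gamma> = nil_map A" using nil_trans_eq[OF c True] by (elim exE conjE)
  show ?thesis unfolding A
    by (rule generic_fixed[OF gr nil_unit_generic[OF True]]) (use nil_trans_unit[OF c] e in \<open>simp add: A[symmetric]\<close>)
qed (simp add: nil_trans_trivial)

lemma nil_unit_kernel: "group G ==> g \<in> tf_derived G 2 ==> nil_unit G g = (0, 0, 0)"
  using generic_kernel[OF _ nil_unit_generic] nil_unit_trivial by metis

lemma countable_coef: "countable (UNIV :: coef set)"
proof -
  have "inj (Polynomial.coeffs :: rat poly => rat list)" by (rule injI) (simp add: coeffs_eq_iff)
  hence p: "countable (UNIV :: rat poly set)" using countable_image_inj_on[of Polynomial.coeffs "UNIV :: rat poly set"] by simp
  have "UNIV = (%(a, b). Fract a b) ` (UNIV :: (rat poly \<times> rat poly) set)"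
  proof (intro equalityI subsetI)
    fix x :: coef
    obtain a b where "x = Fract a b" by (rule Fract_cases)
    thus "x \<in> (%(a, b). Fract a b) ` UNIV" by auto
  qed simp
  moreover have "countable (UNIV :: (rat poly \<times> rat poly) set)"
    unfolding UNIV_Times_UNIV[symmetric] by (intro countable_SIGMA p)
  ultimately show ?thesis by (metis countable_image)
qed

text \<open>Universality is tested only against containers with values in the same type
  \<open>'c\<close>. A product with a countable factor fits into that type.\<close>

lemma pairing_injection:
  assumes "infinite (UNIV :: 'c set)" "countable (UNIV :: 'k set)"
  shows "\<exists>e :: 'c \<times> 'k => 'c. inj e"
proof -
  obtain f :: "'k => 'c" where "inj f" using countable_injection[OF assms(2,1)] by blast
  hence "\<exists>f :: 'k => 'c. inj_on f UNIV & f ` UNIV <= UNIV" by auto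
  note le = card_of_ordLeq[THEN iffD1, OF this]
  note t = conjunct1[OF card_of_Times_infinite[OF assms(1) UNIV_not_empty le]]
  have "\<exists>g :: 'c \<times> 'k => 'c. inj_on g (UNIV \<times> UNIV) & g ` (UNIV \<times> UNIV) <= UNIV"
    by (rule card_of_ordLeq[THEN iffD2, OF ordIso_imp_ordLeq[OF t]])
  thus ?thesis by auto
qed

text \<open>The product of \<open>F\<close> with the nilpotent part, coded by \<open>e\<close> in
  the type of the values of \<open>F\<close>. Its domain is cut down to two-connected homomorphisms,
  on which \<open>nil_trans\<close> is functorial.\<close>

definition container2 :: "('a, 'c) ifunctor => ('c \<times> coef triple => 'c) => ('a, 'c) ifunctor" where
  "container2 F e =
     \<lparr>ifun_obj = (%G. image_group e (ifun_obj F G \<times>\<times> nil_part G)),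
      ifun_def = (%\<pi> G \<alpha>. ifun_def F \<pi> G \<alpha> & two_connected \<pi> G \<alpha>),
      ifun_map = (%\<pi> G \<alpha> z. e (map_prod (ifun_map F \<pi> G \<alpha>) (nil_trans \<pi> G \<alpha>) (inv_into UNIV e z))),
      ifun_unit = (%G g. e (ifun_unit F G g, nil_unit G g))\<rparr>"

lemma I_functorD:
  assumes "I_functor H"
  shows "\<forall>G. group G --> group (ifun_obj H G)"
    "\<forall>\<pi> G \<alpha>. ifun_def H \<pi> G \<alpha> --> \<alpha> \<in> homs \<pi> G & ifun_map H \<pi> G \<alpha> \<in> hom (ifun_obj H \<pi>) (ifun_obj H G)"
    "\<forall>G. group G --> ifun_unit H G \<in> hom G (ifun_obj H G)"
    "\<forall>\<pi> G \<alpha>. Omega_Q \<pi> G \<alpha> --> ifun_def H \<pi> G \<alpha> & inj_on (ifun_map H \<pi> G \<alpha>) (carrier (ifun_obj H \<pi>))"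
    "\<forall>\<pi> G P \<alpha> \<beta>. ifun_def H \<pi> G \<alpha> & ifun_def H G P \<beta> & ifun_def H \<pi> P (compose (carrier \<pi>) \<beta> \<alpha>) -->
        (\<forall>x\<in>carrier (ifun_obj H \<pi>). ifun_map H \<pi> P (compose (carrier \<pi>) \<beta> \<alpha>) x = ifun_map H G P \<beta> (ifun_map H \<pi> G \<alpha> x))"
    "\<forall>\<pi> G \<alpha>. ifun_def H \<pi> G \<alpha> --> (\<forall>g\<in>carrier \<pi>. ifun_map H \<pi> G \<alpha> (ifun_unit H \<pi> g) = ifun_unit H G (\<alpha> g))"
    "\<forall>G. ifun_def H G G (\<lambda>g\<in>carrier G. g) --> (\<forall>x\<in>carrier (ifun_obj H G). ifun_map H G G (\<lambda>g\<in>carrier G. g) x = x)"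
    "\<forall>\<pi> G \<alpha>. \<alpha> \<in> homs \<pi> G & \<alpha> \<in> iso \<pi> G --> ifun_def H \<pi> G \<alpha> & ifun_map H \<pi> G \<alpha> \<in> iso (ifun_obj H \<pi>) (ifun_obj H G)"
  using assms unfolding I_functor_def by - (elim conjE, assumption)+

lemma Omega_two_connected: "Omega_Q \<pi> G \<alpha> ==> two_connected \<pi> G \<alpha>"
  unfolding Omega_Q_def by (elim conjE) (rule rationally_2_connected_two_connected)

context
  fixes F :: "('a, 'c) ifunctor" and e :: "'c \<times> coef triple => 'c"
  assumes F: "I_functor F" and e: "inj e"
begin

abbreviation "PF G == ifun_obj F G \<times>\<times> nil_part G"
abbreviation "F2 G == image_group e (PF G)"
abbreviation "trans2 \<pi> G \<alpha> z == e (map_prod (ifun_map F \<pi> G \<alpha>) (nil_trans \<pi> G \<alpha>) (inv_into UNIV e z))"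

lemma group_PF: "group G ==> group (PF G)"
  using I_functorD(1)[OF F] group_nil_part by (blast intro: DirProd_group)

lemma inj_PF: "inj_on e (carrier (PF G))"
  using e by (rule inj_on_subset) simp

lemmas F'_image = image_group_inj[OF group_PF inj_PF]

lemma inv_e [simp]: "inv_into UNIV e (e p) = p"
  using e by simp

lemma F'_cases:
  assumes "group G" "z \<in> carrier (F2 G)"
  obtains x a where "x \<in> carrier (ifun_obj F G)" "a \<in> carrier (nil_part G)" "z = e (x, a)"
  using assms(2) unfolding F'_image(4)[OF assms(1)] by auto

lemma F'_pair: "group G ==> x \<in> carrier (ifun_obj F G) ==> a \<in> carrier (nil_part G) ==> e (x, a) \<in> carrier (F2 G)"
  unfolding F'_image(4) by auto

lemma F'_mult:
  "[|group G; x \<in> carrier (ifun_obj F G); a \<in> carrier (nil_part G); y \<in> carrier (ifun_obj F G); b \<in> carrier (nil_part G)|] ==>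
    e (x, a) *[F2 G] e (y, b) = e (x *[ifun_obj F G] y, a *[nil_part G] b)"
  using F'_image(3)[of G "(x, a)" "(y, b)"] by (simp add: DirProd_def)

lemma F'_hom:
  assumes gr: "group \<pi>" "group G" and f: "f \<in> hom (ifun_obj F \<pi>) (ifun_obj F G)" and t: "t \<in> hom (nil_part \<pi>) (nil_part G)"
  shows "(%z. e (map_prod f t (inv_into UNIV e z))) \<in> hom (F2 \<pi>) (F2 G)"
proof (rule homI)
  have fc: "f x \<in> carrier (ifun_obj F G)" if "x \<in> carrier (ifun_obj F \<pi>)" for x using f that by (auto simp: hom_def)
  have tc: "t x \<in> carrier (nil_part G)" if "x \<in> carrier (nil_part \<pi>)" for x using t that by (auto simp: hom_def)
  fix z assume z: "z \<in> carrier (F2 \<pi>)"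
  obtain x a where x: "x \<in> carrier (ifun_obj F \<pi>)" "a \<in> carrier (nil_part \<pi>)" "z = e (x, a)" by (rule F'_cases[OF gr(1) z])
  show "e (map_prod f t (inv_into UNIV e z)) \<in> carrier (F2 G)"
    unfolding x(3) by (simp add: F'_pair[OF gr(2) fc[OF x(1)] tc[OF x(2)]])
  fix w assume w: "w \<in> carrier (F2 \<pi>)"
  obtain y b where y: "y \<in> carrier (ifun_obj F \<pi>)" "b \<in> carrier (nil_part \<pi>)" "w = e (y, b)" by (rule F'_cases[OF gr(1) w])
  show "e (map_prod f t (inv_into UNIV e (z *[F2 \<pi>] w))) = e (map_prod f t (inv_into UNIV e z)) *[F2 G] e (map_prod f t (inv_into UNIV e w))"
    unfolding x(3) y(3) F'_mult[OF gr(1) x(1,2) y(1,2)]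
    by (simp add: F'_mult[OF gr(2) fc[OF x(1)] tc[OF x(2)] fc[OF y(1)] tc[OF y(2)]] hom_mult[OF f x(1) y(1)] hom_mult[OF t x(2) y(2)])
qed

lemma F'_bij:
  assumes gr: "group \<pi>" "group G" and f: "bij_betw f (carrier (ifun_obj F \<pi>)) (carrier (ifun_obj F G))"
    and t: "bij_betw t (carrier (nil_part \<pi>)) (carrier (nil_part G))"
  shows "bij_betw (%z. e (map_prod f t (inv_into UNIV e z))) (carrier (F2 \<pi>)) (carrier (F2 G))"
proof -
  have 1: "bij_betw (inv_into UNIV e) (carrier (F2 \<pi>)) (carrier (PF \<pi>))"
    unfolding F'_image(4)[OF gr(1)] bij_betw_def by (auto simp: inj_on_def image_image)
  have 2: "bij_betw (map_prod f t) (carrier (PF \<pi>)) (carrier (PF G))"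
    using bij_betw_map_prod[OF f t] by simp
  have 3: "bij_betw e (carrier (PF G)) (carrier (F2 G))"
    unfolding F'_image(4)[OF gr(2)] by (rule bij_betw_imageI[OF inj_PF HOL.refl])
  show ?thesis using bij_betw_trans[OF bij_betw_trans[OF 1 2] 3] by (simp add: comp_def)
qed

lemma I_functor_container2: "I_functor (container2 F e)"
proof -
  note D = I_functorD[OF F]
  have s: "ifun_obj (container2 F e) = (%G. F2 G)"
    "ifun_def (container2 F e) = (%\<pi> G \<alpha>. ifun_def F \<pi> G \<alpha> & two_connected \<pi> G \<alpha>)"
    "ifun_map (container2 F e) = (%\<pi> G \<alpha> z. trans2 \<pi> G \<alpha> z)"
    "ifun_unit (container2 F e) = (%G g. e (ifun_unit F G g, nil_unit G g))" by (simp_all add: container2_def)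
  have gr: "group \<pi>" "group G" if "two_connected \<pi> G \<alpha>" for \<pi> G :: "'a monoid" and \<alpha> using that by (auto simp: two_connected_def)
  have fh: "ifun_map F \<pi> G \<alpha> \<in> hom (ifun_obj F \<pi>) (ifun_obj F G)" "\<alpha> \<in> homs \<pi> G" if "ifun_def F \<pi> G \<alpha>" for \<pi> G \<alpha> using D(2) that by blast+
  show ?thesis
    unfolding I_functor_def s
  proof (intro conjI allI impI ballI; (elim conjE)?)
    fix G :: "'a monoid" assume "group G" thus "group (F2 G)" by (rule F'_image)
  next
    fix \<pi> G :: "'a monoid" and \<alpha> assume a: "ifun_def F \<pi> G \<alpha>" "two_connected \<pi> G \<alpha>"
    show "\<alpha> \<in> homs \<pi> G" by (rule fh[OF a(1)])
    show "(trans2 \<pi> G \<alpha>) \<in> hom (F2 \<pi>) (F2 G)"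
      by (rule F'_hom[OF gr[OF a(2)] fh(1)[OF a(1)] nil_trans_hom[OF a(2)]])
  next
    fix G :: "'a monoid" assume G: "group G"
    have u: "ifun_unit F G \<in> hom G (ifun_obj F G)" using D(3) G by blast
    show "(%g. e (ifun_unit F G g, nil_unit G g)) \<in> hom G (F2 G)"
    proof (rule homI)
      have uc: "ifun_unit F G g \<in> carrier (ifun_obj F G)" "nil_unit G g \<in> carrier (nil_part G)" if "g \<in> carrier G" for g
        using u nil_unit_hom[OF G] that by (auto simp: hom_def)
      fix g assume g: "g \<in> carrier G"
      show "e (ifun_unit F G g, nil_unit G g) \<in> carrier (F2 G)" by (rule F'_pair[OF G uc[OF g]])
      fix h assume h: "h \<in> carrier G"
      show "e (ifun_unit F G (g *[G] h), nil_unit G (g *[G] h)) =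
        e (ifun_unit F G g, nil_unit G g) *[F2 G] e (ifun_unit F G h, nil_unit G h)"
        unfolding F'_mult[OF G uc[OF g] uc[OF h]] hom_mult[OF u g h] hom_mult[OF nil_unit_hom[OF G] g h] ..
    qed
  next
    fix \<pi> G :: "'a monoid" and \<alpha> assume o: "Omega_Q \<pi> G \<alpha>"
    have f: "ifun_def F \<pi> G \<alpha>" "inj_on (ifun_map F \<pi> G \<alpha>) (carrier (ifun_obj F \<pi>))" using D(4) o by blast+
    have t: "two_connected \<pi> G \<alpha>" by (rule Omega_two_connected[OF o])
    show "ifun_def F \<pi> G \<alpha>" "two_connected \<pi> G \<alpha>" by fact+
    show "inj_on (trans2 \<pi> G \<alpha>) (carrier (F2 \<pi>))"
    proof (rule inj_onI)
      fix z w assume z: "z \<in> carrier (F2 \<pi>)" and w: "w \<in> carrier (F2 \<pi>)"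
        and eq: "trans2 \<pi> G \<alpha> z = e (map_prod (ifun_map F \<pi> G \<alpha>) (nil_trans \<pi> G \<alpha>) (inv_into UNIV e w))"
      obtain x a where x: "x \<in> carrier (ifun_obj F \<pi>)" "a \<in> carrier (nil_part \<pi>)" "z = e (x, a)" by (rule F'_cases[OF gr(1)[OF t] z])
      obtain y b where y: "y \<in> carrier (ifun_obj F \<pi>)" "b \<in> carrier (nil_part \<pi>)" "w = e (y, b)" by (rule F'_cases[OF gr(1)[OF t] w])
      have "ifun_map F \<pi> G \<alpha> x = ifun_map F \<pi> G \<alpha> y & nil_trans \<pi> G \<alpha> a = nil_trans \<pi> G \<alpha> b"
        using injD[OF e eq] unfolding x(3) y(3) by simp
      hence "x = y & a = b" using inj_onD[OF f(2) _ x(1) y(1)] inj_onD[OF bij_betw_imp_inj_on[OF nil_trans_bij[OF t]] _ x(2) y(2)] by blast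
      thus "z = w" by (simp add: x(3) y(3))
    qed
  next
    fix \<pi> G P :: "'a monoid" and \<alpha> \<beta> z
    assume z: "z \<in> carrier (F2 \<pi>)" and d: "ifun_def F \<pi> G \<alpha>" "ifun_def F G P \<beta>" "ifun_def F \<pi> P (compose (carrier \<pi>) \<beta> \<alpha>)"
      and t: "two_connected \<pi> G \<alpha>" "two_connected G P \<beta>" "two_connected \<pi> P (compose (carrier \<pi>) \<beta> \<alpha>)"
    obtain x a where x: "x \<in> carrier (ifun_obj F \<pi>)" "a \<in> carrier (nil_part \<pi>)" "z = e (x, a)" by (rule F'_cases[OF gr(1)[OF t(1)] z])
    have "ifun_map F \<pi> P (compose (carrier \<pi>) \<beta> \<alpha>) x = ifun_map F G P \<beta> (ifun_map F \<pi> G \<alpha> x)" using D(5) d x(1) by blast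
    moreover have "nil_trans \<pi> P (compose (carrier \<pi>) \<beta> \<alpha>) a = nil_trans G P \<beta> (nil_trans \<pi> G \<alpha> a)"
      by (rule nil_trans_comp[OF t]) (simp add: compose_def)
    ultimately show "e (map_prod (ifun_map F \<pi> P (compose (carrier \<pi>) \<beta> \<alpha>)) (nil_trans \<pi> P (compose (carrier \<pi>) \<beta> \<alpha>)) (inv_into UNIV e z)) =
      e (map_prod (ifun_map F G P \<beta>) (nil_trans G P \<beta>) (inv_into UNIV e (trans2 \<pi> G \<alpha> z)))"
      by (simp add: x(3))
  next
    fix \<pi> G :: "'a monoid" and \<alpha> g assume a: "ifun_def F \<pi> G \<alpha>" "two_connected \<pi> G \<alpha>" and g: "g \<in> carrier \<pi>"
    have "ifun_map F \<pi> G \<alpha> (ifun_unit F \<pi> g) = ifun_unit F G (\<alpha> g)" using D(6) a(1) g by blast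
    thus "e (map_prod (ifun_map F \<pi> G \<alpha>) (nil_trans \<pi> G \<alpha>) (inv_into UNIV e (e (ifun_unit F \<pi> g, nil_unit \<pi> g)))) = e (ifun_unit F G (\<alpha> g), nil_unit G (\<alpha> g))"
      by (simp add: nil_trans_unit[OF a(2) g])
  next
    fix G :: "'a monoid" and z assume d: "ifun_def F G G (\<lambda>g\<in>carrier G. g)" "two_connected G G (\<lambda>g\<in>carrier G. g)" and z: "z \<in> carrier (F2 G)"
    obtain x a where x: "x \<in> carrier (ifun_obj F G)" "a \<in> carrier (nil_part G)" "z = e (x, a)" by (rule F'_cases[OF gr(1)[OF d(2)] z])
    have "ifun_map F G G (\<lambda>g\<in>carrier G. g) x = x" using D(7) d(1) x(1) by blast
    moreover have "nil_trans G G (\<lambda>g\<in>carrier G. g) a = a" by (rule nil_trans_id[OF d(2)]) simp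
    ultimately show "e (map_prod (ifun_map F G G (\<lambda>g\<in>carrier G. g)) (nil_trans G G (\<lambda>g\<in>carrier G. g)) (inv_into UNIV e z)) = z"
      by (simp add: x(3))
  next
    fix \<pi> G :: "'a monoid" and \<alpha> assume h: "\<alpha> \<in> homs \<pi> G" and i: "\<alpha> \<in> iso \<pi> G"
    have gr': "group \<pi>" "group G" using h by (auto simp: homs_def)
    have f: "ifun_def F \<pi> G \<alpha>" "ifun_map F \<pi> G \<alpha> \<in> iso (ifun_obj F \<pi>) (ifun_obj F G)" using D(8) h i by blast+
    have t: "two_connected \<pi> G \<alpha>" by (rule iso_two_connected[OF gr' i])
    show "ifun_def F \<pi> G \<alpha>" "two_connected \<pi> G \<alpha>" by fact+
    show "(trans2 \<pi> G \<alpha>) \<in> iso (F2 \<pi>) (F2 G)"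
      using F'_hom[OF gr' _ nil_trans_hom[OF t], of "ifun_map F \<pi> G \<alpha>"] F'_bij[OF gr' _ nil_trans_bij[OF t], of "ifun_map F \<pi> G \<alpha>"] f(2)
      by (simp add: iso_def)
  qed
qed

end

text \<open>The second component descends to \<open>H G\<close> because the unit of \<open>H\<close>
  is surjective and \<open>nil_unit\<close> kills its kernel. Injectivity is inherited from
  \<open>\<tau>\<close>.\<close>

lemma container_container2:
  fixes H :: "('a, 'b) ifunctor" and F :: "('a, 'c) ifunctor"
  assumes c: "container H F \<tau>" and e: "inj e"
    and surj: "!!G. group G ==> carrier (ifun_obj H G) <= ifun_unit H G ` carrier G"
    and ker: "!!G g. group G ==> g \<in> carrier G ==> ifun_unit H G g = 1[ifun_obj H G] ==> nil_unit G g = (0, 0, 0)"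
  shows "container H (container2 F e) (%G x. e (\<tau> G x, nil_unit G (SOME g. g \<in> carrier G & ifun_unit H G g = x)))"
proof -
  have m: "injective_I_morphism H F \<tau>" and isoF: "\<forall>\<pi> G \<alpha>. Omega_Q \<pi> G \<alpha> --> ifun_map F \<pi> G \<alpha> \<in> iso (ifun_obj F \<pi>) (ifun_obj F G)"
    using c unfolding container_def by - (elim conjE, assumption)+
  have injm: "\<forall>G. finitely_presented_group G --> inj_on (\<tau> G) (carrier (ifun_obj H G))" and m': "I_morphism H F \<tau>"
    using m unfolding injective_I_morphism_def by - (elim conjE, assumption)+
  have IH: "I_functor H" and IF: "I_functor F" using m' unfolding I_morphism_def by - (elim conjE, assumption)+
  have tau: "\<forall>G. finitely_presented_group G --> \<tau> G \<in> hom (ifun_obj H G) (ifun_obj F G) &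
      (\<forall>g\<in>carrier G. \<tau> G (ifun_unit H G g) = ifun_unit F G g)"
    and nat: "\<forall>\<pi> G \<alpha>. finitely_presented_group \<pi> & finitely_presented_group G & rationally_2_connected \<pi> G \<alpha> -->
        (\<forall>x\<in>carrier (ifun_obj H \<pi>). \<tau> G (ifun_map H \<pi> G \<alpha> x) = ifun_map F \<pi> G \<alpha> (\<tau> \<pi> x))"
    using m' unfolding I_morphism_def by - (elim conjE, assumption)+
  \<comment> \<open>The factorisation of \<open>nil_unit G\<close> through the unit of
    \<open>H\<close>; the choice of a preimage is harmless by \<open>ker\<close>.\<close>
  define mu where "mu G x = nil_unit G (SOME g. g \<in> carrier G & ifun_unit H G g = x)" for G x
  have uH: "ifun_unit H G \<in> hom G (ifun_obj H G)" and gH: "group (ifun_obj H G)" if "group G" for G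
    using I_functorD(1,3)[OF IH] that by blast+
  have mu: "mu G (ifun_unit H G g) = nil_unit G g" if G: "group G" and g: "g \<in> carrier G" for G g
  proof -
    interpret u: group_hom G "ifun_obj H G" "ifun_unit H G" using G gH[OF G] uH[OF G] by (simp add: group_hom_def group_hom_axioms_def)
    interpret n: group_hom G "nil_part G" "nil_unit G" using G group_nil_part nil_unit_hom[OF G] by (simp add: group_hom_def group_hom_axioms_def)
    define k where "k = (SOME k. k \<in> carrier G & ifun_unit H G k = ifun_unit H G g)"
    have k: "k \<in> carrier G & ifun_unit H G k = ifun_unit H G g" unfolding k_def by (rule someI[of _ g]) (simp add: g)
    have "ifun_unit H G (k *[G] inv[G] g) = 1[ifun_obj H G]" using k g by simp
    hence "nil_unit G (k *[G] inv[G] g) = (0, 0, 0)" using ker[OF G] k g by simp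
    hence 1: "nil_unit G k *[nil_part G] inv[nil_part G] nil_unit G g = 1[nil_part G]"
      using k g by (simp add: nil_part_def)
    have "nil_unit G k = inv[nil_part G] (inv[nil_part G] nil_unit G g)"
      by (rule n.H.inv_equality[OF 1, symmetric]) (use k g in simp_all)
    thus ?thesis using g by (simp add: mu_def k_def[symmetric])
  qed
  have mc: "mu G x \<in> carrier (nil_part G)" if G: "group G" and x: "x \<in> carrier (ifun_obj H G)" for G x
  proof -
    obtain g where g: "g \<in> carrier G" "x = ifun_unit H G g" using surj[OF G] x by blast
    show ?thesis unfolding g(2) mu[OF G g(1)] using nil_unit_hom[OF G] g(1) by (auto simp: hom_def)
  qed
  note F' = group_PF[OF IF e]
  have s: "ifun_obj (container2 F e) = (%G. image_group e (ifun_obj F G \<times>\<times> nil_part G))"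
    "ifun_map (container2 F e) = (%\<pi> G \<alpha> z. e (map_prod (ifun_map F \<pi> G \<alpha>) (nil_trans \<pi> G \<alpha>) (inv_into UNIV e z)))"
    "ifun_unit (container2 F e) = (%G g. e (ifun_unit F G g, nil_unit G g))" by (simp_all add: container2_def)
  have fpg: "group G" if "finitely_presented_group G" for G :: "'a monoid" using that by (simp add: finitely_presented_group_def)
  have "I_morphism H (container2 F e) (%G x. e (\<tau> G x, mu G x))"
    unfolding I_morphism_def s
  proof (intro conjI allI impI ballI; (elim conjE)?)
    show "I_functor H" by (rule IH)
    show "I_functor (container2 F e)" by (rule I_functor_container2[OF IF e])
  next
    fix G :: "'a monoid" assume fp: "finitely_presented_group G"
    have G: "group G" by (rule fpg[OF fp])
    have th: "\<tau> G \<in> hom (ifun_obj H G) (ifun_obj F G)" using tau fp by blast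
    have tc: "\<tau> G x \<in> carrier (ifun_obj F G)" if "x \<in> carrier (ifun_obj H G)" for x using th that by (auto simp: hom_def)
    show "(%x. e (\<tau> G x, mu G x)) \<in> hom (ifun_obj H G) (image_group e (ifun_obj F G \<times>\<times> nil_part G))"
    proof (rule homI)
      fix x assume x: "x \<in> carrier (ifun_obj H G)"
      show "e (\<tau> G x, mu G x) \<in> carrier (image_group e (ifun_obj F G \<times>\<times> nil_part G))"
        by (rule F'_pair[OF IF e G tc[OF x] mc[OF G x]])
      fix y assume y: "y \<in> carrier (ifun_obj H G)"
      obtain g where g: "g \<in> carrier G" "x = ifun_unit H G g" using surj[OF G] x by blast
      obtain h where h: "h \<in> carrier G" "y = ifun_unit H G h" using surj[OF G] y by blast
      have gh: "g *[G] h \<in> carrier G" using G g h by (simp add: group.is_monoid monoid.m_closed)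
      have "mu G (x *[ifun_obj H G] y) = mu G x *[nil_part G] mu G y"
        unfolding g(2) h(2) hom_mult[OF uH[OF G] g(1) h(1), symmetric] mu[OF G g(1)] mu[OF G h(1)] mu[OF G gh]
        by (rule hom_mult[OF nil_unit_hom[OF G] g(1) h(1)])
      thus "e (\<tau> G (x *[ifun_obj H G] y), mu G (x *[ifun_obj H G] y)) =
        e (\<tau> G x, mu G x) *[image_group e (ifun_obj F G \<times>\<times> nil_part G)] e (\<tau> G y, mu G y)"
        unfolding F'_mult[OF IF e G tc[OF x] mc[OF G x] tc[OF y] mc[OF G y]] hom_mult[OF th x y] by simp
    qed
    fix g assume g: "g \<in> carrier G"
    have "\<tau> G (ifun_unit H G g) = ifun_unit F G g" using tau fp g by blast
    thus "e (\<tau> G (ifun_unit H G g), mu G (ifun_unit H G g)) = e (ifun_unit F G g, nil_unit G g)" by (simp add: mu[OF G g])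
  next
    fix \<pi> G :: "'a monoid" and \<alpha> x assume fp: "finitely_presented_group \<pi>" "finitely_presented_group G" and r: "rationally_2_connected \<pi> G \<alpha>"
      and x: "x \<in> carrier (ifun_obj H \<pi>)"
    have o: "Omega_Q \<pi> G \<alpha>" unfolding Omega_Q_def using finitely_presented_generated[OF fp(1)] fp(2) r by blast
    have t: "two_connected \<pi> G \<alpha>" by (rule Omega_two_connected[OF o])
    have gr: "group \<pi>" "group G" "\<alpha> \<in> hom \<pi> G" using t by (auto simp: two_connected_def)
    obtain g where g: "g \<in> carrier \<pi>" "x = ifun_unit H \<pi> g" using surj[OF gr(1)] x by blast
    have ag: "\<alpha> g \<in> carrier G" using gr(3) g(1) by (auto simp: hom_def)
    have "ifun_def H \<pi> G \<alpha>" using I_functorD(4)[OF IH] o by blast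
    hence "ifun_map H \<pi> G \<alpha> x = ifun_unit H G (\<alpha> g)" using I_functorD(6)[OF IH] g by blast
    hence "mu G (ifun_map H \<pi> G \<alpha> x) = nil_trans \<pi> G \<alpha> (mu \<pi> x)"
      using mu[OF gr(2) ag] mu[OF gr(1) g(1)] nil_trans_unit[OF t g(1)] g(2) by simp
    moreover have "\<tau> G (ifun_map H \<pi> G \<alpha> x) = ifun_map F \<pi> G \<alpha> (\<tau> \<pi> x)" using nat fp r x by blast
    ultimately show "e (\<tau> G (ifun_map H \<pi> G \<alpha> x), mu G (ifun_map H \<pi> G \<alpha> x)) =
      e (map_prod (ifun_map F \<pi> G \<alpha>) (nil_trans \<pi> G \<alpha>) (inv_into UNIV e (e (\<tau> \<pi> x, mu \<pi> x))))"
      by (simp add: inv_e[OF IF e])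
  qed
  moreover have "inj_on (%x. e (\<tau> G x, mu G x)) (carrier (ifun_obj H G))" if "finitely_presented_group G" for G
  proof (rule inj_onI)
    fix x y assume x: "x \<in> carrier (ifun_obj H G)" "y \<in> carrier (ifun_obj H G)" and eq: "e (\<tau> G x, mu G x) = e (\<tau> G y, mu G y)"
    have "\<tau> G x = \<tau> G y" using injD[OF e eq] by simp
    thus "x = y" using injm that x by (simp add: inj_on_def)
  qed
  moreover have "ifun_map (container2 F e) \<pi> G \<alpha> \<in> iso (ifun_obj (container2 F e) \<pi>) (ifun_obj (container2 F e) G)" if o: "Omega_Q \<pi> G \<alpha>" for \<pi> G \<alpha>
  proof -
    have t: "two_connected \<pi> G \<alpha>" by (rule Omega_two_connected[OF o])
    have gr: "group \<pi>" "group G" using t by (auto simp: two_connected_def)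
    have f: "ifun_map F \<pi> G \<alpha> \<in> iso (ifun_obj F \<pi>) (ifun_obj F G)" using isoF o by blast
    show ?thesis unfolding s
      using F'_hom[OF IF e gr _ nil_trans_hom[OF t], of "ifun_map F \<pi> G \<alpha>"] F'_bij[OF IF e gr _ nil_trans_bij[OF t], of "ifun_map F \<pi> G \<alpha>"] f
      by (simp add: iso_def)
  qed
  ultimately show ?thesis unfolding container_def injective_I_morphism_def mu_def by blast
qed

text \<open>Stated for any \<open>H\<close> whose unit is surjective with a kernel that
  \<open>nil_unit\<close> kills, so that finite stages and the limit are treated at once.\<close>

lemma not_universal:
  fixes H :: "('a, 'b) ifunctor" and F :: "('a, 'c) ifunctor" and G :: "'a monoid"
  assumes inf: "infinite (UNIV :: 'c set)"
    and surj: "!!G. group G ==> carrier (ifun_obj H G) <= ifun_unit H G ` carrier G"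
    and ker: "!!G g. group G ==> g \<in> carrier G ==> ifun_unit H G g = 1[ifun_obj H G] ==> nil_unit G g = (0, 0, 0)"
    and fp: "finitely_presented_group G" and ab: "a \<in> carrier G" "b \<in> carrier G"
    and nc: "nil_unit G a *[nil] nil_unit G b ~= nil_unit G b *[nil] nil_unit G a"
    and double: "double_commutators (ifun_obj F G)"
  shows "\<not> universal_container H F \<tau>"
proof
  assume u: "universal_container H F \<tau>"
  have c: "container H F \<tau>" using u unfolding universal_container_def by (rule conjunct1)
  have IF: "I_functor F" using c unfolding container_def injective_I_morphism_def I_morphism_def by (elim conjE)
  have G: "group G" using fp by (simp add: finitely_presented_group_def)
  have "countable (UNIV :: coef triple set)" unfolding UNIV_Times_UNIV[symmetric] by (intro countable_SIGMA countable_coef)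
  then obtain e :: "'c \<times> coef triple => 'c" where e: "inj e" using pairing_injection[OF inf] by blast
  let ?F' = "container2 F e"
  obtain \<theta> where "injective_I_morphism F ?F' \<theta>"
    using u container_container2[OF c e surj ker] unfolding universal_container_def Let_def by meson
  hence "I_morphism F ?F' \<theta>" unfolding injective_I_morphism_def by (rule conjunct1)
  hence "\<theta> G \<in> hom (ifun_obj F G) (ifun_obj ?F' G) & (\<forall>g\<in>carrier G. \<theta> G (ifun_unit F G g) = ifun_unit ?F' G g)"
    unfolding I_morphism_def using fp by blast
  hence th: "\<theta> G \<in> hom (ifun_obj F G) (image_group e (ifun_obj F G \<times>\<times> nil_part G))"
    and tu: "\<theta> G (ifun_unit F G g) = e (ifun_unit F G g, nil_unit G g)" if "g \<in> carrier G" for g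
    using that by (auto simp: container2_def)
  have th: "\<theta> G \<in> hom (ifun_obj F G) (image_group e (ifun_obj F G \<times>\<times> nil_part G))" by (rule th[OF ab(1)])
  \<comment> \<open>The second component of \<open>\<theta> G\<close>: an extension of
    \<open>nil_unit G\<close> from \<open>G\<close> to \<open>F(G)\<close>.\<close>
  define f where "f z = snd (inv_into UNIV e (\<theta> G z))" for z
  have fm: "f (x *[ifun_obj F G] y) = f x *[nil] f y" if x: "x \<in> carrier (ifun_obj F G)" and y: "y \<in> carrier (ifun_obj F G)" for x y
  proof -
    have tx: "\<theta> G x \<in> carrier (image_group e (ifun_obj F G \<times>\<times> nil_part G))" and ty: "\<theta> G y \<in> carrier (image_group e (ifun_obj F G \<times>\<times> nil_part G))"
      using th x y by (auto simp: hom_def)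
    obtain p r where p: "p \<in> carrier (ifun_obj F G)" "r \<in> carrier (nil_part G)" "\<theta> G x = e (p, r)" by (rule F'_cases[OF IF e G tx])
    obtain q s where q: "q \<in> carrier (ifun_obj F G)" "s \<in> carrier (nil_part G)" "\<theta> G y = e (q, s)" by (rule F'_cases[OF IF e G ty])
    show ?thesis
      unfolding f_def hom_mult[OF th x y] p(3) q(3) F'_mult[OF IF e G p(1,2) q(1,2)] inv_e[OF IF e] by (simp add: nil_part_mult)
  qed
  interpret FG: group "ifun_obj F G" using I_functorD(1)[OF IF] G by blast
  interpret N: group "nil :: coef triple monoid" by (rule group_nil)
  have uc: "ifun_unit F G g \<in> carrier (ifun_obj F G)" if "g \<in> carrier G" for g
    using I_functorD(3)[OF IF] G that by (auto simp: hom_def)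
  have fu: "f (ifun_unit F G g) = nil_unit G g" if "g \<in> carrier G" for g
    unfolding f_def tu[OF that] inv_e[OF IF e] by simp
  let ?x = "ifun_unit F G a" and ?y = "ifun_unit F G b"
  note x = uc[OF ab(1)] and y = uc[OF ab(2)]
  let ?z = "?x *[ifun_obj F G] ?y *[ifun_obj F G] inv[ifun_obj F G] ?x *[ifun_obj F G] inv[ifun_obj F G] ?y"
  have z: "?z \<in> carrier (ifun_obj F G)" using x y by simp
  have xy: "?x *[ifun_obj F G] ?y = ?z *[ifun_obj F G] ?y *[ifun_obj F G] ?x"
    using x y by (simp add: FG.m_assoc FG.l_inv)
  obtain \<gamma> w v where g: "\<gamma> \<in> carrier (ifun_obj F G)" "w \<in> carrier (ifun_obj F G)" "v \<in> carrier (ifun_obj F G)"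
    "\<gamma> *[ifun_obj F G] w = ?z *[ifun_obj F G] w *[ifun_obj F G] \<gamma>"
    "\<gamma> *[ifun_obj F G] v = w *[ifun_obj F G] v *[ifun_obj F G] \<gamma>" using double[unfolded double_commutators_def, THEN bspec[OF _ x], THEN bspec[OF _ y], THEN bspec[OF _ z], THEN mp, OF xy]
    by (elim bexE conjE)
  have m: "f (p *[ifun_obj F G] q *[ifun_obj F G] r) = f p *[nil] f q *[nil] f r"
    if "p \<in> carrier (ifun_obj F G)" "q \<in> carrier (ifun_obj F G)" "r \<in> carrier (ifun_obj F G)" for p q r
    using fm[OF FG.m_closed[OF that(1,2)] that(3)] fm[OF that(1,2)] by simp
  have "f \<gamma> *[nil] f v = f w *[nil] f v *[nil] f \<gamma>" using fm[OF g(1,3)] m[OF g(2,3,1)] g(5) by simp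
  \<comment> \<open>The image of \<open>w\<close> is a commutator, hence central, and so the image
    of \<open>z\<close>, its commutator with that of \<open>\<gamma>\<close>, is trivial.\<close>
  hence central: "f w *[nil] f \<gamma> = f \<gamma> *[nil] f w" by (rule nil_central)
  have "f \<gamma> *[nil] f w = f ?z *[nil] f w *[nil] f \<gamma>" using fm[OF g(1,2)] m[OF z g(2,1)] g(4) by simp
  hence "1[nil] *[nil] (f w *[nil] f \<gamma>) = f ?z *[nil] (f w *[nil] f \<gamma>)"
    unfolding central[symmetric] by (simp only: N.m_assoc nil_simps(1) UNIV_I N.l_one)
  hence "f ?z = 1[nil]" by (metis N.r_cancel UNIV_I nil_simps(1))
  hence "f ?x *[nil] f ?y = f ?y *[nil] f ?x" using fm[OF x y] m[OF z y x] xy by (simp only: N.l_one nil_simps(1) UNIV_I)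
  thus False using nc unfolding fu[OF ab(1)] fu[OF ab(2)] by simp
qed

section \<open>The free group of rank two\<close>

text \<open>The group \<open>K[[t]] \<rtimes> K\<close>; a homomorphism into it is an
  \<open>exp_derivation\<close> together with its additive function.\<close>

definition exp_group :: "('k::field_char_0 fps \<times> 'k) monoid" where
  "exp_group = \<lparr>carrier = UNIV, monoid.mult = (%(p, l) (q, m). (p + fps_exp l * q, l + m)), one = (0, 0)\<rparr>"

lemma group_exp_group: "group (exp_group :: ('k::field_char_0 fps \<times> 'k) monoid)"
proof (rule groupI)
  fix a :: "'k fps \<times> 'k"
  obtain p l where a: "a = (p, l)" by (cases a)
  have "fps_exp (- l) * fps_exp l = (1 :: 'k fps)" by (simp flip: fps_exp_add_mult)
  thus "\<exists>b\<in>carrier exp_group. b *[exp_group] a = 1[exp_group]"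
    by (intro bexI[of _ "(- (fps_exp (- l) * p), - l)"]) (simp_all add: exp_group_def a)
qed (auto simp: exp_group_def fps_exp_add_mult algebra_simps)

text \<open>Linear independence of 1 and the variable over the rationals. With these as values on
  the generators, an additive function is injective on the two-dimensional first homology of the
  free group.\<close>

lemma coef_variable_irrational:
  assumes "of_rat s + of_rat t * (Fract [:0, 1:] 1 :: coef) = 0" shows "s = 0 & t = 0"
proof -
  have oi: "of_int k = (Fract (of_int k) 1 :: coef)" for k
    by (cases k rule: int_cases2) (simp_all add: of_nat_fract)
  obtain p q where p: "s = Rat.Fract p q" "q > 0" using Rat_cases by blast
  obtain c d where c: "t = Rat.Fract c d" "d > 0" using Rat_cases by blast
  have nz: "(of_int q :: coef) ~= 0" "(of_int d :: coef) ~= 0" using p c by simp_all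
  have "of_int p / of_int q + of_int c / of_int d * (Fract [:0, 1:] 1 :: coef) = 0"
    using assms by (simp add: p(1) c(1) of_rat_rat p(2)[THEN less_imp_neq[symmetric]] c(2)[THEN less_imp_neq[symmetric]])
  hence "of_int (p * d) + of_int (c * q) * (Fract [:0, 1:] 1 :: coef) = 0"
    using nz by (simp add: field_simps)
  hence "Fract (of_int (p * d) + of_int (c * q) * [:0, 1:]) 1 = (0 :: coef)" unfolding oi by simp
  hence e: "of_int (p * d) + of_int (c * q) * [:0, 1:] = (0 :: rat poly)" by (simp add: Zero_fract_def eq_fract)
  have "Polynomial.coeff (of_int (p * d) + of_int (c * q) * [:0, 1:] :: rat poly) 0 = of_int (p * d)"
    "Polynomial.coeff (of_int (p * d) + of_int (c * q) * [:0, 1:] :: rat poly) 1 = of_int (c * q)"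
    by (simp_all add: of_int_poly One_nat_def)
  hence "p * d = 0" "c * q = 0" unfolding e by simp_all
  thus ?thesis using p c by (simp add: rat_number_collapse)
qed

lemma rat_chain_in_span:
  assumes G: "group G" and zero: "(%x. 0) \<in> L" and add: "!!c d. c \<in> L ==> d \<in> L ==> rat_add c d \<in> L"
    and single: "!!g q. g \<in> carrier G ==> rat_single [g] q \<in> L" and c: "c \<in> rat_chains 1 G"
  shows "c \<in> L"
proof -
  have "\<forall>c\<in>rat_chains 1 G. {x. c x ~= 0} <= S --> c \<in> L" if "finite S" for S
    using that
  proof (induction S rule: finite_induct)
    case empty
    have "c = (%x. 0)" if "{x. c x ~= 0} <= {}" for c :: "'a list => rat" using that by auto
    thus ?case using zero by metis
  next
    case (insert x S)
    show ?case
    proof (intro ballI impI)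
      fix c assume c: "c \<in> rat_chains 1 G" and s: "{x. c x ~= 0} <= insert x S"
      show "c \<in> L"
      proof (cases "c x = 0")
        case True
        hence "{x. c x ~= 0} <= S" using s by auto
        thus ?thesis using insert.IH c by blast
      next
        case False
        have "x \<in> tuples 1 G" using c False by (auto simp: chains_on_def rat_ring_type_ring)
        then obtain g where g: "g \<in> carrier G" "x = [g]" by (auto simp: tuples_1 One_nat_def)
        have fin: "finite {y. c y ~= 0}" using c by (simp add: chains_on_def rat_ring_type_ring)
        have "finite {y. (c(x := 0)) y ~= 0}" by (rule finite_subset[OF _ fin]) auto
        hence "c(x := 0) \<in> rat_chains 1 G"
          using c by (simp add: chains_on_def rat_ring_type_ring)
        moreover have "{y. (c(x := 0)) y ~= 0} <= S" using s by auto
        ultimately have "c(x := 0) \<in> L" using insert.IH by blast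
        hence "rat_add (rat_single [g] (c x)) (c(x := 0)) \<in> L" using add single[OF g(1)] by blast
        moreover have "rat_add (rat_single [g] (c x)) (c(x := 0)) = c"
          by (auto simp: chain_add_def chain_single_def rat_ring_type_ring g(2))
        ultimately show ?thesis by simp
      qed
    qed
  qed
  moreover have "finite {x. c x ~= 0}" using c by (simp add: chains_on_def rat_ring_type_ring)
  ultimately show ?thesis using c by blast
qed

context
  fixes e :: "word set => 'a"
  assumes e: "inj_on e (carrier (presented_group 2 {}))"
begin

lemma free2_hom_eq:
  fixes Q :: "'q monoid"
  assumes Q: "group Q" and h: "h \<in> hom (free2 e) Q" "h' \<in> hom (free2 e) Q"
    and eq: "h (e (gen 0)) = h' (e (gen 0))" "h (e (gen 1)) = h' (e (gen 1))" and g: "g \<in> carrier (free2 e)"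
  shows "h g = h' g"
proof (rule free2_induct[OF e g, where P = "%g. h g = h' g"])
  interpret h: group_hom "free2 e" Q h using group_free2[OF e] Q h by (simp add: group_hom_def group_hom_axioms_def)
  interpret h': group_hom "free2 e" Q h' using group_free2[OF e] Q h by (simp add: group_hom_def group_hom_axioms_def)
  show "h 1[free2 e] = h' 1[free2 e]" by simp
  fix g and i :: nat assume *: "g \<in> carrier (free2 e)" "i < 2" "h g = h' g"
  have i: "i = 0 \<or> i = 1" using *(2) by auto
  have "e (gen i) \<in> carrier (free2 e)" "h (e (gen i)) = h' (e (gen i))" using i eq free2_gen[OF e] by auto
  thus "h (e (gen i) *[free2 e] g) = h' (e (gen i) *[free2 e] g) &
      h (inv[free2 e] e (gen i) *[free2 e] g) = h' (inv[free2 e] e (gen i) *[free2 e] g)" using * by simp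
qed

text \<open>Modulo boundaries a 1-chain is a rational combination of the two generators, and
  independence of the values of \<open>lam\<close> on them leaves only the zero combination.\<close>

lemma free2_H1_injective:
  fixes lam :: "'a => 'k::field_char_0"
  assumes lam: "additive_on (free2 e) lam" and l0: "lam (e (gen 0)) = 1"
    and irr: "!!s t. of_rat s + of_rat t * lam (e (gen 1)) = 0 ==> s = 0 & t = 0"
  shows "injective_on_H1 (free2 e) lam"
  unfolding injective_on_H1_def
proof (intro ballI impI)
  let ?G = "free2 e" and ?a = "e (gen 0)" and ?b = "e (gen 1)"
  note G = group_free2[OF e] and ab = free2_gen[OF e]
  interpret group ?G by (rule G)
  interpret R: coeff ?G rat_ring "%g q. q" by (rule rat_coeff[OF G])
  define L where "L = {rat_add b (rat_add (rat_single [?a] s) (rat_single [?b] t)) | b s t. b \<in> rat_boundaries 1 ?G}"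
  have LI: "rat_add b (rat_add (rat_single [?a] s) (rat_single [?b] t)) \<in> L" if "b \<in> rat_boundaries 1 ?G" for b s t
    unfolding L_def using that by blast
  have s0: "rat_single x 0 = (%y. 0)" for x :: "'a list" by (auto simp: chain_single_def rat_ring_type_ring)
  have a0: "rat_add c (%y. 0) = c" "rat_add (%y. 0) c = c" for c :: "'a list => rat" by (auto simp: chain_add_def rat_ring_type_ring)
  have bz: "(%y. 0) \<in> rat_boundaries 1 ?G" using R.B1_zero[of 1] by (simp add: rat_ring_type_ring)
  have Lb: "b \<in> L" if "b \<in> rat_boundaries 1 ?G" for b using LI[OF that, of 0 0] by (simp add: s0 a0)
  have L0: "(%y. 0) \<in> L" by (rule Lb[OF bz])
  have La: "rat_single [?a] s \<in> L" for s using LI[OF bz, of s 0] by (simp add: s0 a0)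
  have Lb': "rat_single [?b] t \<in> L" for t using LI[OF bz, of 0 t] by (simp add: s0 a0)
  have Ladd: "rat_add c d \<in> L" if c: "c \<in> L" and d: "d \<in> L" for c d
  proof -
    obtain b s t where 1: "b \<in> rat_boundaries 1 ?G" "c = rat_add b (rat_add (rat_single [?a] s) (rat_single [?b] t))" using c unfolding L_def by blast
    obtain b' s' t' where 2: "b' \<in> rat_boundaries 1 ?G" "d = rat_add b' (rat_add (rat_single [?a] s') (rat_single [?b] t'))" using d unfolding L_def by blast
    have "rat_add c d = rat_add (rat_add b b') (rat_add (rat_single [?a] (s + s')) (rat_single [?b] (t + t')))"
      unfolding 1(2) 2(2) by (auto simp: chain_add_def chain_single_def rat_ring_type_ring)
    thus ?thesis using LI[OF R.B1_add[OF 1(1) 2(1)]] by simp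
  qed
  have bd: "rat_bd ?G (rat_single [g, h] q) \<in> L" if "g \<in> carrier ?G" "h \<in> carrier ?G" for g h q
  proof -
    have t: "[g, h] \<in> tuples 2 ?G" using that by (simp add: tuples_def)
    have "rat_single [g, h] q \<in> rat_chains 2 ?G"
      using two_modules.chain_single_closed[OF two_modules_rat t] by (simp add: rat_ring_type_ring)
    hence "rat_bd ?G (rat_single [g, h] q) \<in> rat_boundaries 1 ?G" unfolding in_boundaries by (auto simp: numeral_2_eq_2 One_nat_def)
    thus ?thesis by (rule Lb)
  qed
  have mult: "rat_single [g *[?G] h] q = rat_add (rat_add (rat_single [g] q) (rat_single [h] q)) (rat_bd ?G (rat_single [g, h] (- q)))"
    if "g \<in> carrier ?G" "h \<in> carrier ?G" for g h q
    using R.boundary_single_2[OF that, of "- q"] by (auto simp: fun_eq_iff chain_add_def chain_single_def rat_ring_type_ring)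
  have one: "rat_single [1[?G]] q = rat_bd ?G (rat_single [1[?G], 1[?G]] q)" for q
    using R.boundary_single_2[OF one_closed one_closed, of q] by (auto simp: fun_eq_iff chain_add_def chain_single_def rat_ring_type_ring)
  have single: "\<forall>q. rat_single [g] q \<in> L" if g: "g \<in> carrier ?G" for g
  proof (rule free2_induct[OF e g, where P = "%g. \<forall>q. rat_single [g] q \<in> L"])
    show "\<forall>q. rat_single [1[?G]] q \<in> L" unfolding one using bd[OF one_closed one_closed] by blast
    fix g and i :: nat assume *: "g \<in> carrier ?G" "i < 2" "\<forall>q. rat_single [g] q \<in> L"
    have i: "i = 0 \<or> i = 1" using *(2) by auto
    have xc: "e (gen i) \<in> carrier ?G" using i ab by auto
    have x: "rat_single [e (gen i)] q \<in> L" for q using i La Lb' by auto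
    have "rat_single [e (gen i) *[?G] g] q \<in> L" for q
      unfolding mult[OF xc *(1)] by (rule Ladd[OF Ladd[OF x spec[OF *(3)]] bd[OF xc *(1)]])
    moreover have "rat_single [inv[?G] e (gen i) *[?G] g] q \<in> L" for q
    proof -
      let ?h = "inv[?G] e (gen i) *[?G] g"
      have hc: "?h \<in> carrier ?G" using xc *(1) by simp
      have gh: "e (gen i) *[?G] ?h = g" using xc *(1) by (simp add: m_assoc[symmetric])
      \<comment> \<open>For an inverse generator the boundary of the pair of the generator and
        \<open>?h\<close> is used, whose product is \<open>g\<close>.\<close>
      have "rat_single [?h] q = rat_add (rat_add (rat_single [g] q) (rat_single [e (gen i)] (- q))) (rat_bd ?G (rat_single [e (gen i), ?h] q))"
        using R.boundary_single_2[OF xc hc, of q] by (auto simp: fun_eq_iff chain_add_def chain_single_def rat_ring_type_ring gh)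
      thus ?thesis using Ladd[OF Ladd[OF spec[OF *(3)] x] bd[OF xc hc]] by simp
    qed
    ultimately show "(\<forall>q. rat_single [e (gen i) *[?G] g] q \<in> L) & (\<forall>q. rat_single [inv[?G] e (gen i) *[?G] g] q \<in> L)" by blast
  qed
  fix c assume c: "c \<in> rat_chains 1 ?G" and p: "pairing1 lam c = 0"
  have "c \<in> L" by (rule rat_chain_in_span[OF G L0 Ladd spec[OF single] c])
  then obtain b s t where b: "b \<in> rat_boundaries 1 ?G" "c = rat_add b (rat_add (rat_single [?a] s) (rat_single [?b] t))" unfolding L_def by blast
  obtain b2 where b2: "b2 \<in> rat_chains 2 ?G" "b = rat_bd ?G b2" using b(1) unfolding in_boundaries by (auto simp: numeral_2_eq_2 One_nat_def)
  have cl: "b \<in> rat_chains 1 ?G" "rat_single [?a] s \<in> rat_chains 1 ?G" "rat_single [?b] t \<in> rat_chains 1 ?G"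
    using subsetD[OF R.B1_chains b(1)] rat_single_closed ab by auto
  have sg: "pairing1 lam (rat_single [g] q) = of_rat q * lam g" if "g \<in> carrier ?G" for g q
    using pairing_single[OF G, where x = "[g]" and k = 1 and q = q and f = "%x. lam (x ! 0)"] that by (simp add: tuples_def)
  have "pairing1 lam c = of_rat s * lam ?a + of_rat t * lam ?b"
    unfolding b(2) pairing_add[OF G cl(1) R.add_closed[OF cl(2,3)]] pairing_add[OF G cl(2,3)]
      sg[OF ab(1)] sg[OF ab(2)] using pairing1_boundary[OF G lam b2(1)] by (simp add: b2(2))
  hence "s = 0 & t = 0" using p irr l0 by simp
  hence "c = b" by (simp add: b(2) s0 a0)
  thus "c \<in> rat_boundaries 1 ?G" using b(1) by simp
qed

lemma exists_generic_free2:
  "\<exists>lam p. additive_on (free2 e) lam & lam (e (gen 0)) = (1 :: coef) & injective_on_H1 (free2 e) lam &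
    generic (free2 e) (%g. jet (p g) (lam g))"
proof -
  let ?G = "free2 e" and ?a = "e (gen 0)" and ?b = "e (gen 1)"
  define u :: coef where "u = Fract [:0, 1:] 1"
  note G = group_free2[OF e]
  \<comment> \<open>The second generator has \<open>lam\<close>-value \<open>u\<close>, independent
    of 1. Its series has constant term 1, so that the first two coordinates of both generators form
    a basis, and linear term \<open>u / 2\<close>, which is cancelled by the correction in
    \<open>jet\<close>.\<close>
  obtain h where h: "h \<in> hom ?G (exp_group :: (coef fps \<times> coef) monoid)" "h ?a = (0, 1)" "h ?b = (1 + fps_const (u / 2) * fps_X, u)"
    using free2_universal[OF e group_exp_group, of "(0 :: coef fps, 1)" "(1 + fps_const (u / 2) * fps_X, u)"] by (auto simp: exp_group_def)
  define lam where "lam g = snd (h g)" for g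
  define p where "p g = fst (h g)" for g
  have hm: "h (g *[?G] k) = (p g + fps_exp (lam g) * p k, lam g + lam k)" if "g \<in> carrier ?G" "k \<in> carrier ?G" for g k
    using hom_mult[OF h(1) that] by (simp add: exp_group_def lam_def p_def case_prod_beta)
  have lam: "additive_on ?G lam" and p: "exp_derivation ?G lam p"
    using hm unfolding additive_on_def exp_derivation_def by (auto simp: lam_def p_def)
  have l0: "lam ?a = 1" and l1: "lam ?b = u" by (simp_all add: lam_def p_def h)
  have inj: "injective_on_H1 ?G lam"
    by (rule free2_H1_injective[OF lam l0]) (use coef_variable_irrational in \<open>simp add: l1 u_def\<close>)
  define k where "k g = jet (p g) (lam g)" for g
  have kh: "k \<in> hom ?G nil" unfolding k_def by (rule jet_hom[OF lam p])
  have ka: "k ?a = (1, 0, 0)" by (simp add: k_def jet_def lam_def p_def h)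
  have kb: "k ?b = (u, 1, 0)" by (simp add: k_def jet_def lam_def p_def h)
  have "generic ?G k" unfolding generic_def
  proof (intro conjI exI[of _ lam] exI[of _ p] ballI lam inj p k_def)
    fix h' :: "'a => coef triple" assume h': "h' \<in> hom ?G nil"
    obtain a1 a2 a3 where a: "h' ?a = (a1, a2, a3)" by (cases "h' ?a")
    obtain b1 b2 b3 where b: "h' ?b = (b1, b2, b3)" by (cases "h' ?b")
    \<comment> \<open>The values of \<open>k\<close> on the generators are \<open>(1, 0, 0)\<close>
      and \<open>(u, 1, 0)\<close>. So the first triple is the value of \<open>h'\<close> on the
      first generator, and the second is its value on the other one minus \<open>u\<close> times the
      first.\<close>
    show "\<exists>!UV. \<forall>g\<in>carrier ?G. h' g = nil_map UV (k g)"
    proof (rule ex1I[of _ "((a1, a2, a3), (b1 - u * a1, b2 - u * a2, b3 - u * a3))"])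
      let ?UV = "((a1, a2, a3), (b1 - u * a1, b2 - u * a2, b3 - u * a3))"
      have n: "(%g. nil_map ?UV (k g)) \<in> hom ?G nil"
        by (rule homI) (simp, simp only: hom_mult[OF kh] nil_map_hom)
      show "\<forall>g\<in>carrier ?G. h' g = nil_map ?UV (k g)"
      proof
        fix g assume g: "g \<in> carrier ?G"
        show "h' g = nil_map ?UV (k g)"
          by (rule free2_hom_eq[OF group_nil h' n _ _ g]) (simp_all add: a b ka kb nil_map_def)
      qed
    next
      fix UV assume eq: "\<forall>g\<in>carrier ?G. h' g = nil_map UV (k g)"
      obtain u1 u2 u3 v1 v2 v3 where UV: "UV = ((u1, u2, u3), (v1, v2, v3))" by (metis surj_pair)
      have "(a1, a2, a3) = nil_map UV (1, 0, 0)" "(b1, b2, b3) = nil_map UV (u, 1, 0)"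
        using bspec[OF eq free2_gen(1)[OF e]] bspec[OF eq free2_gen(2)[OF e]] by (simp_all add: a b ka kb)
      thus "UV = ((a1, a2, a3), (b1 - u * a1, b2 - u * a2, b3 - u * a3))" by (simp add: UV nil_map_def)
    qed
  qed
  thus ?thesis using lam l0 inj unfolding k_def by blast
qed

text \<open>Freeness gives a homomorphism with noncommuting values on the generators. It factors
  through \<open>nil_unit\<close> by a \<open>nil_map\<close>, which would preserve
  commutation.\<close>

lemma nil_unit_free2:
  "nil_unit (free2 e) (e (gen 0)) *[nil] nil_unit (free2 e) (e (gen 1)) ~=
   nil_unit (free2 e) (e (gen 1)) *[nil] nil_unit (free2 e) (e (gen 0))"
proof
  let ?G = "free2 e" and ?h = "nil_unit (free2 e)"
  assume c: "?h (e (gen 0)) *[nil] ?h (e (gen 1)) = ?h (e (gen 1)) *[nil] ?h (e (gen 0))"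
  have g: "generic ?G ?h" by (rule nil_unit_generic) (use exists_generic_free2 in \<open>auto simp: nil_type_def\<close>)
  obtain k :: "'a => coef triple" where k: "k \<in> hom ?G nil" "k (e (gen 0)) = (1, 0, 0)" "k (e (gen 1)) = (0, 1, 0)"
    using free2_universal[OF e group_nil, of "(1, 0, 0)" "(0, 1, 0)"] by auto
  obtain UV where UV: "\<forall>g\<in>carrier ?G. k g = nil_map UV (?h g)" using generic_unique[OF g k(1)] by blast
  have "k (e (gen 0)) *[nil] k (e (gen 1)) = k (e (gen 1)) *[nil] k (e (gen 0))"
    using UV free2_gen[OF e] c by (simp add: nil_map_hom[symmetric] del: nil_simps)
  thus False by (simp add: k(2,3))
qed

text \<open>The first generator has \<open>lam\<close>-value 1, so it is not in
  \<open>G_H^(1)\<close> and its image in \<open>\<F>_1(G)\<close> is nontrivial. This provides the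
  element that \<open>gam\<close> lifts through the tower.\<close>

lemma CH_module_free2:
  assumes "infinite (UNIV :: 'a set)"
  shows "ch_tower (free2 e)" "\<exists>x\<in>carrier (CH_module (free2 e) 0). x ~= 1[CH_module (free2 e) 0]"
proof -
  let ?G = "free2 e" and ?a = "e (gen 0)"
  note G = group_free2[OF e]
  show t: "ch_tower ?G" unfolding ch_tower_def ch_tower_axioms_def using G countable_free2[OF e] assms by blast
  interpret ch_tower ?G by (rule t)
  obtain lam :: "'a => coef" where lam: "additive_on ?G lam" "lam ?a = 1" "injective_on_H1 ?G lam"
    using exists_generic_free2 by blast
  have a: "?a \<in> carrier ?G" by (rule free2_gen[OF e])
  have st: "CH_unit ?G (Suc 0) \<in> hom ?G (CH_group ?G (Suc 0))"
    "CH_unit ?G (Suc 0) ?a = 1[CH_group ?G (Suc 0)] \<longleftrightarrow> ?a \<in> tf_derived ?G (Suc 0)"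
    using stage[of "Suc 0"] a by (simp_all add: tower_stage_def)
  have "?a \<notin> tf_derived ?G 1" using tf_derived_1_iff[OF G lam(1,3) a] lam(2) by simp
  hence ne: "CH_unit ?G (Suc 0) ?a ~= 1[CH_group ?G (Suc 0)]" using st(2) by (simp add: One_nat_def)
  have "CH_unit ?G (Suc 0) ?a \<in> carrier (CH_group ?G (Suc 0))" using st(1) a by (auto simp: hom_def)
  then obtain x \<gamma> where x: "x \<in> carrier (CH_module ?G 0)" "\<gamma> \<in> carrier (CH_group ?G 0)" "CH_unit ?G (Suc 0) ?a = CH_pair ?G 0 (x, \<gamma>)"
    by (rule CH_Suc_cases)
  have "\<gamma> = 1[CH_group ?G 0]" using x(2) unfolding carrier_0 by (rule singletonD)
  hence "x ~= 1[CH_module ?G 0]" using ne unfolding x(3) pair_one by blast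
  thus "\<exists>x\<in>carrier (CH_module ?G 0). x ~= 1[CH_module ?G 0]" using x(1) by blast
qed

end

lemma one_tf_derived: "group G ==> 1[G] \<in> tf_derived G k"
  using tf_derived_normal_ore[of G k] subgroup.one_closed[OF normal_imp_subgroup] by blast

lemma quotient_unit_surj: "carrier (ifun_obj (quotient_functor N) G) <= ifun_unit (quotient_functor N) G ` carrier G"
  by (auto simp: quotient_functor_def FactGroup_def RCOSETS_def)

lemma quotient_unit_kernel:
  assumes G: "group G" and g: "g \<in> carrier G" and N: "1[G] \<in> N G" "N G <= tf_derived G 2"
    and e: "ifun_unit (quotient_functor N) G g = 1[ifun_obj (quotient_functor N) G]"
  shows "nil_unit G g = (0, 0, 0)"
proof -
  interpret group G by fact
  have "N G #>[G] g = N G" using e by (simp add: quotient_functor_def FactGroup_def)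
  moreover have "1[G] *[G] g \<in> N G #>[G] g" using N(1) unfolding r_coset_def by blast
  ultimately have "g \<in> tf_derived G 2" using N(2) g by auto
  thus ?thesis by (rule nil_unit_kernel[OF G])
qed

theorem theorem3p7:
  assumes "infinite (UNIV :: 'a set)"
  shows "(\<forall>n\<ge>2. \<not> universal_container
                    (H_functor n :: ('a, 'a set) ifunctor) (F_functor n) (sigma n)) \<and>
         \<not> universal_container
              (H_functor_omega :: ('a, 'a set) ifunctor) F_functor_omega sigma_omega"
proof -
  obtain e :: "word set => 'a" where e: "inj_on e (carrier (presented_group 2 {}))"
    using countable_injection[OF countable_presented assms] by blast
  let ?G = "free2 e"
  interpret ch_tower ?G by (rule CH_module_free2(1)[OF e assms])
  obtain x0 where x0: "x0 \<in> carrier (CH_module ?G 0)" "x0 ~= 1[CH_module ?G 0]" using CH_module_free2(2)[OF e assms] by (rule bexE)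
  note fp = finitely_presented_free2[OF e] and ab = free2_gen[OF e] and nc = nil_unit_free2[OF e]
  have "\<not> universal_container (H_functor n :: ('a, 'a set) ifunctor) (F_functor n) (sigma n)" if n: "n \<ge> 2" for n
  proof -
    obtain j where j: "n = Suc j" using n by (cases n) auto
    show ?thesis unfolding H_functor_def
    proof (rule not_universal[OF assms quotient_unit_surj quotient_unit_kernel fp ab nc])
      show "double_commutators (ifun_obj (F_functor n) ?G)" using double_commutators_CH[OF x0] by (simp add: F_functor_def j)
    next
      fix G :: "'a monoid" and g assume "group G"
      thus "1[G] \<in> tf_derived G n" by (rule one_tf_derived)
      \<comment> \<open>The lower bound on \<open>n\<close> is exhausted here: generic homomorphisms
        vanish on the second term of the series, but in general not on the first.\<close>
      show "tf_derived G n <= tf_derived G 2" by (rule tf_derived_mono[OF n])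
    qed
  qed
  moreover have "\<not> universal_container (H_functor_omega :: ('a, 'a set) ifunctor) F_functor_omega sigma_omega"
  proof -
    \<comment> \<open>The values of the limit functor are sequences, and the coding of the second
      container has to take place in their type.\<close>
    have "inj (%(x :: 'a) (n :: nat). x)" by (rule injI) (metis)
    hence inf: "infinite (UNIV :: (nat => 'a) set)" using assms finite_imageD finite_subset subset_UNIV by metis
    show ?thesis unfolding H_functor_omega_def
    proof (rule not_universal[OF inf quotient_unit_surj quotient_unit_kernel fp ab nc])
      show "double_commutators (ifun_obj F_functor_omega ?G)" using double_commutators_omega[OF x0] by (simp add: F_functor_omega_def)
    next
      fix G :: "'a monoid" and g assume "group G"
      thus "1[G] \<in> tf_derived_omega G" "tf_derived_omega G <= tf_derived G 2"
        using one_tf_derived by (auto simp: tf_derived_omega_def)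
    qed
  qed
  ultimately show ?thesis by blast
qed

end
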